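(* Suppose Assumptions A, B, C, D and E (spelled out in the context) hold, and suppose there exists a $\kappa\in\Lambda$ such that $T_\kappa$ is invertible. Then $\Sigma\subset\Lambda$ is discrete without accumulation points in $\Lambda$, and $$\lim_{h\to0,\,N\to\infty}{\rm dist}(\Sigma\cap\Lambda',\Sigma_{h,N}\cap\Lambda')=0$$ for all compact subsets $\Lambda'\subset\Lambda$. Here ${\rm dist}(A,B):=\max\{\sup_{a\in A}\inf_{b\in B}|a-b|,\ \sup_{b\in B}\inf_{a\in A}|a-b|\}$ is the Hausdorff distance of subsets $A,B\subset\mathbb C$.
   Context: All Hilbert spaces are complex; sesquilinear forms are linear in the first and antilinear in the second argument; $L(X,Y)$ is the space of bounded linear operators from $X$ to $Y$, $L(X)=L(X,X)$. **Assumption A (exterior and interior spaces).** $\mathcal V^{\rm int}$, $\mathcal V^{\rm ext}$, $\mathcal Z$ are Hilbert spaces, and ${\rm tr}_+:\mathcal V^{\rm ext}\to\mathcal Z$, ${\rm tr}_-:\mathcal V^{\rm int}\to\mathcal Z$ are bounded, linear, surjective. Put $$\mathcal V:=\left\{\begin{pmatrix}u^{\rm int}\\ u^{\rm ext}\end{pmatrix}\in\mathcal V^{\rm int}\oplus\mathcal V^{\rm ext}:{\rm tr}_+u^{\rm ext}={\rm tr}_-u^{\rm int}\right\},$$ a Hilbert space with the inner product $\langle u^{\rm int},v^{\rm int}\rangle_{\mathcal V^{\rm int}}+\langle u^{\rm ext},v^{\rm ext}\rangle_{\mathcal V^{\rm ext}}$. For $l=1,\dots,L$ there are Hilbert spaces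 $\mathcal X_l^1,\mathcal X_l^2,\mathcal Y_l^1,\mathcal Y_l^2$ with $\mathcal X_l^2\subset\mathcal X_l^1$ and $\mathcal Y_l^2\subset\mathcal Y_l^1$ densely and continuously embedded, such that $\mathcal V^{\rm ext}=\bigoplus_{l=1}^L\mathcal V^{\rm ext}_l$, $\mathcal V_l^{\rm ext}:=(\mathcal X_l^2\otimes\mathcal Y_l^1)\cap(\mathcal X_l^1\otimes\mathcal Y_l^2)$ (Hilbert space tensor products, intersection inside $\mathcal X^1_l\otimes\mathcal Y^1_l$), with inner product $$\langle u^{\rm ext},v^{\rm ext}\rangle_{\mathcal V^{\rm ext}}=\sum_{l=1}^L\left(\langle u_l^{\rm ext},v_l^{\rm ext}\rangle_{\mathcal X_l^2\otimes\mathcal Y_l^1}+\langle u_l^{\rm ext},v_l^{\rm ext}\rangle_{\mathcal X_l^1\otimes\mathcal Y_l^2}\right).$$ $s^{\rm int}:\mathcal V^{\rm int}\times\mathcal V^{\rm int}\to\mathbb C$ and $s^{\rm ext}:\mathcal V^{\rm ext}\times\mathcal V^{\rm ext}\to\mathbb C$ are bounded sesquilinear forms, and $s:\mathcal V\times\mathcal V\to\mathbb C$ is $s(u,v):=s^{\rm int}(u^{\rm int},v^{\rm int})+s^{\rm ext}(u^{\rm ext},v^{\rm ext})$. **Assumption B (separation of $\mathcal V^{\rm ext}$).** There is a complete orthogonal system $\{\varphi_n:n\in\mathbb N\}\subset\bigoplus_{l=1}^L\mathcal Y_l^2$ such that: (i) for every $n$ there is $l(n)\in\{1,\dots,L\}$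 such that, writing $\varphi_n=(\varphi_n^{(1)},\dots,\varphi_n^{(L)})$, one has $\varphi_n^{(j)}=0$ for $j\ne l(n)$; (ii) the subspaces $\mathcal V_n:=(\mathcal X^1_{l(n)}\otimes{\rm span}\{\varphi_n\})\cap\mathcal V^{\rm ext}$ are mutually orthogonal in $\mathcal V^{\rm ext}$ both with respect to the inner product of $\mathcal V^{\rm ext}$ and with respect to $s^{\rm ext}$, and the spaces ${\rm tr}_+(\mathcal V_n)$ are mutually orthogonal in $\mathcal Z$; (iii) $\dim{\rm tr}_+(\mathcal V_n)<\infty$ for all $n$, and $\mathcal V^{\rm ext}=\bigoplus_{n\in\mathbb N}\mathcal V_n$, $\mathcal Z=\bigoplus_{n\in\mathbb N}{\rm tr}_+(\mathcal V_n)$ (Hilbert space orthogonal sums). Set $\mathcal X_n:=\{u_n\in\mathcal X^1_{l(n)}:u_n\otimes\varphi_n\in\mathcal V^{\rm ext}\}$ with $\langle u_n,v_n\rangle_{\mathcal X_n}:=\langle u_n\otimes\varphi_n,v_n\otimes\varphi_n\rangle_{\mathcal V^{\rm ext}}$, and $s_n:\mathcal X_n\times\mathcal X_n\to\mathbb C$, $s_n(u,v):=s^{\rm ext}(u\otimes\varphi_n,v\otimes\varphi_n)$. **Assumption C (boundedness and coercivity).** There are a nonnegative integer $M$, constants $C_s>0$, $\alpha>0$ and $\theta_1,\dots,\theta_M\in\{z\in\mathbb C:|z|=1\}$ such that for all $u_n,v_n\in\mathcal X_n$: $|s_n(u_n,v_n)|\le C_s\|u_n\|_{\mathcal X_n}\|v_n\|_{\mathcal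 X_n}$ for $n\in\mathbb N$; $\Re(\theta_ns_n(u_n,u_n))\ge\alpha\|u_n\|^2_{\mathcal X_n}$ for $n=1,\dots,M$; $\Re(s_n(u_n,u_n))\ge\alpha\|u_n\|^2_{\mathcal X_n}$ for $n>M$. Moreover there is a compact linear operator $K:\mathcal V^{\rm int}\to\mathcal V^{\rm int}$ with $\Re s^{\rm int}(u^{\rm int},u^{\rm int})+\Re\langle Ku^{\rm int},u^{\rm int}\rangle_{\mathcal V^{\rm int}}\ge\alpha\|u^{\rm int}\|^2_{\mathcal V^{\rm int}}$ for all $u^{\rm int}\in\mathcal V^{\rm int}$. **Assumption D (discrete subspaces).** There are families of finite dimensional nested subspaces $\mathcal V_h^{\rm int}\subset\mathcal V^{\rm int}$ and $\mathcal Y_{h,l}\subset\mathcal Y_l^2$, decreasing in the parameter $h>0$, and a family of nested subspaces $\mathcal X_{N,l}\subset\mathcal X_l^2$, increasing in $N\in\mathbb N$, such that $\bigcup_{h>0}\mathcal V_h^{\rm int}\subset\mathcal V^{\rm int}$, $\bigcup_{N}\mathcal X_{N,l}\subset\mathcal X_l^2$ and $\bigcup_{h>0}\mathcal Y_{h,l}\subset\mathcal Y_l^2$ are dense for $l=1,\dots,L$. With $\mathcal V_{h,N}^{\rm ext}:=\bigoplus_{l=1}^L\mathcal X_{N,l}\otimes\mathcal Y_{h,l}$ one has $\mathcal V_{h,N}^{\rm ext}\subset\mathcal V^{\rm ext}$ and ${\rm tr}_+(\mathcal V_{h,N}^{\rm ext})={\rm tr}_-(\mathcal V_h^{\rm int})$.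 Set $$\mathcal V_{h,N}:=\left\{\begin{pmatrix}u^{\rm int}\\ u^{\rm ext}\end{pmatrix}\in\mathcal V_h^{\rm int}\oplus\mathcal V_{h,N}^{\rm ext}:{\rm tr}_-u^{\rm int}={\rm tr}_+u^{\rm ext}\right\}.$$ Finally, there are operators ${\rm tr}_-^\dagger\in L(\mathcal Z,\mathcal V^{\rm int})$ and ${\rm tr}_{h,-}^\dagger\in L(\mathcal Z,\mathcal V_h^{\rm int})$ with ${\rm tr}_-{\rm tr}_-^\dagger={\rm I}_{\mathcal Z}$, ${\rm tr}_-{\rm tr}_{h,-}^\dagger{\rm tr}_-u_h^{\rm int}={\rm tr}_-u_h^{\rm int}$ for all $u_h^{\rm int}\in\mathcal V_h^{\rm int}$, and $\lim_{h\to0}\|{\rm tr}_-^\dagger g-{\rm tr}_{h,-}^\dagger g\|_{\mathcal V^{\rm int}}=0$ for all $g\in\mathcal Z$. **Assumption E (eigenproblem setting).** $\Lambda\subset\mathbb C$ is open and the sesquilinear form $s=s_\kappa$ of Assumption A depends on a parameter $\kappa\in\Lambda$ (the spaces do not). Each $\kappa_0\in\Lambda$ has a neighborhood $\widehat\Lambda$ in which the vectors $\varphi_n$ of Assumption B and the quantities $C_s,\alpha,\theta_n,M,K$ of Assumption C can be chosen independently of $\kappa\in\widehat\Lambda$. Finally $s_\kappa$ depends holomorphically on $\kappa\in\Lambda$, i.e. for the operator $T_\kappa:\mathcal V\to\mathcal V$ defined by $s_\kappa(u,v)=\langle T_\kappa u,v\rangle_{\mathcal V}$ for $u,v\in\mathcal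 V$, the limit $T'_{\kappa_0}:=\lim_{\kappa\to\kappa_0}\frac1{\kappa-\kappa_0}(T_\kappa-T_{\kappa_0})$ exists in the norm of $L(\mathcal V)$ for all $\kappa_0\in\Lambda$. **Eigenvalues.** $\Sigma\subset\Lambda$ is the set of $\kappa\in\Lambda$ for which there is $u\in\mathcal V\setminus\{0\}$ with $s_\kappa(u,v)=0$ for all $v\in\mathcal V$. $\Sigma_{h,N}$ is the set of discrete eigenvalues, i.e. of $\kappa_{h,N}\in\Lambda$ for which there is $u_{h,N}\in\mathcal V_{h,N}\setminus\{0\}$ with $s_{\kappa_{h,N}}(u_{h,N},v_{h,N})=0$ for all $v_{h,N}\in\mathcal V_{h,N}$.
   Formalization: Λ is assumed connected, and the convergence is stated for compact Λ'⊂Λ with no point of Σ on the boundary of Λ'; without these the claim is false. The subspaces X_{N,l} are taken to be closed in X_l^2. *)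

theory Defs
  imports "HOL-Analysis.Analysis" "HOL-Library.Function_Algebras"
begin

section \<open>Complex vector spaces\<close>

class scaleC =
  fixes scaleC :: "complex \<Rightarrow> 'a \<Rightarrow> 'a" (infixr "*\<^sub>C" 75)

class complex_vector = scaleC + ab_group_add +
  assumes scaleC_add_right: "a *\<^sub>C (x + y) = a *\<^sub>C x + a *\<^sub>C y"
    and scaleC_add_left: "(a + b) *\<^sub>C x = a *\<^sub>C x + b *\<^sub>C x"
    and scaleC_scaleC: "a *\<^sub>C (b *\<^sub>C x) = (a * b) *\<^sub>C x"
    and scaleC_one: "1 *\<^sub>C x = x"

global_interpretation complex_vector: vector_space "scaleC :: complex \<Rightarrow> 'a \<Rightarrow> 'a::complex_vector"
  defines csubspace_raw_def: csubspace = complex_vector.subspace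
    and cspan_raw_def: cspan = complex_vector.span
  by unfold_locales (rule scaleC_add_right scaleC_add_left scaleC_scaleC scaleC_one)+

instantiation prod :: (complex_vector, complex_vector) complex_vector
begin
definition scaleC_prod :: "complex \<Rightarrow> 'a \<times> 'b \<Rightarrow> 'a \<times> 'b"
  where "scaleC_prod c p = (c *\<^sub>C fst p, c *\<^sub>C snd p)"
instance
  by standard (auto simp: scaleC_prod_def scaleC_add_right scaleC_add_left scaleC_scaleC scaleC_one)
end

instantiation "fun" :: (type, complex_vector) complex_vector
begin
definition scaleC_fun :: "complex \<Rightarrow> ('a \<Rightarrow> 'b) \<Rightarrow> 'a \<Rightarrow> 'b"
  where "scaleC_fun c f = (\<lambda>i. c *\<^sub>C f i)"
instance
  by standard (auto simp: scaleC_fun_def fun_eq_iff scaleC_add_right scaleC_add_left scaleC_scaleC scaleC_one)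
end

definition clinear_on :: "'a::complex_vector set \<Rightarrow> ('a \<Rightarrow> 'b::complex_vector) \<Rightarrow> bool"
  where "clinear_on S f \<longleftrightarrow>
    (\<forall>x\<in>S. \<forall>y\<in>S. f (x + y) = f x + f y) \<and> (\<forall>c. \<forall>x\<in>S. f (c *\<^sub>C x) = c *\<^sub>C f x)"

definition sesquilinear_on :: "'a::complex_vector set \<Rightarrow> ('a \<Rightarrow> 'a \<Rightarrow> complex) \<Rightarrow> bool"
  where "sesquilinear_on S b \<longleftrightarrow>
    (\<forall>x\<in>S. \<forall>y\<in>S. \<forall>z\<in>S. b (x + y) z = b x z + b y z \<and> b z (x + y) = b z x + b z y) \<and>
    (\<forall>c. \<forall>x\<in>S. \<forall>y\<in>S. b (c *\<^sub>C x) y = c * b x y \<and> b x (c *\<^sub>C y) = cnj c * b x y)"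

definition fin_dim :: "'a::complex_vector set \<Rightarrow> bool"
  where "fin_dim S \<longleftrightarrow> (\<exists>B. finite B \<and> S \<subseteq> cspan B)"


section \<open>Hilbert spaces\<close>

text \<open>A Hilbert space is a linear subspace of some ambient complex vector space (no topology on
  the latter) together with its own inner product. In this way inclusions between Hilbert
  spaces with different inner products are literal inclusions of carriers, and families of
  different Hilbert spaces can be formed inside one ambient type.\<close>

record 'a hspace =
  hcarrier :: "'a set"
  hinner :: "'a \<Rightarrow> 'a \<Rightarrow> complex"

definition hnorm :: "'a::complex_vector hspace \<Rightarrow> 'a \<Rightarrow> real"
  where "hnorm H x = sqrt (Re (hinner H x x))"

text \<open>The value 0 off the carrier is only there because the locale \<^locale>\<open>Metric_space\<close> requires
  nonnegativity and symmetry on the whole type.\<close>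

definition hdist :: "'a::complex_vector hspace \<Rightarrow> 'a \<Rightarrow> 'a \<Rightarrow> real"
  where "hdist H x y = (if x \<in> hcarrier H \<and> y \<in> hcarrier H then hnorm H (x - y) else 0)"

definition htop :: "'a::complex_vector hspace \<Rightarrow> 'a topology"
  where "htop H = Metric_space.mtopology (hcarrier H) (hdist H)"

definition hilbert_space :: "'a::complex_vector hspace \<Rightarrow> bool"
  where "hilbert_space H \<longleftrightarrow>
    csubspace (hcarrier H) \<and>
    sesquilinear_on (hcarrier H) (hinner H) \<and>
    (\<forall>x\<in>hcarrier H. \<forall>y\<in>hcarrier H. hinner H y x = cnj (hinner H x y)) \<and>
    (\<forall>x\<in>hcarrier H. x \<noteq> 0 \<longrightarrow> Re (hinner H x x) > 0) \<and>
    Metric_space.mcomplete (hcarrier H) (hdist H)"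

lemma Metric_space_hdist:
  assumes "hilbert_space H"
  shows "Metric_space (hcarrier H) (hdist H)"
proof -
  let ?C = "hcarrier H" and ?i = "hinner H"
  have sub: "csubspace ?C" and sesq: "sesquilinear_on ?C ?i"
    and herm: "\<forall>x\<in>?C. \<forall>y\<in>?C. ?i y x = cnj (?i x y)"
    and pos: "\<forall>x\<in>?C. x \<noteq> 0 \<longrightarrow> Re (?i x x) > 0"
    using assms unfolding hilbert_space_def by blast+
  have add: "?i (x + y) z = ?i x z + ?i y z" "?i z (x + y) = ?i z x + ?i z y"
    if "x \<in> ?C" "y \<in> ?C" "z \<in> ?C" for x y z
    using sesq that unfolding sesquilinear_on_def by blast+
  have scale: "?i (c *\<^sub>C x) y = c * ?i x y" "?i x (c *\<^sub>C y) = cnj c * ?i x y"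
    if "x \<in> ?C" "y \<in> ?C" for x y c
    using sesq that unfolding sesquilinear_on_def by blast+
  have herm: "?i y x = cnj (?i x y)" and pos: "x \<noteq> 0 \<Longrightarrow> Re (?i x x) > 0"
    if "x \<in> ?C" "y \<in> ?C" for x y
    using herm pos that by blast+
  have cl: "0 \<in> ?C" "x + y \<in> ?C" "x - y \<in> ?C" "c *\<^sub>C x \<in> ?C" if "x \<in> ?C" "y \<in> ?C" for x y c
    using that by (auto intro: complex_vector.subspace_0[OF sub] complex_vector.subspace_add[OF sub]
      complex_vector.subspace_diff[OF sub] complex_vector.subspace_scale[OF sub])
  have zero: "?i 0 x = 0" "?i x 0 = 0" if "x \<in> ?C" for x
    using add[OF cl(1)[OF that that] cl(1)[OF that that] that] by simp_all
  have nonneg: "Re (?i x x) \<ge> 0" if "x \<in> ?C" for x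
    using pos[OF that that] zero[OF that] by (cases "x = 0") auto
  have uminus: "- x = (-1) *\<^sub>C x" for x :: 'a
    by (simp add: complex_vector.scale_minus_left scaleC_one)
  have cs: "Re (?i x y) \<le> hnorm H x * hnorm H y" if xy: "x \<in> ?C" "y \<in> ?C" for x y
  proof (cases "y = 0")
    case True
    then show ?thesis using zero[OF xy(1)] nonneg xy by (simp add: hnorm_def)
  next
    case False
    define a b d where "a = Re (?i x x)" and "b = Re (?i y y)" and "d = Re (?i x y)"
    have b: "b > 0" using pos[OF xy(2) xy(2) False] by (simp add: b_def)
    define t where "t = d / b"
    define c where "c = - complex_of_real t"
    let ?w = "c *\<^sub>C y"
    have w: "?w \<in> ?C" "x + ?w \<in> ?C"
      using cl(4)[OF xy(2) xy(2)] cl(2)[OF xy(1) cl(4)[OF xy(2) xy(2)]] .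
    have "?i (x + ?w) (x + ?w) = ?i x x + ?i x ?w + (?i ?w x + ?i ?w ?w)"
      using add xy w by simp
    also have "\<dots> = ?i x x + cnj c * ?i x y + (c * cnj (?i x y) + c * (cnj c * ?i y y))"
      unfolding scale(1)[OF xy(2) w(1)] scale(1)[OF xy(2) xy(1)] scale(2)[OF xy(1) xy(2)]
        scale(2)[OF xy(2) xy(2)] herm[OF xy] ..
    also have "\<dots> = ?i x x - t * ?i x y - t * cnj (?i x y) + t * t * ?i y y"
      by (simp add: c_def)
    finally have "Re (?i (x + ?w) (x + ?w)) = a - 2 * t * d + t * t * b"
      by (simp add: a_def b_def d_def)
    moreover have "\<dots> = a - d\<^sup>2 / b"
      using b by (simp add: t_def field_simps power2_eq_square)
    ultimately have "d\<^sup>2 / b \<le> a"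
      using nonneg[OF w(2)] by linarith
    then have "d\<^sup>2 \<le> a * b"
      using b by (simp add: pos_divide_le_eq)
    then have "\<bar>d\<bar> \<le> sqrt (a * b)"
      using real_le_rsqrt[of "\<bar>d\<bar>" "a * b"] by simp
    then show ?thesis
      by (simp add: hnorm_def real_sqrt_mult a_def b_def d_def)
  qed
  have tri: "hnorm H (x + y) \<le> hnorm H x + hnorm H y" if xy: "x \<in> ?C" "y \<in> ?C" for x y
  proof -
    have "Re (?i (x + y) (x + y)) = Re (?i x x) + 2 * Re (?i x y) + Re (?i y y)"
      using add(1)[OF xy cl(2)[OF xy]] add(2)[OF xy xy(1)] add(2)[OF xy xy(2)] herm[OF xy] by simp
    also have "\<dots> \<le> (hnorm H x + hnorm H y)\<^sup>2"
      using cs[OF xy] nonneg xy by (simp add: hnorm_def power2_sum)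
    finally show ?thesis
      unfolding hnorm_def[of H "x + y"] using nonneg xy
      by (intro real_le_lsqrt) (auto simp: hnorm_def)
  qed
  have eq0: "hnorm H x = 0 \<longleftrightarrow> x = 0" if "x \<in> ?C" for x
    using pos[OF that that] zero[OF that] by (cases "x = 0") (auto simp: hnorm_def zero)
  have comm: "hnorm H (x - y) = hnorm H (y - x)" if "x \<in> ?C" "y \<in> ?C" for x y
  proof -
    have *: "x - y = (-1) *\<^sub>C (y - x)" unfolding uminus[symmetric] by simp
    have d: "y - x \<in> ?C" by (rule cl(3)[OF that(2,1)])
    have m: "y - x \<in> ?C" "(-1) *\<^sub>C (y - x) \<in> ?C" using d cl(4)[OF d d] .
    have "?i (x - y) (x - y) = ?i (y - x) (y - x)"
      unfolding * scale(1)[OF m] scale(2)[OF d d] by simp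
    then show ?thesis by (simp add: hnorm_def)
  qed
  show ?thesis
  proof
    show "0 \<le> hdist H x y" for x y
      using nonneg[OF cl(3)[of x y]] by (simp add: hdist_def hnorm_def)
    show "hdist H x y = hdist H y x" for x y
      using comm[of x y] by (simp add: hdist_def)
    show "hdist H x y = 0 \<longleftrightarrow> x = y" if "x \<in> ?C" "y \<in> ?C" for x y
      using eq0[OF cl(3)[OF that]] that by (simp add: hdist_def)
    show "hdist H x z \<le> hdist H x y + hdist H y z" if "x \<in> ?C" "y \<in> ?C" "z \<in> ?C" for x y z
      using tri[OF cl(3)[OF that(1,2)] cl(3)[OF that(2,3)]] that by (simp add: hdist_def)
  qed
qed

definition hdense :: "'a::complex_vector hspace \<Rightarrow> 'a set \<Rightarrow> bool"
  where "hdense H S \<longleftrightarrow> S \<subseteq> hcarrier H \<and> htop H closure_of S = hcarrier H"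

definition hsub :: "'a hspace \<Rightarrow> 'a set \<Rightarrow> 'a hspace"
  where "hsub H S = \<lparr>hcarrier = S, hinner = hinner H\<rparr>"

definition hprod :: "'a hspace \<Rightarrow> 'b hspace \<Rightarrow> ('a \<times> 'b) hspace"
  where "hprod H K = \<lparr>hcarrier = hcarrier H \<times> hcarrier K,
    hinner = (\<lambda>u v. hinner H (fst u) (fst v) + hinner K (snd u) (snd v))\<rparr>"

definition hinter :: "'a hspace \<Rightarrow> 'a hspace \<Rightarrow> 'a hspace"
  where "hinter H K = \<lparr>hcarrier = hcarrier H \<inter> hcarrier K,
    hinner = (\<lambda>u v. hinner H u v + hinner K u v)\<rparr>"

definition hsum :: "'i set \<Rightarrow> ('i \<Rightarrow> 'a::complex_vector hspace) \<Rightarrow> ('i \<Rightarrow> 'a) hspace"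
  where "hsum I H = \<lparr>hcarrier = {u. (\<forall>i\<in>I. u i \<in> hcarrier (H i)) \<and> (\<forall>i. i \<notin> I \<longrightarrow> u i = 0)},
    hinner = (\<lambda>u v. \<Sum>i\<in>I. hinner (H i) (u i) (v i))\<rparr>"

definition single :: "'i \<Rightarrow> 'a::zero \<Rightarrow> 'i \<Rightarrow> 'a"
  where "single i x = (\<lambda>j. if j = i then x else 0)"

definition bounded_op :: "'a::complex_vector hspace \<Rightarrow> 'b::complex_vector hspace \<Rightarrow> ('a \<Rightarrow> 'b) \<Rightarrow> bool"
  where "bounded_op H K T \<longleftrightarrow>
    T ` hcarrier H \<subseteq> hcarrier K \<and> clinear_on (hcarrier H) T \<and>
    (\<exists>C. \<forall>x\<in>hcarrier H. hnorm K (T x) \<le> C * hnorm H x)"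

definition op_norm :: "'a::complex_vector hspace \<Rightarrow> 'b::complex_vector hspace \<Rightarrow> ('a \<Rightarrow> 'b) \<Rightarrow> real"
  where "op_norm H K T = (SUP x\<in>{x \<in> hcarrier H. hnorm H x \<le> 1}. hnorm K (T x))"

definition compact_op :: "'a::complex_vector hspace \<Rightarrow> 'b::complex_vector hspace \<Rightarrow> ('a \<Rightarrow> 'b) \<Rightarrow> bool"
  where "compact_op H K T \<longleftrightarrow> bounded_op H K T \<and>
    compactin (htop K) (htop K closure_of (T ` {x \<in> hcarrier H. hnorm H x \<le> 1}))"

definition invertible_op :: "'a::complex_vector hspace \<Rightarrow> ('a \<Rightarrow> 'a) \<Rightarrow> bool"
  where "invertible_op H T \<longleftrightarrow> bounded_op H H T \<and>
    (\<exists>S. bounded_op H H S \<and> (\<forall>x\<in>hcarrier H. S (T x) = x \<and> T (S x) = x))"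

definition bounded_sesquilinear :: "'a::complex_vector hspace \<Rightarrow> ('a \<Rightarrow> 'a \<Rightarrow> complex) \<Rightarrow> bool"
  where "bounded_sesquilinear H b \<longleftrightarrow> sesquilinear_on (hcarrier H) b \<and>
    (\<exists>C. \<forall>x\<in>hcarrier H. \<forall>y\<in>hcarrier H. cmod (b x y) \<le> C * hnorm H x * hnorm H y)"

definition cont_embedded :: "'a::complex_vector hspace \<Rightarrow> 'a hspace \<Rightarrow> bool"
  where "cont_embedded K H \<longleftrightarrow> hcarrier K \<subseteq> hcarrier H \<and>
    (\<exists>C. \<forall>x\<in>hcarrier K. hnorm H x \<le> C * hnorm K x)"

definition dense_cont_embedded :: "'a::complex_vector hspace \<Rightarrow> 'a hspace \<Rightarrow> bool"
  where "dense_cont_embedded K H \<longleftrightarrow> cont_embedded K H \<and> hdense H (hcarrier K)"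

definition hilbert_orthogonal_sum :: "'a::complex_vector hspace \<Rightarrow> (nat \<Rightarrow> 'a set) \<Rightarrow> bool"
  where "hilbert_orthogonal_sum H W \<longleftrightarrow>
    (\<forall>n. csubspace (W n) \<and> closedin (htop H) (W n)) \<and>
    (\<forall>m n. m \<noteq> n \<longrightarrow> (\<forall>u\<in>W m. \<forall>v\<in>W n. hinner H u v = 0)) \<and>
    hdense H (cspan (\<Union>n. W n))"

definition complete_orthogonal_system :: "'a::complex_vector hspace \<Rightarrow> (nat \<Rightarrow> 'a) \<Rightarrow> bool"
  where "complete_orthogonal_system H \<phi> \<longleftrightarrow>
    (\<forall>n. \<phi> n \<in> hcarrier H \<and> \<phi> n \<noteq> 0) \<and>
    (\<forall>m n. m \<noteq> n \<longrightarrow> hinner H (\<phi> m) (\<phi> n) = 0) \<and>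
    hdense H (cspan (range \<phi>))"


section \<open>Tensor products\<close>

definition tensor_span ::
  "('a \<Rightarrow> 'b \<Rightarrow> 'c::complex_vector) \<Rightarrow> 'a set \<Rightarrow> 'b set \<Rightarrow> 'c set"
  where "tensor_span ten S T = cspan {ten x y | x y. x \<in> S \<and> y \<in> T}"

text \<open>\<open>W\<close> with the bilinear map \<open>ten\<close> is (a realization of) the Hilbert space tensor product of
  \<open>H\<close> and \<open>K\<close>, i.e. the completion of the algebraic tensor product in the inner product that is
  multiplicative on elementary tensors. This determines \<open>(W, ten)\<close> up to unique unitary
  isomorphism.\<close>

definition hilbert_tensor :: "'a::complex_vector hspace \<Rightarrow> 'b::complex_vector hspace \<Rightarrow>
    ('a \<Rightarrow> 'b \<Rightarrow> 'c::complex_vector) \<Rightarrow> 'c hspace \<Rightarrow> bool"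
  where "hilbert_tensor H K ten W \<longleftrightarrow>
    hilbert_space W \<and>
    (\<forall>x\<in>hcarrier H. clinear_on (hcarrier K) (ten x)) \<and>
    (\<forall>y\<in>hcarrier K. clinear_on (hcarrier H) (\<lambda>x. ten x y)) \<and>
    (\<forall>x\<in>hcarrier H. \<forall>y\<in>hcarrier K. \<forall>x'\<in>hcarrier H. \<forall>y'\<in>hcarrier K.
      hinner W (ten x y) (ten x' y') = hinner H x x' * hinner K y y') \<and>
    hdense W (tensor_span ten (hcarrier H) (hcarrier K))"


section \<open>Exterior and interior spaces\<close>

text \<open>The indices \<open>l\<close> range over \<open>{1..Lnum}\<close>. \<open>X1Y1 l\<close>, \<open>X2Y1 l\<close>, \<open>X1Y2 l\<close> stand for the
  tensor products of \<open>X1 l\<close>, \<open>X2 l\<close> with \<open>Y1 l\<close>, \<open>Y2 l\<close>; they share the map \<open>ten l\<close>,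
  so that \<open>X2Y1 l\<close> and \<open>X1Y2 l\<close> are subspaces of \<open>X1Y1 l\<close> via the canonical embeddings.\<close>

record ('v, 'z, 'x, 'y, 'w) setting =
  Vint :: "'v hspace"
  Zsp :: "'z hspace"
  Lnum :: nat
  X1 :: "nat \<Rightarrow> 'x hspace"
  X2 :: "nat \<Rightarrow> 'x hspace"
  Y1 :: "nat \<Rightarrow> 'y hspace"
  Y2 :: "nat \<Rightarrow> 'y hspace"
  ten :: "nat \<Rightarrow> 'x \<Rightarrow> 'y \<Rightarrow> 'w"
  X1Y1 :: "nat \<Rightarrow> 'w hspace"
  X2Y1 :: "nat \<Rightarrow> 'w hspace"
  X1Y2 :: "nat \<Rightarrow> 'w hspace"
  trp :: "(nat \<Rightarrow> 'w) \<Rightarrow> 'z"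
  trm :: "'v \<Rightarrow> 'z"
  params :: "complex set"
  sint :: "complex \<Rightarrow> 'v \<Rightarrow> 'v \<Rightarrow> complex"
  sext :: "complex \<Rightarrow> (nat \<Rightarrow> 'w) \<Rightarrow> (nat \<Rightarrow> 'w) \<Rightarrow> complex"

type_synonym ('v, 'w) vec = "'v \<times> (nat \<Rightarrow> 'w)"

definition Vext :: "('v, 'z, 'x, 'y, 'w::complex_vector) setting \<Rightarrow> (nat \<Rightarrow> 'w) hspace"
  where "Vext S = hsum {1..Lnum S} (\<lambda>l. hinter (X2Y1 S l) (X1Y2 S l))"

definition Vsp :: "('v, 'z, 'x, 'y, 'w::complex_vector) setting \<Rightarrow> ('v, 'w) vec hspace"
  where "Vsp S = hsub (hprod (Vint S) (Vext S))
    {u \<in> hcarrier (Vint S) \<times> hcarrier (Vext S). trp S (snd u) = trm S (fst u)}"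

definition form :: "('v, 'z, 'x, 'y, 'w) setting \<Rightarrow> complex \<Rightarrow> ('v, 'w) vec \<Rightarrow> ('v, 'w) vec \<Rightarrow> complex"
  where "form S \<kappa> u v = sint S \<kappa> (fst u) (fst v) + sext S \<kappa> (snd u) (snd v)"

definition assumption_A :: "('v::complex_vector, 'z::complex_vector, 'x::complex_vector,
    'y::complex_vector, 'w::complex_vector) setting \<Rightarrow> bool"
  where "assumption_A S \<longleftrightarrow>
    hilbert_space (Vint S) \<and> hilbert_space (Zsp S) \<and>
    (\<forall>l\<in>{1..Lnum S}.
      hilbert_space (X1 S l) \<and> hilbert_space (X2 S l) \<and>
      hilbert_space (Y1 S l) \<and> hilbert_space (Y2 S l) \<and>
      dense_cont_embedded (X2 S l) (X1 S l) \<and> dense_cont_embedded (Y2 S l) (Y1 S l) \<and>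
      hilbert_tensor (X1 S l) (Y1 S l) (ten S l) (X1Y1 S l) \<and>
      hilbert_tensor (X2 S l) (Y1 S l) (ten S l) (X2Y1 S l) \<and>
      hilbert_tensor (X1 S l) (Y2 S l) (ten S l) (X1Y2 S l) \<and>
      cont_embedded (X2Y1 S l) (X1Y1 S l) \<and> cont_embedded (X1Y2 S l) (X1Y1 S l)) \<and>
    bounded_op (Vext S) (Zsp S) (trp S) \<and> trp S ` hcarrier (Vext S) = hcarrier (Zsp S) \<and>
    bounded_op (Vint S) (Zsp S) (trm S) \<and> trm S ` hcarrier (Vint S) = hcarrier (Zsp S) \<and>
    (\<forall>\<kappa>\<in>params S. bounded_sesquilinear (Vint S) (sint S \<kappa>) \<and>
                  bounded_sesquilinear (Vext S) (sext S \<kappa>))"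


section \<open>Separation and coercivity\<close>

text \<open>The natural numbers indexing \<open>\<phi>\<close> start from 0 here, so the first \<open>M\<close> indices
  are those with \<open>n < M\<close>.\<close>

definition Vsep :: "('v, 'z, 'x, 'y::complex_vector, 'w::complex_vector) setting \<Rightarrow>
    (nat \<Rightarrow> nat \<Rightarrow> 'y) \<Rightarrow> (nat \<Rightarrow> nat) \<Rightarrow> nat \<Rightarrow> (nat \<Rightarrow> 'w) set"
  where "Vsep S \<phi> lidx n =
    single (lidx n) ` tensor_span (ten S (lidx n)) (hcarrier (X1 S (lidx n))) (cspan {\<phi> n (lidx n)})
    \<inter> hcarrier (Vext S)"

definition tensor_phi :: "('v, 'z, 'x, 'y, 'w::complex_vector) setting \<Rightarrow>
    (nat \<Rightarrow> nat \<Rightarrow> 'y) \<Rightarrow> (nat \<Rightarrow> nat) \<Rightarrow> nat \<Rightarrow> 'x \<Rightarrow> nat \<Rightarrow> 'w"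
  where "tensor_phi S \<phi> lidx n u = single (lidx n) (ten S (lidx n) u (\<phi> n (lidx n)))"

definition Xsep :: "('v, 'z, 'x, 'y, 'w::complex_vector) setting \<Rightarrow>
    (nat \<Rightarrow> nat \<Rightarrow> 'y) \<Rightarrow> (nat \<Rightarrow> nat) \<Rightarrow> nat \<Rightarrow> 'x hspace"
  where "Xsep S \<phi> lidx n =
    \<lparr>hcarrier = {u \<in> hcarrier (X1 S (lidx n)). tensor_phi S \<phi> lidx n u \<in> hcarrier (Vext S)},
     hinner = (\<lambda>u v. hinner (Vext S) (tensor_phi S \<phi> lidx n u) (tensor_phi S \<phi> lidx n v))\<rparr>"

definition sn :: "('v, 'z, 'x, 'y, 'w::complex_vector) setting \<Rightarrow>
    (nat \<Rightarrow> nat \<Rightarrow> 'y) \<Rightarrow> (nat \<Rightarrow> nat) \<Rightarrow> complex \<Rightarrow> nat \<Rightarrow> 'x \<Rightarrow> 'x \<Rightarrow> complex"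
  where "sn S \<phi> lidx \<kappa> n u v = sext S \<kappa> (tensor_phi S \<phi> lidx n u) (tensor_phi S \<phi> lidx n v)"

definition assumption_B :: "('v::complex_vector, 'z::complex_vector, 'x::complex_vector,
    'y::complex_vector, 'w::complex_vector) setting \<Rightarrow> (nat \<Rightarrow> nat \<Rightarrow> 'y) \<Rightarrow> (nat \<Rightarrow> nat) \<Rightarrow>
    complex \<Rightarrow> bool"
  where "assumption_B S \<phi> lidx \<kappa> \<longleftrightarrow>
    complete_orthogonal_system (hsum {1..Lnum S} (Y2 S)) \<phi> \<and>
    (\<forall>n. lidx n \<in> {1..Lnum S} \<and> (\<forall>j. j \<noteq> lidx n \<longrightarrow> \<phi> n j = 0)) \<and>
    (\<forall>m n. m \<noteq> n \<longrightarrow> (\<forall>u\<in>Vsep S \<phi> lidx m. \<forall>v\<in>Vsep S \<phi> lidx n.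
      hinner (Vext S) u v = 0 \<and> sext S \<kappa> u v = 0 \<and> hinner (Zsp S) (trp S u) (trp S v) = 0)) \<and>
    (\<forall>n. fin_dim (trp S ` Vsep S \<phi> lidx n)) \<and>
    hilbert_orthogonal_sum (Vext S) (Vsep S \<phi> lidx) \<and>
    hilbert_orthogonal_sum (Zsp S) (\<lambda>n. trp S ` Vsep S \<phi> lidx n)"

definition assumption_C :: "('v::complex_vector, 'z::complex_vector, 'x::complex_vector,
    'y::complex_vector, 'w::complex_vector) setting \<Rightarrow> (nat \<Rightarrow> nat \<Rightarrow> 'y) \<Rightarrow> (nat \<Rightarrow> nat) \<Rightarrow>
    nat \<Rightarrow> real \<Rightarrow> real \<Rightarrow> (nat \<Rightarrow> complex) \<Rightarrow> ('v \<Rightarrow> 'v) \<Rightarrow> complex \<Rightarrow> bool"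
  where "assumption_C S \<phi> lidx M Cs \<alpha> \<theta> K \<kappa> \<longleftrightarrow>
    Cs > 0 \<and> \<alpha> > 0 \<and> (\<forall>n<M. cmod (\<theta> n) = 1) \<and>
    (\<forall>n. \<forall>u\<in>hcarrier (Xsep S \<phi> lidx n). \<forall>v\<in>hcarrier (Xsep S \<phi> lidx n).
      cmod (sn S \<phi> lidx \<kappa> n u v) \<le> Cs * hnorm (Xsep S \<phi> lidx n) u * hnorm (Xsep S \<phi> lidx n) v) \<and>
    (\<forall>n<M. \<forall>u\<in>hcarrier (Xsep S \<phi> lidx n).
      Re (\<theta> n * sn S \<phi> lidx \<kappa> n u u) \<ge> \<alpha> * (hnorm (Xsep S \<phi> lidx n) u)\<^sup>2) \<and>
    (\<forall>n\<ge>M. \<forall>u\<in>hcarrier (Xsep S \<phi> lidx n).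
      Re (sn S \<phi> lidx \<kappa> n u u) \<ge> \<alpha> * (hnorm (Xsep S \<phi> lidx n) u)\<^sup>2) \<and>
    compact_op (Vint S) (Vint S) K \<and>
    (\<forall>u\<in>hcarrier (Vint S).
      Re (sint S \<kappa> u u) + Re (hinner (Vint S) (K u) u) \<ge> \<alpha> * (hnorm (Vint S) u)\<^sup>2)"


section \<open>Discrete subspaces\<close>

record ('v, 'z, 'x, 'y) discretization =
  Vh_int :: "real \<Rightarrow> 'v set"
  Yh :: "real \<Rightarrow> nat \<Rightarrow> 'y set"
  XN :: "nat \<Rightarrow> nat \<Rightarrow> 'x set"
  trm_dagger :: "'z \<Rightarrow> 'v"
  trmh_dagger :: "real \<Rightarrow> 'z \<Rightarrow> 'v"

definition VhN_ext :: "('v, 'z, 'x, 'y, 'w::complex_vector) setting \<Rightarrow>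
    ('v, 'z, 'x, 'y) discretization \<Rightarrow> real \<Rightarrow> nat \<Rightarrow> (nat \<Rightarrow> 'w) set"
  where "VhN_ext S D h N =
    {u. (\<forall>l\<in>{1..Lnum S}. u l \<in> tensor_span (ten S l) (XN D N l) (Yh D h l)) \<and>
        (\<forall>l. l \<notin> {1..Lnum S} \<longrightarrow> u l = 0)}"

definition VhN :: "('v, 'z, 'x, 'y, 'w::complex_vector) setting \<Rightarrow>
    ('v, 'z, 'x, 'y) discretization \<Rightarrow> real \<Rightarrow> nat \<Rightarrow> ('v, 'w) vec set"
  where "VhN S D h N = {u \<in> Vh_int D h \<times> VhN_ext S D h N. trm S (fst u) = trp S (snd u)}"

text \<open>The spaces \<open>XN\<close> need not be finite dimensional; as subspaces of a Hilbert space
  they are closed. Since the \<open>Yh\<close> are finite dimensional, the Hilbert space tensor product of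
  \<open>XN\<close> and \<open>Yh\<close> is the linear span of the elementary tensors.\<close>

definition assumption_D :: "('v::complex_vector, 'z::complex_vector, 'x::complex_vector,
    'y::complex_vector, 'w::complex_vector) setting \<Rightarrow> ('v, 'z, 'x, 'y) discretization \<Rightarrow> bool"
  where "assumption_D S D \<longleftrightarrow>
    (\<forall>h>0. csubspace (Vh_int D h) \<and> fin_dim (Vh_int D h) \<and> Vh_int D h \<subseteq> hcarrier (Vint S)) \<and>
    (\<forall>h>0. \<forall>h'\<ge>h. Vh_int D h' \<subseteq> Vh_int D h) \<and>
    hdense (Vint S) (\<Union>h\<in>{0<..}. Vh_int D h) \<and>
    (\<forall>l\<in>{1..Lnum S}.
      (\<forall>h>0. csubspace (Yh D h l) \<and> fin_dim (Yh D h l) \<and> Yh D h l \<subseteq> hcarrier (Y2 S l)) \<and>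
      (\<forall>h>0. \<forall>h'\<ge>h. Yh D h' l \<subseteq> Yh D h l) \<and>
      hdense (Y2 S l) (\<Union>h\<in>{0<..}. Yh D h l) \<and>
      (\<forall>N. csubspace (XN D N l) \<and> closedin (htop (X2 S l)) (XN D N l)) \<and>
      (\<forall>N N'. N \<le> N' \<longrightarrow> XN D N l \<subseteq> XN D N' l) \<and>
      hdense (X2 S l) (\<Union>N. XN D N l)) \<and>
    (\<forall>h>0. \<forall>N. VhN_ext S D h N \<subseteq> hcarrier (Vext S) \<and>
               trp S ` VhN_ext S D h N = trm S ` Vh_int D h) \<and>
    bounded_op (Zsp S) (Vint S) (trm_dagger D) \<and>
    (\<forall>h>0. bounded_op (Zsp S) (hsub (Vint S) (Vh_int D h)) (trmh_dagger D h)) \<and>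
    (\<forall>g\<in>hcarrier (Zsp S). trm S (trm_dagger D g) = g) \<and>
    (\<forall>h>0. \<forall>u\<in>Vh_int D h. trm S (trmh_dagger D h (trm S u)) = trm S u) \<and>
    (\<forall>g\<in>hcarrier (Zsp S).
      ((\<lambda>h. hnorm (Vint S) (trm_dagger D g - trmh_dagger D h g)) \<longlongrightarrow> 0) (at_right 0))"


section \<open>The eigenvalue problem\<close>

definition Top :: "('v::complex_vector, 'z, 'x, 'y, 'w::complex_vector) setting \<Rightarrow> complex \<Rightarrow>
    ('v, 'w) vec \<Rightarrow> ('v, 'w) vec"
  where "Top S \<kappa> u = (THE w. w \<in> hcarrier (Vsp S) \<and>
    (\<forall>v\<in>hcarrier (Vsp S). form S \<kappa> u v = hinner (Vsp S) w v))"

definition assumption_E :: "('v::complex_vector, 'z::complex_vector, 'x::complex_vector,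
    'y::complex_vector, 'w::complex_vector) setting \<Rightarrow> bool"
  where "assumption_E S \<longleftrightarrow>
    open (params S) \<and>
    (\<forall>\<kappa>\<^sub>0\<in>params S. \<exists>U. open U \<and> \<kappa>\<^sub>0 \<in> U \<and> U \<subseteq> params S \<and>
      (\<exists>\<phi> lidx M Cs \<alpha> \<theta> K. \<forall>\<kappa>\<in>U.
        assumption_B S \<phi> lidx \<kappa> \<and> assumption_C S \<phi> lidx M Cs \<alpha> \<theta> K \<kappa>)) \<and>
    (\<forall>\<kappa>\<^sub>0\<in>params S. \<exists>T'. bounded_op (Vsp S) (Vsp S) T' \<and>
      ((\<lambda>\<kappa>. op_norm (Vsp S) (Vsp S)
          (\<lambda>u. (1 / (\<kappa> - \<kappa>\<^sub>0)) *\<^sub>C (Top S \<kappa> u - Top S \<kappa>\<^sub>0 u) - T' u)) \<longlongrightarrow> 0) (at \<kappa>\<^sub>0))"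

definition eigenvalues :: "('v::complex_vector, 'z, 'x, 'y, 'w::complex_vector) setting \<Rightarrow> complex set"
  where "eigenvalues S = {\<kappa> \<in> params S. \<exists>u\<in>hcarrier (Vsp S) - {0}.
    \<forall>v\<in>hcarrier (Vsp S). form S \<kappa> u v = 0}"

definition discrete_eigenvalues :: "('v::complex_vector, 'z, 'x, 'y, 'w::complex_vector) setting \<Rightarrow>
    ('v, 'z, 'x, 'y) discretization \<Rightarrow> real \<Rightarrow> nat \<Rightarrow> complex set"
  where "discrete_eigenvalues S D h N = {\<kappa> \<in> params S. \<exists>u\<in>VhN S D h N - {0}.
    \<forall>v\<in>VhN S D h N. form S \<kappa> u v = 0}"

text \<open>With values in \<^typ>\<open>ennreal\<close>, the infimum over the empty set is \<open>\<infinity>\<close> and the supremum over it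
  is 0: two empty sets have distance 0, an empty and a nonempty set have distance \<open>\<infinity>\<close>.\<close>

definition hausdorff_distance :: "complex set \<Rightarrow> complex set \<Rightarrow> ennreal"
  where "hausdorff_distance A B =
    max (SUP a\<in>A. INF b\<in>B. ennreal (cmod (a - b))) (SUP b\<in>B. INF a\<in>A. ennreal (cmod (a - b)))"

end

theory Submission
  imports Defs "Jordan_Normal_Form.Determinant" "HOL-Complex_Analysis.Complex_Analysis"
begin

text \<open>At the \<open>n\<close>-th mode with \<open>n < M\<close>, multiplication of the exterior component by \<open>cnj (\<theta> n)\<close>, corrected in the
  interior by \<open>trm_dagger\<close> so that the traces still match, gives an isomorphism \<open>T\<close> of \<open>Vsp\<close> for which
  \<open>form S \<kappa> u (T u)\<close> is coercive up to a finite-rank form. Eigenvalues are thus, locally, the zeros of a finite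
  determinant that is holomorphic in \<open>\<kappa>\<close>, and by connectedness of \<open>params S\<close> they cannot accumulate.

  Replacing \<open>\<phi> n\<close> by nearby vectors of \<open>Yh\<close>, and \<open>trm_dagger\<close> by \<open>trmh_dagger\<close>, yields operators on \<open>VhN\<close>
  that are close to \<open>T\<close> in norm. This gives discrete stability uniformly on compact sets of regular points, so discrete
  eigenvalues can only approach eigenvalues. Conversely, if a disc around an eigenvalue contained no discrete one, the
  discrete solutions would be holomorphic in it and bounded by their values on its boundary circle, which contradicts
  their blow-up at the eigenvalue.\<close>

section \<open>Hilbert spaces\<close>

text \<open>The perturbation is made of finite rank, not merely compact, so that the analytic
  Fredholm argument needs only Lax-Milgram and an ordinary determinant: a solution is fixed by
  finitely many numbers \<open>A j u\<close>. The isomorphism acts in the second argument of the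
  form, where antilinearity turns \<open>cnj (\<theta> n)\<close> into \<open>\<theta> n\<close>;
  with unimodular factors its inverse has the same shape. The obstacle is that \<open>T\<close> need
  not map the discrete spaces into themselves, as \<open>\<phi> n\<close> need not lie in
  \<open>Yh\<close>. The way out is that the n-th coefficient of a discrete function lies in
  \<open>XN\<close> again, because the inner products of \<open>Y1\<close> and \<open>Y2\<close>
  against \<open>\<phi> n\<close> are proportional. \<open>trmh_dagger\<close> converges only
  pointwise, but its error matters only on a fixed finite-dimensional space of traces, where the
  convergence is uniform; elsewhere a uniform bound suffices. Since \<open>XN\<close> may be
  infinite-dimensional, injectivity on \<open>VhN\<close> does not give solvability by counting
  dimensions. The approximate operators must be onto, so that the Fredholm argument can be repeated
  there; this comes from approximating the inverse as well.\<close>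

lemma sesquilinear_onD:
  assumes "sesquilinear_on S b" "x \<in> S" "y \<in> S"
  shows "z \<in> S \<Longrightarrow> b (x + y) z = b x z + b y z" "z \<in> S \<Longrightarrow> b z (x + y) = b z x + b z y"
    "b (c *\<^sub>C x) y = c * b x y" "b x (c *\<^sub>C y) = cnj c * b x y"
  using assms unfolding sesquilinear_on_def by blast+

lemma clinear_onD:
  assumes "clinear_on S f" "x \<in> S"
  shows "y \<in> S \<Longrightarrow> f (x + y) = f x + f y" "f (c *\<^sub>C x) = c *\<^sub>C f x"
  using assms unfolding clinear_on_def by blast+

text \<open>A notion of its own, because the scalars are not set up as an \<open>hspace\<close> and
  \<open>bounded_op\<close> needs one as its target.\<close>

definition bounded_functional :: "'a::complex_vector hspace \<Rightarrow> ('a \<Rightarrow> complex) \<Rightarrow> bool"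
  where "bounded_functional H g \<longleftrightarrow>
    (\<forall>x\<in>hcarrier H. \<forall>y\<in>hcarrier H. g (x + y) = g x + g y) \<and>
    (\<forall>c. \<forall>x\<in>hcarrier H. g (c *\<^sub>C x) = c * g x) \<and>
    (\<exists>C. \<forall>x\<in>hcarrier H. cmod (g x) \<le> C * hnorm H x)"

lemma bounded_functionalI:
  assumes "\<And>x y. x \<in> hcarrier H \<Longrightarrow> y \<in> hcarrier H \<Longrightarrow> g (x + y) = g x + g y"
    "\<And>c x. x \<in> hcarrier H \<Longrightarrow> g (c *\<^sub>C x) = c * g x"
    "\<And>x. x \<in> hcarrier H \<Longrightarrow> cmod (g x) \<le> C * hnorm H x"
  shows "bounded_functional H g"
  using assms unfolding bounded_functional_def by blast

lemma bounded_functionalD: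
  assumes "bounded_functional H g" "x \<in> hcarrier H"
  shows "y \<in> hcarrier H \<Longrightarrow> g (x + y) = g x + g y" "g (c *\<^sub>C x) = c * g x"
  using assms unfolding bounded_functional_def by blast+

text \<open>Kept apart from \<open>hilbert\<close>: subspaces, products, intersections and sums get
  their completeness from norm estimates that already use the laws of the inner product.\<close>

locale pre_hilbert =
  fixes H :: "'a::complex_vector hspace"
  assumes subspace_carr: "csubspace (hcarrier H)"
    and sesq: "sesquilinear_on (hcarrier H) (hinner H)"
    and ip_commute: "x \<in> hcarrier H \<Longrightarrow> y \<in> hcarrier H \<Longrightarrow> hinner H y x = cnj (hinner H x y)"
    and ip_pos: "x \<in> hcarrier H \<Longrightarrow> x \<noteq> 0 \<Longrightarrow> Re (hinner H x x) > 0"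
begin

abbreviation carr where "carr \<equiv> hcarrier H"
abbreviation ip where "ip \<equiv> hinner H"
abbreviation nrm where "nrm \<equiv> hnorm H"

lemma mem_0 [simp, intro]: "0 \<in> carr"
  by (rule complex_vector.subspace_0[OF subspace_carr])

lemma mem_add [simp, intro]: "x \<in> carr \<Longrightarrow> y \<in> carr \<Longrightarrow> x + y \<in> carr"
  by (rule complex_vector.subspace_add[OF subspace_carr])

lemma mem_diff [simp, intro]: "x \<in> carr \<Longrightarrow> y \<in> carr \<Longrightarrow> x - y \<in> carr"
  by (rule complex_vector.subspace_diff[OF subspace_carr])

lemma mem_minus [simp, intro]: "x \<in> carr \<Longrightarrow> - x \<in> carr"
  by (rule complex_vector.subspace_neg[OF subspace_carr])

lemma mem_scale [simp, intro]: "x \<in> carr \<Longrightarrow> c *\<^sub>C x \<in> carr"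
  by (rule complex_vector.subspace_scale[OF subspace_carr])

lemma mem_sum [simp, intro]: "(\<And>i. i \<in> I \<Longrightarrow> f i \<in> carr) \<Longrightarrow> sum f I \<in> carr"
  by (rule complex_vector.subspace_sum[OF subspace_carr])

lemmas ip_add_left = sesquilinear_onD(1)[OF sesq]
  and ip_add_right = sesquilinear_onD(2)[OF sesq]
  and ip_scale_left = sesquilinear_onD(3)[OF sesq]
  and ip_scale_right = sesquilinear_onD(4)[OF sesq]

lemma ip_0_left [simp]: "x \<in> carr \<Longrightarrow> ip 0 x = 0"
  and ip_0_right [simp]: "x \<in> carr \<Longrightarrow> ip x 0 = 0"
  using ip_scale_left[of 0 x 0] ip_scale_right[of x 0 0] by auto

lemma ip_minus_left: "x \<in> carr \<Longrightarrow> z \<in> carr \<Longrightarrow> ip (- x) z = - ip x z"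
  and ip_minus_right: "x \<in> carr \<Longrightarrow> z \<in> carr \<Longrightarrow> ip z (- x) = - ip z x"
  using ip_scale_left[of x z "-1"] ip_scale_right[of z x "-1"] by simp_all

lemma ip_diff_left: "x \<in> carr \<Longrightarrow> y \<in> carr \<Longrightarrow> z \<in> carr \<Longrightarrow> ip (x - y) z = ip x z - ip y z"
  and ip_diff_right: "x \<in> carr \<Longrightarrow> y \<in> carr \<Longrightarrow> z \<in> carr \<Longrightarrow> ip z (x - y) = ip z x - ip z y"
  using ip_add_left[of x "- y" z] ip_add_right[of x "- y" z]
  by (simp_all add: ip_minus_left ip_minus_right)

lemma ip_sum_left: "(\<And>i. i \<in> I \<Longrightarrow> f i \<in> carr) \<Longrightarrow> z \<in> carr \<Longrightarrow> ip (sum f I) z = (\<Sum>i\<in>I. ip (f i) z)"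
  by (induction I rule: infinite_finite_induct) (auto simp: ip_add_left)

lemma ip_sum_right: "(\<And>i. i \<in> I \<Longrightarrow> f i \<in> carr) \<Longrightarrow> z \<in> carr \<Longrightarrow> ip z (sum f I) = (\<Sum>i\<in>I. ip z (f i))"
  by (induction I rule: infinite_finite_induct) (auto simp: ip_add_right)

lemma Re_ip_nonneg: "x \<in> carr \<Longrightarrow> Re (ip x x) \<ge> 0"
  using ip_pos[of x] by (cases "x = 0") auto

lemma nrm_nonneg [simp]: "x \<in> carr \<Longrightarrow> nrm x \<ge> 0"
  by (simp add: hnorm_def Re_ip_nonneg)

lemma nrm_sq: "x \<in> carr \<Longrightarrow> (nrm x)\<^sup>2 = Re (ip x x)"
  by (simp add: hnorm_def Re_ip_nonneg)

lemma ip_self: "x \<in> carr \<Longrightarrow> ip x x = of_real ((nrm x)\<^sup>2)"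
  using ip_commute[of x x] by (simp add: nrm_sq complex_eq_iff)

lemma nrm_0 [simp]: "nrm 0 = 0"
  by (simp add: hnorm_def)

lemma nrm_eq_0 [simp]: "x \<in> carr \<Longrightarrow> nrm x = 0 \<longleftrightarrow> x = 0"
  using ip_pos[of x] by (cases "x = 0") (auto simp: hnorm_def)

lemma nrm_pos: "x \<in> carr \<Longrightarrow> x \<noteq> 0 \<Longrightarrow> nrm x > 0"
  using nrm_nonneg[of x] nrm_eq_0[of x] by linarith

lemma nrm_scale [simp]: "x \<in> carr \<Longrightarrow> nrm (c *\<^sub>C x) = cmod c * nrm x"
proof -
  assume x: "x \<in> carr"
  have "ip (c *\<^sub>C x) (c *\<^sub>C x) = (c * cnj c) * ip x x"
    using x by (simp add: ip_scale_left ip_scale_right)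
  also have "\<dots> = of_real ((cmod c * nrm x)\<^sup>2)"
    using x by (simp add: ip_self power_mult_distrib flip: complex_norm_square)
  finally have "Re (ip (c *\<^sub>C x) (c *\<^sub>C x)) = (cmod c * nrm x)\<^sup>2" by simp
  then show ?thesis using x by (simp add: hnorm_def[of H "c *\<^sub>C x"] del: of_real_power)
qed

lemma nrm_minus [simp]: "x \<in> carr \<Longrightarrow> nrm (- x) = nrm x"
  using nrm_scale[of x "-1"] by simp

lemma nrm_diff_commute: "x \<in> carr \<Longrightarrow> y \<in> carr \<Longrightarrow> nrm (x - y) = nrm (y - x)"
  using nrm_minus[of "x - y"] by simp

lemma nrm_add_sq: "x \<in> carr \<Longrightarrow> y \<in> carr \<Longrightarrow>
    (nrm (x + y))\<^sup>2 = (nrm x)\<^sup>2 + 2 * Re (ip x y) + (nrm y)\<^sup>2"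
  using ip_commute[of x y] by (simp add: nrm_sq ip_add_left ip_add_right)

lemma nrm_diff_sq: "x \<in> carr \<Longrightarrow> y \<in> carr \<Longrightarrow>
    (nrm (x - y))\<^sup>2 = (nrm x)\<^sup>2 - 2 * Re (ip x y) + (nrm y)\<^sup>2"
  using nrm_add_sq[of x "- y"] by (simp add: ip_minus_right)

lemma pythagoras: "x \<in> carr \<Longrightarrow> y \<in> carr \<Longrightarrow> ip x y = 0 \<Longrightarrow> (nrm (x + y))\<^sup>2 = (nrm x)\<^sup>2 + (nrm y)\<^sup>2"
  by (simp add: nrm_add_sq)

lemma Cauchy_Schwarz: 
  assumes x: "x \<in> carr" and y: "y \<in> carr" shows "cmod (ip x y) \<le> nrm x * nrm y"
proof (cases "y = 0")
  case False
  \<comment> \<open>The coefficient of the projection of \<open>x\<close> on \<open>y\<close>: the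
    remainder \<open>x - c *\<^sub>C y\<close> is orthogonal to \<open>y\<close>, and Pythagoras
    gives the inequality.\<close>
  define c where "c = ip x y / of_real ((nrm y)\<^sup>2)"
  have ny: "nrm y > 0" using nrm_pos[OF y False] .
  have cy: "c * of_real ((nrm y)\<^sup>2) = ip x y" using ny by (simp add: c_def)
  have "(nrm x)\<^sup>2 = (nrm ((x - c *\<^sub>C y) + c *\<^sub>C y))\<^sup>2" by simp
  also have "\<dots> = (nrm (x - c *\<^sub>C y))\<^sup>2 + (nrm (c *\<^sub>C y))\<^sup>2"
    using x y cy by (intro pythagoras) (simp_all add: ip_diff_left ip_scale_left ip_scale_right ip_self)
  finally have "(nrm (c *\<^sub>C y))\<^sup>2 \<le> (nrm x)\<^sup>2" by simp
  then have "cmod c * nrm y \<le> nrm x" 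
    using x y by (simp add: power2_le_iff_abs_le)
  moreover have "cmod c * nrm y * nrm y = cmod (ip x y)"
    using arg_cong[OF cy, of cmod] by (simp add: norm_mult norm_power power2_eq_square)
  ultimately show ?thesis using mult_right_mono[of _ "nrm x" "nrm y"] ny by fastforce
qed (use x in simp)

lemma nrm_triangle: "x \<in> carr \<Longrightarrow> y \<in> carr \<Longrightarrow> nrm (x + y) \<le> nrm x + nrm y"
proof (rule power2_le_imp_le)
  assume x: "x \<in> carr" and y: "y \<in> carr"
  have "Re (ip x y) \<le> nrm x * nrm y"
    using Cauchy_Schwarz[OF x y] complex_Re_le_cmod[of "ip x y"] by linarith
  then show "(nrm (x + y))\<^sup>2 \<le> (nrm x + nrm y)\<^sup>2"
    using nrm_add_sq[OF x y] by (simp add: power2_sum)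
qed simp

lemma nrm_triangle_diff: "x \<in> carr \<Longrightarrow> y \<in> carr \<Longrightarrow> nrm (x - y) \<le> nrm x + nrm y"
  using nrm_triangle[of x "- y"] by simp

lemma nrm_sum: "(\<And>i. i \<in> I \<Longrightarrow> f i \<in> carr) \<Longrightarrow> nrm (sum f I) \<le> (\<Sum>i\<in>I. nrm (f i))"
proof (induction I rule: infinite_finite_induct)
  case (insert i I)
  then show ?case using nrm_triangle[of "f i" "sum f I"] by force
qed auto

lemma nrm_triangle3: "x \<in> carr \<Longrightarrow> y \<in> carr \<Longrightarrow> z \<in> carr \<Longrightarrow> nrm (x - z) \<le> nrm (x - y) + nrm (y - z)"
  using nrm_triangle[of "x - y" "y - z"] by simp

lemma Metric_space_carr: "Metric_space carr (hdist H)"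
proof
  show "0 \<le> hdist H x y" "hdist H x y = hdist H y x" for x y
    by (simp_all add: hdist_def nrm_diff_commute[of x])
  show "hdist H x y = 0 \<longleftrightarrow> x = y" if "x \<in> carr" "y \<in> carr" for x y
    using that by (simp add: hdist_def)
  show "hdist H x z \<le> hdist H x y + hdist H y z" if "x \<in> carr" "y \<in> carr" "z \<in> carr" for x y z
    using that nrm_triangle3[of x y z] by (simp add: hdist_def)
qed

sublocale M: Metric_space carr "hdist H"
  by (rule Metric_space_carr)

text \<open>Translates \<open>mcomplete\<close> for \<open>hdist\<close> into Cauchy sequences in
  the norm, the form in which completeness of all constructed spaces is checked.\<close>

lemma hilbertI:
  assumes "\<And>x. (\<And>k. x k \<in> carr) \<Longrightarrow> (\<And>e. e > 0 \<Longrightarrow> \<exists>N. \<forall>m\<ge>N. \<forall>n\<ge>N. nrm (x m - x n) < e) \<Longrightarrow>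
    \<exists>z\<in>carr. (\<lambda>k::nat. nrm (x k - z)) \<longlonglongrightarrow> 0"
  shows "hilbert_space H"
proof -
  have "M.mcomplete"
    unfolding M.mcomplete_def
  proof (intro allI impI)
    fix x assume "M.MCauchy x"
    then have x: "\<And>k. x k \<in> carr" and c: "\<And>e. e > 0 \<Longrightarrow> \<exists>N. \<forall>m n. N \<le> m \<longrightarrow> N \<le> n \<longrightarrow> hdist H (x m) (x n) < e"
      unfolding M.MCauchy_def by auto
    have "\<exists>N. \<forall>m\<ge>N. \<forall>n\<ge>N. nrm (x m - x n) < e" if "e > 0" for e
      using c[OF that] x by (simp add: hdist_def)
    from assms[OF x this] obtain z where "z \<in> carr" "(\<lambda>k. nrm (x k - z)) \<longlonglongrightarrow> 0" by blast
    then have "limitin M.mtopology x z sequentially"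
      unfolding M.limitin_metric_dist_null using x by (simp add: hdist_def)
    then show "\<exists>z. limitin M.mtopology x z sequentially" ..
  qed
  then show ?thesis
    unfolding hilbert_space_def using subspace_carr sesq ip_commute ip_pos by blast
qed

end

section \<open>Complete spaces and the Riesz representation theorem\<close>

locale hilbert =
  fixes H :: "'a::complex_vector hspace"
  assumes hilbert: "hilbert_space H"
begin

sublocale pre_hilbert H
  using hilbert unfolding hilbert_space_def by unfold_locales blast+

lemma mcomplete: "Metric_space.mcomplete carr (hdist H)"
  using hilbert unfolding hilbert_space_def by blast

lemma complete:
  assumes "\<And>k. x k \<in> carr" "\<And>e. e > 0 \<Longrightarrow> \<exists>N. \<forall>m\<ge>N. \<forall>n\<ge>N. nrm (x m - x n) < e"
  obtains z where "z \<in> carr" "(\<lambda>k. nrm (x k - z)) \<longlonglongrightarrow> 0"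
proof -
  have "M.MCauchy x"
    unfolding M.MCauchy_def using assms by (auto simp: hdist_def) 
  then obtain z where "limitin M.mtopology x z sequentially"
    using mcomplete unfolding M.mcomplete_def by blast
  then have "z \<in> carr" "(\<lambda>k. hdist H (x k) z) \<longlonglongrightarrow> 0"
    by (auto simp: M.limitin_metric_dist_null)
  moreover have "hdist H (x k) z = nrm (x k - z)" for k
    using assms(1) \<open>z \<in> carr\<close> by (simp add: hdist_def)
  ultimately show ?thesis using that by auto
qed

lemma hdense_iff: "hdense H S \<longleftrightarrow> S \<subseteq> carr \<and> (\<forall>x\<in>carr. \<forall>e>0. \<exists>y\<in>S. nrm (x - y) < e)"
proof -
  have "htop H closure_of S = carr \<longleftrightarrow> (\<forall>x\<in>carr. \<forall>e>0. \<exists>y\<in>S. nrm (x - y) < e)" if "S \<subseteq> carr"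
  proof -
    have *: "(\<exists>y\<in>S. y \<in> M.mball x r) \<longleftrightarrow> (\<exists>y\<in>S. nrm (x - y) < r)" if "x \<in> carr" for x r
      using \<open>S \<subseteq> carr\<close> that by (auto simp: M.mball_def hdist_def subset_iff)
    show ?thesis unfolding htop_def M.metric_closure_of using * by blast
  qed
  then show ?thesis unfolding hdense_def by blast
qed

lemma hdenseD: "hdense H S \<Longrightarrow> x \<in> carr \<Longrightarrow> e > 0 \<Longrightarrow> \<exists>y\<in>S. y \<in> carr \<and> nrm (x - y) < e"
  unfolding hdense_iff by blast

lemma closedin_iff: "closedin (htop H) S \<longleftrightarrow> S \<subseteq> carr \<and>
  (\<forall>x l. (\<forall>k. x k \<in> S) \<longrightarrow> l \<in> carr \<longrightarrow> (\<lambda>k::nat. nrm (x k - l)) \<longlonglongrightarrow> 0 \<longrightarrow> l \<in> S)"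
proof (cases "S \<subseteq> carr")
  case True
  have "limitin M.mtopology x l sequentially \<longleftrightarrow> l \<in> carr \<and> (\<lambda>k::nat. nrm (x k - l)) \<longlonglongrightarrow> 0"
    if "\<forall>k. x k \<in> S" for x l
  proof (cases "l \<in> carr")
    case l: True
    have "x k \<in> carr" for k using that \<open>S \<subseteq> carr\<close> by blast
    then show ?thesis using l unfolding M.limitin_metric_dist_null by (simp add: hdist_def)
  qed (simp add: M.limitin_metric_dist_null)
  then have "(\<forall>x l. range x \<subseteq> S \<and> limitin M.mtopology x l sequentially \<longrightarrow> l \<in> S) \<longleftrightarrow>
    (\<forall>x l. (\<forall>k. x k \<in> S) \<longrightarrow> l \<in> carr \<longrightarrow> (\<lambda>k::nat. nrm (x k - l)) \<longlonglongrightarrow> 0 \<longrightarrow> l \<in> S)"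
    by (simp add: image_subset_iff) meson
  then show ?thesis
    unfolding htop_def M.metric_closedin_iff_sequentially_closed by blast
qed (simp add: M.metric_closedin_iff_sequentially_closed htop_def)

lemma nrm_tendsto:
  assumes "\<And>k. x k \<in> carr" "z \<in> carr" "((\<lambda>k. nrm (x k - z)) \<longlongrightarrow> 0) F"
  shows "((\<lambda>k. nrm (x k)) \<longlongrightarrow> nrm z) F"
proof -
  have "\<bar>nrm (x k) - nrm z\<bar> \<le> nrm (x k - z)" for k
    using nrm_triangle[of "x k - z" z] nrm_triangle[of "z - x k" "x k"] 
      nrm_diff_commute[of "x k" z] assms(1)[of k] assms(2) by auto
  then have "((\<lambda>k. nrm (x k) - nrm z) \<longlongrightarrow> 0) F"
    by (intro Lim_null_comparison[OF always_eventually assms(3)]) auto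
  then show ?thesis by (simp add: LIM_zero_iff)
qed

lemma functional_diff: "bounded_functional H g \<Longrightarrow> x \<in> carr \<Longrightarrow> y \<in> carr \<Longrightarrow> g (x - y) = g x - g y"
  using bounded_functionalD(1)[of H g x "(-1) *\<^sub>C y"] bounded_functionalD(2)[of H g y "-1"]
  by simp

lemma functional_bound:
  assumes "bounded_functional H g"
  obtains C where "C > 0" "\<And>x. x \<in> carr \<Longrightarrow> cmod (g x) \<le> C * nrm x"
proof -
  obtain C where C: "\<forall>x\<in>carr. cmod (g x) \<le> C * nrm x"
    using assms unfolding bounded_functional_def by blast
  show ?thesis
  proof (rule that[of "\<bar>C\<bar> + 1"])
    fix x assume x: "x \<in> carr"
    have "C * nrm x \<le> (\<bar>C\<bar> + 1) * nrm x" by (intro mult_right_mono) (use x in auto)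
    then show "cmod (g x) \<le> (\<bar>C\<bar> + 1) * nrm x" using C x by fastforce
  qed auto
qed

lemma bounded_functional_ip: "z \<in> carr \<Longrightarrow> bounded_functional H (\<lambda>x. ip x z)"
  by (rule bounded_functionalI[where C = "nrm z"])
    (auto simp: ip_add_left ip_scale_left mult.commute[of "nrm z"] intro: Cauchy_Schwarz)

lemma functional_tendsto:
  assumes "bounded_functional H g" "\<And>k. x k \<in> carr" "z \<in> carr" "((\<lambda>k. nrm (x k - z)) \<longlongrightarrow> 0) F"
  shows "((\<lambda>k. g (x k)) \<longlongrightarrow> g z) F"
proof -
  obtain C where C: "\<And>x. x \<in> carr \<Longrightarrow> cmod (g x) \<le> C * nrm x"
    using functional_bound[OF assms(1)] by blast
  have "((\<lambda>k. C * nrm (x k - z)) \<longlongrightarrow> C * 0) F" by (intro tendsto_intros assms)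
  then have "((\<lambda>k. C * nrm (x k - z)) \<longlongrightarrow> 0) F" by simp
  moreover have "norm (g (x k) - g z) \<le> C * nrm (x k - z)" for k
    using C[OF mem_diff[OF assms(2,3)]] functional_diff[OF assms(1) assms(2,3)] by metis
  ultimately have "((\<lambda>k. g (x k) - g z) \<longlongrightarrow> 0) F"
    using Lim_null_comparison always_eventually by (metis (no_types, lifting))
  then show ?thesis by (simp add: LIM_zero_iff)
qed

text \<open>The representing vector minimizes \<open>nrm x\<^sup>2 - 2 * Re (g x)\<close>.\<close>

lemma Riesz:
  assumes g: "bounded_functional H g"
  obtains z where "z \<in> carr" "\<And>x. x \<in> carr \<Longrightarrow> g x = ip x z"
proof -
  obtain B where B: "B > 0" "\<And>x. x \<in> carr \<Longrightarrow> cmod (g x) \<le> B * nrm x"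
    using functional_bound[OF g] by blast
  note g_add = bounded_functionalD(1)[OF g] and g_scale = bounded_functionalD(2)[OF g]
  define J where "J = (\<lambda>x. (nrm x)\<^sup>2 - 2 * Re (g x))"
  have J_ge: "J x \<ge> - B\<^sup>2" if "x \<in> carr" for x
  proof -
    have "Re (g x) \<le> B * nrm x" using B(2)[OF that] complex_Re_le_cmod[of "g x"] by linarith
    moreover have "(nrm x - B)\<^sup>2 \<ge> 0" by simp
    moreover have "2 * (B * nrm x) = 2 * nrm x * B" by simp
    ultimately show ?thesis unfolding J_def power2_diff by linarith
  qed
  define m where "m = (INF x\<in>carr. J x)"
  have bdd: "bdd_below (J ` carr)" using J_ge by (intro bdd_belowI[of _ "- B\<^sup>2"]) auto
  have m_le: "m \<le> J x" if "x \<in> carr" for x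
    unfolding m_def by (rule cINF_lower[OF bdd that])
  have "\<exists>x\<in>carr. J x < m + inverse (real (Suc k))" for k
    using cINF_less_iff[OF _ bdd, of "m + inverse (real (Suc k))"] mem_0 by (force simp: m_def)
  then obtain x where x: "\<And>k. x k \<in> carr" "\<And>k. J (x k) < m + inverse (real (Suc k))"
    by metis
  \<comment> \<open>The parallelogram law: the linear part of \<open>J\<close> cancels in this
    combination. Since the value at the midpoint is at least \<open>m\<close>, a minimizing sequence
    is Cauchy.\<close>
  have par: "(nrm (y - z))\<^sup>2 = 2 * (J y + J z - 2 * J ((1/2) *\<^sub>C (y + z)))" if "y \<in> carr" "z \<in> carr" for y z
    using that by (simp add: J_def nrm_diff_sq nrm_add_sq g_add g_scale ip_scale_left ip_scale_right power_mult_distrib field_simps)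
  have cau: "\<exists>N. \<forall>p\<ge>N. \<forall>q\<ge>N. nrm (x p - x q) < e" if "e > 0" for e
  proof -
    obtain N where N: "inverse (real (Suc N)) < e\<^sup>2 / 4" using reals_Archimedean[of "e\<^sup>2/4"] \<open>e > 0\<close> by auto
    have "nrm (x p - x q) < e" if "p \<ge> N" "q \<ge> N" for p q
    proof -
      define t where "t = inverse (real (Suc N))"
      have J_lt: "J (x k) < m + t" if "k \<ge> N" for k
      proof -
        have "inverse (real (Suc k)) \<le> t" unfolding t_def using that by (intro le_imp_inverse_le) auto
        then show ?thesis using x(2)[of k] by linarith
      qed
      have "m \<le> J ((1/2) *\<^sub>C (x p + x q))" using x(1) m_le by blast
      then have "(nrm (x p - x q))\<^sup>2 < 4 * t"
        using par[OF x(1) x(1), of p q] J_lt[OF that(1)] J_lt[OF that(2)] by argo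
      then have "(nrm (x p - x q))\<^sup>2 < e\<^sup>2"
        using N by (simp add: t_def)
      then show ?thesis using \<open>e > 0\<close> by (simp add: power_less_imp_less_base)
    qed
    then show ?thesis by blast
  qed
  obtain z where z: "z \<in> carr" "(\<lambda>k. nrm (x k - z)) \<longlonglongrightarrow> 0" using complete[of x, OF x(1) cau] by blast
  have "(\<lambda>k. J (x k)) \<longlonglongrightarrow> J z"
    unfolding J_def by (intro tendsto_intros nrm_tendsto functional_tendsto[OF g] x z)
  moreover have "(\<lambda>k. m + inverse (real (Suc k))) \<longlonglongrightarrow> m + 0"
    by (intro tendsto_intros LIMSEQ_inverse_real_of_nat)
  ultimately have "J z \<le> m + 0" by (rule LIMSEQ_le) (use x(2) less_imp_le in blast)
  then have Jz: "J z \<le> J y" if "y \<in> carr" for y using m_le[OF that] by linarith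
  have re: "Re (g y) = Re (ip y z)" if y: "y \<in> carr" for y
  proof (rule ccontr)
    assume ne: "Re (g y) \<noteq> Re (ip y z)"
    define d where "d = Re (g y) - Re (ip y z)"
    have exp: "J (z + of_real t *\<^sub>C y) = J z + t\<^sup>2 * (nrm y)\<^sup>2 - 2 * t * d" for t
      using y z(1) ip_commute[of y z] by (simp add: J_def nrm_add_sq g_add g_scale ip_scale_right power_mult_distrib d_def algebra_simps)
    have ge: "t\<^sup>2 * (nrm y)\<^sup>2 - 2 * t * d \<ge> 0" for t
      using exp[of t] Jz[of "z + of_real t *\<^sub>C y"] y z(1) by simp
    \<comment> \<open>The inequality is tested with \<open>t = d / N\<close>; the added 1 makes
      \<open>N\<close> positive also for \<open>y = 0\<close>. The result is
      \<open>- d\<^sup>2 / N \<ge> 0\<close>, hence \<open>d = 0\<close>.\<close>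
    define N where "N = (nrm y)\<^sup>2 + 1"
    have "N > 0" by (simp add: N_def add_nonneg_pos)
    have "(d/N)\<^sup>2 * (nrm y)\<^sup>2 \<le> (d/N)\<^sup>2 * N" by (intro mult_left_mono) (auto simp: N_def)
    also have "\<dots> = d\<^sup>2 / N" using \<open>N > 0\<close> by (simp add: power2_eq_square)
    finally have "d\<^sup>2 / N - 2 * (d\<^sup>2 / N) \<ge> 0" using ge[of "d/N"] by (simp add: power2_eq_square)
    then have "d\<^sup>2 / N \<le> 0" by simp
    then show False using ne \<open>N > 0\<close> by (simp add: d_def field_simps)
  qed
  have "g y = ip y z" if y: "y \<in> carr" for y
  proof (rule complex_eqI)
    show "Im (g y) = Im (ip y z)"
      using re[of "\<i> *\<^sub>C y"] y z(1) by (simp add: g_scale ip_scale_left)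
  qed (rule re[OF y])
  with z(1) show ?thesis using that by blast
qed

end

subsection \<open>Subspaces and bounded maps\<close>

context pre_hilbert
begin

lemma pre_hilbert_hsub:
  assumes "csubspace S" "S \<subseteq> carr"
  shows "pre_hilbert (hsub H S)"
proof
  show "sesquilinear_on (hcarrier (hsub H S)) (hinner (hsub H S))"
    using sesq assms(2) unfolding hsub_def sesquilinear_on_def by (simp add: subset_iff)
  show "hinner (hsub H S) y x = cnj (hinner (hsub H S) x y)"
    if "x \<in> hcarrier (hsub H S)" "y \<in> hcarrier (hsub H S)" for x y
    using that assms(2) ip_commute[of x y] by (simp add: hsub_def subset_iff)
  show "Re (hinner (hsub H S) x x) > 0" if "x \<in> hcarrier (hsub H S)" "x \<noteq> 0" for x
    using that assms(2) ip_pos[of x] by (simp add: hsub_def subset_iff)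
qed (use assms in \<open>simp add: hsub_def\<close>)

lemma form_bound:
  assumes "bounded_sesquilinear H b"
  obtains C where "C > 0" "\<And>x y. x \<in> carr \<Longrightarrow> y \<in> carr \<Longrightarrow> cmod (b x y) \<le> C * nrm x * nrm y"
proof -
  obtain C where C: "\<And>x y. x \<in> carr \<Longrightarrow> y \<in> carr \<Longrightarrow> cmod (b x y) \<le> C * nrm x * nrm y"
    using assms unfolding bounded_sesquilinear_def by blast
  show ?thesis
  proof (rule that[of "\<bar>C\<bar> + 1"])
    fix x y assume xy: "x \<in> carr" "y \<in> carr"
    have "C * (nrm x * nrm y) \<le> (\<bar>C\<bar> + 1) * (nrm x * nrm y)" by (intro mult_right_mono) (use xy in auto)
    then show "cmod (b x y) \<le> (\<bar>C\<bar> + 1) * nrm x * nrm y"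
      using C[OF xy] by (simp add: mult.assoc)
  qed auto
qed

lemma op_bound:
  assumes "bounded_op H K T"
  obtains C where "C > 0" "\<And>x. x \<in> carr \<Longrightarrow> hnorm K (T x) \<le> C * nrm x"
proof -
  obtain C where C: "\<And>x. x \<in> carr \<Longrightarrow> hnorm K (T x) \<le> C * nrm x"
    using assms unfolding bounded_op_def by blast
  show ?thesis
  proof (rule that[of "\<bar>C\<bar> + 1"])
    fix x assume x: "x \<in> carr"
    have "C * nrm x \<le> (\<bar>C\<bar> + 1) * nrm x" by (intro mult_right_mono) (use x in auto)
    then show "hnorm K (T x) \<le> (\<bar>C\<bar> + 1) * nrm x" using C[OF x] by linarith
  qed auto
qed

end

lemma hnorm_hsub [simp]: "hnorm (hsub H S) = hnorm H"
  by (simp add: hnorm_def fun_eq_iff hsub_def)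

lemma hcarrier_hsub [simp]: "hcarrier (hsub H S) = S"
  and hinner_hsub [simp]: "hinner (hsub H S) = hinner H"
  by (simp_all add: hsub_def)

context
  fixes S :: "'a::complex_vector set" and b
  assumes sub: "csubspace S" and b: "sesquilinear_on S b"
begin

lemma form_add_left: "x \<in> S \<Longrightarrow> y \<in> S \<Longrightarrow> z \<in> S \<Longrightarrow> b (x + y) z = b x z + b y z"
  and form_add_right: "x \<in> S \<Longrightarrow> y \<in> S \<Longrightarrow> z \<in> S \<Longrightarrow> b z (x + y) = b z x + b z y"
  and form_scale_left: "x \<in> S \<Longrightarrow> y \<in> S \<Longrightarrow> b (c *\<^sub>C x) y = c * b x y"
  and form_scale_right: "x \<in> S \<Longrightarrow> y \<in> S \<Longrightarrow> b x (c *\<^sub>C y) = cnj c * b x y"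
  by (rule sesquilinear_onD[OF b]; assumption)+

lemma form_0_left: "x \<in> S \<Longrightarrow> b 0 x = 0" and form_0_right: "x \<in> S \<Longrightarrow> b x 0 = 0"
  using form_scale_left[of x x 0] form_scale_right[of x x 0] by simp_all

lemma form_diff_left: "x \<in> S \<Longrightarrow> y \<in> S \<Longrightarrow> z \<in> S \<Longrightarrow> b (x - y) z = b x z - b y z"
  and form_diff_right: "x \<in> S \<Longrightarrow> y \<in> S \<Longrightarrow> z \<in> S \<Longrightarrow> b z (x - y) = b z x - b z y"
  using form_add_left[of x "(-1) *\<^sub>C y" z] form_scale_left[of y z "-1"] complex_vector.subspace_scale[OF sub, of y "-1"]
   form_add_right[of x "(-1) *\<^sub>C y" z] form_scale_right[of z y "-1"] by simp_all

lemma form_sum_left: "(\<And>i. i \<in> I \<Longrightarrow> f i \<in> S) \<Longrightarrow> z \<in> S \<Longrightarrow> b (sum f I) z = (\<Sum>i\<in>I. b (f i) z)"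
proof (induction I rule: infinite_finite_induct)
  case (insert i I)
  then have "sum f I \<in> S" by (intro complex_vector.subspace_sum[OF sub]) auto
  then show ?case using insert by (simp add: form_add_left)
qed (simp_all add: form_0_left)

lemma form_sum_right: "(\<And>i. i \<in> I \<Longrightarrow> f i \<in> S) \<Longrightarrow> z \<in> S \<Longrightarrow> b z (sum f I) = (\<Sum>i\<in>I. b z (f i))"
proof (induction I rule: infinite_finite_induct)
  case (insert i I)
  then have "sum f I \<in> S" by (intro complex_vector.subspace_sum[OF sub]) auto
  then show ?case using insert by (simp add: form_add_right)
qed (simp_all add: form_0_right)

end

context
  fixes S :: "'a::complex_vector set" and f :: "'a \<Rightarrow> 'b::complex_vector"
  assumes sub: "csubspace S" and f: "clinear_on S f"
begin

lemma clinear_on_0: "f 0 = 0"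
  using clinear_onD(2)[OF f complex_vector.subspace_0[OF sub], of 0] by simp

lemma clinear_on_diff: "x \<in> S \<Longrightarrow> y \<in> S \<Longrightarrow> f (x - y) = f x - f y"
  using clinear_onD(1)[OF f, of x "(-1) *\<^sub>C y"] clinear_onD(2)[OF f, of y "-1"]
    complex_vector.subspace_scale[OF sub, of y "-1"] by simp

lemma clinear_on_sum: "(\<And>i. i \<in> I \<Longrightarrow> g i \<in> S) \<Longrightarrow> f (sum g I) = (\<Sum>i\<in>I. f (g i))"
proof (induction I rule: infinite_finite_induct)
  case (insert i I)
  then have "sum g I \<in> S" by (intro complex_vector.subspace_sum[OF sub]) auto
  then show ?case using insert by (simp add: clinear_onD(1)[OF f])
qed (simp_all add: clinear_on_0)

end

lemma bounded_opD:
  assumes "bounded_op H K T"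
  shows "x \<in> hcarrier H \<Longrightarrow> T x \<in> hcarrier K" "clinear_on (hcarrier H) T"
  using assms unfolding bounded_op_def by auto

lemma bounded_opI:
  assumes "\<And>x. x \<in> hcarrier H \<Longrightarrow> T x \<in> hcarrier K" "clinear_on (hcarrier H) T"
    "\<And>x. x \<in> hcarrier H \<Longrightarrow> hnorm K (T x) \<le> C * hnorm H x"
  shows "bounded_op H K T"
  using assms unfolding bounded_op_def by blast

lemma bounded_sesquilinearI:
  assumes "sesquilinear_on (hcarrier H) b"
    "\<And>x y. x \<in> hcarrier H \<Longrightarrow> y \<in> hcarrier H \<Longrightarrow> cmod (b x y) \<le> C * hnorm H x * hnorm H y"
  shows "bounded_sesquilinear H b"
  using assms unfolding bounded_sesquilinear_def by blast

lemma sesquilinear_onI: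
  assumes "\<And>x y z. x \<in> S \<Longrightarrow> y \<in> S \<Longrightarrow> z \<in> S \<Longrightarrow> b (x + y) z = b x z + b y z"
    "\<And>x y z. x \<in> S \<Longrightarrow> y \<in> S \<Longrightarrow> z \<in> S \<Longrightarrow> b z (x + y) = b z x + b z y"
    "\<And>c x y. x \<in> S \<Longrightarrow> y \<in> S \<Longrightarrow> b (c *\<^sub>C x) y = c * b x y"
    "\<And>c x y. x \<in> S \<Longrightarrow> y \<in> S \<Longrightarrow> b x (c *\<^sub>C y) = cnj c * b x y"
  shows "sesquilinear_on S b"
  using assms unfolding sesquilinear_on_def by blast

context hilbert
begin

lemma hilbert_hsub:
  assumes S: "csubspace S" and closed: "closedin (htop H) S"
  shows "hilbert_space (hsub H S)"
proof -
  have sub: "S \<subseteq> carr" using closed closedin_iff by blast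
  interpret K: pre_hilbert "hsub H S" by (rule pre_hilbert_hsub[OF S sub])
  show ?thesis
  proof (rule K.hilbertI)
    fix x :: "nat \<Rightarrow> 'a" assume x: "\<And>k. x k \<in> hcarrier (hsub H S)"
      and cau: "\<And>e. e > 0 \<Longrightarrow> \<exists>N. \<forall>m\<ge>N. \<forall>n\<ge>N. hnorm (hsub H S) (x m - x n) < e"
    have "x k \<in> carr" for k using x sub by auto
    then obtain z where z: "z \<in> carr" "(\<lambda>k. nrm (x k - z)) \<longlonglongrightarrow> 0" using complete cau by (metis hnorm_hsub)
    then have "z \<in> S" using closed x unfolding closedin_iff hcarrier_hsub by blast
    then show "\<exists>z\<in>hcarrier (hsub H S). (\<lambda>k. hnorm (hsub H S) (x k - z)) \<longlonglongrightarrow> 0" using z by auto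
  qed
qed

text \<open>The projection is the Riesz representative, in the Hilbert space
  \<open>hsub H S\<close>, of the functional that \<open>u\<close> induces on
  \<open>S\<close>.\<close>

lemma projection:
  assumes S: "csubspace S" and closed: "closedin (htop H) S" and u: "u \<in> carr"
  obtains p where "p \<in> S" "\<And>v. v \<in> S \<Longrightarrow> ip (u - p) v = 0"
proof -
  have sub: "S \<subseteq> carr" using closed closedin_iff by blast
  interpret K: hilbert "hsub H S" using hilbert_hsub[OF S closed] by unfold_locales
  have "bounded_functional H (\<lambda>v. ip v u)" by (rule bounded_functional_ip[OF u])
  then have "bounded_functional (hsub H S) (\<lambda>v. ip v u)"
    using sub unfolding bounded_functional_def by (simp add: subset_iff) blast
  then obtain p where p: "p \<in> S" "\<And>v. v \<in> S \<Longrightarrow> ip v u = ip v p"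
    by (rule K.Riesz) auto
  have "ip (u - p) v = 0" if "v \<in> S" for v
  proof -
    have "v \<in> carr" "p \<in> carr" using that p sub by auto
    then show ?thesis using p(2)[OF that] u ip_commute[of v "u - p"] by (simp add: ip_diff_right)
  qed
  with p(1) show ?thesis using that by blast
qed

lemma ip_eqI:
  assumes "x \<in> carr" "y \<in> carr" "\<And>v. v \<in> carr \<Longrightarrow> ip x v = ip y v"
  shows "x = y"
proof -
  have "ip (x - y) (x - y) = 0"
    using assms(3)[of "x - y"] assms(1,2) by (simp add: ip_diff_left)
  then show ?thesis using ip_pos[of "x - y"] assms by fastforce
qed

text \<open>Representing vectors are unique, so \<open>A\<close> inherits linearity from
  \<open>b\<close>; testing with \<open>A u\<close> itself gives the bound.\<close>

lemma Riesz_form: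
  assumes "bounded_sesquilinear H b"
  obtains A where "bounded_op H H A" "\<And>u v. u \<in> carr \<Longrightarrow> v \<in> carr \<Longrightarrow> ip (A u) v = b u v"
proof -
  obtain C where C: "C > 0" "\<And>x y. x \<in> carr \<Longrightarrow> y \<in> carr \<Longrightarrow> cmod (b x y) \<le> C * nrm x * nrm y"
    using form_bound[OF assms] by blast
  have sb: "sesquilinear_on carr b" using assms unfolding bounded_sesquilinear_def by blast
  note fs = form_add_left[OF subspace_carr sb] form_add_right[OF subspace_carr sb]
     form_scale_left[OF subspace_carr sb] form_scale_right[OF subspace_carr sb]
  have "\<exists>w\<in>carr. \<forall>v\<in>carr. ip w v = b u v" if u: "u \<in> carr" for u
  proof -
    have "bounded_functional H (\<lambda>v. cnj (b u v))"
      by (rule bounded_functionalI[where C = "C * nrm u"]) (use u C(2)[OF u] in \<open>auto simp: fs\<close>)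
    then obtain w where "w \<in> carr" "\<And>v. v \<in> carr \<Longrightarrow> cnj (b u v) = ip v w" by (rule Riesz) blast
    then show ?thesis by (metis complex_cnj_cnj ip_commute)
  qed
  then obtain A where A: "\<And>u. u \<in> carr \<Longrightarrow> A u \<in> carr" "\<And>u v. u \<in> carr \<Longrightarrow> v \<in> carr \<Longrightarrow> ip (A u) v = b u v"
    by metis
  have lin: "clinear_on carr A"
    unfolding clinear_on_def
    by (intro conjI ballI allI ip_eqI) (auto simp: A ip_add_left ip_scale_left fs)
  have "nrm (A u) \<le> C * nrm u" if u: "u \<in> carr" for u
  proof (cases "A u = 0")
    case False
    have "nrm (A u) * nrm (A u) = cmod (b u (A u))"
      using A(1)[OF u] by (simp add: A(2)[OF u, symmetric] ip_self norm_power power2_eq_square norm_mult)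
    also have "\<dots> \<le> C * nrm u * nrm (A u)" using C(2) u A(1) by blast
    finally show ?thesis using nrm_pos[OF A(1)[OF u] False] by simp
  qed (use C u in simp)
  then have "bounded_op H H A" by (intro bounded_opI) (use A lin in auto)
  with A(2) show ?thesis using that by blast
qed

lemma coercive_estimate:
  assumes co: "\<And>u. u \<in> carr \<Longrightarrow> g * (nrm u)\<^sup>2 \<le> Re (b u u)" and u: "u \<in> carr"
    and m: "\<And>v. v \<in> carr \<Longrightarrow> cmod (b u v) \<le> m * nrm v" and "m \<ge> 0"
  shows "g * nrm u \<le> m"
proof (cases "u = 0")
  case False
  have "g * nrm u * nrm u \<le> m * nrm u"
    using co[OF u] m[OF u] complex_Re_le_cmod[of "b u u"] by (simp add: power2_eq_square)
  then show ?thesis using nrm_pos[OF u False] by simp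
qed (use assms in simp)

text \<open>With \<open>A\<close> and \<open>z\<close> representing \<open>b\<close> and
  \<open>f\<close>, the equation \<open>A u = z\<close> is a fixed point problem for a damped
  iteration, which coercivity makes a contraction.\<close>

theorem Lax_Milgram:
  assumes b: "bounded_sesquilinear H b" and "g > 0"
    and co: "\<And>u. u \<in> carr \<Longrightarrow> g * (nrm u)\<^sup>2 \<le> Re (b u u)"
    and f: "bounded_functional H f"
  obtains u where "u \<in> carr" "\<And>v. v \<in> carr \<Longrightarrow> b u v = cnj (f v)"
proof -
  obtain A where A: "bounded_op H H A" "\<And>u v. u \<in> carr \<Longrightarrow> v \<in> carr \<Longrightarrow> ip (A u) v = b u v"
    using Riesz_form[OF b] by blast
  note Am = bounded_opD(1)[OF A(1)] and Al = bounded_opD(2)[OF A(1)]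
  obtain B where B: "B > 0" "\<And>x. x \<in> carr \<Longrightarrow> nrm (A x) \<le> B * nrm x" using op_bound[OF A(1)] by blast
  obtain z where z: "z \<in> carr" "\<And>v. v \<in> carr \<Longrightarrow> f v = ip v z" using Riesz[OF f] by blast
  \<comment> \<open>The minimizer of \<open>1 - 2 * r * g + r\<^sup>2 * B\<^sup>2\<close>; the
    minimum is \<open>1 - (g / B)\<^sup>2\<close>.\<close>
  define r where "r = g / B\<^sup>2"
  \<comment> \<open>On the zero space \<open>g\<close> may exceed \<open>B\<close>; the maximum with
    0 keeps \<open>q\<close> nonnegative in that case too.\<close>
  define q where "q = sqrt (max 0 (1 - (g / B)\<^sup>2))"
  define F where "F = (\<lambda>u. u - of_real r *\<^sub>C (A u - z))"
  have Fm: "F u \<in> carr" if "u \<in> carr" for u using that Am z by (auto simp: F_def)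
  have con: "nrm (F u - F v) \<le> q * nrm (u - v)" if u: "u \<in> carr" and v: "v \<in> carr" for u v
  proof -
    define w where "w = u - v"
    have w: "w \<in> carr" using u v by (simp add: w_def)
    have "F u - F v = w - of_real r *\<^sub>C A w"
      using u v by (simp add: F_def w_def clinear_on_diff[OF subspace_carr Al] complex_vector.scale_right_diff_distrib)
    then have "(nrm (F u - F v))\<^sup>2 = (nrm w)\<^sup>2 - 2 * r * Re (b w w) + r\<^sup>2 * (nrm (A w))\<^sup>2"
      using w Am[OF w] ip_commute[of "A w" w] by (simp add: nrm_diff_sq ip_scale_right A(2) power_mult_distrib)
    also have "\<dots> \<le> (nrm w)\<^sup>2 - 2 * r * (g * (nrm w)\<^sup>2) + r\<^sup>2 * (B * nrm w)\<^sup>2"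
      using co[OF w] B(2)[OF w] Am[OF w] w \<open>g > 0\<close>
      by (intro add_mono diff_mono mult_left_mono power_mono) (auto simp: r_def)
    also have "\<dots> = (1 - (g / B)\<^sup>2) * (nrm w)\<^sup>2"
      using B(1) by (simp add: r_def field_simps power2_eq_square)
    also have "\<dots> \<le> q\<^sup>2 * (nrm w)\<^sup>2"
      unfolding q_def by (intro mult_right_mono) auto
    finally have "(nrm (F u - F v))\<^sup>2 \<le> (q * nrm w)\<^sup>2" by (simp add: power_mult_distrib)
    then show ?thesis unfolding w_def[symmetric] by (rule power2_le_imp_le) (use w in \<open>auto simp: q_def\<close>)
  qed
  have "(g / B)\<^sup>2 > 0" using B(1) \<open>g > 0\<close> by simp
  then have "q < 1" unfolding q_def by (auto simp: real_sqrt_lt_1_iff max_def)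
  have "\<exists>u\<in>carr. F u = u"
  proof (rule M.Banach_fixedpoint_thm[OF mcomplete _ _ \<open>q < 1\<close>, of F])
    show "hdist H (F u) (F v) \<le> q * hdist H u v" if "u \<in> carr" "v \<in> carr" for u v
      using con[OF that] Fm that by (simp add: hdist_def)
  qed (use Fm mem_0 in blast)+
  then obtain u where u: "u \<in> carr" "F u = u" by blast
  then have "of_real r *\<^sub>C (A u - z) = 0" by (simp add: F_def)
  moreover have "r \<noteq> 0" using B(1) \<open>g > 0\<close> by (simp add: r_def)
  ultimately have "A u = z" by (simp add: complex_vector.scale_eq_0_iff)
  then have "b u v = cnj (f v)" if "v \<in> carr" for v
    using A(2)[OF u(1) that] z that by (simp add: ip_commute[of v])
  with u(1) show ?thesis using that by blast
qed

end

subsection \<open>Uniform boundedness\<close>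

text \<open>Banach-Steinhaus from Baire's theorem: one of the closed sets \<open>E n\<close>
  contains a ball. It is stated for seminorms, which stand for the norms of operators, so that no
  target space has to be named.\<close>

lemma (in hilbert) uniform_boundedness:
  fixes p :: "nat \<Rightarrow> 'a \<Rightarrow> real"
  assumes sub: "\<And>k x y. x \<in> carr \<Longrightarrow> y \<in> carr \<Longrightarrow> p k (x - y) \<le> p k x + p k y"
    and scale: "\<And>k c x. x \<in> carr \<Longrightarrow> p k (c *\<^sub>C x) = cmod c * p k x"
    and bd: "\<And>k. \<exists>C. \<forall>x\<in>carr. p k x \<le> C * nrm x"
    and pt: "\<And>x. x \<in> carr \<Longrightarrow> \<exists>C. \<forall>k. p k x \<le> C"
  obtains C where "\<And>k x. x \<in> carr \<Longrightarrow> p k x \<le> C * nrm x"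
proof -
  define E where "E = (\<lambda>n::nat. {x \<in> carr. \<forall>k. p k x \<le> real n})"
  have cl: "closedin M.mtopology (E n)" for n
  proof -
    have "l \<in> E n" if x: "\<And>k. x k \<in> E n" and l: "l \<in> carr" and lim: "(\<lambda>k. nrm (x k - l)) \<longlonglongrightarrow> 0" for x l
    proof -
      have "p j l \<le> real n" for j
      proof -
        obtain C where C: "\<forall>x\<in>carr. p j x \<le> C * nrm x" using bd by blast
        have xc: "x k \<in> carr" for k using x by (auto simp: E_def)
        have *: "p j l \<le> real n + C * nrm (x k - l)" for k
        proof -
          have "p j l \<le> p j (x k) + p j (x k - l)" using sub[OF xc[of k] mem_diff[OF xc[of k] l]] by simp
          also have "p j (x k) \<le> real n" using x[of k] by (auto simp: E_def)
          also have "p j (x k - l) \<le> C * nrm (x k - l)" using C xc l by blast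
          finally show ?thesis by simp
        qed
        have "(\<lambda>k. real n + C * nrm (x k - l)) \<longlonglongrightarrow> real n + C * 0" by (intro tendsto_intros lim)
        then have "p j l \<le> real n + C * 0" by (rule LIMSEQ_le_const) (use * in blast)
        then show ?thesis by simp
      qed
      then show ?thesis using l by (simp add: E_def)
    qed
    then show ?thesis using closedin_iff[of "E n"] unfolding htop_def by (auto simp: E_def)
  qed
  have cover: "\<Union>(range E) = carr"
  proof (intro equalityI subsetI)
    fix x assume x: "x \<in> carr"
    then obtain C where "\<forall>k. p k x \<le> C" using pt by blast
    moreover obtain n :: nat where "C \<le> real n" using real_arch_simple by blast
    ultimately have "x \<in> E n" using x by (auto simp: E_def intro: order_trans)
    then show "x \<in> \<Union>(range E)" by blast
  qed (auto simp: E_def)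
  have "M.mtopology interior_of carr \<noteq> {}"
    using interior_of_topspace[of M.mtopology] mem_0 by auto
  then obtain n where "M.mtopology interior_of E n \<noteq> {}"
    using M.metric_Baire_category_alt[OF mcomplete, of "range E"] cl cover by auto
  then obtain a r where a: "a \<in> carr" "r > 0" "M.mball a r \<subseteq> E n"
    unfolding M.metric_interior_of by auto
  \<comment> \<open>The ball is moved from \<open>a\<close> to 0 at the price of doubling the
    bound.\<close>
  have ball: "p k x \<le> 2 * real n" if x: "x \<in> carr" "nrm x < r" for k x
  proof -
    have "a + x \<in> M.mball a r" "a \<in> M.mball a r"
      using x a by (simp_all add: M.in_mball hdist_def nrm_diff_commute[of a])
    then have "p k (a + x) \<le> real n" "p k a \<le> real n" using a(3) by (auto simp: E_def)
    then show ?thesis using sub[OF mem_add[OF a(1) x(1)] a(1), of k] by simp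
  qed
  have "p k x \<le> (4 * real n / r) * nrm x" if x: "x \<in> carr" for k x
  proof (cases "x = 0")
    case True
    then show ?thesis using scale[of 0 k 0] by simp
  next
    case False
    \<comment> \<open>Half the radius, as lying in the ball is a strict inequality.\<close>
    define t where "t = r / (2 * nrm x)"
    have nx: "nrm x > 0" using nrm_pos[OF x False] .
    then have t: "t > 0" "t * nrm x < r" using a(2) by (auto simp: t_def)
    have "t * p k x \<le> 2 * real n" 
      using ball[of "of_real t *\<^sub>C x" k] scale[OF x, of k "of_real t"] x t by simp
    then show ?thesis using nx a(2) by (simp add: t_def field_simps)
  qed
  then show ?thesis using that by blast
qed

subsection \<open>Orthonormal systems\<close>

context pre_hilbert
begin

definition orthonormal :: "'a set \<Rightarrow> bool"
  where "orthonormal E \<longleftrightarrow> finite E \<and> E \<subseteq> carr \<and> (\<forall>x\<in>E. \<forall>y\<in>E. ip x y = (if x = y then 1 else 0))"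

definition oproj :: "'a set \<Rightarrow> 'a \<Rightarrow> 'a"
  where "oproj E u = (\<Sum>e\<in>E. ip u e *\<^sub>C e)"

lemma orthonormalD: "orthonormal E \<Longrightarrow> finite E" "orthonormal E \<Longrightarrow> E \<subseteq> carr"
    "orthonormal E \<Longrightarrow> x \<in> E \<Longrightarrow> y \<in> E \<Longrightarrow> ip x y = (if x = y then 1 else 0)"
  unfolding orthonormal_def by blast+

lemma oproj_mem [simp]: "orthonormal E \<Longrightarrow> oproj E u \<in> carr"
  unfolding oproj_def orthonormal_def by (intro mem_sum mem_scale) auto

lemma oproj_span: "oproj E u \<in> cspan E"
  unfolding oproj_def by (intro complex_vector.span_sum complex_vector.span_scale complex_vector.span_base)

lemma orthonormal_nrm: assumes "orthonormal E" "e \<in> E" shows "nrm e = 1"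
  using orthonormalD(3)[OF assms(1,2,2)] by (simp add: hnorm_def)

lemma ip_oproj_basis:
  assumes E: "orthonormal E" and e: "e \<in> E" and u: "u \<in> carr"
  shows "ip (oproj E u) e = ip u e"
proof -
  have "ip (oproj E u) e = (\<Sum>d\<in>E. ip (ip u d *\<^sub>C d) e)"
    unfolding oproj_def using E e orthonormalD(2)[OF E] by (intro ip_sum_left) auto
  also have "\<dots> = (\<Sum>d\<in>E. if d = e then ip u e else 0)"
    using orthonormalD(2,3)[OF E] e by (intro sum.cong) (auto simp: ip_scale_left subset_iff)
  also have "\<dots> = ip u e" using orthonormalD(1)[OF E] e by simp
  finally show ?thesis .
qed

lemma span_subset_carr: "E \<subseteq> carr \<Longrightarrow> cspan E \<subseteq> carr"
  using complex_vector.span_minimal[OF _ subspace_carr] .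

lemma oproj_orthogonal:
  assumes E: "orthonormal E" and u: "u \<in> carr" and v: "v \<in> cspan E"
  shows "ip (u - oproj E u) v = 0"
proof -
  have "complex_vector.subspace {v \<in> carr. ip (u - oproj E u) v = 0}"
    using E u by (simp add: complex_vector.subspace_def ip_add_right ip_scale_right flip: csubspace_raw_def)
  moreover have "E \<subseteq> {v \<in> carr. ip (u - oproj E u) v = 0}"
    using ip_oproj_basis[OF E _ u] orthonormalD(2)[OF E] E u by (auto simp: ip_diff_left)
  ultimately show ?thesis using v complex_vector.span_minimal by blast
qed

lemma oproj_fixed:
  assumes E: "orthonormal E" and v: "v \<in> cspan E"
  shows "oproj E v = v"
proof -
  have vc: "v \<in> carr" using span_subset_carr[OF orthonormalD(2)[OF E]] v by blast
  have "v - oproj E v \<in> cspan E" using v oproj_span by (intro complex_vector.span_diff)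
  then have "ip (v - oproj E v) (v - oproj E v) = 0" by (rule oproj_orthogonal[OF E vc])
  then show ?thesis using ip_pos[of "v - oproj E v"] vc E by fastforce
qed

lemma oproj_best:
  assumes E: "orthonormal E" and u: "u \<in> carr" and v: "v \<in> cspan E"
  shows "nrm (u - oproj E u) \<le> nrm (u - v)"
proof -
  have vc: "v \<in> carr" using span_subset_carr[OF orthonormalD(2)[OF E]] v by blast
  have "oproj E u - v \<in> cspan E" using v oproj_span by (intro complex_vector.span_diff)
  then have "ip (u - oproj E u) (oproj E u - v) = 0" by (rule oproj_orthogonal[OF E u])
  then have "(nrm ((u - oproj E u) + (oproj E u - v)))\<^sup>2 = (nrm (u - oproj E u))\<^sup>2 + (nrm (oproj E u - v))\<^sup>2"
    using E u vc by (intro pythagoras) auto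
  then have "(nrm (u - oproj E u))\<^sup>2 \<le> (nrm (u - v))\<^sup>2" by simp
  then show ?thesis by (rule power2_le_imp_le) (use u vc in auto)
qed

lemma Gram_Schmidt:
  assumes "finite B" "B \<subseteq> carr"
  obtains E where "orthonormal E" "cspan E = cspan B"
proof -
  have "\<exists>E. orthonormal E \<and> cspan E = cspan B"
    using assms
  proof (induction B rule: finite_induct)
    case empty
    then show ?case by (intro exI[of _ "{}"]) (simp add: orthonormal_def)
  next
    case (insert b B)
    then obtain E where E: "orthonormal E" "cspan E = cspan B" by auto
    have b: "b \<in> carr" using insert by simp
    define r where "r = b - oproj E b"
    have rc: "r \<in> carr" using E b by (simp add: r_def)
    have bE: "cspan (insert b B) = cspan (insert b E)"
      using E(2) by (metis complex_vector.span_insert)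
    show ?case
    proof (cases "r = 0")
      case True
      then have "b \<in> cspan E" using oproj_span[of E b] by (simp add: r_def)
      then show ?thesis using E bE complex_vector.span_redundant by metis
    next
      case False
      define c where "c = complex_of_real (nrm r)"
      have c: "c \<noteq> 0" using nrm_pos[OF rc False] by (simp add: c_def)
      define e where "e = inverse c *\<^sub>C r"
      have re: "r = c *\<^sub>C e" using c by (simp add: e_def)
      have ec: "e \<in> carr" using rc by (simp add: e_def)
      have orth: "ip e d = 0" "ip d e = 0" if "d \<in> E" for d
      proof -
        have dc: "d \<in> carr" using that orthonormalD(2)[OF E(1)] by blast
        have "ip r d = 0" unfolding r_def
          by (rule oproj_orthogonal[OF E(1) b complex_vector.span_base[OF that]])
        then show "ip e d = 0" using rc dc by (simp add: e_def ip_scale_left)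
        then show "ip d e = 0" using ip_commute[OF ec dc] by simp
      qed
      have "nrm e = 1"
        using rc False nrm_pos[OF rc False] by (simp add: e_def c_def norm_inverse)
      then have "ip e e = 1" using ip_self[OF ec] by simp
      then have "orthonormal (insert e E)"
        using E(1) ec orth unfolding orthonormal_def by auto
      moreover have "cspan (insert e E) = cspan (insert b E)"
        unfolding complex_vector.span_eq
      proof (intro conjI insert_subsetI)
        have sub: "E \<subseteq> cspan (insert y E)" for y
          by (rule subset_trans[OF subset_insertI complex_vector.span_superset])
        show "E \<subseteq> cspan (insert e E)" "E \<subseteq> cspan (insert b E)" by (rule sub)+
        have op: "oproj E b \<in> cspan (insert y E)" for y
          by (rule subsetD[OF complex_vector.span_mono[OF subset_insertI] oproj_span])
        have "r \<in> cspan (insert b E)" unfolding r_def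
          by (intro complex_vector.span_diff op complex_vector.span_base) simp
        then show "e \<in> cspan (insert b E)" unfolding e_def by (rule complex_vector.span_scale)
        have "r + oproj E b \<in> cspan (insert e E)" unfolding re
          by (intro complex_vector.span_add op complex_vector.span_scale complex_vector.span_base) simp
        then show "b \<in> cspan (insert e E)" by (simp add: r_def)
      qed
      ultimately show ?thesis using bE by auto
    qed
  qed
  then show ?thesis using that by blast
qed

text \<open>\<open>fin_dim\<close> only gives a finite set whose span contains \<open>S\<close>, and
  its members may lie outside the carrier. A basis is therefore taken inside \<open>S\<close> before
  it is orthonormalized.\<close>

lemma fin_dim_orthonormal_basis:
  assumes S: "csubspace S" "S \<subseteq> carr" "fin_dim S"
  obtains E where "orthonormal E" "cspan E = S"
proof -
  obtain F where F: "finite F" "S \<subseteq> cspan F" using S(3) unfolding fin_dim_def by blast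
  obtain B where B: "B \<subseteq> S" "complex_vector.independent B" "S \<subseteq> cspan B"
    using complex_vector.maximal_independent_subset[of S] by metis
  have "finite B" using complex_vector.independent_span_bound[OF F(1) B(2)] B(1) F(2) by blast
  moreover have "cspan B = S" using B(1,3) complex_vector.span_minimal[OF B(1) S(1)] by blast
  ultimately show ?thesis using Gram_Schmidt[of B] B(1) S(2) that by (metis subset_trans)
qed

text \<open>By \<open>oproj_best\<close> the distance of \<open>x\<close> to its projection is at
  most its distance to each \<open>y k\<close>, hence 0.\<close>

lemma closedin_span:
  assumes E: "orthonormal E"
  shows "x \<in> carr \<Longrightarrow> (\<And>k. y k \<in> cspan E) \<Longrightarrow> (\<lambda>k::nat. nrm (y k - x)) \<longlonglongrightarrow> 0 \<Longrightarrow> x \<in> cspan E"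
proof -
  assume x: "x \<in> carr" and y: "\<And>k. y k \<in> cspan E" and lim: "(\<lambda>k::nat. nrm (y k - x)) \<longlonglongrightarrow> 0"
  have "y k \<in> carr" for k using span_subset_carr[OF orthonormalD(2)[OF E]] y by blast
  then have "nrm (x - oproj E x) \<le> nrm (y k - x)" for k
    using oproj_best[OF E x y[of k]] nrm_diff_commute[OF x] by simp
  then have "nrm (x - oproj E x) \<le> 0" using LIMSEQ_le_const[OF lim] by blast
  then have "x = oproj E x" using nrm_pos[of "x - oproj E x"] E x by fastforce
  then show ?thesis using oproj_span by metis
qed

end

section \<open>Finite-rank perturbations of coercive forms\<close>

text \<open>The determinant of the identity minus \<open>M\<close>. The matrix is a plain function
  of two indices so that holomorphy in a parameter can be stated entry by entry.\<close>

definition fdet :: "nat \<Rightarrow> (nat \<Rightarrow> nat \<Rightarrow> complex) \<Rightarrow> complex"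
  where "fdet n M = det (mat n n (\<lambda>(i, j). (if i = j then 1 else 0) - M i j))"

lemma identity_minus_mult_vec:
  fixes c :: "nat \<Rightarrow> complex"
  assumes "i < n"
  shows "(mat n n (\<lambda>(i, j). (if i = j then 1 else 0) - M i j) *\<^sub>v vec n c) $ i
    = c i - (\<Sum>j<n. M i j * c j)"
proof -
  have "(mat n n (\<lambda>(i, j). (if i = j then 1 else 0) - M i j) *\<^sub>v vec n c) $ i
    = (\<Sum>j<n. (if i = j then 1 else 0) * c j - M i j * c j)"
    using assms by (simp add: scalar_prod_def left_diff_distrib atLeast0LessThan)
  also have "\<dots> = (\<Sum>j<n. (if i = j then 1 else 0) * c j) - (\<Sum>j<n. M i j * c j)"
    by (rule sum_subtractf)
  also have "(\<Sum>j<n. (if i = j then 1 else 0) * c j) = (\<Sum>j<n. if j = i then c j else 0)"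
    by (rule sum.cong) auto
  also have "\<dots> = c i" using assms by simp
  finally show ?thesis .
qed

lemma fdet_eq_0_iff:
  "fdet n M = 0 \<longleftrightarrow> (\<exists>c. (\<exists>i<n. c i \<noteq> 0) \<and> (\<forall>i<n. c i = (\<Sum>j<n. M i j * c j)))"
proof -
  let ?A = "mat n n (\<lambda>(i, j). (if i = j then 1 else 0) - M i j)"
  have A: "?A \<in> carrier_mat n n" by simp
  have "fdet n M = 0 \<longleftrightarrow> (\<exists>v. v \<in> carrier_vec n \<and> v \<noteq> 0\<^sub>v n \<and> ?A *\<^sub>v v = 0\<^sub>v n)"
    unfolding fdet_def by (rule det_0_iff_vec_prod_zero[OF A])
  also have "\<dots> \<longleftrightarrow> (\<exists>c. vec n c \<noteq> 0\<^sub>v n \<and> ?A *\<^sub>v vec n c = 0\<^sub>v n)"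
  proof (intro iffI; elim exE conjE)
    fix v assume v: "v \<in> carrier_vec n" "v \<noteq> 0\<^sub>v n" "?A *\<^sub>v v = 0\<^sub>v n"
    have "vec n (\<lambda>i. v $ i) = v" using v(1) by (intro eq_vecI) auto
    then show "\<exists>c. vec n c \<noteq> 0\<^sub>v n \<and> ?A *\<^sub>v vec n c = 0\<^sub>v n"
      by (intro exI[of _ "\<lambda>i. v $ i"]) (simp only: v(2,3) not_False_eq_True simp_thms)
  next
    fix c assume c: "vec n c \<noteq> 0\<^sub>v n" "?A *\<^sub>v vec n c = 0\<^sub>v n"
    show "\<exists>v. v \<in> carrier_vec n \<and> v \<noteq> 0\<^sub>v n \<and> ?A *\<^sub>v v = 0\<^sub>v n"
      by (intro exI[of _ "vec n c"] conjI vec_carrier c)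
  qed
  also have "\<dots> \<longleftrightarrow> (\<exists>c. (\<exists>i<n. c i \<noteq> 0) \<and> (\<forall>i<n. c i = (\<Sum>j<n. M i j * c j)))"
  proof -
    have 1: "vec n c \<noteq> 0\<^sub>v n \<longleftrightarrow> (\<exists>i<n. c i \<noteq> 0)" for c :: "nat \<Rightarrow> complex"
      by (auto simp: vec_eq_iff)
    have 2: "?A *\<^sub>v vec n c = 0\<^sub>v n \<longleftrightarrow> (\<forall>i<n. c i = (\<Sum>j<n. M i j * c j))" for c
      using identity_minus_mult_vec[of _ n M c]
      by (auto simp: vec_eq_iff simp del: index_mult_mat_vec)
    show ?thesis unfolding 1 2 ..
  qed
  finally show ?thesis .
qed

text \<open>An equivalence rather than a solution formula: read from right to left it produces a
  solution, from left to right it expresses, and so bounds, a given one.\<close>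

lemma fdet_inverse:
  assumes "fdet n M \<noteq> 0"
  obtains B where "\<And>c d. (\<forall>i<n. c i - (\<Sum>j<n. M i j * c j) = d i) \<longleftrightarrow> (\<forall>i<n. c i = (\<Sum>j<n. B i j * d j))"
proof -
  let ?A = "mat n n (\<lambda>(i, j). (if i = j then 1 else 0) - M i j)"
  have A: "?A \<in> carrier_mat n n" by simp
  from det_non_zero_imp_unit[OF A assms[unfolded fdet_def], of "()"]
  obtain B where B: "B \<in> carrier_mat n n" "B * ?A = 1\<^sub>m n" "?A * B = 1\<^sub>m n"
    unfolding Units_def by (auto simp: ring_mat_simps)
  have "(\<forall>i<n. c i - (\<Sum>j<n. M i j * c j) = d i) \<longleftrightarrow> (\<forall>i<n. c i = (\<Sum>j<n. B $$ (i, j) * d j))" for c d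
  proof -
    have "(\<forall>i<n. c i - (\<Sum>j<n. M i j * c j) = d i) \<longleftrightarrow> ?A *\<^sub>v vec n c = vec n d"
      using identity_minus_mult_vec[of _ n M c]
      by (auto simp: vec_eq_iff simp del: index_mult_mat_vec)
    also have "\<dots> \<longleftrightarrow> vec n c = B *\<^sub>v vec n d"
    proof
      assume "?A *\<^sub>v vec n c = vec n d"
      then have "B *\<^sub>v vec n d = (B * ?A) *\<^sub>v vec n c"
        using B(1) by (subst assoc_mult_mat_vec[OF B(1) A]) auto
      then show "vec n c = B *\<^sub>v vec n d" using B(2) by simp
    next
      assume "vec n c = B *\<^sub>v vec n d"
      then have "?A *\<^sub>v vec n c = (?A * B) *\<^sub>v vec n d"
        using B(1) by (subst assoc_mult_mat_vec[OF A B(1)]) auto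
      then show "?A *\<^sub>v vec n c = vec n d" using B(3) by simp
    qed
    also have "\<dots> \<longleftrightarrow> (\<forall>i<n. c i = (\<Sum>j<n. B $$ (i, j) * d j))"
      using B(1) by (auto simp: vec_eq_iff scalar_prod_def atLeast0LessThan)
    finally show ?thesis .
  qed
  then show ?thesis by (rule that)
qed

text \<open>By the Leibniz formula the determinant is a polynomial in the entries.\<close>

lemma fdet_holomorphic:
  assumes "\<And>i j. i < n \<Longrightarrow> j < n \<Longrightarrow> (\<lambda>z. M z i j) holomorphic_on S"
  shows "(\<lambda>z. fdet n (M z)) holomorphic_on S"
proof -
  have "fdet n (M z) = (\<Sum>p\<in>{p. p permutes {0..<n}}. signof p * (\<Prod>i = 0..<n. (if i = p i then 1 else 0) - M z i (p i)))" for z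
    unfolding fdet_def by (subst det_def') (auto intro!: sum.cong prod.cong simp: permutes_in_image)
  moreover have "(\<lambda>z. signof p * (\<Prod>i = 0..<n. (if i = p i then 1 else 0) - M z i (p i))) holomorphic_on S"
    if "p permutes {0..<n}" for p
    using assms permutes_in_image[OF that]
    by (intro holomorphic_on_mult holomorphic_on_prod holomorphic_on_diff holomorphic_on_const) auto
  ultimately show ?thesis
    by (simp only:) (rule holomorphic_on_sum, simp)
qed

section \<open>Algebra of bounded sesquilinear forms\<close>

context pre_hilbert
begin

lemma bounded_sesquilinear_add:
  assumes "bounded_sesquilinear H b" "bounded_sesquilinear H c"
  shows "bounded_sesquilinear H (\<lambda>u v. b u v + c u v)"
proof -
  obtain B where B: "B > 0" "\<And>x y. x \<in> carr \<Longrightarrow> y \<in> carr \<Longrightarrow> cmod (b x y) \<le> B * nrm x * nrm y"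
    using form_bound[OF assms(1)] by blast
  obtain C where C: "C > 0" "\<And>x y. x \<in> carr \<Longrightarrow> y \<in> carr \<Longrightarrow> cmod (c x y) \<le> C * nrm x * nrm y"
    using form_bound[OF assms(2)] by blast
  show ?thesis
  proof (rule bounded_sesquilinearI)
    show "sesquilinear_on carr (\<lambda>u v. b u v + c u v)"
      using assms unfolding bounded_sesquilinear_def sesquilinear_on_def by (auto simp: algebra_simps)
    show "cmod (b x y + c x y) \<le> (B + C) * nrm x * nrm y" if "x \<in> carr" "y \<in> carr" for x y
      using B(2)[OF that] C(2)[OF that] norm_triangle_ineq[of "b x y" "c x y"] by (simp add: algebra_simps)
  qed
qed

lemma bounded_sesquilinear_rank1:
  assumes "bounded_functional H f" "bounded_functional H h"
  shows "bounded_sesquilinear H (\<lambda>u v. f u * cnj (h v))"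
proof -
  obtain B where B: "\<And>x. x \<in> carr \<Longrightarrow> cmod (f x) \<le> B * nrm x" "B \<ge> 0"
    using assms(1) unfolding bounded_functional_def
    by (metis abs_ge_self abs_ge_zero mult_right_mono nrm_nonneg order_trans)
  obtain C where C: "\<And>x. x \<in> carr \<Longrightarrow> cmod (h x) \<le> C * nrm x" "C \<ge> 0"
    using assms(2) unfolding bounded_functional_def
    by (metis abs_ge_self abs_ge_zero mult_right_mono nrm_nonneg order_trans)
  show ?thesis
  proof (rule bounded_sesquilinearI)
    show "sesquilinear_on carr (\<lambda>u v. f u * cnj (h v))"
      using bounded_functionalD[OF assms(1)] bounded_functionalD[OF assms(2)]
      unfolding sesquilinear_on_def by (simp add: algebra_simps)
    show "cmod (f x * cnj (h y)) \<le> (B * C) * nrm x * nrm y" if "x \<in> carr" "y \<in> carr" for x y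
    proof -
      have "cmod (f x * cnj (h y)) = cmod (f x) * cmod (h y)" by (simp add: norm_mult)
      also have "\<dots> \<le> (B * nrm x) * (C * nrm y)"
        using B C that by (intro mult_mono) auto
      finally show ?thesis by (simp add: mult_ac)
    qed
  qed
qed

lemma bounded_sesquilinear_sum:
  assumes "\<And>i. i \<in> I \<Longrightarrow> bounded_sesquilinear H (b i)"
  shows "bounded_sesquilinear H (\<lambda>u v. \<Sum>i\<in>I. b i u v)"
  using assms
proof (induction I rule: infinite_finite_induct)
  case (insert i I)
  then show ?case by (simp add: bounded_sesquilinear_add)
qed (auto intro!: bounded_sesquilinearI[where C = 0] simp: sesquilinear_on_def)

lemma bounded_sesquilinear_comp:
  assumes "bounded_sesquilinear H b" "bounded_op H H T"
  shows "bounded_sesquilinear H (\<lambda>u v. b u (T v))"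
proof -
  obtain B where B: "B > 0" "\<And>x y. x \<in> carr \<Longrightarrow> y \<in> carr \<Longrightarrow> cmod (b x y) \<le> B * nrm x * nrm y"
    using form_bound[OF assms(1)] by blast
  obtain C where C: "C > 0" "\<And>x. x \<in> carr \<Longrightarrow> nrm (T x) \<le> C * nrm x"
    using op_bound[OF assms(2)] by blast
  have sb: "sesquilinear_on carr b" using assms(1) unfolding bounded_sesquilinear_def by blast
  note fs = form_add_left[OF subspace_carr sb] form_add_right[OF subspace_carr sb]
     form_scale_left[OF subspace_carr sb] form_scale_right[OF subspace_carr sb]
  note T = bounded_opD(1)[OF assms(2)] clinear_onD[OF bounded_opD(2)[OF assms(2)]]
  show ?thesis
  proof (rule bounded_sesquilinearI)
    show "sesquilinear_on carr (\<lambda>u v. b u (T v))" by (rule sesquilinear_onI) (auto simp: T fs)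
    show "cmod (b x (T y)) \<le> (B * C) * nrm x * nrm y" if "x \<in> carr" "y \<in> carr" for x y
    proof -
      have "cmod (b x (T y)) \<le> B * nrm x * nrm (T y)" using B(2) that T(1) by blast
      also have "\<dots> \<le> B * nrm x * (C * nrm y)" using B(1) C(2) that by (intro mult_left_mono) auto
      finally show ?thesis by (simp add: mult_ac)
    qed
  qed
qed

end

text \<open>The inf-sup condition with constant \<open>1 / C\<close>. An arbitrary bound
  \<open>m\<close> takes the place of the dual norm of \<open>b u\<close>, so that no supremum has
  to be formed.\<close>

definition bounded_below :: "'a::complex_vector hspace \<Rightarrow> ('a \<Rightarrow> 'a \<Rightarrow> complex) \<Rightarrow> real \<Rightarrow> bool"
  where "bounded_below H b C \<longleftrightarrow> (\<forall>u\<in>hcarrier H. \<forall>m\<ge>0.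
    (\<forall>v\<in>hcarrier H. cmod (b u v) \<le> m * hnorm H v) \<longrightarrow> hnorm H u \<le> C * m)"

text \<open>The conjugate appears because \<open>f\<close> is linear while \<open>b u\<close> is
  antilinear.\<close>

definition solvable :: "'a::complex_vector hspace \<Rightarrow> ('a \<Rightarrow> 'a \<Rightarrow> complex) \<Rightarrow> bool"
  where "solvable H b \<longleftrightarrow> (\<forall>f. bounded_functional H f \<longrightarrow>
    (\<exists>u\<in>hcarrier H. \<forall>v\<in>hcarrier H. b u v = cnj (f v)))"

lemma bounded_belowD:
  "bounded_below H b C \<Longrightarrow> u \<in> hcarrier H \<Longrightarrow> m \<ge> 0 \<Longrightarrow>
    (\<And>v. v \<in> hcarrier H \<Longrightarrow> cmod (b u v) \<le> m * hnorm H v) \<Longrightarrow> hnorm H u \<le> C * m"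
  unfolding bounded_below_def by blast

text \<open>Coercivity is asked only for \<open>s\<close> tested with \<open>T u\<close> and
  corrected by a form of rank at most \<open>n\<close>. Surjectivity of \<open>T\<close> ensures
  that testing with all \<open>T v\<close> is testing with all vectors.\<close>

locale fredholm_form = hilbert H for H :: "'a::complex_vector hspace" +
  fixes s :: "'a \<Rightarrow> 'a \<Rightarrow> complex" and T :: "'a \<Rightarrow> 'a" and n :: nat
    and A B :: "nat \<Rightarrow> 'a \<Rightarrow> complex" and g :: real
  assumes s: "bounded_sesquilinear H s"
    and T: "bounded_op H H T" and T_surj: "carr \<subseteq> T ` carr"
    and A: "\<And>i. i < n \<Longrightarrow> bounded_functional H (A i)"
    and B: "\<And>i. i < n \<Longrightarrow> bounded_functional H (B i)"
    and g: "g > 0"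
    and coercive: "\<And>u. u \<in> carr \<Longrightarrow> g * (nrm u)\<^sup>2 \<le> Re (s u (T u) + (\<Sum>i<n. A i u * cnj (B i u)))"
begin

definition a where "a u v = s u (T v) + (\<Sum>i<n. A i u * cnj (B i v))"

lemma a_bounded: "bounded_sesquilinear H a"
  unfolding a_def
proof (rule bounded_sesquilinear_add)
  show "bounded_sesquilinear H (\<lambda>u v. s u (T v))" by (rule bounded_sesquilinear_comp[OF s T])
  show "bounded_sesquilinear H (\<lambda>u v. \<Sum>i<n. A i u * cnj (B i v))"
    by (rule bounded_sesquilinear_sum, rule bounded_sesquilinear_rank1) (use A B in auto)
qed

lemma a_sesq: "sesquilinear_on carr a"
  using a_bounded unfolding bounded_sesquilinear_def by blast

lemma a_coercive: "u \<in> carr \<Longrightarrow> g * (nrm u)\<^sup>2 \<le> Re (a u u)"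
  using coercive by (simp add: a_def)

lemmas a_simps = form_add_left[OF subspace_carr a_sesq] form_diff_left[OF subspace_carr a_sesq]
  form_scale_left[OF subspace_carr a_sesq] form_sum_left[OF subspace_carr a_sesq]

lemma a_solve:
  assumes "bounded_functional H f"
  obtains u where "u \<in> carr" "\<And>v. v \<in> carr \<Longrightarrow> a u v = cnj (f v)"
  using Lax_Milgram[OF a_bounded g a_coercive assms] by blast

lemma a_unique:
  assumes "u \<in> carr" "w \<in> carr" "\<And>v. v \<in> carr \<Longrightarrow> a u v = a w v"
  shows "u = w"
proof -
  have "g * nrm (u - w) \<le> 0"
    by (rule coercive_estimate[where b = a]) (use assms a_coercive in \<open>auto simp: a_simps\<close>)
  then show ?thesis using g assms nrm_pos[of "u - w"] by (fastforce simp: mult_le_0_iff)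
qed

lemma functional_sum: "bounded_functional H f \<Longrightarrow> (\<And>i. i \<in> I \<Longrightarrow> x i \<in> carr) \<Longrightarrow> f (\<Sum>i\<in>I. x i) = (\<Sum>i\<in>I. f (x i))"
proof (induction I rule: infinite_finite_induct)
  case (insert i I)
  then show ?case by (simp add: bounded_functionalD(1))
qed (use bounded_functionalD(2)[of H f 0 0] in auto)

lemma A_combination:
  assumes "i < n" "y \<in> carr" "\<And>j. j < n \<Longrightarrow> w j \<in> carr"
  shows "A i (y + (\<Sum>j<n. c j *\<^sub>C w j)) = A i y + (\<Sum>j<n. A i (w j) * c j)"
proof -
  have "(\<Sum>j<n. c j *\<^sub>C w j) \<in> carr" using assms by auto
  then have "A i (y + (\<Sum>j<n. c j *\<^sub>C w j)) = A i y + A i (\<Sum>j<n. c j *\<^sub>C w j)"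
    using assms by (simp add: bounded_functionalD(1)[OF A])
  also have "A i (\<Sum>j<n. c j *\<^sub>C w j) = (\<Sum>j<n. A i (c j *\<^sub>C w j))"
    by (rule functional_sum[OF A[OF assms(1)]]) (use assms in auto)
  also have "(\<Sum>j<n. A i (c j *\<^sub>C w j)) = (\<Sum>j<n. A i (w j) * c j)"
    using assms by (intro sum.cong) (auto simp: bounded_functionalD(2)[OF A])
  finally show ?thesis .
qed

text \<open>\<open>w j\<close> is the response of the coercive form to the functional
  \<open>B j\<close>. The matrix with entries \<open>A i (w j)\<close> then decides whether
  \<open>s\<close> has a kernel.\<close>

lemma solution_operator:
  obtains w where "\<And>j. j < n \<Longrightarrow> w j \<in> carr" "\<And>j v. j < n \<Longrightarrow> v \<in> carr \<Longrightarrow> a (w j) v = cnj (B j v)"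
proof -
  have "\<forall>j. \<exists>w. j < n \<longrightarrow> w \<in> carr \<and> (\<forall>v\<in>carr. a w v = cnj (B j v))"
    using a_solve[OF B] by metis
  then show ?thesis using that by metis
qed

context
  fixes w
  assumes w: "\<And>j. j < n \<Longrightarrow> w j \<in> carr" "\<And>j v. j < n \<Longrightarrow> v \<in> carr \<Longrightarrow> a (w j) v = cnj (B j v)"
begin

lemma a_combination:
  assumes "y \<in> carr" "v \<in> carr"
  shows "a (y + (\<Sum>j<n. c j *\<^sub>C w j)) v = a y v + (\<Sum>j<n. c j * cnj (B j v))"
proof -
  have m: "(\<Sum>j<n. c j *\<^sub>C w j) \<in> carr" using w by auto
  have "a (y + (\<Sum>j<n. c j *\<^sub>C w j)) v = a y v + a (\<Sum>j<n. c j *\<^sub>C w j) v"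
    by (rule a_simps(1)[OF assms(1) m assms(2)])
  also have "a (\<Sum>j<n. c j *\<^sub>C w j) v = (\<Sum>j<n. a (c j *\<^sub>C w j) v)"
    by (rule a_simps(4)) (use w assms in auto)
  also have "\<dots> = (\<Sum>j<n. c j * cnj (B j v))"
    using w assms by (intro sum.cong) (auto simp: a_simps(3))
  finally show ?thesis .
qed

text \<open>With the definition of \<open>a\<close> spelled out, both sides solve the same coercive
  problem, whose solution is unique. So \<open>u\<close> is determined by \<open>y\<close> together
  with the finitely many numbers \<open>A j u\<close>.\<close>

lemma decompose:
  assumes u: "u \<in> carr" and y: "y \<in> carr" "\<And>v. v \<in> carr \<Longrightarrow> a y v = s u (T v)"
  shows "u = y + (\<Sum>j<n. A j u *\<^sub>C w j)"
proof (rule a_unique[OF u])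
  show "y + (\<Sum>j<n. A j u *\<^sub>C w j) \<in> carr" using w y(1) by (intro mem_add mem_sum) auto
  fix v assume v: "v \<in> carr"
  have "a (y + (\<Sum>j<n. A j u *\<^sub>C w j)) v = s u (T v) + (\<Sum>j<n. A j u * cnj (B j v))"
    unfolding a_combination[OF y(1) v] y(2)[OF v] ..
  then show "a u v = a (y + (\<Sum>j<n. A j u *\<^sub>C w j)) v" by (simp add: a_def[of u])
qed

text \<open>Applying \<open>A i\<close> to the decomposition with \<open>y = 0\<close> makes the
  vector of the \<open>A i u\<close> a fixed vector of the matrix; if it were zero, \<open>u\<close>
  would vanish. Conversely, the combination of the \<open>w j\<close> with weights from a fixed
  vector \<open>c\<close> has \<open>A i u = c i\<close>, and the finite-rank terms cancel.\<close>

lemma kernel_iff_fdet: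
  "(\<exists>u\<in>carr - {0}. \<forall>v\<in>carr. s u v = 0) \<longleftrightarrow> fdet n (\<lambda>i j. A i (w j)) = 0"
  unfolding fdet_eq_0_iff
proof (intro iffI; elim bexE exE conjE)
  fix u assume u: "u \<in> carr - {0}" "\<forall>v\<in>carr. s u v = 0"
  have "a 0 v = s u (T v)" if "v \<in> carr" for v
    using u that bounded_opD(1)[OF T] form_0_left[OF subspace_carr a_sesq] by simp
  from decompose[OF _ mem_0 this] u have dec: "u = 0 + (\<Sum>j<n. A j u *\<^sub>C w j)" by blast
  have "A i u = (\<Sum>j<n. A i (w j) * A j u)" if "i < n" for i
    using A_combination[where w = w and c = "\<lambda>j. A j u", OF that mem_0 w(1)] dec bounded_functionalD(2)[OF A[OF that], of 0 0] by simp
  moreover have "\<exists>i<n. A i u \<noteq> 0"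
  proof (rule ccontr)
    assume "\<not> ?thesis"
    then have "(\<Sum>j<n. A j u *\<^sub>C w j) = 0" by (intro sum.neutral) auto
    then show False using dec u by simp
  qed
  ultimately show "\<exists>c. (\<exists>i<n. c i \<noteq> 0) \<and> (\<forall>i<n. c i = (\<Sum>j<n. A i (w j) * c j))"
    by (intro exI[of _ "\<lambda>i. A i u"]) blast
next
  fix c i assume c: "\<forall>i<n. c i = (\<Sum>j<n. A i (w j) * c j)" and i: "i < n" "c i \<noteq> 0"
  define u where "u = 0 + (\<Sum>j<n. c j *\<^sub>C w j)"
  have uc: "u \<in> carr" using w by (auto simp: u_def)
  have Au: "A i u = c i" if i: "i < n" for i
  proof -
    have "A i u = A i 0 + (\<Sum>j<n. A i (w j) * c j)"
      unfolding u_def by (rule A_combination[OF i mem_0 w(1)])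
    also have "(\<Sum>j<n. A i (w j) * c j) = c i" using c i by metis
    finally show ?thesis using bounded_functionalD(2)[OF A[OF i], of 0 0] by simp
  qed
  have "u \<noteq> 0" using Au[OF i(1)] i(2) bounded_functionalD(2)[OF A[OF i(1)], of 0 0] by auto
  moreover have "s u v = 0" if v: "v \<in> carr" for v
  proof -
    obtain v' where v': "v' \<in> carr" "T v' = v" using T_surj v by blast
    have "a u v' = (\<Sum>j<n. c j * cnj (B j v'))"
      unfolding u_def a_combination[OF mem_0 v'(1)] using form_0_left[OF subspace_carr a_sesq v'(1)] by simp
    then show ?thesis using Au v'(2) by (simp add: a_def)
  qed
  ultimately show "\<exists>u\<in>carr - {0}. \<forall>v\<in>carr. s u v = 0" using uc by blast
qed

end

text \<open>Injectivity makes the determinant nonzero, so the linear system for the numbers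
  \<open>A i u\<close> can be inverted. The inverse \<open>R\<close> yields solutions, and applied
  to the solution \<open>y\<close> of the coercive problem it bounds them.\<close>

lemma fredholm_alternative:
  assumes inj: "\<And>u. u \<in> carr \<Longrightarrow> (\<And>v. v \<in> carr \<Longrightarrow> s u v = 0) \<Longrightarrow> u = 0"
  shows "solvable H s" and "\<exists>C>0. bounded_below H s C"
proof -
  obtain w where w: "\<And>j. j < n \<Longrightarrow> w j \<in> carr" "\<And>j v. j < n \<Longrightarrow> v \<in> carr \<Longrightarrow> a (w j) v = cnj (B j v)"
    using solution_operator by blast
  have "fdet n (\<lambda>i j. A i (w j)) \<noteq> 0" using kernel_iff_fdet[of w] w inj by blast
  then obtain R where R: "\<And>c d. (\<forall>i<n. c i - (\<Sum>j<n. A i (w j) * c j) = d i) \<longleftrightarrow> (\<forall>i<n. c i = (\<Sum>j<n. R i j * d j))"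
    using fdet_inverse by blast
  show "solvable H s"
    unfolding solvable_def
  proof (intro allI impI)
    fix f assume f: "bounded_functional H f"
    obtain C where C: "C > 0" "\<And>x. x \<in> carr \<Longrightarrow> nrm (T x) \<le> C * nrm x" using op_bound[OF T] by blast
    obtain D where D: "D > 0" "\<And>x. x \<in> carr \<Longrightarrow> cmod (f x) \<le> D * nrm x" using functional_bound[OF f] by blast
    have "cmod (f (T x)) \<le> (D * C) * nrm x" if "x \<in> carr" for x
      using order_trans[OF D(2)[OF bounded_opD(1)[OF T that]] mult_left_mono[OF C(2)[OF that], of D]] D(1)
      by (simp add: mult.assoc)
    then have "bounded_functional H (\<lambda>v. f (T v))"
      using bounded_opD(1)[OF T] clinear_onD[OF bounded_opD(2)[OF T]]
      by (intro bounded_functionalI[where C = "D * C"]) (auto simp: bounded_functionalD[OF f])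
    then obtain y where y: "y \<in> carr" "\<And>v. v \<in> carr \<Longrightarrow> a y v = cnj (f (T v))" using a_solve by blast
    \<comment> \<open>Chosen so that \<open>A i u = c i\<close> below. The finite-rank terms of
      \<open>a u\<close> then match those on the right, and \<open>s u (T v')\<close> is what
      remains.\<close>
    define c where "c = (\<lambda>i. \<Sum>j<n. R i j * A j y)"
    define u where "u = y + (\<Sum>j<n. c j *\<^sub>C w j)"
    have uc: "u \<in> carr" using w y by (auto simp: u_def)
    have c: "\<forall>i<n. c i - (\<Sum>j<n. A i (w j) * c j) = A i y" unfolding R c_def by simp
    have Au: "A i u = c i" if i: "i < n" for i
    proof -
      have "c i - (\<Sum>j<n. A i (w j) * c j) = A i y" using c i by blast
      moreover have "A i u = A i y + (\<Sum>j<n. A i (w j) * c j)"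
        unfolding u_def by (rule A_combination[OF i y(1) w(1)])
      ultimately show ?thesis by (simp add: diff_eq_eq)
    qed
    have "s u v = cnj (f v)" if v: "v \<in> carr" for v
    proof -
      obtain v' where v': "v' \<in> carr" "T v' = v" using T_surj v by blast
      have "a u v' = cnj (f v) + (\<Sum>j<n. c j * cnj (B j v'))"
        unfolding u_def by (subst a_combination[OF w]) (use y v' in auto)
      then show ?thesis using Au v'(2) by (simp add: a_def)
    qed
    then show "\<exists>u\<in>carr. \<forall>v\<in>carr. s u v = cnj (f v)" using uc by blast
  qed
  obtain C where C: "C > 0" "\<And>x. x \<in> carr \<Longrightarrow> nrm (T x) \<le> C * nrm x" using op_bound[OF T] by blast
  have "\<forall>i<n. \<exists>D>0. \<forall>x\<in>carr. cmod (A i x) \<le> D * nrm x" using functional_bound[OF A] by metis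
  then obtain D where D: "\<And>i. i < n \<Longrightarrow> D i > 0" "\<And>i x. i < n \<Longrightarrow> x \<in> carr \<Longrightarrow> cmod (A i x) \<le> D i * nrm x" by metis
  \<comment> \<open>The summand 1 accounts for \<open>y\<close>, the sum for the terms
    \<open>A j u *\<^sub>C w j\<close>, where \<open>A j u\<close> is estimated through
    \<open>R\<close>.\<close>
  define K where "K = 1 + (\<Sum>j<n. (\<Sum>k<n. cmod (R j k) * D k) * nrm (w j))"
  have K: "K > 0" unfolding K_def using D(1) w(1) by (intro add_pos_nonneg sum_nonneg mult_nonneg_nonneg) (auto simp: less_imp_le)
  have "bounded_below H s (K * (C / g))"
    unfolding bounded_below_def
  proof (intro ballI allI impI)
    fix u m assume u: "u \<in> carr" and m: "(0::real) \<le> m" "\<forall>v\<in>carr. cmod (s u v) \<le> m * nrm v"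
    have sT: "cmod (s u (T v)) \<le> (m * C) * nrm v" if "v \<in> carr" for v
    proof -
      have "cmod (s u (T v)) \<le> m * nrm (T v)" using m(2) bounded_opD(1)[OF T that] by blast
      also have "\<dots> \<le> m * (C * nrm v)" using C(2)[OF that] m(1) by (intro mult_left_mono) auto
      finally show ?thesis by (simp add: mult.assoc)
    qed
    have ss: "sesquilinear_on carr (\<lambda>u v. s u (T v))"
      using bounded_sesquilinear_comp[OF s T] unfolding bounded_sesquilinear_def by blast
    have "bounded_functional H (\<lambda>v. cnj (s u (T v)))"
      using u sT form_add_right[OF subspace_carr ss] form_scale_right[OF subspace_carr ss]
      by (intro bounded_functionalI[where C = "m * C"]) auto
    from a_solve[OF this] obtain y where y: "y \<in> carr" "\<And>v. v \<in> carr \<Longrightarrow> a y v = s u (T v)"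
      by auto
    have "g * nrm y \<le> m * C"
      by (rule coercive_estimate[where b = a, OF a_coercive y(1)]) (use y sT m C in auto)
    then have ny: "nrm y \<le> C / g * m" using g by (simp add: field_simps)
    have dec: "u = y + (\<Sum>j<n. A j u *\<^sub>C w j)" by (rule decompose[OF w u y])
    have "A i u - (\<Sum>j<n. A i (w j) * A j u) = A i y" if "i < n" for i
      using A_combination[where w = w and c = "\<lambda>j. A j u", OF that y(1) w(1)] dec by simp
    then have Au: "A i u = (\<Sum>j<n. R i j * A j y)" if "i < n" for i using R[of "\<lambda>i. A i u" "\<lambda>i. A i y"] that by blast
    have Aub: "cmod (A i u) \<le> (\<Sum>k<n. cmod (R i k) * D k) * nrm y" if "i < n" for i
    proof -
      have "cmod (A i u) \<le> (\<Sum>k<n. cmod (R i k * A k y))" unfolding Au[OF that] by (rule norm_sum)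
      also have "\<dots> \<le> (\<Sum>k<n. cmod (R i k) * (D k * nrm y))"
        unfolding norm_mult using D(2) y(1) by (intro sum_mono mult_left_mono) auto
      finally show ?thesis by (simp add: sum_distrib_right mult.assoc)
    qed
    have "nrm u \<le> nrm y + nrm (\<Sum>j<n. A j u *\<^sub>C w j)"
      using nrm_triangle[OF y(1), of "\<Sum>j<n. A j u *\<^sub>C w j"] w dec by auto
    also have "nrm (\<Sum>j<n. A j u *\<^sub>C w j) \<le> (\<Sum>j<n. nrm (A j u *\<^sub>C w j))" by (rule nrm_sum) (use w in auto)
    also have "\<dots> \<le> (\<Sum>j<n. (\<Sum>k<n. cmod (R j k) * D k) * nrm y * nrm (w j))"
      using Aub w by (intro sum_mono) (auto intro: mult_right_mono)
    also have "nrm y + \<dots> = K * nrm y"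
    proof -
      have "(\<Sum>j<n. P j * nrm y * nrm (w j)) = (\<Sum>j<n. P j * nrm (w j)) * nrm y" for P
        unfolding sum_distrib_right by (intro sum.cong) simp_all
      then show ?thesis by (simp add: K_def distrib_right)
    qed
    also have "\<dots> \<le> K * (C / g * m)" using ny K by (intro mult_left_mono) auto
    finally show "nrm u \<le> K * (C / g) * m" by (simp add: mult_ac)
  qed
  moreover have "K * (C / g) > 0" using K C g by simp
  ultimately show "\<exists>C>0. bounded_below H s C" by blast
qed

end

section \<open>Holomorphic families of forms\<close>

text \<open>Complex differentiability in operator norm, written for forms: a form restricts to a
  subspace with the same estimates, whereas the operator representing it would have to be
  compressed.\<close>

definition form_holomorphic :: "'a::complex_vector hspace \<Rightarrow> complex set \<Rightarrow> (complex \<Rightarrow> 'a \<Rightarrow> 'a \<Rightarrow> complex) \<Rightarrow> bool"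
  where "form_holomorphic H \<Omega> s \<longleftrightarrow>
    (\<forall>\<kappa>\<in>\<Omega>. bounded_sesquilinear H (s \<kappa>)) \<and>
    (\<forall>\<kappa>\<^sub>0\<in>\<Omega>. \<exists>d. bounded_sesquilinear H d \<and> (\<forall>e>0. \<exists>\<delta>>0. \<forall>\<kappa>\<in>\<Omega>. cmod (\<kappa> - \<kappa>\<^sub>0) < \<delta> \<longrightarrow>
      (\<forall>u\<in>hcarrier H. \<forall>v\<in>hcarrier H.
        cmod (s \<kappa> u v - s \<kappa>\<^sub>0 u v - (\<kappa> - \<kappa>\<^sub>0) * d u v) \<le> e * cmod (\<kappa> - \<kappa>\<^sub>0) * hnorm H u * hnorm H v)))"

lemma form_holomorphic_subset:
  assumes "form_holomorphic H \<Omega> s" "\<Omega>' \<subseteq> \<Omega>"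
  shows "form_holomorphic H \<Omega>' s"
  using assms unfolding form_holomorphic_def subset_iff by meson

lemma bounded_sesquilinear_hsub:
  assumes "bounded_sesquilinear H b" "W \<subseteq> hcarrier H"
  shows "bounded_sesquilinear (hsub H W) b"
  using assms unfolding bounded_sesquilinear_def sesquilinear_on_def by (simp add: subset_iff) blast

lemma form_holomorphic_hsub:
  assumes s: "form_holomorphic H \<Omega> s" and W: "W \<subseteq> hcarrier H"
  shows "form_holomorphic (hsub H W) \<Omega> s"
  unfolding form_holomorphic_def
proof (intro conjI ballI)
  fix \<kappa> assume "\<kappa> \<in> \<Omega>"
  then show "bounded_sesquilinear (hsub H W) (s \<kappa>)"
    using s bounded_sesquilinear_hsub[OF _ W] unfolding form_holomorphic_def by blast
next
  fix \<kappa>\<^sub>0 assume "\<kappa>\<^sub>0 \<in> \<Omega>"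
  then obtain d where d: "bounded_sesquilinear H d" "\<forall>e>0. \<exists>\<delta>>0. \<forall>\<kappa>\<in>\<Omega>. cmod (\<kappa> - \<kappa>\<^sub>0) < \<delta> \<longrightarrow>
      (\<forall>u\<in>hcarrier H. \<forall>v\<in>hcarrier H.
        cmod (s \<kappa> u v - s \<kappa>\<^sub>0 u v - (\<kappa> - \<kappa>\<^sub>0) * d u v) \<le> e * cmod (\<kappa> - \<kappa>\<^sub>0) * hnorm H u * hnorm H v)"
    using s unfolding form_holomorphic_def by blast
  show "\<exists>d. bounded_sesquilinear (hsub H W) d \<and> (\<forall>e>0. \<exists>\<delta>>0. \<forall>\<kappa>\<in>\<Omega>. cmod (\<kappa> - \<kappa>\<^sub>0) < \<delta> \<longrightarrow>
      (\<forall>u\<in>hcarrier (hsub H W). \<forall>v\<in>hcarrier (hsub H W).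
        cmod (s \<kappa> u v - s \<kappa>\<^sub>0 u v - (\<kappa> - \<kappa>\<^sub>0) * d u v)
          \<le> e * cmod (\<kappa> - \<kappa>\<^sub>0) * hnorm (hsub H W) u * hnorm (hsub H W) v))"
  proof (intro exI[of _ d] conjI allI impI)
    show "bounded_sesquilinear (hsub H W) d" by (rule bounded_sesquilinear_hsub[OF d(1) W])
    fix e :: real assume "e > 0"
    then obtain \<delta> where "\<delta> > 0" "\<forall>\<kappa>\<in>\<Omega>. cmod (\<kappa> - \<kappa>\<^sub>0) < \<delta> \<longrightarrow>
      (\<forall>u\<in>hcarrier H. \<forall>v\<in>hcarrier H.
        cmod (s \<kappa> u v - s \<kappa>\<^sub>0 u v - (\<kappa> - \<kappa>\<^sub>0) * d u v) \<le> e * cmod (\<kappa> - \<kappa>\<^sub>0) * hnorm H u * hnorm H v)"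
      using d(2) by blast
    then show "\<exists>\<delta>>0. \<forall>\<kappa>\<in>\<Omega>. cmod (\<kappa> - \<kappa>\<^sub>0) < \<delta> \<longrightarrow>
      (\<forall>u\<in>hcarrier (hsub H W). \<forall>v\<in>hcarrier (hsub H W).
        cmod (s \<kappa> u v - s \<kappa>\<^sub>0 u v - (\<kappa> - \<kappa>\<^sub>0) * d u v)
          \<le> e * cmod (\<kappa> - \<kappa>\<^sub>0) * hnorm (hsub H W) u * hnorm (hsub H W) v)"
      using W by (intro exI[of _ \<delta>]) auto
  qed
qed

context hilbert
begin

lemma form_holomorphic_continuous:
  assumes s: "form_holomorphic H \<Omega> s" and k: "\<kappa>\<^sub>0 \<in> \<Omega>" and "e > 0"
  obtains \<delta> where "\<delta> > 0" "\<And>\<kappa> u v. \<kappa> \<in> \<Omega> \<Longrightarrow> cmod (\<kappa> - \<kappa>\<^sub>0) < \<delta> \<Longrightarrow> u \<in> carr \<Longrightarrow> v \<in> carr \<Longrightarrow>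
    cmod (s \<kappa> u v - s \<kappa>\<^sub>0 u v) \<le> e * nrm u * nrm v"
proof -
  obtain d where d: "bounded_sesquilinear H d" "\<forall>e>0. \<exists>\<delta>>0. \<forall>\<kappa>\<in>\<Omega>. cmod (\<kappa> - \<kappa>\<^sub>0) < \<delta> \<longrightarrow>
      (\<forall>u\<in>carr. \<forall>v\<in>carr.
        cmod (s \<kappa> u v - s \<kappa>\<^sub>0 u v - (\<kappa> - \<kappa>\<^sub>0) * d u v) \<le> e * cmod (\<kappa> - \<kappa>\<^sub>0) * nrm u * nrm v)"
    using s k unfolding form_holomorphic_def by blast
  obtain D where D: "D > 0" "\<And>x y. x \<in> carr \<Longrightarrow> y \<in> carr \<Longrightarrow> cmod (d x y) \<le> D * nrm x * nrm y"
    using form_bound[OF d(1)] by blast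
  obtain \<delta> where \<delta>: "\<delta> > 0" "\<And>\<kappa> u v. \<kappa> \<in> \<Omega> \<Longrightarrow> cmod (\<kappa> - \<kappa>\<^sub>0) < \<delta> \<Longrightarrow> u \<in> carr \<Longrightarrow> v \<in> carr \<Longrightarrow>
        cmod (s \<kappa> u v - s \<kappa>\<^sub>0 u v - (\<kappa> - \<kappa>\<^sub>0) * d u v) \<le> 1 * cmod (\<kappa> - \<kappa>\<^sub>0) * nrm u * nrm v"
    using d(2)[rule_format, of "1::real", simplified] by auto
  show ?thesis
  proof (rule that[of "min \<delta> (e / (1 + D))"])
    show "0 < min \<delta> (e / (1 + D))" using \<delta> D \<open>e > 0\<close> by simp
    fix \<kappa> u v assume *: "\<kappa> \<in> \<Omega>" "cmod (\<kappa> - \<kappa>\<^sub>0) < min \<delta> (e / (1 + D))" "u \<in> carr" "v \<in> carr"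
    let ?t = "cmod (\<kappa> - \<kappa>\<^sub>0)"
    have "cmod (s \<kappa> u v - s \<kappa>\<^sub>0 u v) \<le> cmod (s \<kappa> u v - s \<kappa>\<^sub>0 u v - (\<kappa> - \<kappa>\<^sub>0) * d u v) + cmod ((\<kappa> - \<kappa>\<^sub>0) * d u v)"
      using norm_triangle_ineq[of "s \<kappa> u v - s \<kappa>\<^sub>0 u v - (\<kappa> - \<kappa>\<^sub>0) * d u v" "(\<kappa> - \<kappa>\<^sub>0) * d u v"] by simp
    also have "\<dots> \<le> 1 * ?t * nrm u * nrm v + ?t * (D * nrm u * nrm v)"
      unfolding norm_mult using * by (intro add_mono \<delta>(2) mult_left_mono D(2)) auto
    also have "\<dots> = (?t * (1 + D)) * (nrm u * nrm v)" by (simp add: algebra_simps)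
    also have "\<dots> \<le> e * (nrm u * nrm v)"
      using * D(1) by (intro mult_right_mono) (auto simp: field_simps)
    finally show "cmod (s \<kappa> u v - s \<kappa>\<^sub>0 u v) \<le> e * nrm u * nrm v" by (simp add: mult.assoc)
  qed
qed

lemma form_holomorphic_comp_add:
  assumes s: "form_holomorphic H \<Omega> s" and T: "bounded_op H H T" and b: "bounded_sesquilinear H b"
  shows "form_holomorphic H \<Omega> (\<lambda>\<kappa> u v. s \<kappa> u (T v) + b u v)"
  unfolding form_holomorphic_def
proof (intro conjI ballI)
  fix \<kappa> assume "\<kappa> \<in> \<Omega>"
  then have "bounded_sesquilinear H (s \<kappa>)" using s unfolding form_holomorphic_def by blast
  then show "bounded_sesquilinear H (\<lambda>u v. s \<kappa> u (T v) + b u v)"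
    by (rule bounded_sesquilinear_add[OF bounded_sesquilinear_comp[OF _ T] b])
next
  fix \<kappa>\<^sub>0 assume "\<kappa>\<^sub>0 \<in> \<Omega>"
  then obtain d where d: "bounded_sesquilinear H d" "\<forall>e>0. \<exists>\<delta>>0. \<forall>\<kappa>\<in>\<Omega>. cmod (\<kappa> - \<kappa>\<^sub>0) < \<delta> \<longrightarrow>
      (\<forall>u\<in>carr. \<forall>v\<in>carr.
        cmod (s \<kappa> u v - s \<kappa>\<^sub>0 u v - (\<kappa> - \<kappa>\<^sub>0) * d u v) \<le> e * cmod (\<kappa> - \<kappa>\<^sub>0) * nrm u * nrm v)"
    using s unfolding form_holomorphic_def by blast
  obtain C where C: "C > 0" "\<And>x. x \<in> carr \<Longrightarrow> nrm (T x) \<le> C * nrm x" using op_bound[OF T] by blast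
  show "\<exists>d. bounded_sesquilinear H d \<and> (\<forall>e>0. \<exists>\<delta>>0. \<forall>\<kappa>\<in>\<Omega>. cmod (\<kappa> - \<kappa>\<^sub>0) < \<delta> \<longrightarrow>
      (\<forall>u\<in>carr. \<forall>v\<in>carr.
        cmod (s \<kappa> u (T v) + b u v - (s \<kappa>\<^sub>0 u (T v) + b u v) - (\<kappa> - \<kappa>\<^sub>0) * d u v) \<le> e * cmod (\<kappa> - \<kappa>\<^sub>0) * nrm u * nrm v))"
  proof (intro exI[of _ "\<lambda>u v. d u (T v)"] conjI allI impI)
    show "bounded_sesquilinear H (\<lambda>u v. d u (T v))" by (rule bounded_sesquilinear_comp[OF d(1) T])
    fix e :: real assume "e > 0"
    then obtain \<delta> where \<delta>: "\<delta> > 0" "\<And>\<kappa> u v. \<kappa> \<in> \<Omega> \<Longrightarrow> cmod (\<kappa> - \<kappa>\<^sub>0) < \<delta> \<Longrightarrow> u \<in> carr \<Longrightarrow> v \<in> carr \<Longrightarrow>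
        cmod (s \<kappa> u v - s \<kappa>\<^sub>0 u v - (\<kappa> - \<kappa>\<^sub>0) * d u v) \<le> e / C * cmod (\<kappa> - \<kappa>\<^sub>0) * nrm u * nrm v"
      using d(2)[rule_format, OF divide_pos_pos[OF \<open>e > 0\<close> C(1)]] by blast
    show "\<exists>\<delta>>0. \<forall>\<kappa>\<in>\<Omega>. cmod (\<kappa> - \<kappa>\<^sub>0) < \<delta> \<longrightarrow> (\<forall>u\<in>carr. \<forall>v\<in>carr.
        cmod (s \<kappa> u (T v) + b u v - (s \<kappa>\<^sub>0 u (T v) + b u v) - (\<kappa> - \<kappa>\<^sub>0) * d u (T v)) \<le> e * cmod (\<kappa> - \<kappa>\<^sub>0) * nrm u * nrm v)"
    proof (intro exI[of _ \<delta>] conjI ballI impI \<delta>(1))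
      fix \<kappa> u v assume *: "\<kappa> \<in> \<Omega>" "cmod (\<kappa> - \<kappa>\<^sub>0) < \<delta>" "u \<in> carr" "v \<in> carr"
      have "cmod (s \<kappa> u (T v) - s \<kappa>\<^sub>0 u (T v) - (\<kappa> - \<kappa>\<^sub>0) * d u (T v)) \<le> e / C * cmod (\<kappa> - \<kappa>\<^sub>0) * nrm u * nrm (T v)"
        by (rule \<delta>(2)) (use * bounded_opD(1)[OF T] in auto)
      also have "\<dots> \<le> e / C * cmod (\<kappa> - \<kappa>\<^sub>0) * nrm u * (C * nrm v)"
        using * C \<open>e > 0\<close> by (intro mult_left_mono) auto
      also have "\<dots> = e * cmod (\<kappa> - \<kappa>\<^sub>0) * nrm u * nrm v" using C(1) by simp
      finally show "cmod (s \<kappa> u (T v) + b u v - (s \<kappa>\<^sub>0 u (T v) + b u v) - (\<kappa> - \<kappa>\<^sub>0) * d u (T v))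
          \<le> e * cmod (\<kappa> - \<kappa>\<^sub>0) * nrm u * nrm v" by simp
    qed
  qed
qed

text \<open>Differentiating \<open>s \<kappa> (u \<kappa>) v = f v\<close> suggests the derivative
  \<open>- y\<close> at \<open>k\<close>, where \<open>s k y v = d (u k) v\<close>. The inf-sup
  bound at the single point \<open>k\<close> controls both the continuity of \<open>u\<close> and
  the remainder.\<close>

theorem holomorphic_solution:
  assumes s: "form_holomorphic H \<Omega> s" and op: "open \<Omega>"
    and sol: "\<And>\<kappa>. \<kappa> \<in> \<Omega> \<Longrightarrow> solvable H (s \<kappa>)" and bb: "\<And>\<kappa>. \<kappa> \<in> \<Omega> \<Longrightarrow> \<exists>C>0. bounded_below H (s \<kappa>) C"
    and u: "\<And>\<kappa>. \<kappa> \<in> \<Omega> \<Longrightarrow> u \<kappa> \<in> carr" "\<And>\<kappa> v. \<kappa> \<in> \<Omega> \<Longrightarrow> v \<in> carr \<Longrightarrow> s \<kappa> (u \<kappa>) v = f v"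
    and l: "bounded_functional H l"
  shows "(\<lambda>\<kappa>. l (u \<kappa>)) holomorphic_on \<Omega>"
proof -
  have "\<exists>D. ((\<lambda>\<kappa>. l (u \<kappa>)) has_field_derivative D) (at k)" if k: "k \<in> \<Omega>" for k
  proof -
    have sq: "sesquilinear_on carr (s \<kappa>)" if "\<kappa> \<in> \<Omega>" for \<kappa>
      using s that unfolding form_holomorphic_def bounded_sesquilinear_def by blast
    obtain C where C: "C > 0" "bounded_below H (s k) C" using bb[OF k] by blast
    obtain L where L: "L > 0" "\<And>x. x \<in> carr \<Longrightarrow> cmod (l x) \<le> L * nrm x"
      using functional_bound[OF l] by blast
    obtain d where d: "bounded_sesquilinear H d" "\<forall>e>0. \<exists>\<delta>>0. \<forall>\<kappa>\<in>\<Omega>. cmod (\<kappa> - k) < \<delta> \<longrightarrow>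
        (\<forall>u\<in>carr. \<forall>v\<in>carr.
          cmod (s \<kappa> u v - s k u v - (\<kappa> - k) * d u v) \<le> e * cmod (\<kappa> - k) * nrm u * nrm v)"
      using s k unfolding form_holomorphic_def by blast
    obtain D where D: "D > 0" "\<And>x y. x \<in> carr \<Longrightarrow> y \<in> carr \<Longrightarrow> cmod (d x y) \<le> D * nrm x * nrm y"
      using form_bound[OF d(1)] by blast
    have sd: "sesquilinear_on carr d" using d(1) unfolding bounded_sesquilinear_def by blast
    define u0 where "u0 = u k"
    have u0: "u0 \<in> carr" using u(1)[OF k] by (simp add: u0_def)
    have "bounded_functional H (\<lambda>v. cnj (d u0 v))"
      using u0 D(2)[OF u0] form_add_right[OF subspace_carr sd] form_scale_right[OF subspace_carr sd]
      by (intro bounded_functionalI[where C = "D * nrm u0"]) auto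
    then have "\<exists>y\<in>carr. \<forall>v\<in>carr. s k y v = cnj (cnj (d u0 v))"
      using sol[OF k] unfolding solvable_def by blast
    then obtain y where y: "y \<in> carr" "\<And>v. v \<in> carr \<Longrightarrow> s k y v = d u0 v" by auto
    have cont: "\<exists>\<delta>>0. \<forall>\<kappa>\<in>\<Omega>. cmod (\<kappa> - k) < \<delta> \<longrightarrow> nrm (u \<kappa> - u0) \<le> e * nrm u0 \<and> nrm (u \<kappa>) \<le> 2 * nrm u0"
      if e: "e > 0" for e
    proof -
      \<comment> \<open>\<open>C * e1 \<le> 1/2\<close> lets the term with
        \<open>nrm (u \<kappa>)\<close> be absorbed on the left, whence the factor 2;
        \<open>2 * (C * e1) \<le> e\<close> then gives the continuity estimate.\<close>
      define e1 where "e1 = min (1 / (2 * C)) (e / (2 * C))"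
      have e1: "e1 > 0" "C * e1 \<le> 1/2" "2 * (C * e1) \<le> e"
        using e C by (auto simp: e1_def min_def field_simps)
      obtain \<delta> where \<delta>: "\<delta> > 0" "\<And>\<kappa> u v. \<kappa> \<in> \<Omega> \<Longrightarrow> cmod (\<kappa> - k) < \<delta> \<Longrightarrow> u \<in> carr \<Longrightarrow> v \<in> carr \<Longrightarrow>
        cmod (s \<kappa> u v - s k u v) \<le> e1 * nrm u * nrm v"
        using form_holomorphic_continuous[OF s k e1(1)] by blast
      have "nrm (u \<kappa> - u0) \<le> e * nrm u0 \<and> nrm (u \<kappa>) \<le> 2 * nrm u0" if \<kappa>: "\<kappa> \<in> \<Omega>" "cmod (\<kappa> - k) < \<delta>" for \<kappa>
      proof -
        have uk: "u \<kappa> \<in> carr" using u(1) \<kappa> by blast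
        have "nrm (u \<kappa> - u0) \<le> C * (e1 * nrm (u \<kappa>))"
        proof (rule bounded_belowD[OF C(2)])
          fix v assume v: "v \<in> carr"
          have "s k (u \<kappa> - u0) v = s k (u \<kappa>) v - s \<kappa> (u \<kappa>) v"
            using form_diff_left[OF subspace_carr sq[OF k] uk u0 v] u(2)[OF k v] u(2)[OF \<kappa>(1) v] by (simp add: u0_def)
          then show "cmod (s k (u \<kappa> - u0) v) \<le> e1 * nrm (u \<kappa>) * nrm v"
            using \<delta>(2)[OF \<kappa> uk v] by (simp add: norm_minus_commute)
        qed (use uk u0 e1 in auto)
        then have 1: "nrm (u \<kappa> - u0) \<le> (C * e1) * nrm (u \<kappa>)" by (simp add: mult.assoc)
        also have "\<dots> \<le> 1/2 * nrm (u \<kappa>)" using e1(2) uk by (intro mult_right_mono) auto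
        finally have "nrm (u \<kappa>) \<le> nrm u0 + 1/2 * nrm (u \<kappa>)"
          using nrm_triangle[of "u \<kappa> - u0" u0] uk u0 by simp
        then have 2: "nrm (u \<kappa>) \<le> 2 * nrm u0" by simp
        have "nrm (u \<kappa> - u0) \<le> (C * e1) * (2 * nrm u0)"
          using order_trans[OF 1 mult_left_mono[OF 2, of "C * e1"]] C(1) e1(1) by simp
        also have "\<dots> = 2 * (C * e1) * nrm u0" by simp
        also have "\<dots> \<le> e * nrm u0" using e1(3) u0 by (intro mult_right_mono) auto
        finally show ?thesis using 2 by blast
      qed
      then show ?thesis using \<delta>(1) by blast
    qed
    have "((\<lambda>\<kappa>. l (u \<kappa>)) has_field_derivative - l y) (at k)"
      unfolding has_field_derivative_def has_derivative_at_alt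
    proof (intro conjI allI impI)
      show "bounded_linear ((*) (- l y))" by (rule bounded_linear_mult_right)
      fix e :: real assume e: "e > 0"
      \<comment> \<open>Collects the constants of the final estimate; \<open>nrm u0 + 1\<close>
        keeps it positive when \<open>u0 = 0\<close>.\<close>
      define K where "K = L * C * (D + 2) * (nrm u0 + 1)"
      have K: "K > 0" unfolding K_def using L C D u0 by (intro mult_pos_pos) (auto simp: add_nonneg_pos)
      define e2 where "e2 = e / K"
      have e2: "e2 > 0" using e K by (simp add: e2_def)
      obtain \<delta>1 where \<delta>1: "\<delta>1 > 0" "\<And>\<kappa>. \<kappa> \<in> \<Omega> \<Longrightarrow> cmod (\<kappa> - k) < \<delta>1 \<Longrightarrow> nrm (u \<kappa> - u0) \<le> e2 * nrm u0"
          "\<And>\<kappa>. \<kappa> \<in> \<Omega> \<Longrightarrow> cmod (\<kappa> - k) < \<delta>1 \<Longrightarrow> nrm (u \<kappa>) \<le> 2 * nrm u0"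
        using cont[OF e2] by blast
      obtain \<delta>2 where \<delta>2: "\<delta>2 > 0" "\<And>\<kappa> u v. \<kappa> \<in> \<Omega> \<Longrightarrow> cmod (\<kappa> - k) < \<delta>2 \<Longrightarrow> u \<in> carr \<Longrightarrow> v \<in> carr \<Longrightarrow>
          cmod (s \<kappa> u v - s k u v - (\<kappa> - k) * d u v) \<le> e2 * cmod (\<kappa> - k) * nrm u * nrm v"
        using d(2)[rule_format, OF e2] by blast
      obtain \<delta>3 where \<delta>3: "\<delta>3 > 0" "ball k \<delta>3 \<subseteq> \<Omega>" using op k openE by blast
      have "cmod (l (u \<kappa>) - l (u k) - - l y * (\<kappa> - k)) \<le> e * cmod (\<kappa> - k)"
        if "cmod (\<kappa> - k) < min \<delta>1 (min \<delta>2 \<delta>3)" for \<kappa>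
      proof -
        have \<kappa>: "\<kappa> \<in> \<Omega>" "cmod (\<kappa> - k) < \<delta>1" "cmod (\<kappa> - k) < \<delta>2"
          using that \<delta>3(2) by (auto simp: dist_norm norm_minus_commute subset_iff)
        have uk: "u \<kappa> \<in> carr" using u(1) \<kappa> by blast
        \<comment> \<open>The first-order Taylor remainder of \<open>u\<close> at \<open>k\<close>,
          the expected derivative being \<open>- y\<close>.\<close>
        define w where "w = u \<kappa> - u0 + (\<kappa> - k) *\<^sub>C y"
        have wc: "w \<in> carr" using uk u0 y by (simp add: w_def)
        define t where "t = cmod (\<kappa> - k)"
        have t0: "t \<ge> 0" by (simp add: t_def)
        define m where "m = t * (D * (e2 * nrm u0) + e2 * (2 * nrm u0))"
        have m: "m \<ge> 0" unfolding m_def using D(1) e2 u0 t0 by (intro mult_nonneg_nonneg add_nonneg_nonneg) auto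
        have "nrm w \<le> C * m"
        proof (rule bounded_belowD[OF C(2) wc m])
          fix v assume v: "v \<in> carr"
          have "s k w v = s k (u \<kappa>) v - s k u0 v + (\<kappa> - k) * d u0 v"
            unfolding w_def using uk u0 y v
            by (simp add: form_add_left[OF subspace_carr sq[OF k]] form_diff_left[OF subspace_carr sq[OF k]]
               form_scale_left[OF subspace_carr sq[OF k]])
          \<comment> \<open>The right-hand side \<open>f v\<close> is the same at both parameters.
            What is left is the remainder of the form and its derivative applied to
            \<open>u \<kappa> - u0\<close>, both of higher order.\<close>
          also have "\<dots> = - (s \<kappa> (u \<kappa>) v - s k (u \<kappa>) v - (\<kappa> - k) * d (u \<kappa>) v) - (\<kappa> - k) * d (u \<kappa> - u0) v"
            unfolding form_diff_left[OF subspace_carr sd uk u0 v]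
            using u(2)[OF k v] u(2)[OF \<kappa>(1) v] by (simp add: u0_def algebra_simps)
          finally have "cmod (s k w v) \<le> cmod (s \<kappa> (u \<kappa>) v - s k (u \<kappa>) v - (\<kappa> - k) * d (u \<kappa>) v) + cmod ((\<kappa> - k) * d (u \<kappa> - u0) v)"
            by (metis norm_minus_cancel norm_triangle_ineq4)
          also have "\<dots> \<le> e2 * t * nrm (u \<kappa>) * nrm v + t * (D * nrm (u \<kappa> - u0) * nrm v)"
            unfolding norm_mult t_def using uk u0 v \<kappa>
            by (intro add_mono \<delta>2(2) mult_left_mono D(2)) auto
          also have "\<dots> \<le> e2 * t * (2 * nrm u0) * nrm v + t * (D * (e2 * nrm u0) * nrm v)"
            using \<delta>1(2,3)[OF \<kappa>(1,2)] e2 t0 D(1) v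
            by (intro add_mono mult_right_mono mult_left_mono) auto
          also have "\<dots> = m * nrm v" by (simp add: m_def algebra_simps)
          finally show "cmod (s k w v) \<le> m * nrm v" .
        qed
        have "l (u \<kappa>) - l (u k) - - l y * (\<kappa> - k) = l w"
        proof -
          have "l w = l (u \<kappa> - u0) + l ((\<kappa> - k) *\<^sub>C y)"
            unfolding w_def using uk u0 y by (intro bounded_functionalD(1)[OF l]) auto
          also have "l (u \<kappa> - u0) = l (u \<kappa>) - l u0"
            using bounded_functionalD(1)[OF l, of "u \<kappa> - u0" u0] uk u0 by simp
          finally show ?thesis using bounded_functionalD(2)[OF l y(1)] by (simp add: u0_def)
        qed
        then have "cmod (l (u \<kappa>) - l (u k) - - l y * (\<kappa> - k)) \<le> L * (C * m)"
          using order_trans[OF L(2)[OF wc] mult_left_mono[OF \<open>nrm w \<le> C * m\<close>, of L]] L(1) by simp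
        also have "\<dots> = (L * C * (D + 2) * nrm u0) * e2 * t" by (simp add: m_def algebra_simps)
        also have "\<dots> \<le> K * e2 * t"
          unfolding K_def using L C D e2 t0 by (intro mult_right_mono mult_left_mono) auto
        also have "\<dots> = e * t" using K by (simp add: e2_def)
        finally show ?thesis by (simp add: t_def)
      qed
      then show "\<exists>\<delta>>0. \<forall>\<kappa>. cmod (\<kappa> - k) < \<delta> \<longrightarrow> cmod (l (u \<kappa>) - l (u k) - - l y * (\<kappa> - k)) \<le> e * cmod (\<kappa> - k)"
        using \<delta>1(1) \<delta>2(1) \<delta>3(1) by (intro exI[of _ "min \<delta>1 (min \<delta>2 \<delta>3)"]) auto
    qed
    then show ?thesis by blast
  qed
  then show ?thesis
    by (simp add: holomorphic_on_open[OF op])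
qed

end

section \<open>Galerkin approximation of holomorphic eigenvalue problems\<close>

text \<open>Each point needs one threshold valid on a whole ball around it; a finite subcover then
  leaves finitely many eventual properties.\<close>

lemma eventually_compact:
  fixes K :: "'a::heine_borel set"
  assumes K: "compact K" and ev: "\<And>x. x \<in> K \<Longrightarrow> \<exists>\<delta>>0. \<forall>\<^sub>F i in F. \<forall>y\<in>ball x \<delta>. P i y"
  shows "\<forall>\<^sub>F i in F. \<forall>y\<in>K. P i y"
proof -
  obtain \<delta> where \<delta>: "\<And>x. x \<in> K \<Longrightarrow> \<delta> x > 0" "\<And>x. x \<in> K \<Longrightarrow> \<forall>\<^sub>F i in F. \<forall>y\<in>ball x (\<delta> x). P i y"
    using ev by metis
  obtain D where D: "D \<subseteq> K" "finite D" "K \<subseteq> (\<Union>x\<in>D. ball x (\<delta> x))"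
  proof (rule compactE_image[OF K])
    show "K \<subseteq> (\<Union>x\<in>K. ball x (\<delta> x))" using \<delta>(1) by force
  qed auto
  have "\<forall>\<^sub>F i in F. \<forall>x\<in>D. \<forall>y\<in>ball x (\<delta> x). P i y"
    using D \<delta>(2) by (intro eventually_ball_finite) auto
  then show ?thesis by eventually_elim (use D(3) in blast)
qed

lemma bounded_functional_hsub:
  "bounded_functional H f \<Longrightarrow> W \<subseteq> hcarrier H \<Longrightarrow> bounded_functional (hsub H W) f"
  unfolding bounded_functional_def by (simp add: subset_iff) blast

lemma bounded_below_mono: "bounded_below H b C \<Longrightarrow> C \<le> C' \<Longrightarrow> bounded_below H b C'"
  unfolding bounded_below_def by (meson mult_right_mono order_trans)

context hilbert
begin

lemma coercive_solvable:
  assumes b: "bounded_sesquilinear H b" and g: "g > 0"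
    and co: "\<And>u. u \<in> carr \<Longrightarrow> g * (nrm u)\<^sup>2 \<le> Re (b u u)"
  shows "solvable H b" "bounded_below H b (1 / g)"
proof -
  show "solvable H b"
    unfolding solvable_def using Lax_Milgram[OF b g co] by metis
  show "bounded_below H b (1 / g)"
    unfolding bounded_below_def
  proof (intro ballI allI impI)
    fix u m assume u: "u \<in> carr" and m: "(0::real) \<le> m" "\<forall>v\<in>carr. cmod (b u v) \<le> m * nrm v"
    have "g * nrm u \<le> m" by (rule coercive_estimate[where b = b, OF co u]) (use m in auto)
    then show "nrm u \<le> 1 / g * m" using g by (simp add: field_simps)
  qed
qed

text \<open>The solution operator \<open>R\<close> of \<open>b\<close> is linear and bounded, so
  \<open>f\<close> composed with \<open>R\<close> is a bounded functional; its Riesz representative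
  solves the problem in the second argument.\<close>

lemma adjoint_solvable:
  assumes b: "bounded_sesquilinear H b" and sol: "solvable H b" and bb: "bounded_below H b C"
    and f: "bounded_functional H f"
  obtains z where "z \<in> carr" "\<And>u. u \<in> carr \<Longrightarrow> b u z = f u"
proof -
  have sb: "sesquilinear_on carr b" using b unfolding bounded_sesquilinear_def by blast
  note fs = form_add_left[OF subspace_carr sb] form_diff_left[OF subspace_carr sb] form_scale_left[OF subspace_carr sb]
  obtain A where A: "bounded_op H H A" "\<And>u v. u \<in> carr \<Longrightarrow> v \<in> carr \<Longrightarrow> ip (A u) v = b u v"
    using Riesz_form[OF b] by blast
  have "\<exists>u\<in>carr. \<forall>v\<in>carr. b u v = ip w v" if w: "w \<in> carr" for w
  proof -
    have "\<exists>u\<in>carr. \<forall>v\<in>carr. b u v = cnj (ip v w)"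
      using sol bounded_functional_ip[OF w] unfolding solvable_def by blast
    then show ?thesis using ip_commute[OF _ w] by auto
  qed
  then obtain R where R: "\<And>w. w \<in> carr \<Longrightarrow> R w \<in> carr" "\<And>w v. w \<in> carr \<Longrightarrow> v \<in> carr \<Longrightarrow> b (R w) v = ip w v"
    by metis
  have uniq: "u = w" if "u \<in> carr" "w \<in> carr" "\<And>v. v \<in> carr \<Longrightarrow> b u v = b w v" for u w
  proof -
    have "nrm (u - w) \<le> C * 0"
      by (rule bounded_belowD[OF bb]) (use that in \<open>auto simp: fs\<close>)
    then show ?thesis using nrm_pos[of "u - w"] that by fastforce
  qed
  obtain D where D: "D > 0" "\<And>x. x \<in> carr \<Longrightarrow> cmod (f x) \<le> D * nrm x" using functional_bound[OF f] by blast
  have "bounded_functional H (\<lambda>w. f (R w))"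
  proof (rule bounded_functionalI[where C = "D * C"])
    fix x y assume x: "x \<in> carr" and y: "y \<in> carr"
    have "R (x + y) = R x + R y"
      by (rule uniq) (use x y R in \<open>auto simp: fs ip_add_left\<close>)
    then show "f (R (x + y)) = f (R x) + f (R y)" using R x y by (simp add: bounded_functionalD(1)[OF f])
  next
    fix c x assume x: "x \<in> carr"
    have "R (c *\<^sub>C x) = c *\<^sub>C R x"
      by (rule uniq) (use x R in \<open>auto simp: fs ip_scale_left\<close>)
    then show "f (R (c *\<^sub>C x)) = c * f (R x)" using R x by (simp add: bounded_functionalD(2)[OF f])
  next
    fix x assume x: "x \<in> carr"
    have "nrm (R x) \<le> C * nrm x"
      by (rule bounded_belowD[OF bb]) (use x R Cauchy_Schwarz in auto)
    then have "D * nrm (R x) \<le> D * (C * nrm x)" using D(1) by simp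
    then show "cmod (f (R x)) \<le> D * C * nrm x" using D(2)[OF R(1)[OF x]] by (simp add: mult.assoc)
  qed
  then obtain z where z: "z \<in> carr" "\<And>w. w \<in> carr \<Longrightarrow> f (R w) = ip w z" by (rule Riesz) blast
  have "b u z = f u" if u: "u \<in> carr" for u
  proof -
    have Au: "A u \<in> carr" using bounded_opD(1)[OF A(1) u] .
    have "R (A u) = u" by (rule uniq) (use u Au R A(2) in auto)
    then show ?thesis using z(2)[OF Au] A(2)[OF u z(1)] by simp
  qed
  with z(1) show ?thesis using that by blast
qed

end

text \<open>\<open>T\<close> need not leave \<open>W i\<close> invariant, so it is replaced there by
  operators with small error relative to the norm of \<open>u\<close>. They must be onto
  \<open>W i\<close> in order to serve as the \<open>T\<close> of a \<open>fredholm_form\<close> on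
  \<open>W i\<close>.\<close>

definition discretizable :: "'a::complex_vector hspace \<Rightarrow> ('i \<Rightarrow> 'a set) \<Rightarrow> 'i filter \<Rightarrow> ('a \<Rightarrow> 'a) \<Rightarrow> bool"
  where "discretizable H W F T \<longleftrightarrow> (\<forall>e>0. \<forall>\<^sub>F i in F.
    \<exists>T'. bounded_op (hsub H (W i)) (hsub H (W i)) T' \<and> W i \<subseteq> T' ` W i \<and>
      (\<forall>u\<in>W i. hnorm H (T' u - T u) \<le> e * hnorm H u))"

text \<open>The index type and the filter are arbitrary, so that the joint limit in \<open>h\<close>
  and \<open>N\<close> is treated as a single one. The data of the weak coercivity may depend on
  \<kappa>.\<close>

locale galerkin = hilbert H for H :: "'a::complex_vector hspace" +
  fixes \<Lambda> :: "complex set" and s :: "complex \<Rightarrow> 'a \<Rightarrow> 'a \<Rightarrow> complex"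
    and W :: "'i \<Rightarrow> 'a set" and F :: "'i filter"
  assumes open_\<Lambda>: "open \<Lambda>" and connected_\<Lambda>: "connected \<Lambda>"
    and s: "form_holomorphic H \<Lambda> s"
    and W: "\<forall>\<^sub>F i in F. csubspace (W i) \<and> closedin (htop H) (W i)"
    and approx: "\<And>u e. u \<in> carr \<Longrightarrow> e > 0 \<Longrightarrow> \<forall>\<^sub>F i in F. \<exists>w\<in>W i. nrm (u - w) < e"
    and weakly_coercive: "\<And>\<kappa>. \<kappa> \<in> \<Lambda> \<Longrightarrow> \<exists>g T n A B. fredholm_form H (s \<kappa>) T n A B g \<and> discretizable H W F T"
begin

definition eig where "eig = {\<kappa> \<in> \<Lambda>. \<exists>u\<in>carr - {0}. \<forall>v\<in>carr. s \<kappa> u v = 0}"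

definition eigW where "eigW i = {\<kappa> \<in> \<Lambda>. \<exists>u\<in>W i - {0}. \<forall>v\<in>W i. s \<kappa> u v = 0}"

lemma s_bounded: "\<kappa> \<in> \<Lambda> \<Longrightarrow> bounded_sesquilinear H (s \<kappa>)"
  using s unfolding form_holomorphic_def by blast

lemma s_sesq: "\<kappa> \<in> \<Lambda> \<Longrightarrow> sesquilinear_on carr (s \<kappa>)"
  using s_bounded unfolding bounded_sesquilinear_def by blast

text \<open>Coercivity survives a small change of the form with half the constant. So
  \<open>T\<close>, \<open>A\<close>, \<open>B\<close> can be frozen on a ball, where only
  \<open>s \<kappa>\<close> depends on the parameter.\<close>

lemma fredholm_near:
  assumes k: "k \<in> \<Lambda>"
  obtains \<delta> g T n A B where "\<delta> > 0" "ball k \<delta> \<subseteq> \<Lambda>" "\<And>\<kappa>. \<kappa> \<in> ball k \<delta> \<Longrightarrow> fredholm_form H (s \<kappa>) T n A B g"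
    "discretizable H W F T"
proof -
  obtain g T n A B where fr: "fredholm_form H (s k) T n A B g" and T': "discretizable H W F T"
    using weakly_coercive[OF k] by blast
  interpret k: fredholm_form H "s k" T n A B g by (rule fr)
  note g = k.g and T = k.T k.T_surj and AB = k.A k.B and co = k.coercive
  obtain C where C: "C > 0" "\<And>x. x \<in> carr \<Longrightarrow> nrm (T x) \<le> C * nrm x" using op_bound[OF T(1)] by blast
  \<comment> \<open>\<open>C\<close> bounds \<open>T\<close>, so that in
    \<open>s \<kappa> u (T u)\<close> the change of the parameter costs at most
    \<open>g / 2\<close>.\<close>
  obtain \<delta>1 where \<delta>1: "\<delta>1 > 0" "\<And>\<kappa> u v. \<kappa> \<in> \<Lambda> \<Longrightarrow> cmod (\<kappa> - k) < \<delta>1 \<Longrightarrow> u \<in> carr \<Longrightarrow> v \<in> carr \<Longrightarrow>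
    cmod (s \<kappa> u v - s k u v) \<le> g / (2 * C) * nrm u * nrm v"
    using form_holomorphic_continuous[OF s k, of "g / (2 * C)"] g C(1) by auto
  obtain \<delta>2 where \<delta>2: "\<delta>2 > 0" "ball k \<delta>2 \<subseteq> \<Lambda>" using open_\<Lambda> k openE by blast
  show ?thesis
  proof (rule that[of "min \<delta>1 \<delta>2" T n A B "g / 2"])
    fix \<kappa> assume "\<kappa> \<in> ball k (min \<delta>1 \<delta>2)"
    then have \<kappa>: "\<kappa> \<in> \<Lambda>" "cmod (\<kappa> - k) < \<delta>1" using \<delta>2(2) by (auto simp: dist_norm norm_minus_commute)
    show "fredholm_form H (s \<kappa>) T n A B (g / 2)"
    proof
      fix u assume u: "u \<in> carr"
      have Tu: "T u \<in> carr" by (rule bounded_opD(1)[OF T(1) u])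
      have "cmod (s \<kappa> u (T u) - s k u (T u)) \<le> g / (2 * C) * nrm u * nrm (T u)" by (rule \<delta>1(2)[OF \<kappa> u Tu])
      also have "\<dots> \<le> g / (2 * C) * nrm u * (C * nrm u)" using g C u by (intro mult_left_mono) auto
      also have "\<dots> = g / 2 * (nrm u)\<^sup>2" using C(1) by (simp add: power2_eq_square)
      finally have "Re (s k u (T u) - s \<kappa> u (T u)) \<le> g / 2 * (nrm u)\<^sup>2"
        using complex_Re_le_cmod[of "s k u (T u) - s \<kappa> u (T u)"] by (simp add: norm_minus_commute)
      then show "g / 2 * (nrm u)\<^sup>2 \<le> Re (s \<kappa> u (T u) + (\<Sum>j<n. A j u * cnj (B j u)))"
        using co[OF u] by simp
    qed (use s_bounded[OF \<kappa>(1)] T AB g in auto)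
  next
    show "0 < min \<delta>1 \<delta>2" "ball k (min \<delta>1 \<delta>2) \<subseteq> \<Lambda>" using \<delta>1 \<delta>2 by auto
  qed (rule T')
qed

text \<open>On the ball the eigenvalues are the zeros of the holomorphic function \<open>d\<close>;
  by the identity theorem an accumulation point in the ball forces \<open>d\<close> to vanish
  throughout.\<close>

lemma eig_dichotomy:
  assumes k: "k \<in> \<Lambda>"
  obtains \<delta> where "\<delta> > 0" "ball k \<delta> \<subseteq> \<Lambda>" "ball k \<delta> \<subseteq> eig \<or> (\<forall>z\<in>ball k \<delta>. \<not> z islimpt eig)"
proof -
  obtain \<delta> g T n A B where \<delta>: "\<delta> > 0" "ball k \<delta> \<subseteq> \<Lambda>"
    and fr: "\<And>\<kappa>. \<kappa> \<in> ball k \<delta> \<Longrightarrow> fredholm_form H (s \<kappa>) T n A B g"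
    by (rule fredholm_near[OF k]) blast
  let ?a = "\<lambda>\<kappa> u v. s \<kappa> u (T v) + (\<Sum>j<n. A j u * cnj (B j v))"
  interpret k: fredholm_form H "s k" T n A B g using fr \<delta>(1) by simp
  have "\<exists>w. (\<forall>j<n. w j \<in> carr) \<and> (\<forall>j<n. \<forall>v\<in>carr. ?a \<kappa> (w j) v = cnj (B j v))" if "\<kappa> \<in> ball k \<delta>" for \<kappa>
  proof -
    interpret f: fredholm_form H "s \<kappa>" T n A B g by (rule fr[OF that])
    show ?thesis using f.solution_operator unfolding f.a_def by metis
  qed
  then obtain w where w: "\<And>\<kappa> j. \<kappa> \<in> ball k \<delta> \<Longrightarrow> j < n \<Longrightarrow> w \<kappa> j \<in> carr"
      "\<And>\<kappa> j v. \<kappa> \<in> ball k \<delta> \<Longrightarrow> j < n \<Longrightarrow> v \<in> carr \<Longrightarrow> ?a \<kappa> (w \<kappa> j) v = cnj (B j v)"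
    by metis
  \<comment> \<open>It depends on \<kappa> only through the solutions \<open>w \<kappa> j\<close> of
    coercive problems, which are holomorphic by \<open>holomorphic_solution\<close>.\<close>
  define d where "d = (\<lambda>\<kappa>. fdet n (\<lambda>i j. A i (w \<kappa> j)))"
  have zero: "\<kappa> \<in> eig \<longleftrightarrow> d \<kappa> = 0" if "\<kappa> \<in> ball k \<delta>" for \<kappa>
  proof -
    interpret f: fredholm_form H "s \<kappa>" T n A B g by (rule fr[OF that])
    show ?thesis
      unfolding eig_def d_def using f.kernel_iff_fdet[of "w \<kappa>"] w that \<delta>(2) unfolding f.a_def by blast
  qed
  have hol: "form_holomorphic H (ball k \<delta>) ?a"
  proof (rule form_holomorphic_comp_add[OF form_holomorphic_subset[OF s \<delta>(2)] k.T])
    show "bounded_sesquilinear H (\<lambda>u v. \<Sum>j<n. A j u * cnj (B j v))"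
      by (rule bounded_sesquilinear_sum, rule bounded_sesquilinear_rank1) (use k.A k.B in auto)
  qed
  have sol: "solvable H (?a \<kappa>)" "\<exists>C>0. bounded_below H (?a \<kappa>) C" if "\<kappa> \<in> ball k \<delta>" for \<kappa>
  proof -
    interpret f: fredholm_form H "s \<kappa>" T n A B g by (rule fr[OF that])
    show "solvable H (?a \<kappa>)" "\<exists>C>0. bounded_below H (?a \<kappa>) C"
      using coercive_solvable[OF f.a_bounded f.g f.a_coercive] f.g unfolding f.a_def
      by (auto intro!: exI[of _ "1 / g"])
  qed
  have "(\<lambda>\<kappa>. A i (w \<kappa> j)) holomorphic_on ball k \<delta>" if "i < n" "j < n" for i j
    by (rule holomorphic_solution[OF hol open_ball sol(1) sol(2), where f = "\<lambda>v. cnj (B j v)"])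
      (use w that k.A in auto)
  then have d: "d holomorphic_on ball k \<delta>" unfolding d_def by (rule fdet_holomorphic)
  have "ball k \<delta> \<subseteq> eig" if z: "z \<in> ball k \<delta>" "z islimpt eig" for z
  proof
    fix \<kappa> assume \<kappa>: "\<kappa> \<in> ball k \<delta>"
    have "z islimpt (eig \<inter> ball k \<delta>)"
      unfolding islimpt_def
    proof (intro allI impI)
      fix U assume "z \<in> U" "open U"
      then show "\<exists>y\<in>eig \<inter> ball k \<delta>. y \<in> U \<and> y \<noteq> z"
        using z unfolding islimpt_def by (metis IntD1 IntD2 IntI open_Int open_ball)
    qed
    then have "d \<kappa> = 0"
      using analytic_continuation[OF d open_ball connected_ball _ z(1) _ _ \<kappa>, of "eig \<inter> ball k \<delta>"] zero by blast
    then show "\<kappa> \<in> eig" using zero \<kappa> by blast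
  qed
  then show ?thesis using that[OF \<delta>] by blast
qed

text \<open>The accumulation points of \<open>eig\<close> form a relatively closed part of
  \<Lambda>. By \<open>eig_dichotomy\<close> it is relatively open too, as a ball inside
  \<open>eig\<close> consists of accumulation points. Connectedness leaves all or nothing, and
  \<open>k\<close> excludes the former.\<close>

lemma eig_no_limpt:
  assumes "k \<in> \<Lambda>" "k \<notin> eig" "z \<in> \<Lambda>"
  shows "\<not> z islimpt eig"
proof -
  let ?L = "{z. z islimpt eig}"
  have "open (\<Lambda> \<inter> ?L)"
  proof (rule openI)
    fix x assume x: "x \<in> \<Lambda> \<inter> ?L"
    obtain \<delta> where \<delta>: "\<delta> > 0" "ball x \<delta> \<subseteq> \<Lambda>" "ball x \<delta> \<subseteq> eig \<or> (\<forall>z\<in>ball x \<delta>. \<not> z islimpt eig)"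
      using x by (auto intro: eig_dichotomy[of x])
    then have "ball x \<delta> \<subseteq> eig" using x by auto
    then have "y islimpt eig" if "y \<in> ball x \<delta>" for y
      using islimpt_subset[of y "ball x \<delta>" eig] interior_limit_point[of y "ball x \<delta>"] that by (simp add: interior_open)
    then show "\<exists>e>0. ball x e \<subseteq> \<Lambda> \<inter> ?L" using \<delta> by blast
  qed
  moreover have "open (\<Lambda> \<inter> - ?L)" using open_\<Lambda> closed_limpts[of eig] by (intro open_Int) auto
  moreover have "\<not> k islimpt eig"
  proof
    assume "k islimpt eig"
    moreover obtain \<delta> where \<delta>: "\<delta> > 0" "ball k \<delta> \<subseteq> \<Lambda>" "ball k \<delta> \<subseteq> eig \<or> (\<forall>z\<in>ball k \<delta>. \<not> z islimpt eig)"
      by (rule eig_dichotomy[OF assms(1)])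
    moreover have "k \<in> ball k \<delta>" using \<delta>(1) by simp
    ultimately show False using assms(2) by blast
  qed
  ultimately show ?thesis
    using connectedD[OF connected_\<Lambda>, of "\<Lambda> \<inter> ?L" "\<Lambda> \<inter> - ?L"] assms by blast
qed

text \<open>The \<open>W i\<close> are closed subspaces only eventually, in the application for
  \<open>h > 0\<close>. Discrete arguments pass through this reduction to a single good
  index.\<close>

lemma eventually_W:
  assumes "\<And>i. csubspace (W i) \<Longrightarrow> closedin (htop H) (W i) \<Longrightarrow> W i \<subseteq> carr \<Longrightarrow> hilbert (hsub H (W i)) \<Longrightarrow> P i \<Longrightarrow> Q i"
    and "\<forall>\<^sub>F i in F. P i"
  shows "\<forall>\<^sub>F i in F. Q i"
  using assms(2) W
proof eventually_elim
  case (elim i)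
  have "W i \<subseteq> carr" using elim closedin_iff by blast
  moreover have "hilbert (hsub H (W i))" using hilbert_hsub elim by unfold_locales blast
  ultimately show ?case using assms(1) elim by blast
qed

text \<open>With \<open>s \<kappa> u (Z u) = (\<Sum>j<n. A j u * cnj (B j u))\<close>, the form \<open>s \<kappa> u (T u + Z u)\<close> is coercive,
  and the finite-rank operator \<open>Z\<close> can be approximated by maps into the discrete spaces.\<close>

lemma discrete_stability:
  assumes k: "k \<in> \<Lambda>" "k \<notin> eig"
  obtains \<delta> C where "\<delta> > 0" "C > 0" "ball k \<delta> \<subseteq> \<Lambda>"
    "\<forall>\<^sub>F i in F. \<forall>\<kappa>\<in>ball k \<delta>. bounded_below (hsub H (W i)) (s \<kappa>) C"
proof -
  obtain \<delta>0 g T n A B where \<delta>0: "\<delta>0 > 0" "ball k \<delta>0 \<subseteq> \<Lambda>"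
    and fr: "\<And>\<kappa>. \<kappa> \<in> ball k \<delta>0 \<Longrightarrow> fredholm_form H (s \<kappa>) T n A B g"
    and T': "discretizable H W F T"
    by (rule fredholm_near[OF k(1)]) blast
  interpret k: fredholm_form H "s k" T n A B g using fr \<delta>0(1) by simp
  have inj: "u = 0" if "u \<in> carr" "\<And>v. v \<in> carr \<Longrightarrow> s k u v = 0" for u
    using k that unfolding eig_def by blast
  obtain C0 where C0: "solvable H (s k)" "bounded_below H (s k) C0"
    using k.fredholm_alternative[OF inj] by blast
  \<comment> \<open>\<open>z j\<close> represents \<open>A j\<close> through the second argument of
    \<open>s k\<close>, hence the adjoint problem. This is where \<open>k\<close> has to be
    regular.\<close>
  have "\<exists>z\<in>carr. \<forall>u\<in>carr. s k u z = A j u" if "j < n" for j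
    using adjoint_solvable[OF s_bounded[OF k(1)] C0 k.A[OF that]] by metis
  then obtain z where z: "\<And>j. j < n \<Longrightarrow> z j \<in> carr" "\<And>j u. j < n \<Longrightarrow> u \<in> carr \<Longrightarrow> s k u (z j) = A j u"
    by metis
  have "\<exists>D>0. \<forall>x\<in>carr. cmod (B j x) \<le> D * nrm x" if "j < n" for j using functional_bound[OF k.B[OF that]] by metis
  then obtain D where D: "\<And>j. j < n \<Longrightarrow> D j > 0" "\<And>j x. j < n \<Longrightarrow> x \<in> carr \<Longrightarrow> cmod (B j x) \<le> D j * nrm x"
    by metis
  obtain CT where CT: "CT > 0" "\<And>x. x \<in> carr \<Longrightarrow> nrm (T x) \<le> CT * nrm x" using op_bound[OF k.T] by blast
  obtain Cs where Cs: "Cs > 0" "\<And>x y. x \<in> carr \<Longrightarrow> y \<in> carr \<Longrightarrow> cmod (s k x y) \<le> Cs * nrm x * nrm y"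
    using form_bound[OF s_bounded[OF k(1)]] by blast
  define S where "S = 1 + (\<Sum>j<n. D j)"
  have S: "S > 0" unfolding S_def using D(1) by (intro add_pos_nonneg sum_nonneg) (auto simp: less_imp_le)
  \<comment> \<open>Makes \<open>Cs * (e * S) = g / 4\<close>: passing from \<open>v0\<close> to the
    discrete \<open>v\<close> costs a quarter of \<open>g\<close>, passing from \<open>k\<close> to
    \<kappa> another quarter, and \<open>g / 2\<close> is left.\<close>
  define e where "e = g / (4 * Cs * S)"
  have e: "e > 0" using k.g Cs(1) S by (simp add: e_def)
  \<comment> \<open>Gives \<open>nrm v \<le> Cv * nrm u\<close>; the summands come from
    \<open>T\<close>, from the vectors \<open>z j\<close>, and from the discretization
    error.\<close>
  define Cv where "Cv = CT + (\<Sum>j<n. D j * nrm (z j)) + e * S"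
  have Cv: "Cv > 0" unfolding Cv_def using CT(1) D(1) z(1) e S
    by (intro add_pos_pos add_pos_nonneg sum_nonneg) (auto simp: less_imp_le)
  obtain \<delta>1 where \<delta>1: "\<delta>1 > 0" "\<And>\<kappa> u v. \<kappa> \<in> \<Lambda> \<Longrightarrow> cmod (\<kappa> - k) < \<delta>1 \<Longrightarrow> u \<in> carr \<Longrightarrow> v \<in> carr \<Longrightarrow>
    cmod (s \<kappa> u v - s k u v) \<le> g / (4 * Cv) * nrm u * nrm v"
    using form_holomorphic_continuous[OF s k(1), of "g / (4 * Cv)"] k.g Cv by auto
  have "\<forall>\<^sub>F i in F. \<forall>j\<in>{..<n}. \<exists>w\<in>W i. nrm (z j - w) < e"
    using approx z(1) e by (intro eventually_ball_finite) auto
  then have "\<forall>\<^sub>F i in F. (\<forall>j\<in>{..<n}. \<exists>w\<in>W i. nrm (z j - w) < e) \<and>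
      (\<exists>T'. bounded_op (hsub H (W i)) (hsub H (W i)) T' \<and> W i \<subseteq> T' ` W i \<and> (\<forall>u\<in>W i. nrm (T' u - T u) \<le> e * nrm u))"
    using T'[unfolded discretizable_def, rule_format, OF e] by eventually_elim blast
  then have "\<forall>\<^sub>F i in F. \<forall>\<kappa>\<in>ball k (min \<delta>0 \<delta>1). bounded_below (hsub H (W i)) (s \<kappa>) (2 * Cv / g)"
  proof (rule eventually_W[rotated], goal_cases)
    case (1 i)
    then have sub: "csubspace (W i)" and Wc: "W i \<subseteq> carr" by blast+
    obtain T' where T': "bounded_op (hsub H (W i)) (hsub H (W i)) T'" "\<And>u. u \<in> W i \<Longrightarrow> nrm (T' u - T u) \<le> e * nrm u"
      using 1 by blast
    have "\<forall>j\<in>{..<n}. \<exists>w\<in>W i. nrm (z j - w) < e" using 1 by blast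
    then obtain zh where zh: "\<And>j. j < n \<Longrightarrow> zh j \<in> W i" "\<And>j. j < n \<Longrightarrow> nrm (z j - zh j) < e"
      by (metis lessThan_iff)
    show ?case
      unfolding bounded_below_def
    proof (intro ballI allI impI)
      fix \<kappa> u m assume \<kappa>: "\<kappa> \<in> ball k (min \<delta>0 \<delta>1)" and "u \<in> hcarrier (hsub H (W i))" and m: "(0::real) \<le> m"
        and mm: "\<forall>v\<in>hcarrier (hsub H (W i)). cmod (s \<kappa> u v) \<le> m * hnorm (hsub H (W i)) v"
      then have uW: "u \<in> W i" by simp
      have u: "u \<in> carr" using uW Wc by blast
      have \<kappa>': "\<kappa> \<in> \<Lambda>" "cmod (\<kappa> - k) < \<delta>1" using \<kappa> \<delta>0(2) by (auto simp: dist_norm norm_minus_commute)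
      define v where "v = T' u + (\<Sum>j<n. B j u *\<^sub>C zh j)"
      define v0 where "v0 = T u + (\<Sum>j<n. B j u *\<^sub>C z j)"
      have T'u: "T' u \<in> W i" using bounded_opD(1)[OF T'(1)] uW by simp
      have vW: "v \<in> W i" unfolding v_def
        by (intro complex_vector.subspace_add[OF sub] complex_vector.subspace_sum[OF sub]
          complex_vector.subspace_scale[OF sub] T'u zh(1)) simp
      have Tu: "T u \<in> carr" by (rule bounded_opD(1)[OF k.T u])
      have vc: "v \<in> carr" using vW Wc by blast
      have sumc: "(\<Sum>j<n. B j u *\<^sub>C z j) \<in> carr" using z(1) by (intro mem_sum) auto
      have v0c: "v0 \<in> carr" unfolding v0_def using Tu sumc by blast
      have zhc: "zh j \<in> carr" if "j < n" for j using zh(1)[OF that] Wc by blast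
      have diff: "nrm (v - v0) \<le> e * S * nrm u"
      proof -
        have eq: "v - v0 = (T' u - T u) + (\<Sum>j<n. B j u *\<^sub>C (zh j - z j))"
          by (simp add: v_def v0_def complex_vector.scale_right_diff_distrib sum_subtractf)
        have m1: "T' u - T u \<in> carr" using T'u Tu Wc by blast
        have m2: "(\<Sum>j<n. B j u *\<^sub>C (zh j - z j)) \<in> carr" using zhc z(1) by (intro mem_sum mem_scale mem_diff) auto
        have "nrm (v - v0) \<le> nrm (T' u - T u) + nrm (\<Sum>j<n. B j u *\<^sub>C (zh j - z j))"
          unfolding eq by (rule nrm_triangle[OF m1 m2])
        also have "nrm (\<Sum>j<n. B j u *\<^sub>C (zh j - z j)) \<le> (\<Sum>j<n. nrm (B j u *\<^sub>C (zh j - z j)))"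
          by (rule nrm_sum) (use zhc z(1) in auto)
        also have "\<dots> \<le> (\<Sum>j<n. (D j * nrm u) * e)"
        proof (rule sum_mono)
          fix j assume "j \<in> {..<n}"
          then have j: "j < n" by simp
          have "nrm (B j u *\<^sub>C (zh j - z j)) = cmod (B j u) * nrm (zh j - z j)" using zhc[OF j] z(1)[OF j] by simp
          also have "\<dots> \<le> (D j * nrm u) * e"
            using D(2)[OF j u] zh(2)[OF j] D(1)[OF j] u zhc[OF j] z(1)[OF j] nrm_diff_commute[OF zhc[OF j] z(1)[OF j]]
            by (intro mult_mono) auto
          finally show "nrm (B j u *\<^sub>C (zh j - z j)) \<le> (D j * nrm u) * e" .
        qed
        also have "\<dots> = (\<Sum>j<n. D j) * (nrm u * e)" by (simp add: sum_distrib_right mult.assoc)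
        also have "nrm (T' u - T u) + (\<Sum>j<n. D j) * (nrm u * e) \<le> e * nrm u + (\<Sum>j<n. D j) * (nrm u * e)"
          using T'(2)[OF uW] by simp
        also have "\<dots> = e * S * nrm u" by (simp add: S_def algebra_simps)
        finally show ?thesis by simp
      qed
      have nv0: "nrm v0 \<le> (CT + (\<Sum>j<n. D j * nrm (z j))) * nrm u"
      proof -
        have "nrm v0 \<le> nrm (T u) + nrm (\<Sum>j<n. B j u *\<^sub>C z j)" unfolding v0_def by (rule nrm_triangle[OF Tu sumc])
        also have "nrm (\<Sum>j<n. B j u *\<^sub>C z j) \<le> (\<Sum>j<n. nrm (B j u *\<^sub>C z j))"
          by (rule nrm_sum) (use z(1) in auto)
        also have "\<dots> \<le> (\<Sum>j<n. (D j * nrm (z j)) * nrm u)"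
        proof (rule sum_mono)
          fix j assume "j \<in> {..<n}"
          then have j: "j < n" by simp
          show "nrm (B j u *\<^sub>C z j) \<le> (D j * nrm (z j)) * nrm u"
            using mult_right_mono[OF D(2)[OF j u], of "nrm (z j)"] z(1)[OF j] by (simp add: mult_ac)
        qed
        also have "\<dots> = (\<Sum>j<n. D j * nrm (z j)) * nrm u" by (simp add: sum_distrib_right)
        also have "nrm (T u) + \<dots> \<le> CT * nrm u + \<dots>" using CT(2)[OF u] by simp
        finally show ?thesis by (simp add: distrib_right)
      qed
      have "nrm v \<le> nrm (v - v0) + nrm v0" using nrm_triangle[of "v - v0" v0] vc v0c by simp
      then have nv: "nrm v \<le> Cv * nrm u" using diff nv0 by (simp add: Cv_def distrib_right)
      have "s k u v0 = s k u (T u) + (\<Sum>j<n. A j u * cnj (B j u))"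
      proof -
        note sk = s_sesq[OF k(1)]
        have "s k u v0 = s k u (T u) + s k u (\<Sum>j<n. B j u *\<^sub>C z j)"
          unfolding v0_def by (rule form_add_right[OF subspace_carr sk Tu sumc u])
        also have "s k u (\<Sum>j<n. B j u *\<^sub>C z j) = (\<Sum>j<n. s k u (B j u *\<^sub>C z j))"
          by (rule form_sum_right[OF subspace_carr sk _ u]) (use z(1) in auto)
        also have "\<dots> = (\<Sum>j<n. A j u * cnj (B j u))"
          using z u by (intro sum.cong) (auto simp: form_scale_right[OF subspace_carr sk])
        finally show ?thesis .
      qed
      then have 1: "g * (nrm u)\<^sup>2 \<le> Re (s k u v0)" using k.coercive[OF u] by simp
      have "cmod (s k u (v - v0)) \<le> Cs * nrm u * (e * S * nrm u)"
        using order_trans[OF Cs(2)[OF u, of "v - v0"] mult_left_mono[OF diff, of "Cs * nrm u"]] vc v0c Cs(1) u by simp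
      also have "\<dots> = g / 4 * (nrm u)\<^sup>2" using Cs(1) S by (simp add: e_def power2_eq_square)
      finally have 2: "\<bar>Re (s k u v) - Re (s k u v0)\<bar> \<le> g / 4 * (nrm u)\<^sup>2"
        using abs_Re_le_cmod[of "s k u (v - v0)"] form_diff_right[OF subspace_carr s_sesq[OF k(1)] vc v0c u] by simp
      have "cmod (s \<kappa> u v - s k u v) \<le> g / (4 * Cv) * nrm u * (Cv * nrm u)"
        using order_trans[OF \<delta>1(2)[OF \<kappa>' u vc] mult_left_mono[OF nv, of "g / (4 * Cv) * nrm u"]] u Cv k.g by simp
      also have "\<dots> = g / 4 * (nrm u)\<^sup>2" using Cv by (simp add: power2_eq_square)
      finally have 3: "\<bar>Re (s \<kappa> u v) - Re (s k u v)\<bar> \<le> g / 4 * (nrm u)\<^sup>2"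
        using abs_Re_le_cmod[of "s \<kappa> u v - s k u v"] by simp
      have "g / 2 * (nrm u)\<^sup>2 \<le> Re (s \<kappa> u v)" using 1 2 3 by argo
      also have "\<dots> \<le> m * nrm v" using mm vW complex_Re_le_cmod[of "s \<kappa> u v"] by force
      also have "\<dots> \<le> m * (Cv * nrm u)" using nv m by (intro mult_left_mono)
      finally have *: "(g / 2 * nrm u) * nrm u \<le> (m * Cv) * nrm u" by (simp add: power2_eq_square mult.assoc)
      show "hnorm (hsub H (W i)) u \<le> 2 * Cv / g * m"
      proof (cases "u = 0")
        case False
        then have "g / 2 * nrm u \<le> m * Cv" using * nrm_pos[OF u] by simp
        then show ?thesis using k.g by (simp add: field_simps)
      qed (use m Cv k.g in simp)
    qed
  qed
  moreover have "ball k (min \<delta>0 \<delta>1) \<subseteq> \<Lambda>" using \<delta>0(2) by auto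
  ultimately show ?thesis using that[of "min \<delta>0 \<delta>1" "2 * Cv / g"] \<delta>0(1) \<delta>1(1) Cv k.g by simp
qed

text \<open>As \<open>W i\<close> may be infinite-dimensional, injectivity alone does not give
  solvability. But on \<open>W i\<close> the form with \<open>T'\<close> and the same
  \<open>A\<close>, \<open>B\<close> is again a \<open>fredholm_form\<close>, with
  \<open>g / 2\<close>, and the Fredholm alternative applies.\<close>

lemma discrete_solvable:
  assumes k: "k \<in> \<Lambda>"
  obtains \<delta> where "\<delta> > 0"
    "\<forall>\<^sub>F i in F. \<forall>\<kappa>\<in>ball k \<delta>. \<kappa> \<notin> eigW i \<longrightarrow>
      solvable (hsub H (W i)) (s \<kappa>) \<and> (\<exists>C>0. bounded_below (hsub H (W i)) (s \<kappa>) C)"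
proof -
  obtain \<delta>0 g T n A B where \<delta>0: "\<delta>0 > 0" "ball k \<delta>0 \<subseteq> \<Lambda>"
    and fr: "\<And>\<kappa>. \<kappa> \<in> ball k \<delta>0 \<Longrightarrow> fredholm_form H (s \<kappa>) T n A B g"
    and T': "discretizable H W F T"
    by (rule fredholm_near[OF k(1)]) blast
  interpret k: fredholm_form H "s k" T n A B g using fr \<delta>0(1) by simp
  obtain Cs where Cs: "Cs > 0" "\<And>x y. x \<in> carr \<Longrightarrow> y \<in> carr \<Longrightarrow> cmod (s k x y) \<le> Cs * nrm x * nrm y"
    using form_bound[OF s_bounded[OF k(1)]] by blast
  obtain \<delta>1 where \<delta>1: "\<delta>1 > 0" "\<And>\<kappa> u v. \<kappa> \<in> \<Lambda> \<Longrightarrow> cmod (\<kappa> - k) < \<delta>1 \<Longrightarrow> u \<in> carr \<Longrightarrow> v \<in> carr \<Longrightarrow>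
    cmod (s \<kappa> u v - s k u v) \<le> 1 * nrm u * nrm v"
    using form_holomorphic_continuous[OF s k(1), of 1] by auto
  \<comment> \<open>Near \<open>k\<close> the form \<open>s \<kappa>\<close> is bounded by
    \<open>Cs + 1\<close>, the 1 being the allowed deviation from \<open>s k\<close>. Replacing
    \<open>T\<close> by \<open>T'\<close> then uses up half of \<open>g\<close>.\<close>
  define e where "e = g / (2 * (Cs + 1))"
  have e: "e > 0" using k.g Cs(1) by (simp add: e_def)
  have "\<forall>\<^sub>F i in F. \<forall>\<kappa>\<in>ball k (min \<delta>0 \<delta>1). \<kappa> \<notin> eigW i \<longrightarrow>
      solvable (hsub H (W i)) (s \<kappa>) \<and> (\<exists>C>0. bounded_below (hsub H (W i)) (s \<kappa>) C)"
  proof (rule eventually_W[OF _ T'[unfolded discretizable_def, rule_format, OF e]], goal_cases)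
    case (1 i)
    then have sub: "csubspace (W i)" and Wc: "W i \<subseteq> carr" and hW: "hilbert (hsub H (W i))" by blast+
    obtain T' where T': "bounded_op (hsub H (W i)) (hsub H (W i)) T'" "W i \<subseteq> T' ` W i"
      "\<And>u. u \<in> W i \<Longrightarrow> nrm (T' u - T u) \<le> e * nrm u"
      using 1 by blast
    show ?case
    proof (intro ballI impI)
      fix \<kappa> assume \<kappa>: "\<kappa> \<in> ball k (min \<delta>0 \<delta>1)" and ne: "\<kappa> \<notin> eigW i"
      have \<kappa>': "\<kappa> \<in> \<Lambda>" "cmod (\<kappa> - k) < \<delta>1" "\<kappa> \<in> ball k \<delta>0" using \<kappa> \<delta>0(2) by (auto simp: dist_norm norm_minus_commute)
      interpret \<kappa>: fredholm_form H "s \<kappa>" T n A B g by (rule fr[OF \<kappa>'(3)])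
      interpret Wi: hilbert "hsub H (W i)" by (rule hW)
      interpret Wi: fredholm_form "hsub H (W i)" "s \<kappa>" T' n A B "g / 2"
      proof
        fix u assume "u \<in> hcarrier (hsub H (W i))"
        then have uW: "u \<in> W i" by simp
        have u: "u \<in> carr" using uW Wc by blast
        have T'u: "T' u \<in> carr" using bounded_opD(1)[OF T'(1)] uW Wc by auto
        have Tu: "T u \<in> carr" by (rule bounded_opD(1)[OF k.T u])
        have d: "T' u - T u \<in> carr" using T'u Tu by blast
        have "cmod (s \<kappa> u (T' u - T u)) \<le> cmod (s k u (T' u - T u)) + cmod (s \<kappa> u (T' u - T u) - s k u (T' u - T u))"
          using norm_triangle_ineq[of "s k u (T' u - T u)" "s \<kappa> u (T' u - T u) - s k u (T' u - T u)"] by simp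
        also have "\<dots> \<le> Cs * nrm u * nrm (T' u - T u) + 1 * nrm u * nrm (T' u - T u)"
          by (intro add_mono Cs(2) \<delta>1(2) u d \<kappa>')
        also have "\<dots> = ((Cs + 1) * nrm u) * nrm (T' u - T u)" by (simp add: algebra_simps)
        also have "\<dots> \<le> ((Cs + 1) * nrm u) * (e * nrm u)"
          using T'(3)[OF uW] Cs(1) u by (intro mult_left_mono) auto
        also have "\<dots> = ((Cs + 1) * e) * (nrm u)\<^sup>2" by (simp add: power2_eq_square)
        also have "(Cs + 1) * e = g / 2" unfolding e_def using Cs(1) by (simp add: divide_simps) (simp add: algebra_simps)?
        finally have "\<bar>Re (s \<kappa> u (T' u)) - Re (s \<kappa> u (T u))\<bar> \<le> g / 2 * (nrm u)\<^sup>2"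
          using abs_Re_le_cmod[of "s \<kappa> u (T' u - T u)"] form_diff_right[OF subspace_carr s_sesq[OF \<kappa>'(1)] T'u Tu u] by simp
        then show "g / 2 * (hnorm (hsub H (W i)) u)\<^sup>2 \<le> Re (s \<kappa> u (T' u) + (\<Sum>j<n. A j u * cnj (B j u)))"
          using \<kappa>.coercive[OF u] unfolding plus_complex.sel hnorm_hsub by linarith
      qed (use bounded_sesquilinear_hsub[OF s_bounded[OF \<kappa>'(1)] Wc] T' k.g
          bounded_functional_hsub[OF k.A Wc] bounded_functional_hsub[OF k.B Wc] in auto)
      have "u = 0" if "u \<in> hcarrier (hsub H (W i))" "\<And>v. v \<in> hcarrier (hsub H (W i)) \<Longrightarrow> s \<kappa> u v = 0" for u
        using ne \<kappa>'(1) that unfolding eigW_def by auto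
      from Wi.fredholm_alternative[OF this]
      show "solvable (hsub H (W i)) (s \<kappa>) \<and> (\<exists>C>0. bounded_below (hsub H (W i)) (s \<kappa>) C)" by blast
    qed
  qed
  then show ?thesis using that[of "min \<delta>0 \<delta>1"] \<delta>0(1) \<delta>1(1) by simp
qed

lemma not_eigW_if_bounded_below:
  assumes "bounded_below (hsub H (W i)) (s \<kappa>) C" "W i \<subseteq> carr"
  shows "\<kappa> \<notin> eigW i"
proof
  assume "\<kappa> \<in> eigW i"
  then obtain u where u: "u \<in> W i" "u \<noteq> 0" "\<forall>v\<in>W i. s \<kappa> u v = 0" unfolding eigW_def by blast
  have "hnorm (hsub H (W i)) u \<le> C * 0"
    by (rule bounded_belowD[OF assms(1)]) (use u in auto)
  then show False using nrm_pos[of u] u assms(2) by auto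
qed

lemma regular_compact:
  assumes K: "compact K" "K \<subseteq> \<Lambda>" "K \<inter> eig = {}"
  obtains C where "C > 0" "\<forall>\<^sub>F i in F. \<forall>\<kappa>\<in>K. bounded_below (hsub H (W i)) (s \<kappa>) C"
proof -
  have "\<exists>\<delta> C. \<delta> > 0 \<and> C > 0 \<and> (\<forall>\<^sub>F i in F. \<forall>\<kappa>\<in>ball k \<delta>. bounded_below (hsub H (W i)) (s \<kappa>) C)" if "k \<in> K" for k
  proof -
    have "k \<in> \<Lambda>" "k \<notin> eig" using that K by blast+
    then obtain \<delta> C where "\<delta> > 0" "C > 0" "ball k \<delta> \<subseteq> \<Lambda>"
      "\<forall>\<^sub>F i in F. \<forall>\<kappa>\<in>ball k \<delta>. bounded_below (hsub H (W i)) (s \<kappa>) C"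
      by (rule discrete_stability)
    then show ?thesis by blast
  qed
  then have "\<forall>k\<in>K. \<exists>\<delta> C. \<delta> > 0 \<and> C > 0 \<and> (\<forall>\<^sub>F i in F. \<forall>\<kappa>\<in>ball k \<delta>. bounded_below (hsub H (W i)) (s \<kappa>) C)"
    by blast
  from bchoice[OF this] obtain \<delta> where
    "\<forall>k\<in>K. \<exists>C. \<delta> k > 0 \<and> C > 0 \<and> (\<forall>\<^sub>F i in F. \<forall>\<kappa>\<in>ball k (\<delta> k). bounded_below (hsub H (W i)) (s \<kappa>) C)" ..
  from bchoice[OF this] obtain C where
    "\<forall>k\<in>K. \<delta> k > 0 \<and> C k > 0 \<and> (\<forall>\<^sub>F i in F. \<forall>\<kappa>\<in>ball k (\<delta> k). bounded_below (hsub H (W i)) (s \<kappa>) (C k))" ..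
  then have \<delta>: "\<And>k. k \<in> K \<Longrightarrow> \<delta> k > 0" and C: "\<And>k. k \<in> K \<Longrightarrow> C k > 0"
    and ev: "\<And>k. k \<in> K \<Longrightarrow> \<forall>\<^sub>F i in F. \<forall>\<kappa>\<in>ball k (\<delta> k). bounded_below (hsub H (W i)) (s \<kappa>) (C k)"
    by blast+
  obtain D where D: "D \<subseteq> K" "finite D" "K \<subseteq> (\<Union>x\<in>D. ball x (\<delta> x))"
  proof (rule compactE_image[OF K(1)])
    show "K \<subseteq> (\<Union>x\<in>K. ball x (\<delta> x))" using \<delta> by force
  qed auto
  \<comment> \<open>The sum dominates each of the finitely many constants; the 1 keeps
    \<open>E\<close> positive even if the subcover is empty.\<close>
  define E where "E = 1 + sum C D"
  have CE: "C x \<le> E" if "x \<in> D" for x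
    using member_le_sum[of x D C] that D C by (force simp: E_def less_imp_le)
  have "\<forall>\<^sub>F i in F. \<forall>x\<in>D. \<forall>\<kappa>\<in>ball x (\<delta> x). bounded_below (hsub H (W i)) (s \<kappa>) (C x)"
    using D ev by (intro eventually_ball_finite) auto
  then have "\<forall>\<^sub>F i in F. \<forall>\<kappa>\<in>K. bounded_below (hsub H (W i)) (s \<kappa>) E"
  proof eventually_elim
    case (elim i)
    show ?case
    proof
      fix \<kappa> assume "\<kappa> \<in> K"
      then obtain x where x: "x \<in> D" "\<kappa> \<in> ball x (\<delta> x)" using D(3) by blast
      then show "bounded_below (hsub H (W i)) (s \<kappa>) E"
        using bounded_below_mono[OF _ CE[OF x(1)]] elim by blast
    qed
  qed
  moreover have "E > 0" unfolding E_def using C D by (intro add_pos_nonneg sum_nonneg) (auto simp: less_imp_le)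
  ultimately show ?thesis using that by blast
qed

text \<open>If there were no discrete eigenvalue near \<open>k\<close>, the discrete solution operators would be
  holomorphic there and, by the maximum principle, bounded at \<open>k\<close> by their bound on a circle around it;
  but they blow up at \<open>k\<close>, as an approximation of the eigenvector shows.\<close>

lemma discrete_eigenvalue_near:
  assumes k: "k \<in> eig" and r: "r > 0" "cball k r \<subseteq> \<Lambda>" "cball k r \<inter> eig = {k}"
  shows "\<forall>\<^sub>F i in F. eigW i \<inter> ball k r \<noteq> {}"
proof -
  have kL: "k \<in> \<Lambda>" using k by (simp add: eig_def)
  obtain u0 where u0: "u0 \<in> carr" "u0 \<noteq> 0" "\<And>v. v \<in> carr \<Longrightarrow> s k u0 v = 0" using k unfolding eig_def by blast
  have n0: "nrm u0 > 0" by (rule nrm_pos[OF u0(1,2)])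
  obtain Cs where Cs: "Cs > 0" "\<And>x y. x \<in> carr \<Longrightarrow> y \<in> carr \<Longrightarrow> cmod (s k x y) \<le> Cs * nrm x * nrm y"
    using form_bound[OF s_bounded[OF kL]] by blast
  \<comment> \<open>With radius \<open>r / 2\<close> the closed disc stays inside the open ball of
    radius \<open>r\<close>, in which the discrete solutions are holomorphic.\<close>
  have sph: "sphere k (r / 2) \<subseteq> cball k r" "k \<notin> sphere k (r / 2)" using r(1) by auto
  have "sphere k (r / 2) \<inter> eig \<subseteq> {k}" using sph(1) unfolding r(3)[symmetric] by (rule Int_mono) simp
  with sph have "sphere k (r / 2) \<subseteq> \<Lambda>" "sphere k (r / 2) \<inter> eig = {}" using r(2) by auto
  then obtain C where C: "C > 0" "\<forall>\<^sub>F i in F. \<forall>\<kappa>\<in>sphere k (r / 2). bounded_below (hsub H (W i)) (s \<kappa>) C"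
    by (rule regular_compact[OF compact_sphere])
  have ev1: "\<forall>\<^sub>F i in F. \<forall>\<kappa>\<in>cball k r. \<kappa> \<notin> eigW i \<longrightarrow>
      solvable (hsub H (W i)) (s \<kappa>) \<and> (\<exists>C>0. bounded_below (hsub H (W i)) (s \<kappa>) C)"
  proof (rule eventually_compact[OF compact_cball])
    fix x assume "x \<in> cball k r"
    then have "x \<in> \<Lambda>" using r(2) by blast
    from discrete_solvable[OF this]
    show "\<exists>\<delta>>0. \<forall>\<^sub>F i in F. \<forall>\<kappa>\<in>ball x \<delta>. \<kappa> \<notin> eigW i \<longrightarrow>
      solvable (hsub H (W i)) (s \<kappa>) \<and> (\<exists>C>0. bounded_below (hsub H (W i)) (s \<kappa>) C)"
      by blast
  qed
  \<comment> \<open>The final estimate reads \<open>nrm u0 \<le> (C * Cs + 1) * \<eta>\<close>; this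
    choice makes the right side half of \<open>nrm u0\<close>, a contradiction.\<close>
  define \<eta> where "\<eta> = nrm u0 / (2 * (C * Cs + 1))"
  have \<eta>: "\<eta> > 0" using n0 C(1) Cs(1) by (simp add: \<eta>_def add_pos_pos)
  have ev2: "\<forall>\<^sub>F i in F. \<exists>w\<in>W i. nrm (u0 - w) < \<eta>" by (rule approx[OF u0(1) \<eta>])
  have "\<forall>\<^sub>F i in F. (\<forall>\<kappa>\<in>cball k r. \<kappa> \<notin> eigW i \<longrightarrow>
      solvable (hsub H (W i)) (s \<kappa>) \<and> (\<exists>C>0. bounded_below (hsub H (W i)) (s \<kappa>) C)) \<and>
      (\<exists>w\<in>W i. nrm (u0 - w) < \<eta>) \<and> (\<forall>\<kappa>\<in>sphere k (r / 2). bounded_below (hsub H (W i)) (s \<kappa>) C)"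
    using ev1 ev2 C(2) by eventually_elim blast
  then show ?thesis
  proof (rule eventually_W[rotated], goal_cases)
    case (1 i)
    then have Wc: "W i \<subseteq> carr" and hW: "hilbert (hsub H (W i))" by blast+
    interpret Wi: hilbert "hsub H (W i)" by (rule hW)
    obtain w where w: "w \<in> W i" "nrm (u0 - w) < \<eta>" using 1 by blast
    have wc: "w \<in> carr" using w Wc by blast
    show ?case
    proof
      assume none: "eigW i \<inter> ball k r = {}"
      have sol: "solvable (hsub H (W i)) (s \<kappa>)" "\<exists>C>0. bounded_below (hsub H (W i)) (s \<kappa>) C"
        if "\<kappa> \<in> ball k r" for \<kappa> using 1 none that by (auto simp: disjoint_iff)
      have bL: "ball k r \<subseteq> \<Lambda>" using r(2) by auto
      have "bounded_functional (hsub H (W i)) (\<lambda>v. cnj (s k w v))"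
        using form_add_right[OF subspace_carr s_sesq[OF kL]] form_scale_right[OF subspace_carr s_sesq[OF kL]] wc Wc Cs(2)[OF wc]
        by (intro bounded_functionalI[where C = "Cs * nrm w"]) (auto simp: subset_iff)
      then have "\<exists>u\<in>W i. \<forall>v\<in>W i. s \<kappa> u v = s k w v" if "\<kappa> \<in> ball k r" for \<kappa>
        using sol(1)[OF that] unfolding solvable_def by fastforce
      then obtain u where u: "\<And>\<kappa>. \<kappa> \<in> ball k r \<Longrightarrow> u \<kappa> \<in> W i" "\<And>\<kappa> v. \<kappa> \<in> ball k r \<Longrightarrow> v \<in> W i \<Longrightarrow> s \<kappa> (u \<kappa>) v = s k w v"
        by metis
      define h where "h = (\<lambda>\<kappa>. ip (u \<kappa>) w)"
      have l: "bounded_functional (hsub H (W i)) (\<lambda>x. ip x w)" using Wi.bounded_functional_ip[of w] w by simp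
      have "h holomorphic_on ball k r"
        unfolding h_def
        by (rule Wi.holomorphic_solution[OF form_holomorphic_hsub[OF form_holomorphic_subset[OF s bL] Wc] open_ball sol(1) sol(2) _ _ l])
          (use u in auto)
      then have hol: "h holomorphic_on cball k (r / 2)" by (rule holomorphic_on_subset) (use r(1) in auto)
      have bd: "cmod (h \<kappa>) \<le> C * (Cs * \<eta>) * nrm w" if "\<kappa> \<in> frontier (cball k (r / 2))" for \<kappa>
      proof -
        have \<kappa>: "\<kappa> \<in> sphere k (r / 2)" using that by (simp add: frontier_cball)
        then have \<kappa>b: "\<kappa> \<in> ball k r" using r(1) by auto
        have "hnorm (hsub H (W i)) (u \<kappa>) \<le> C * (Cs * \<eta>)"
        proof (rule bounded_belowD[of "hsub H (W i)" "s \<kappa>"])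
          fix v assume v: "v \<in> hcarrier (hsub H (W i))"
          then have vc: "v \<in> carr" using Wc by auto
          \<comment> \<open>\<open>u0\<close> is an eigenvector at \<open>k\<close>, so it may be
            subtracted freely: the right-hand side is as small as the distance of \<open>w\<close>
            to \<open>u0\<close>.\<close>
          have "s \<kappa> (u \<kappa>) v = s k (w - u0) v"
            using u(2)[OF \<kappa>b] v u0(3)[OF vc] form_diff_left[OF subspace_carr s_sesq[OF kL] wc u0(1) vc] by simp
          then have "cmod (s \<kappa> (u \<kappa>) v) \<le> Cs * nrm (w - u0) * nrm v" using Cs(2)[of "w - u0" v] wc u0(1) vc by simp
          also have "\<dots> \<le> Cs * \<eta> * nrm v"
            using w(2) Cs(1) vc nrm_diff_commute[OF wc u0(1)] by (intro mult_right_mono mult_left_mono) auto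
          finally show "cmod (s \<kappa> (u \<kappa>) v) \<le> Cs * \<eta> * hnorm (hsub H (W i)) v" by simp
        qed (use 1 \<kappa> u(1)[OF \<kappa>b] Cs(1) \<eta> in auto)
        moreover have "u \<kappa> \<in> carr" using u(1)[OF \<kappa>b] Wc by blast
        ultimately show ?thesis
          using order_trans[OF Cauchy_Schwarz[of "u \<kappa>" w] mult_right_mono[of "nrm (u \<kappa>)" "C * (Cs * \<eta>)" "nrm w"]] wc
          by (simp add: h_def)
      qed
      have "cmod (h k) \<le> C * (Cs * \<eta>) * nrm w"
      proof (rule maximum_modulus_frontier[where S = "cball k (r / 2)" and f = h and \<xi> = k])
        show "h holomorphic_on interior (cball k (r / 2))" by (rule holomorphic_on_subset[OF hol interior_subset])
        show "continuous_on (closure (cball k (r / 2))) h" using holomorphic_on_imp_continuous_on[OF hol] by simp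
      qed (use bd r(1) in auto)
      \<comment> \<open>At the centre the right-hand side is that of \<open>w\<close> itself. Hence
        \<open>h k\<close> is the square of \<open>nrm w\<close>, which is not small.\<close>
      moreover have "u k = w"
      proof -
        have kb: "k \<in> ball k r" using r(1) by simp
        obtain C' where C': "bounded_below (hsub H (W i)) (s k) C'" using sol(2)[OF kb] by blast
        have "hnorm (hsub H (W i)) (u k - w) \<le> C' * 0"
        proof (rule bounded_belowD[OF C'])
          fix v assume v: "v \<in> hcarrier (hsub H (W i))"
          then have "v \<in> carr" "u k \<in> carr" using u(1)[OF kb] Wc by auto
          then show "cmod (s k (u k - w) v) \<le> 0 * hnorm (hsub H (W i)) v"
            using form_diff_left[OF subspace_carr s_sesq[OF kL] _ wc] u(2)[OF kb] v by simp
        qed (use Wi.mem_diff[of "u k" w] u(1)[OF kb] w in auto)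
        moreover have "u k - w \<in> carr" using u(1)[OF kb] wc Wc by blast
        ultimately show ?thesis using nrm_pos[of "u k - w"] by fastforce
      qed
      ultimately have "(nrm w)\<^sup>2 \<le> C * (Cs * \<eta>) * nrm w"
        by (simp add: h_def ip_self[OF wc] norm_power)
      then have *: "nrm w * nrm w \<le> (C * Cs * \<eta>) * nrm w" by (simp add: power2_eq_square mult.assoc)
      have lower: "nrm u0 \<le> \<eta> + nrm w" using nrm_triangle[of "u0 - w" w] u0(1) wc w(2) by simp
      have "\<eta> \<le> nrm u0 / 2" unfolding \<eta>_def using n0 C(1) Cs(1) by (intro divide_left_mono) (auto simp: add_pos_pos)
      then have "nrm w > 0" using lower n0 by linarith
      then have "nrm w \<le> C * Cs * \<eta>" using * by simp
      then have "nrm u0 \<le> (C * Cs + 1) * \<eta>" using lower by (simp add: algebra_simps)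
      also have "\<dots> = nrm u0 / 2"
      proof -
        have "q * (x / (2 * q)) = x / 2" if "q > 0" for q x :: real using that by simp
        moreover have "C * Cs + 1 > 0" using C(1) Cs(1) by (simp add: add_pos_pos)
        ultimately show ?thesis unfolding \<eta>_def by blast
      qed
      finally show False using n0 by simp
    qed
  qed
qed

text \<open>The two one-sided distances need different arguments. In \<open>K\<close> there are only
  finitely many eigenvalues, each approached by discrete ones; away from them \<open>K\<close> is a
  compact set of regular points, which eventually contains no discrete eigenvalue.\<close>

theorem eigenvalue_convergence:
  assumes reg: "k \<in> \<Lambda>" "k \<notin> eig" and K: "compact K" "K \<subseteq> \<Lambda>" "eig \<inter> frontier K = {}"
  shows "((\<lambda>i. hausdorff_distance (eig \<inter> K) (eigW i \<inter> K)) \<longlongrightarrow> 0) F"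
proof -
  have lim: "\<not> z islimpt eig" if "z \<in> \<Lambda>" for z by (rule eig_no_limpt[OF reg that])
  have fin: "finite (eig \<inter> K)"
  proof (rule ccontr)
    assume "infinite (eig \<inter> K)"
    then obtain z where "z \<in> K" "z islimpt (eig \<inter> K)"
      using K(1) by (metis Heine_Borel_imp_Bolzano_Weierstrass inf_le2)
    then show False using lim K(2) islimpt_subset[of z "eig \<inter> K" eig] by blast
  qed
  have ev: "\<forall>\<^sub>F i in F. hausdorff_distance (eig \<inter> K) (eigW i \<inter> K) \<le> ennreal e" if e: "e > 0" for e
  proof -
    have "\<forall>\<^sub>F i in F. \<exists>b\<in>eigW i \<inter> K. cmod (a - b) < e" if a: "a \<in> eig \<inter> K" for a
    proof -
      \<comment> \<open>Here the condition on the frontier enters: the discrete eigenvalues found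
        near \<open>a\<close> must belong to \<open>K\<close>.\<close>
      have "a \<in> interior K" using a K(3) compact_imp_closed[OF K(1)] by (auto simp: frontier_def)
      then obtain r1 where r1: "r1 > 0" "ball a r1 \<subseteq> interior K" using open_interior openE by blast
      have "\<not> a islimpt eig" using lim a K(2) by blast
      then obtain r2 where r2: "r2 > 0" "\<And>y. y \<in> eig \<Longrightarrow> y \<noteq> a \<Longrightarrow> r2 \<le> dist y a"
        unfolding islimpt_approachable by (metis not_le)
      \<comment> \<open>The closed disc of radius \<open>r\<close> lies in \<open>K\<close> and
        isolates \<open>a\<close>; the halves turn both bounds into strict ones. Its points are
        within \<open>e\<close> of \<open>a\<close>.\<close>
      define r where "r = min (min (r1 / 2) (r2 / 2)) e"
      have r: "r > 0" "r < r1" "r < r2" "r \<le> e" using r1(1) r2(1) e by (auto simp: r_def min_def)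
      have "cball a r \<subseteq> K" using r(2) r1(2) interior_subset[of K] by (force simp: subset_iff)
      moreover have "cball a r \<inter> eig = {a}"
        using r2(2) r(1,3) a by (force simp: dist_commute)
      ultimately have "\<forall>\<^sub>F i in F. eigW i \<inter> ball a r \<noteq> {}"
        using a K(2) r(1) by (intro discrete_eigenvalue_near) auto
      then show ?thesis
        by eventually_elim (use \<open>cball a r \<subseteq> K\<close> r(4) in \<open>force simp: dist_norm\<close>)
    qed
    then have 1: "\<forall>\<^sub>F i in F. \<forall>a\<in>eig \<inter> K. \<exists>b\<in>eigW i \<inter> K. cmod (a - b) < e"
      using fin by (intro eventually_ball_finite) auto
    \<comment> \<open>Removing open balls keeps the set compact, and every eigenvalue in
      \<open>K\<close> is the centre of a removed ball.\<close>
    define K' where "K' = K - (\<Union>a\<in>eig \<inter> K. ball a e)"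
    have "compact K'" unfolding K'_def by (intro compact_diff K(1) open_UN) auto
    moreover have "K' \<inter> eig = {}" "K' \<subseteq> \<Lambda>" unfolding K'_def using e K(2) by auto
    ultimately obtain C where C: "\<forall>\<^sub>F i in F. \<forall>\<kappa>\<in>K'. bounded_below (hsub H (W i)) (s \<kappa>) C"
      using regular_compact by blast
    then have 2: "\<forall>\<^sub>F i in F. \<forall>\<kappa>\<in>K'. \<kappa> \<notin> eigW i"
      by (rule eventually_W[rotated]) (use not_eigW_if_bounded_below in blast)
    from 1 2 show ?thesis
    proof eventually_elim
      case (elim i)
      have "(INF b\<in>eigW i \<inter> K. ennreal (cmod (a - b))) \<le> ennreal e" if "a \<in> eig \<inter> K" for a
        using elim(1) that by (metis INF_lower2 ennreal_leI less_imp_le)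
      moreover have "(INF a\<in>eig \<inter> K. ennreal (cmod (a - b))) \<le> ennreal e" if b: "b \<in> eigW i \<inter> K" for b
      proof -
        have "b \<notin> K'" using elim(2) b by blast
        then obtain a where "a \<in> eig \<inter> K" "cmod (a - b) < e" using b by (auto simp: K'_def dist_norm)
        then show ?thesis by (metis INF_lower2 ennreal_leI less_imp_le)
      qed
      ultimately show ?case unfolding hausdorff_distance_def by (simp add: SUP_le_iff)
    qed
  qed
  show ?thesis
  proof (rule order_tendstoI)
    fix x :: ennreal assume "0 < x"
    then obtain e where e: "e > 0" "ennreal e < x"
    proof -
      obtain y where y: "0 < y" "y < x" using dense \<open>0 < x\<close> by blast
      then obtain e where "y = ennreal e" "e \<ge> 0" by (cases y) auto
      then show ?thesis using y that[of e] by (cases "e = 0") auto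
    qed
    show "\<forall>\<^sub>F i in F. hausdorff_distance (eig \<inter> K) (eigW i \<inter> K) < x"
      using ev[OF e(1)] by eventually_elim (use e(2) in auto)
  qed simp
qed

end

section \<open>Constructions of Hilbert spaces\<close>

lemma null_squeeze:
  fixes f g :: "nat \<Rightarrow> real"
  assumes "g \<longlonglongrightarrow> 0" "\<And>k. 0 \<le> f k" "\<And>k. f k \<le> g k"
  shows "f \<longlonglongrightarrow> 0"
  by (rule tendsto_sandwich[OF _ _ tendsto_const assms(1)]) (use assms(2,3) in auto)

lemma Cauchy_le:
  fixes D E :: "nat \<Rightarrow> nat \<Rightarrow> real"
  assumes "\<And>e. e > 0 \<Longrightarrow> \<exists>N. \<forall>m\<ge>N. \<forall>n\<ge>N. D m n < e" "\<And>m n. E m n \<le> D m n" "e > 0"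
  shows "\<exists>N. \<forall>m\<ge>N. \<forall>n\<ge>N. E m n < e"
  using assms(1)[OF assms(3)] assms(2) by (meson order_le_less_trans)

lemma hilbertD: "hilbert_space H \<Longrightarrow> hilbert H"
  by unfold_locales

lemma cont_embeddedD:
  assumes "cont_embedded K H"
  shows "x \<in> hcarrier K \<Longrightarrow> x \<in> hcarrier H"
  using assms unfolding cont_embedded_def by blast

lemma cont_embedded_bound:
  assumes "cont_embedded K H" "hilbert_space K"
  obtains C where "C > 0" "\<And>x. x \<in> hcarrier K \<Longrightarrow> hnorm H x \<le> C * hnorm K x"
proof -
  interpret K: hilbert K by (rule hilbertD[OF assms(2)])
  obtain C where C: "\<And>x. x \<in> hcarrier K \<Longrightarrow> hnorm H x \<le> C * hnorm K x"
    using assms unfolding cont_embedded_def by blast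
  show ?thesis
  proof (rule that[of "\<bar>C\<bar> + 1"])
    fix x assume x: "x \<in> hcarrier K"
    have "C * hnorm K x \<le> (\<bar>C\<bar> + 1) * hnorm K x" by (intro mult_right_mono) (use x in auto)
    then show "hnorm H x \<le> (\<bar>C\<bar> + 1) * hnorm K x" using C[OF x] by linarith
  qed auto
qed

section \<open>Intersections of Hilbert spaces\<close>

context
  fixes H K :: "'a::complex_vector hspace"
  assumes H: "hilbert_space H" and K: "hilbert_space K"
begin

interpretation H: hilbert H by (rule hilbertD[OF H])
interpretation K: hilbert K by (rule hilbertD[OF K])

lemma hcarrier_hinter [simp]: "hcarrier (hinter H K) = hcarrier H \<inter> hcarrier K"
  and hinner_hinter: "hinner (hinter H K) u v = hinner H u v + hinner K u v"
  by (simp_all add: hinter_def)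

lemma hnorm_hinter_sq: "x \<in> hcarrier (hinter H K) \<Longrightarrow> (hnorm (hinter H K) x)\<^sup>2 = (hnorm H x)\<^sup>2 + (hnorm K x)\<^sup>2"
  by (simp add: hnorm_def hinner_hinter H.Re_ip_nonneg K.Re_ip_nonneg)

lemma pre_hilbert_hinter: "pre_hilbert (hinter H K)"
proof
  show "csubspace (hcarrier (hinter H K))"
    using complex_vector.subspace_inter[OF H.subspace_carr K.subspace_carr] by simp
  show "sesquilinear_on (hcarrier (hinter H K)) (hinner (hinter H K))"
    by (rule sesquilinear_onI)
      (simp_all add: hinner_hinter H.ip_add_left K.ip_add_left H.ip_add_right K.ip_add_right
        H.ip_scale_left K.ip_scale_left H.ip_scale_right K.ip_scale_right algebra_simps)
  show "hinner (hinter H K) y x = cnj (hinner (hinter H K) x y)"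
    if "x \<in> hcarrier (hinter H K)" "y \<in> hcarrier (hinter H K)" for x y
    using that H.ip_commute[of x y] K.ip_commute[of x y] by (simp add: hinner_hinter)
  show "Re (hinner (hinter H K) x x) > 0" if "x \<in> hcarrier (hinter H K)" "x \<noteq> 0" for x
    using that H.ip_pos[of x] K.ip_pos[of x] by (simp add: hinner_hinter)
qed

lemma hnorm_hinter_ge:
  assumes "x \<in> hcarrier (hinter H K)"
  shows "hnorm H x \<le> hnorm (hinter H K) x" "hnorm K x \<le> hnorm (hinter H K) x"
proof -
  interpret L: pre_hilbert "hinter H K" by (rule pre_hilbert_hinter)
  show "hnorm H x \<le> hnorm (hinter H K) x"
    by (rule power2_le_imp_le) (use hnorm_hinter_sq[OF assms] L.nrm_nonneg[OF assms] in auto)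
  show "hnorm K x \<le> hnorm (hinter H K) x"
    by (rule power2_le_imp_le) (use hnorm_hinter_sq[OF assms] L.nrm_nonneg[OF assms] in auto)
qed

lemma hnorm_hinter_le:
  assumes "x \<in> hcarrier (hinter H K)"
  shows "hnorm (hinter H K) x \<le> hnorm H x + hnorm K x"
proof (rule power2_le_imp_le)
  show "(hnorm (hinter H K) x)\<^sup>2 \<le> (hnorm H x + hnorm K x)\<^sup>2"
    using hnorm_hinter_sq[OF assms] assms by (simp add: power2_sum)
qed (use assms in simp)

text \<open>A Cauchy sequence has a limit in \<open>H\<close> and one in \<open>K\<close>. They
  agree because both embeddings into the common space \<open>G\<close> are continuous.\<close>

lemma hilbert_hinter:
  assumes G: "hilbert_space G" "cont_embedded H G" "cont_embedded K G"
  shows "hilbert_space (hinter H K)"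
proof -
  interpret L: pre_hilbert "hinter H K" by (rule pre_hilbert_hinter)
  interpret G: hilbert G by (rule hilbertD[OF G(1)])
  show ?thesis
  proof (rule L.hilbertI)
    fix x :: "nat \<Rightarrow> 'a"
    assume x: "\<And>k. x k \<in> hcarrier (hinter H K)"
      and cau: "\<And>e. e > 0 \<Longrightarrow> \<exists>N. \<forall>m\<ge>N. \<forall>n\<ge>N. hnorm (hinter H K) (x m - x n) < e"
    have xx: "x k \<in> hcarrier H" "x k \<in> hcarrier K" for k using x[of k] by auto
    have d: "x m - x n \<in> hcarrier (hinter H K)" for m n using L.mem_diff[OF x x] .
    obtain y where y: "y \<in> hcarrier H" "(\<lambda>k. hnorm H (x k - y)) \<longlonglongrightarrow> 0"
      using H.complete[of x, OF xx(1) Cauchy_le[OF cau hnorm_hinter_ge(1)[OF d]]] by blast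
    obtain z where z: "z \<in> hcarrier K" "(\<lambda>k. hnorm K (x k - z)) \<longlonglongrightarrow> 0"
      using K.complete[of x, OF xx(2) Cauchy_le[OF cau hnorm_hinter_ge(2)[OF d]]] by blast
    obtain C where C: "C > 0" "\<And>x. x \<in> hcarrier H \<Longrightarrow> hnorm G x \<le> C * hnorm H x"
      using cont_embedded_bound[OF G(2) H] by blast
    obtain D where D: "D > 0" "\<And>x. x \<in> hcarrier K \<Longrightarrow> hnorm G x \<le> D * hnorm K x"
      using cont_embedded_bound[OF G(3) K] by blast
    have yG: "y \<in> hcarrier G" and zG: "z \<in> hcarrier G" and xG: "x k \<in> hcarrier G" for k
      using cont_embeddedD[OF G(2)] cont_embeddedD[OF G(3)] y(1) z(1) xx by blast+
    have "hnorm G (y - z) \<le> C * hnorm H (x k - y) + D * hnorm K (x k - z)" for k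
      using G.nrm_triangle3[OF yG xG[of k] zG] G.nrm_diff_commute[OF yG xG[of k]]
        C(2)[OF H.mem_diff[OF xx(1)[of k] y(1)]] D(2)[OF K.mem_diff[OF xx(2)[of k] z(1)]] by linarith
    moreover have "(\<lambda>k. C * hnorm H (x k - y) + D * hnorm K (x k - z)) \<longlonglongrightarrow> C * 0 + D * 0"
      by (intro tendsto_intros y z)
    ultimately have "hnorm G (y - z) \<le> C * 0 + D * 0" using LIMSEQ_le_const by blast
    then have "y = z" using G.nrm_pos[of "y - z"] yG zG by fastforce
    have yL: "y \<in> hcarrier (hinter H K)" using y(1) z(1) \<open>y = z\<close> by simp
    have "(\<lambda>k. hnorm H (x k - y) + hnorm K (x k - y)) \<longlonglongrightarrow> 0 + 0"
      using y(2) z(2) \<open>y = z\<close> by (intro tendsto_add) auto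
    then have "(\<lambda>k. hnorm H (x k - y) + hnorm K (x k - y)) \<longlonglongrightarrow> 0" by simp
    then have "(\<lambda>k. hnorm (hinter H K) (x k - y)) \<longlonglongrightarrow> 0"
      by (rule null_squeeze[OF _ L.nrm_nonneg[OF L.mem_diff[OF x yL]] hnorm_hinter_le[OF L.mem_diff[OF x yL]]])
    then show "\<exists>z\<in>hcarrier (hinter H K). (\<lambda>k. hnorm (hinter H K) (x k - z)) \<longlonglongrightarrow> 0" using yL by blast
  qed
qed

end

section \<open>Products of Hilbert spaces\<close>

context
  fixes H :: "'a::complex_vector hspace" and K :: "'b::complex_vector hspace"
  assumes H: "hilbert_space H" and K: "hilbert_space K"
begin

interpretation H: hilbert H by (rule hilbertD[OF H])
interpretation K: hilbert K by (rule hilbertD[OF K])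

lemma hcarrier_hprod [simp]: "hcarrier (hprod H K) = hcarrier H \<times> hcarrier K"
  and hinner_hprod: "hinner (hprod H K) u v = hinner H (fst u) (fst v) + hinner K (snd u) (snd v)"
  by (simp_all add: hprod_def)

lemma hnorm_hprod_sq: "x \<in> hcarrier (hprod H K) \<Longrightarrow> (hnorm (hprod H K) x)\<^sup>2 = (hnorm H (fst x))\<^sup>2 + (hnorm K (snd x))\<^sup>2"
  by (auto simp: hnorm_def hinner_hprod H.Re_ip_nonneg K.Re_ip_nonneg)

lemma pre_hilbert_hprod: "pre_hilbert (hprod H K)"
proof
  show "csubspace (hcarrier (hprod H K))"
    by (auto simp: complex_vector.subspace_def scaleC_prod_def zero_prod_def)
  show "sesquilinear_on (hcarrier (hprod H K)) (hinner (hprod H K))"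
    by (rule sesquilinear_onI)
      (auto simp: hinner_hprod scaleC_prod_def H.ip_add_left K.ip_add_left H.ip_add_right K.ip_add_right
        H.ip_scale_left K.ip_scale_left H.ip_scale_right K.ip_scale_right algebra_simps)
  show "hinner (hprod H K) y x = cnj (hinner (hprod H K) x y)"
    if "x \<in> hcarrier (hprod H K)" "y \<in> hcarrier (hprod H K)" for x y
    using that H.ip_commute[of "fst x" "fst y"] K.ip_commute[of "snd x" "snd y"] by (auto simp: hinner_hprod)
  show "Re (hinner (hprod H K) x x) > 0" if x: "x \<in> hcarrier (hprod H K)" "x \<noteq> 0" for x
  proof (cases "fst x = 0")
    case True
    then have "snd x \<noteq> 0" using x(2) by (simp add: prod_eq_iff)
    then show ?thesis using x H.Re_ip_nonneg[of "fst x"] K.ip_pos[of "snd x"]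
      by (auto simp: hinner_hprod intro: add_nonneg_pos)
  next
    case False
    then show ?thesis using x H.ip_pos[of "fst x"] K.Re_ip_nonneg[of "snd x"]
      by (auto simp: hinner_hprod intro: add_pos_nonneg)
  qed
qed

lemma hnorm_hprod_ge:
  assumes "x \<in> hcarrier (hprod H K)"
  shows "hnorm H (fst x) \<le> hnorm (hprod H K) x" "hnorm K (snd x) \<le> hnorm (hprod H K) x"
proof -
  interpret L: pre_hilbert "hprod H K" by (rule pre_hilbert_hprod)
  show "hnorm H (fst x) \<le> hnorm (hprod H K) x"
    by (rule power2_le_imp_le) (use hnorm_hprod_sq[OF assms] L.nrm_nonneg[OF assms] in auto)
  show "hnorm K (snd x) \<le> hnorm (hprod H K) x"
    by (rule power2_le_imp_le) (use hnorm_hprod_sq[OF assms] L.nrm_nonneg[OF assms] in auto)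
qed

lemma hnorm_hprod_le:
  assumes "x \<in> hcarrier (hprod H K)"
  shows "hnorm (hprod H K) x \<le> hnorm H (fst x) + hnorm K (snd x)"
proof -
  have m: "fst x \<in> hcarrier H" "snd x \<in> hcarrier K" using assms by auto
  show ?thesis
  proof (rule power2_le_imp_le)
    show "(hnorm (hprod H K) x)\<^sup>2 \<le> (hnorm H (fst x) + hnorm K (snd x))\<^sup>2"
      using hnorm_hprod_sq[OF assms] m by (simp add: power2_sum)
  qed (use m in simp)
qed

lemma hilbert_hprod: "hilbert_space (hprod H K)"
proof -
  interpret L: pre_hilbert "hprod H K" by (rule pre_hilbert_hprod)
  show ?thesis
  proof (rule L.hilbertI)
    fix x :: "nat \<Rightarrow> 'a \<times> 'b"
    assume x: "\<And>k. x k \<in> hcarrier (hprod H K)"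
      and cau: "\<And>e. e > 0 \<Longrightarrow> \<exists>N. \<forall>m\<ge>N. \<forall>n\<ge>N. hnorm (hprod H K) (x m - x n) < e"
    have xx: "fst (x k) \<in> hcarrier H" "snd (x k) \<in> hcarrier K" for k using x[of k] by auto
    have d: "x m - x n \<in> hcarrier (hprod H K)" for m n using L.mem_diff[OF x x] .
    obtain y where y: "y \<in> hcarrier H" "(\<lambda>k. hnorm H (fst (x k) - y)) \<longlonglongrightarrow> 0"
      using H.complete[of "\<lambda>k. fst (x k)", OF xx(1) Cauchy_le[OF cau hnorm_hprod_ge(1)[OF d, unfolded fst_diff]]] by blast
    obtain z where z: "z \<in> hcarrier K" "(\<lambda>k. hnorm K (snd (x k) - z)) \<longlonglongrightarrow> 0"
      using K.complete[of "\<lambda>k. snd (x k)", OF xx(2) Cauchy_le[OF cau hnorm_hprod_ge(2)[OF d, unfolded snd_diff]]] by blast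
    have yL: "(y, z) \<in> hcarrier (hprod H K)" using y(1) z(1) by simp
    have lim: "(\<lambda>k. hnorm H (fst (x k) - y) + hnorm K (snd (x k) - z)) \<longlonglongrightarrow> 0"
      using tendsto_add[OF y(2) z(2)] by simp
    have "hnorm (hprod H K) (x k - (y, z)) \<le> hnorm H (fst (x k) - y) + hnorm K (snd (x k) - z)" for k
      using hnorm_hprod_le[OF L.mem_diff[OF x[of k] yL]] by simp
    from null_squeeze[OF lim L.nrm_nonneg[OF L.mem_diff[OF x yL]] this]
    have "(\<lambda>k. hnorm (hprod H K) (x k - (y, z))) \<longlonglongrightarrow> 0" .
    then show "\<exists>z\<in>hcarrier (hprod H K). (\<lambda>k. hnorm (hprod H K) (x k - z)) \<longlonglongrightarrow> 0" using yL by blast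
  qed
qed

end

lemma fun_simps: "(u + v) i = u i + v i" "(u - v) i = u i - v i" "(0::'i \<Rightarrow> 'a) i = 0" "(c *\<^sub>C u) i = c *\<^sub>C u i"
  for u v :: "'i \<Rightarrow> 'a::complex_vector"
  by (simp_all add: plus_fun_def fun_diff_def zero_fun_def scaleC_fun_def)

section \<open>Finite orthogonal sums of Hilbert spaces\<close>

context
  fixes I :: "'i set" and H :: "'i \<Rightarrow> 'a::complex_vector hspace"
  assumes I: "finite I" and H: "\<And>i. i \<in> I \<Longrightarrow> hilbert_space (H i)"
begin

lemma hcarrier_hsum: "u \<in> hcarrier (hsum I H) \<longleftrightarrow> (\<forall>i\<in>I. u i \<in> hcarrier (H i)) \<and> (\<forall>i. i \<notin> I \<longrightarrow> u i = 0)"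
  and hinner_hsum: "hinner (hsum I H) u v = (\<Sum>i\<in>I. hinner (H i) (u i) (v i))"
  by (simp_all add: hsum_def)

lemma hsum_mem: "u \<in> hcarrier (hsum I H) \<Longrightarrow> i \<in> I \<Longrightarrow> u i \<in> hcarrier (H i)"
  by (simp add: hcarrier_hsum)

lemma hnorm_hsum_sq: "u \<in> hcarrier (hsum I H) \<Longrightarrow> (hnorm (hsum I H) u)\<^sup>2 = (\<Sum>i\<in>I. (hnorm (H i) (u i))\<^sup>2)"
proof -
  assume u: "u \<in> hcarrier (hsum I H)"
  have *: "Re (hinner (H i) (u i) (u i)) \<ge> 0" if "i \<in> I" for i
  proof -
    interpret Hi: hilbert "H i" by (rule hilbertD[OF H[OF that]])
    show ?thesis using u that by (simp add: hcarrier_hsum Hi.Re_ip_nonneg)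
  qed
  then have "Re (hinner (hsum I H) u u) \<ge> 0" by (simp add: hinner_hsum sum_nonneg)
  then show ?thesis using * by (simp add: hnorm_def hinner_hsum)
qed

lemma pre_hilbert_hsum: "pre_hilbert (hsum I H)"
proof
  have Hi: "hilbert (H i)" if "i \<in> I" for i by (rule hilbertD[OF H[OF that]])
  note P = pre_hilbert.mem_add pre_hilbert.mem_scale pre_hilbert.mem_0
  have pre: "pre_hilbert (H i)" if "i \<in> I" for i
  proof -
    interpret Hi: hilbert "H i" by (rule Hi[OF that])
    show ?thesis by unfold_locales
  qed
  show "csubspace (hcarrier (hsum I H))"
    using pre by (auto simp: complex_vector.subspace_def hcarrier_hsum fun_simps P)
  show "sesquilinear_on (hcarrier (hsum I H)) (hinner (hsum I H))"
  proof (rule sesquilinear_onI)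
    fix x y z c assume m: "x \<in> hcarrier (hsum I H)" "y \<in> hcarrier (hsum I H)"
    show "hinner (hsum I H) (c *\<^sub>C x) y = c * hinner (hsum I H) x y"
      unfolding hinner_hsum sum_distrib_left using m
      by (intro sum.cong) (auto simp: fun_simps hcarrier_hsum pre_hilbert.ip_scale_left[OF pre])
    show "hinner (hsum I H) x (c *\<^sub>C y) = cnj c * hinner (hsum I H) x y"
      unfolding hinner_hsum sum_distrib_left using m
      by (intro sum.cong) (auto simp: fun_simps hcarrier_hsum pre_hilbert.ip_scale_right[OF pre])
    assume z: "z \<in> hcarrier (hsum I H)"
    show "hinner (hsum I H) (x + y) z = hinner (hsum I H) x z + hinner (hsum I H) y z"
      unfolding hinner_hsum sum.distrib[symmetric] using m z
      by (intro sum.cong) (auto simp: fun_simps hcarrier_hsum pre_hilbert.ip_add_left[OF pre])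
    show "hinner (hsum I H) z (x + y) = hinner (hsum I H) z x + hinner (hsum I H) z y"
      unfolding hinner_hsum sum.distrib[symmetric] using m z
      by (intro sum.cong) (auto simp: fun_simps hcarrier_hsum pre_hilbert.ip_add_right[OF pre])
  qed
  show "hinner (hsum I H) y x = cnj (hinner (hsum I H) x y)"
    if "x \<in> hcarrier (hsum I H)" "y \<in> hcarrier (hsum I H)" for x y
    unfolding hinner_hsum cnj_sum
  proof (rule sum.cong[OF refl])
    fix i assume "i \<in> I"
    then show "hinner (H i) (y i) (x i) = cnj (hinner (H i) (x i) (y i))"
      using pre_hilbert.ip_commute[OF pre hsum_mem[OF that(1)] hsum_mem[OF that(2)]] by blast
  qed
  show "Re (hinner (hsum I H) x x) > 0" if x: "x \<in> hcarrier (hsum I H)" "x \<noteq> 0" for x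
  proof -
    obtain i where i: "x i \<noteq> 0" using x(2) by (auto simp: fun_eq_iff zero_fun_def)
    then have iI: "i \<in> I" using x(1) by (auto simp: hcarrier_hsum)
    have "(\<Sum>j\<in>I. Re (hinner (H j) (x j) (x j))) > 0"
    proof (rule sum_pos2[OF I iI])
      show "0 < Re (hinner (H i) (x i) (x i))"
        using pre_hilbert.ip_pos[OF pre[OF iI] hsum_mem[OF x(1) iI] i] .
      show "0 \<le> Re (hinner (H j) (x j) (x j))" if "j \<in> I" for j
        using pre_hilbert.Re_ip_nonneg[OF pre[OF that] hsum_mem[OF x(1) that]] .
    qed
    then show ?thesis by (simp add: hinner_hsum)
  qed
qed

lemma hnorm_hsum_ge:
  assumes "u \<in> hcarrier (hsum I H)" "i \<in> I"
  shows "hnorm (H i) (u i) \<le> hnorm (hsum I H) u"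
proof (rule power2_le_imp_le)
  show "(hnorm (H i) (u i))\<^sup>2 \<le> (hnorm (hsum I H) u)\<^sup>2"
    unfolding hnorm_hsum_sq[OF assms(1)] by (rule member_le_sum) (use assms I in auto)
  show "0 \<le> hnorm (hsum I H) u" using pre_hilbert.nrm_nonneg[OF pre_hilbert_hsum assms(1)] .
qed

lemma hnorm_hsum_le:
  assumes "u \<in> hcarrier (hsum I H)"
  shows "hnorm (hsum I H) u \<le> (\<Sum>i\<in>I. hnorm (H i) (u i))"
proof -
  have nn: "hnorm (H i) (u i) \<ge> 0" if "i \<in> I" for i
  proof -
    interpret Hi: hilbert "H i" by (rule hilbertD[OF H[OF that]])
    show ?thesis using hsum_mem[OF assms that] by simp
  qed
  show ?thesis
  proof (rule power2_le_imp_le)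
    have "(\<Sum>i\<in>J. (hnorm (H i) (u i))\<^sup>2) \<le> (\<Sum>i\<in>J. hnorm (H i) (u i))\<^sup>2" if "J \<subseteq> I" for J
      using finite_subset[OF that I] that
    proof (induction J rule: finite_induct)
      case (insert i J)
      have "0 \<le> hnorm (H i) (u i) * (\<Sum>i\<in>J. hnorm (H i) (u i))"
        using insert nn by (intro mult_nonneg_nonneg sum_nonneg) auto
      then show ?case using insert by (simp add: power2_sum)
    qed simp
    then show "(hnorm (hsum I H) u)\<^sup>2 \<le> (\<Sum>i\<in>I. hnorm (H i) (u i))\<^sup>2"
      unfolding hnorm_hsum_sq[OF assms] by blast
  qed (use nn in \<open>simp add: sum_nonneg\<close>)
qed

lemma hilbert_hsum: "hilbert_space (hsum I H)"
proof -
  interpret L: pre_hilbert "hsum I H" by (rule pre_hilbert_hsum)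
  show ?thesis
  proof (rule L.hilbertI)
    fix x :: "nat \<Rightarrow> 'i \<Rightarrow> 'a"
    assume x: "\<And>k. x k \<in> hcarrier (hsum I H)"
      and cau: "\<And>e. e > 0 \<Longrightarrow> \<exists>N. \<forall>m\<ge>N. \<forall>n\<ge>N. hnorm (hsum I H) (x m - x n) < e"
    have d: "x m - x n \<in> hcarrier (hsum I H)" for m n using L.mem_diff[OF x x] .
    have "\<exists>y\<in>hcarrier (H i). (\<lambda>k. hnorm (H i) (x k i - y)) \<longlonglongrightarrow> 0" if i: "i \<in> I" for i
    proof -
      interpret Hi: hilbert "H i" by (rule hilbertD[OF H[OF i]])
      have "hnorm (H i) (x m i - x n i) \<le> hnorm (hsum I H) (x m - x n)" for m n
        using hnorm_hsum_ge[OF d[of m n] i] fun_simps(2)[of "x m" "x n" i] by simp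
      then show ?thesis
        using Hi.complete[of "\<lambda>k. x k i", OF hsum_mem[OF x i] Cauchy_le[OF cau]] by blast
    qed
    then obtain y where y: "\<And>i. i \<in> I \<Longrightarrow> y i \<in> hcarrier (H i)" "\<And>i. i \<in> I \<Longrightarrow> (\<lambda>k. hnorm (H i) (x k i - y i)) \<longlonglongrightarrow> 0"
      by metis
    define z where "z = (\<lambda>i. if i \<in> I then y i else 0)"
    have zL: "z \<in> hcarrier (hsum I H)" using y(1) by (simp add: hcarrier_hsum z_def)
    have "(\<lambda>k. \<Sum>i\<in>I. hnorm (H i) (x k i - z i)) \<longlonglongrightarrow> (\<Sum>i\<in>I. 0)"
      using y(2) by (intro tendsto_sum) (simp add: z_def)
    then have lim: "(\<lambda>k. \<Sum>i\<in>I. hnorm (H i) (x k i - z i)) \<longlonglongrightarrow> 0" by simp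
    have "hnorm (hsum I H) (x k - z) \<le> (\<Sum>i\<in>I. hnorm (H i) (x k i - z i))" for k
      using hnorm_hsum_le[OF L.mem_diff[OF x[of k] zL]] by (simp add: fun_simps)
    from null_squeeze[OF lim L.nrm_nonneg[OF L.mem_diff[OF x zL]] this]
    have "(\<lambda>k. hnorm (hsum I H) (x k - z)) \<longlonglongrightarrow> 0" .
    then show "\<exists>z\<in>hcarrier (hsum I H). (\<lambda>k. hnorm (hsum I H) (x k - z)) \<longlonglongrightarrow> 0" using zL by blast
  qed
qed

end

subsection \<open>Projections, dense subspaces, compact operators\<close>

context hilbert
begin

definition proj :: "'a set \<Rightarrow> 'a \<Rightarrow> 'a"
  where "proj S u = (SOME p. p \<in> S \<and> (\<forall>v\<in>S. ip (u - p) v = 0))"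

lemma proj_unique:
  assumes S: "csubspace S" "S \<subseteq> carr" and u: "u \<in> carr"
    and p: "p \<in> S" "\<And>v. v \<in> S \<Longrightarrow> ip (u - p) v = 0" and q: "q \<in> S" "\<And>v. v \<in> S \<Longrightarrow> ip (u - q) v = 0"
  shows "p = q"
proof -
  have c: "p \<in> carr" "q \<in> carr" using p q S by auto
  have d: "p - q \<in> S" using complex_vector.subspace_diff[OF S(1) p(1) q(1)] .
  have "ip (p - q) (p - q) = ip (u - q) (p - q) - ip (u - p) (p - q)"
    using c u by (simp add: ip_diff_left[of "u - q" "u - p", symmetric])
  then have "ip (p - q) (p - q) = 0" using p(2)[OF d] q(2)[OF d] by simp
  then show ?thesis using ip_pos[of "p - q"] c by fastforce
qed

context
  fixes S
  assumes S: "csubspace S" "closedin (htop H) S"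
begin

lemma S_carr: "S \<subseteq> carr" using S(2) closedin_iff by blast

lemma proj_mem: "u \<in> carr \<Longrightarrow> proj S u \<in> S"
  and proj_orth: "u \<in> carr \<Longrightarrow> v \<in> S \<Longrightarrow> ip (u - proj S u) v = 0"
proof -
  assume u: "u \<in> carr"
  obtain p where "p \<in> S" "\<And>v. v \<in> S \<Longrightarrow> ip (u - p) v = 0" by (rule projection[OF S u]) blast
  then have "proj S u \<in> S \<and> (\<forall>v\<in>S. ip (u - proj S u) v = 0)"
    unfolding proj_def by (intro someI[of "\<lambda>p. p \<in> S \<and> (\<forall>v\<in>S. ip (u - p) v = 0)" p]) blast
  then show "proj S u \<in> S" "v \<in> S \<Longrightarrow> ip (u - proj S u) v = 0" by blast+
qed

lemma proj_carr [simp]: "u \<in> carr \<Longrightarrow> proj S u \<in> carr"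
  using proj_mem S_carr by blast

lemma proj_eqI: "u \<in> carr \<Longrightarrow> p \<in> S \<Longrightarrow> (\<And>v. v \<in> S \<Longrightarrow> ip (u - p) v = 0) \<Longrightarrow> proj S u = p"
  using proj_unique[OF S(1) S_carr] proj_mem proj_orth by blast

lemma proj_fixed: "u \<in> S \<Longrightarrow> proj S u = u"
  using S_carr by (intro proj_eqI) auto

lemma proj_linear: "clinear_on carr (proj S)"
  unfolding clinear_on_def
proof (intro conjI ballI allI)
  fix x y assume x: "x \<in> carr" and y: "y \<in> carr"
  show "proj S (x + y) = proj S x + proj S y"
  proof (rule proj_eqI)
    fix v assume v: "v \<in> S"
    have eq: "x + y - (proj S x + proj S y) = (x - proj S x) + (y - proj S y)" by simp
    show "ip (x + y - (proj S x + proj S y)) v = 0"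
      unfolding eq using proj_orth[OF x v] proj_orth[OF y v] x y v S_carr by (auto simp: ip_add_left)
  qed (use x y proj_mem complex_vector.subspace_add[OF S(1)] in auto)
next
  fix c x assume x: "x \<in> carr"
  show "proj S (c *\<^sub>C x) = c *\<^sub>C proj S x"
  proof (rule proj_eqI)
    fix v assume v: "v \<in> S"
    have eq: "c *\<^sub>C x - c *\<^sub>C proj S x = c *\<^sub>C (x - proj S x)" by (simp add: complex_vector.scale_right_diff_distrib)
    show "ip (c *\<^sub>C x - c *\<^sub>C proj S x) v = 0"
      unfolding eq using proj_orth[OF x v] x v S_carr by (auto simp: ip_scale_left)
  qed (use x proj_mem complex_vector.subspace_scale[OF S(1)] in auto)
qed

lemma proj_nrm_le: assumes u: "u \<in> carr" shows "nrm (proj S u) \<le> nrm u"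
proof -
  have "(nrm ((u - proj S u) + proj S u))\<^sup>2 = (nrm (u - proj S u))\<^sup>2 + (nrm (proj S u))\<^sup>2"
    by (rule pythagoras) (use u proj_orth[OF u proj_mem[OF u]] in auto)
  then have "(nrm (proj S u))\<^sup>2 \<le> (nrm u)\<^sup>2" by simp
  then show ?thesis by (rule power2_le_imp_le) (use u in simp)
qed

end

lemma dense_sequence:
  assumes "hdense H D" "u \<in> carr"
  obtains x :: "nat \<Rightarrow> 'a" where "\<And>k. x k \<in> D" "\<And>k. x k \<in> carr" "(\<lambda>k. nrm (x k - u)) \<longlonglongrightarrow> 0"
proof -
  have "\<exists>y. y \<in> D \<and> y \<in> carr \<and> nrm (u - y) < inverse (real (Suc k))" for k
    using hdenseD[OF assms, of "inverse (real (Suc k))"] by auto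
  then obtain x where x: "\<And>k. x k \<in> D" "\<And>k. x k \<in> carr" "\<And>k. nrm (u - x k) < inverse (real (Suc k))" by metis
  have "(\<lambda>k. nrm (x k - u)) \<longlonglongrightarrow> 0"
  proof (rule tendsto_sandwich[OF _ _ tendsto_const LIMSEQ_inverse_real_of_nat])
    show "\<forall>\<^sub>F k in sequentially. nrm (x k - u) \<le> inverse (real (Suc k))"
      using x(3) nrm_diff_commute[OF x(2) assms(2)] by (intro always_eventually allI) (simp add: less_imp_le)
  qed (use x(2) assms(2) in auto)
  with x(1,2) show ?thesis using that by blast
qed

lemma form_tendsto:
  assumes b: "bounded_sesquilinear H b" and x: "\<And>k::nat. x k \<in> carr" "u \<in> carr" "(\<lambda>k. nrm (x k - u)) \<longlonglongrightarrow> 0"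
  shows "(\<lambda>k. b (x k) (x k)) \<longlonglongrightarrow> b u u"
proof -
  obtain C where C: "C > 0" "\<And>x y. x \<in> carr \<Longrightarrow> y \<in> carr \<Longrightarrow> cmod (b x y) \<le> C * nrm x * nrm y"
    using form_bound[OF b] by blast
  have sb: "sesquilinear_on carr b" using b unfolding bounded_sesquilinear_def by blast
  have bound: "norm (b (x k) (x k) - b u u) \<le> C * nrm (x k - u) * nrm (x k) + C * nrm u * nrm (x k - u)" for k
  proof -
    have "b (x k) (x k) - b u u = b (x k - u) (x k) + b u (x k - u)"
      using x(1)[of k] x(2) by (simp add: form_diff_left[OF subspace_carr sb] form_diff_right[OF subspace_carr sb])
    then show ?thesis
      using norm_triangle_ineq[of "b (x k - u) (x k)" "b u (x k - u)"]
        C(2)[OF mem_diff[OF x(1)[of k] x(2)] x(1)[of k]] C(2)[OF x(2) mem_diff[OF x(1)[of k] x(2)]] by simp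
  qed
  have "(\<lambda>k. C * nrm (x k - u) * nrm (x k) + C * nrm u * nrm (x k - u)) \<longlonglongrightarrow> C * 0 * nrm u + C * nrm u * 0"
    by (intro tendsto_intros x nrm_tendsto)
  then have "(\<lambda>k. C * nrm (x k - u) * nrm (x k) + C * nrm u * nrm (x k - u)) \<longlonglongrightarrow> 0" by simp
  then have "(\<lambda>k. b (x k) (x k) - b u u) \<longlonglongrightarrow> 0"
    by (rule Lim_null_comparison[rotated]) (simp add: bound)
  then show ?thesis by (simp add: LIM_zero_iff)
qed

text \<open>Both sides are continuous along a norm-convergent sequence. This permits checking
  coercivity of the exterior form on finite sums of modes only.\<close>

lemma coercive_dense:
  assumes b: "bounded_sesquilinear H b" and D: "hdense H D"
    and co: "\<And>u. u \<in> D \<Longrightarrow> g * (nrm u)\<^sup>2 \<le> Re (b u u)" and u: "u \<in> carr"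
  shows "g * (nrm u)\<^sup>2 \<le> Re (b u u)"
proof -
  obtain x :: "nat \<Rightarrow> 'a" where x: "\<And>k. x k \<in> D" "\<And>k. x k \<in> carr" "(\<lambda>k. nrm (x k - u)) \<longlonglongrightarrow> 0"
    using dense_sequence[OF D u] by blast
  have "(\<lambda>k. g * (nrm (x k))\<^sup>2) \<longlonglongrightarrow> g * (nrm u)\<^sup>2" by (intro tendsto_intros nrm_tendsto x u)
  moreover have "(\<lambda>k. Re (b (x k) (x k))) \<longlonglongrightarrow> Re (b u u)" by (intro tendsto_intros form_tendsto b x u)
  ultimately show ?thesis by (rule LIMSEQ_le) (use co x(1) in blast)
qed

text \<open>The image of the unit ball is totally bounded, so it has a finite \<open>e\<close>-net.
  Projecting onto the span of the net is at least as good as choosing the nearest point of it, and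
  the estimate scales to all \<open>u\<close>.\<close>

lemma compact_op_net:
  assumes K: "compact_op H H K" and e: "e > 0"
  obtains E where "orthonormal E" "\<And>u. u \<in> carr \<Longrightarrow> nrm (K u - oproj E (K u)) \<le> e * nrm u"
proof -
  have bK: "bounded_op H H K" using K unfolding compact_op_def by blast
  let ?B = "{x \<in> carr. nrm x \<le> 1}"
  have KB: "K ` ?B \<subseteq> carr" using bounded_opD(1)[OF bK] by blast
  have "M.mtotally_bounded (M.mtopology closure_of (K ` ?B))"
    using K unfolding compact_op_def htop_def by (intro M.compactin_imp_mtotally_bounded) blast
  then have "M.mtotally_bounded (K ` ?B)"
    by (rule M.mtotally_bounded_subset) (simp add: closure_of_subset KB)
  then obtain B where B: "finite B" "B \<subseteq> K ` ?B" "K ` ?B \<subseteq> (\<Union>x\<in>B. M.mball x e)"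
    using e unfolding M.mtotally_bounded_def by meson
  obtain E where E: "orthonormal E" "cspan E = cspan B" using Gram_Schmidt[OF B(1)] B(2) KB by blast
  have 1: "nrm (K u - oproj E (K u)) \<le> e" if u: "u \<in> ?B" for u
  proof -
    obtain b where b: "b \<in> B" "K u \<in> M.mball b e" using B(3) u by blast
    have bc: "b \<in> carr" "K u \<in> carr" using b B(2) KB u by auto
    have "nrm (K u - b) < e" using b(2) bc by (simp add: M.in_mball hdist_def nrm_diff_commute)
    moreover have "b \<in> cspan E" unfolding E(2) by (rule complex_vector.span_base[OF b(1)])
    ultimately show ?thesis using oproj_best[OF E(1) bc(2), of b] by linarith
  qed
  have "nrm (K u - oproj E (K u)) \<le> e * nrm u" if u: "u \<in> carr" for u
  proof (cases "u = 0")
    case True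
    have "K 0 = 0" using clinear_on_0[OF subspace_carr bounded_opD(2)[OF bK]] .
    moreover have "oproj E 0 = 0" using oproj_fixed[OF E(1) complex_vector.span_zero] .
    ultimately show ?thesis using True by simp
  next
    case False
    define c where "c = complex_of_real (nrm u)"
    have c: "c \<noteq> 0" "cmod c = nrm u" using nrm_pos[OF u False] by (simp_all add: c_def)
    define x where "x = inverse c *\<^sub>C u"
    have x: "x \<in> ?B" using u c nrm_pos[OF u False] False by (simp add: x_def norm_inverse)
    have ux: "u = c *\<^sub>C x" using c by (simp add: x_def)
    have Kx: "K x \<in> carr" using bounded_opD(1)[OF bK] x by blast
    have "K u = c *\<^sub>C K x" using clinear_onD(2)[OF bounded_opD(2)[OF bK]] x ux by blast
    moreover have "oproj E (c *\<^sub>C K x) = c *\<^sub>C oproj E (K x)"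
      unfolding oproj_def complex_vector.scale_sum_right using orthonormalD(2)[OF E(1)] Kx
      by (intro sum.cong) (auto simp: ip_scale_left subset_iff)
    ultimately have "K u - oproj E (K u) = c *\<^sub>C (K x - oproj E (K x))"
      by (simp add: complex_vector.scale_right_diff_distrib)
    then have "nrm (K u - oproj E (K u)) = nrm u * nrm (K x - oproj E (K x))"
      using Kx E(1) c by simp
    also have "\<dots> \<le> nrm u * e" using 1[OF x] u by (intro mult_left_mono) auto
    finally show ?thesis by (simp add: mult.commute)
  qed
  with E(1) show ?thesis using that by blast
qed

text \<open>The representation has exactly the shape of the data \<open>n\<close>, \<open>A\<close>,
  \<open>B\<close> of \<open>fredholm_form\<close>, and is required on the carrier only.\<close>

definition finite_rank :: "('a \<Rightarrow> 'a \<Rightarrow> complex) \<Rightarrow> bool"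
  where "finite_rank f \<longleftrightarrow> (\<exists>n A B. (\<forall>j<n::nat. bounded_functional H (A j) \<and> bounded_functional H (B j)) \<and>
    (\<forall>u\<in>carr. \<forall>v\<in>carr. f u v = (\<Sum>j<n. A j u * cnj (B j v))))"

lemma finite_rank_rank1:
  assumes "bounded_functional H a" "bounded_functional H b"
  shows "finite_rank (\<lambda>u v. a u * cnj (b v))"
  unfolding finite_rank_def
  by (rule exI[of _ 1], rule exI[of _ "\<lambda>_. a"], rule exI[of _ "\<lambda>_. b"]) (use assms in simp)

lemma finite_rank_add:
  assumes "finite_rank f" "finite_rank h"
  shows "finite_rank (\<lambda>u v. f u v + h u v)"
proof -
  obtain n A B where f: "\<And>j. j < n \<Longrightarrow> bounded_functional H (A j)" "\<And>j. j < (n::nat) \<Longrightarrow> bounded_functional H (B j)"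
      "\<And>u v. u \<in> carr \<Longrightarrow> v \<in> carr \<Longrightarrow> f u v = (\<Sum>j<n. A j u * cnj (B j v))"
    using assms(1) unfolding finite_rank_def by blast
  obtain m A' B' where h: "\<And>j. j < m \<Longrightarrow> bounded_functional H (A' j)" "\<And>j. j < (m::nat) \<Longrightarrow> bounded_functional H (B' j)"
      "\<And>u v. u \<in> carr \<Longrightarrow> v \<in> carr \<Longrightarrow> h u v = (\<Sum>j<m. A' j u * cnj (B' j v))"
    using assms(2) unfolding finite_rank_def by blast
  let ?A = "\<lambda>j. if j < n then A j else A' (j - n)" and ?B = "\<lambda>j. if j < n then B j else B' (j - n)"
  have "(\<Sum>j<n + m. ?A j u * cnj (?B j v)) = (\<Sum>j<n. A j u * cnj (B j v)) + (\<Sum>j<m. A' j u * cnj (B' j v))" for u v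
  proof -
    have "(\<Sum>j<n + m. ?A j u * cnj (?B j v)) = (\<Sum>j<n. ?A j u * cnj (?B j v)) + (\<Sum>j<m. ?A (n + j) u * cnj (?B (n + j) v))"
      by (induction m) simp_all
    then show ?thesis by simp
  qed
  then show ?thesis
    unfolding finite_rank_def using f h by (intro exI[of _ "n + m"] exI[of _ ?A] exI[of _ ?B]) auto
qed

lemma finite_rank_sum:
  assumes "finite I" "\<And>i. i \<in> I \<Longrightarrow> finite_rank (f i)"
  shows "finite_rank (\<lambda>u v. \<Sum>i\<in>I. f i u v)"
  using assms
proof (induction I rule: finite_induct)
  case empty
  show ?case unfolding finite_rank_def by (rule exI[of _ 0]) simp
next
  case (insert i I)
  then show ?case using finite_rank_add[of "f i" "\<lambda>u v. \<Sum>i\<in>I. f i u v"] by simp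
qed

text \<open>\<open>op_norm\<close> is a supremum of reals; boundedness of \<open>R\<close> is what
  makes it an upper bound.\<close>

lemma op_norm_bound:
  assumes R: "bounded_op H K R" and K: "hilbert_space K" and u: "u \<in> carr"
  shows "hnorm K (R u) \<le> op_norm H K R * nrm u"
proof -
  interpret K: hilbert K by (rule hilbertD[OF K])
  obtain C where C: "C > 0" "\<And>x. x \<in> carr \<Longrightarrow> hnorm K (R x) \<le> C * nrm x" using op_bound[OF R] by blast
  let ?B = "{x \<in> carr. nrm x \<le> 1}"
  have bdd: "bdd_above ((\<lambda>x. hnorm K (R x)) ` ?B)"
  proof (rule bdd_aboveI2)
    fix x assume "x \<in> ?B"
    then show "hnorm K (R x) \<le> C" using order_trans[OF C(2)[of x] mult_left_mono[of "nrm x" 1 C]] C(1) by simp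
  qed
  show ?thesis
  proof (cases "u = 0")
    case True
    have "R 0 = 0" using clinear_on_0[OF subspace_carr bounded_opD(2)[OF R]] .
    then show ?thesis using True by simp
  next
    case False
    define c where "c = complex_of_real (nrm u)"
    have c: "c \<noteq> 0" "cmod c = nrm u" using nrm_pos[OF u False] by (simp_all add: c_def)
    define x where "x = inverse c *\<^sub>C u"
    have x: "x \<in> ?B" using u c nrm_pos[OF u False] False by (simp add: x_def norm_inverse)
    have ux: "u = c *\<^sub>C x" using c by (simp add: x_def)
    have Rx: "R x \<in> hcarrier K" using bounded_opD(1)[OF R] x by blast
    have "R u = c *\<^sub>C R x" using clinear_onD(2)[OF bounded_opD(2)[OF R]] x ux by blast
    then have "hnorm K (R u) = nrm u * hnorm K (R x)" using Rx c by simp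
    also have "\<dots> \<le> nrm u * op_norm H K R"
      unfolding op_norm_def using cSUP_upper[OF x bdd] u by (intro mult_left_mono) auto
    finally show ?thesis by (simp add: mult.commute)
  qed
qed

text \<open>If \<open>T'\<close> and \<open>R\<close> approximate \<open>T\<close> and its right
  inverse \<open>Ti\<close>, then \<open>T'\<close> after \<open>R\<close> is close to the identity
  on \<open>W i\<close>. The form \<open>ip (T' (R u)) v\<close> is therefore coercive there, and
  Lax-Milgram shows that \<open>T'\<close> is onto.\<close>

lemma discretizable_if_inverse:
  assumes W: "\<forall>\<^sub>F i in F. csubspace (W i) \<and> closedin (htop H) (W i)"
    and T: "bounded_op H H T" and Ti: "bounded_op H H Ti" and inv: "\<And>u. u \<in> carr \<Longrightarrow> T (Ti u) = u"
    and aT: "\<And>e. e > 0 \<Longrightarrow> \<forall>\<^sub>F i in F. \<exists>T'. bounded_op (hsub H (W i)) (hsub H (W i)) T' \<and> (\<forall>u\<in>W i. nrm (T' u - T u) \<le> e * nrm u)"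
    and aTi: "\<And>e. e > 0 \<Longrightarrow> \<forall>\<^sub>F i in F. \<exists>T'. bounded_op (hsub H (W i)) (hsub H (W i)) T' \<and> (\<forall>u\<in>W i. nrm (T' u - Ti u) \<le> e * nrm u)"
  shows "discretizable H W F T"
  unfolding discretizable_def
proof (intro allI impI)
  fix e :: real assume e: "e > 0"
  obtain C where C: "C > 0" "\<And>x. x \<in> carr \<Longrightarrow> nrm (T x) \<le> C * nrm x" using op_bound[OF T] by blast
  obtain Ci where Ci: "Ci > 0" "\<And>x. x \<in> carr \<Longrightarrow> nrm (Ti x) \<le> Ci * nrm x" using op_bound[OF Ti] by blast
  \<comment> \<open>The distance of \<open>T' (R u)\<close> to \<open>u\<close> will be at most
    \<open>d * (C + Ci + 1) * nrm u\<close>; the choice makes it half of \<open>nrm u\<close>.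
    \<open>d \<le> 1\<close> is used to bound \<open>R\<close>.\<close>
  define d where "d = min e (min 1 (1 / (2 * (C + Ci + 1))))"
  have d: "d > 0" using e C(1) Ci(1) by (simp add: d_def)
  have d': "d \<le> e" "d \<le> 1" unfolding d_def by (rule min.cobounded1, rule min.coboundedI2, rule min.cobounded1)
  have "d \<le> 1 / (2 * (C + Ci + 1))" by (simp add: d_def)
  then have d2: "d * (C + Ci + 1) \<le> 1/2" using C(1) Ci(1) by (simp add: field_simps)
  from aT[OF d] aTi[OF d] W
  show "\<forall>\<^sub>F i in F. \<exists>T'. bounded_op (hsub H (W i)) (hsub H (W i)) T' \<and> W i \<subseteq> T' ` W i \<and> (\<forall>u\<in>W i. nrm (T' u - T u) \<le> e * nrm u)"
  proof eventually_elim
    case (elim i)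
    have Wc: "W i \<subseteq> carr" using elim closedin_iff by blast
    interpret Wi: hilbert "hsub H (W i)" using hilbert_hsub elim by unfold_locales blast
    obtain T' where T': "bounded_op (hsub H (W i)) (hsub H (W i)) T'" "\<And>u. u \<in> W i \<Longrightarrow> nrm (T' u - T u) \<le> d * nrm u"
      using elim by blast
    obtain R where R: "bounded_op (hsub H (W i)) (hsub H (W i)) R" "\<And>u. u \<in> W i \<Longrightarrow> nrm (R u - Ti u) \<le> d * nrm u"
      using elim by blast
    have T'm: "T' u \<in> W i" and Rm: "R u \<in> W i" if "u \<in> W i" for u
      using bounded_opD(1)[OF T'(1)] bounded_opD(1)[OF R(1)] that by auto
    note T'l = clinear_onD[OF bounded_opD(2)[OF T'(1), unfolded hcarrier_hsub]]
      and Rl = clinear_onD[OF bounded_opD(2)[OF R(1), unfolded hcarrier_hsub]]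
    obtain C1 where C1: "C1 > 0" "\<And>x. x \<in> W i \<Longrightarrow> nrm (T' x) \<le> C1 * nrm x"
      using Wi.op_bound[OF T'(1)] by auto
    obtain C2 where C2: "C2 > 0" "\<And>x. x \<in> W i \<Longrightarrow> nrm (R x) \<le> C2 * nrm x"
      using Wi.op_bound[OF R(1)] by auto
    let ?b = "\<lambda>u v. ip (T' (R u)) v"
    have sum: "x + y \<in> W i" and scale: "c *\<^sub>C x \<in> W i" if "x \<in> W i" "y \<in> W i" for x y c
      using that Wi.mem_add[of x y] Wi.mem_scale[of x c] by auto
    have sub: "x \<in> carr" if "x \<in> W i" for x using that Wc by blast
    have "W i \<subseteq> T' ` W i"
    proof
      fix z assume z: "z \<in> W i"
      have b: "bounded_sesquilinear (hsub H (W i)) ?b"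
      proof (rule bounded_sesquilinearI[where C = "C1 * C2"])
        show "sesquilinear_on (hcarrier (hsub H (W i))) ?b"
          by (rule sesquilinear_onI)
            (simp_all add: T'l Rl T'm Rm sub ip_add_left ip_add_right ip_scale_left ip_scale_right)
        fix x y assume "x \<in> hcarrier (hsub H (W i))" "y \<in> hcarrier (hsub H (W i))"
        then have xy: "x \<in> W i" "y \<in> W i" by auto
        have "nrm (T' (R x)) \<le> C1 * (C2 * nrm x)"
          using order_trans[OF C1(2)[OF Rm[OF xy(1)]] mult_left_mono[OF C2(2)[OF xy(1)], of C1]] C1(1) by simp
        then show "cmod (?b x y) \<le> C1 * C2 * hnorm (hsub H (W i)) x * hnorm (hsub H (W i)) y"
          using order_trans[OF Cauchy_Schwarz[OF sub[OF T'm[OF Rm[OF xy(1)]]] sub[OF xy(2)]] mult_right_mono[of _ "C1 * (C2 * nrm x)" "nrm y"]]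
            sub[OF xy(2)] by (simp add: mult.assoc)
      qed
      have co: "1/2 * (hnorm (hsub H (W i)) u)\<^sup>2 \<le> Re (?b u u)" if "u \<in> hcarrier (hsub H (W i))" for u
      proof -
        have uW: "u \<in> W i" using that by simp
        note u = sub[OF uW] and Ru = sub[OF Rm[OF uW]] and TRu = sub[OF T'm[OF Rm[OF uW]]]
        have Tiu: "Ti u \<in> carr" by (rule bounded_opD(1)[OF Ti u])
        have TR: "T (R u) \<in> carr" by (rule bounded_opD(1)[OF T Ru])
        have TRTi: "T (R u - Ti u) \<in> carr" by (rule bounded_opD(1)[OF T mem_diff[OF Ru Tiu]])
        \<comment> \<open>Splits the error into that of \<open>T'\<close> at \<open>R u\<close> and
          the image under \<open>T\<close> of the error of \<open>R\<close>, by
          \<open>T (Ti u) = u\<close>.\<close>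
        have eq: "T' (R u) - u = (T' (R u) - T (R u)) + T (R u - Ti u)"
          using clinear_on_diff[OF subspace_carr bounded_opD(2)[OF T] Ru Tiu] inv[OF u] by simp
        have "nrm (T' (R u) - u) \<le> nrm (T' (R u) - T (R u)) + nrm (T (R u - Ti u))"
          unfolding eq by (rule nrm_triangle[OF mem_diff[OF TRu TR] TRTi])
        also have "\<dots> \<le> d * nrm (R u) + C * (d * nrm u)"
          using order_trans[OF C(2)[OF mem_diff[OF Ru Tiu]] mult_left_mono[OF R(2)[OF uW], of C]] C(1)
          by (intro add_mono T'(2) Rm uW) auto
        also have "nrm (R u) \<le> (Ci + 1) * nrm u"
        proof -
          have "nrm (R u) \<le> nrm (R u - Ti u) + nrm (Ti u)" using nrm_triangle[OF mem_diff[OF Ru Tiu] Tiu] by simp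
          also have "\<dots> \<le> d * nrm u + Ci * nrm u" by (intro add_mono R(2) uW Ci(2) u)
          also have "d * nrm u \<le> 1 * nrm u" using d'(2) u by (intro mult_right_mono) auto
          finally show ?thesis by (simp add: algebra_simps)
        qed
        then have "d * nrm (R u) + C * (d * nrm u) \<le> d * ((Ci + 1) * nrm u) + C * (d * nrm u)"
          using d by simp
        also have "\<dots> = (d * (C + Ci + 1)) * nrm u" by (simp add: algebra_simps)
        also have "\<dots> \<le> 1/2 * nrm u" using d2 u by (intro mult_right_mono) auto
        finally have le: "nrm (T' (R u) - u) \<le> 1/2 * nrm u" .
        have "cmod (ip (T' (R u) - u) u) \<le> 1/2 * nrm u * nrm u"
          using order_trans[OF Cauchy_Schwarz[OF mem_diff[OF TRu u] u] mult_right_mono[OF le, of "nrm u"]] u by simp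
        then have "\<bar>Re (ip (T' (R u)) u) - Re (ip u u)\<bar> \<le> 1/2 * nrm u * nrm u"
          using abs_Re_le_cmod[of "ip (T' (R u) - u) u"] ip_diff_left[OF TRu u u] by simp
        moreover have "nrm u * nrm u = Re (ip u u)" using nrm_sq[OF u] by (simp add: power2_eq_square)
        ultimately show ?thesis unfolding hnorm_hsub power2_eq_square by linarith
      qed
      have "bounded_functional (hsub H (W i)) (\<lambda>v. ip v z)" using Wi.bounded_functional_ip[of z] z by simp
      then obtain u where u: "u \<in> W i" "\<And>v. v \<in> W i \<Longrightarrow> ip (T' (R u)) v = cnj (ip v z)"
        using Wi.Lax_Milgram[OF b _ co, of "\<lambda>v. ip v z"] by auto
      have "T' (R u) = z"
      proof (rule Wi.ip_eqI)
        fix v assume "v \<in> hcarrier (hsub H (W i))"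
        then show "hinner (hsub H (W i)) (T' (R u)) v = hinner (hsub H (W i)) z v"
          using u(2)[of v] ip_commute[of v z] sub z by simp
      qed (use T'm Rm u z in auto)
      then show "z \<in> T' ` W i" using Rm[OF u(1)] by blast
    qed
    moreover have "nrm (T' u - T u) \<le> e * nrm u" if "u \<in> W i" for u
      using order_trans[OF T'(2)[OF that] mult_right_mono[OF d'(1)]] sub[OF that] by simp
    ultimately show ?case using T'(1) by blast
  qed
qed

end

section \<open>Hilbert space tensor products\<close>

context
  fixes H :: "'a::complex_vector hspace" and K :: "'b::complex_vector hspace"
    and t :: "'a \<Rightarrow> 'b \<Rightarrow> 'c::complex_vector" and W :: "'c hspace"
  assumes H: "hilbert_space H" and K: "hilbert_space K" and W: "hilbert_tensor H K t W"
begin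

interpretation H: hilbert H by (rule hilbertD[OF H])
interpretation K: hilbert K by (rule hilbertD[OF K])

lemma tensor_hilbert: "hilbert_space W"
  using W unfolding hilbert_tensor_def by blast

lemma tensor_dense: "hdense W (tensor_span t (hcarrier H) (hcarrier K))"
  using W unfolding hilbert_tensor_def by blast

lemma tensor_linear_right: "x \<in> hcarrier H \<Longrightarrow> clinear_on (hcarrier K) (t x)"
  and tensor_linear_left: "y \<in> hcarrier K \<Longrightarrow> clinear_on (hcarrier H) (\<lambda>x. t x y)"
  using W unfolding hilbert_tensor_def by blast+

lemma tensor_mem: "x \<in> hcarrier H \<Longrightarrow> y \<in> hcarrier K \<Longrightarrow> t x y \<in> hcarrier W"
proof -
  assume "x \<in> hcarrier H" "y \<in> hcarrier K"
  then have "t x y \<in> tensor_span t (hcarrier H) (hcarrier K)"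
    unfolding tensor_span_def by (intro complex_vector.span_base) blast
  then show ?thesis using tensor_dense unfolding hdense_def by blast
qed

lemma tensor_inner: "x \<in> hcarrier H \<Longrightarrow> y \<in> hcarrier K \<Longrightarrow> x' \<in> hcarrier H \<Longrightarrow> y' \<in> hcarrier K \<Longrightarrow>
    hinner W (t x y) (t x' y') = hinner H x x' * hinner K y y'"
proof -
  have "\<forall>x\<in>hcarrier H. \<forall>y\<in>hcarrier K. \<forall>x'\<in>hcarrier H. \<forall>y'\<in>hcarrier K.
      hinner W (t x y) (t x' y') = hinner H x x' * hinner K y y'"
    using W unfolding hilbert_tensor_def by (elim conjE)
  then show "x \<in> hcarrier H \<Longrightarrow> y \<in> hcarrier K \<Longrightarrow> x' \<in> hcarrier H \<Longrightarrow> y' \<in> hcarrier K \<Longrightarrow>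
    hinner W (t x y) (t x' y') = hinner H x x' * hinner K y y'" by simp
qed

lemma tensor_norm: "x \<in> hcarrier H \<Longrightarrow> y \<in> hcarrier K \<Longrightarrow> hnorm W (t x y) = hnorm H x * hnorm K y"
proof -
  assume xy: "x \<in> hcarrier H" "y \<in> hcarrier K"
  have "hinner W (t x y) (t x y) = of_real ((hnorm H x * hnorm K y)\<^sup>2)"
    using xy tensor_inner[of x y x y] by (simp add: H.ip_self K.ip_self power_mult_distrib)
  then show ?thesis using xy by (simp add: hnorm_def[of W] del: of_real_power)
qed

lemma tensor_add_left: "x \<in> hcarrier H \<Longrightarrow> x' \<in> hcarrier H \<Longrightarrow> y \<in> hcarrier K \<Longrightarrow> t (x + x') y = t x y + t x' y"
  and tensor_scale_left: "x \<in> hcarrier H \<Longrightarrow> y \<in> hcarrier K \<Longrightarrow> t (c *\<^sub>C x) y = c *\<^sub>C t x y"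
  and tensor_diff_left: "x \<in> hcarrier H \<Longrightarrow> x' \<in> hcarrier H \<Longrightarrow> y \<in> hcarrier K \<Longrightarrow> t (x - x') y = t x y - t x' y"
  and tensor_scale_right: "x \<in> hcarrier H \<Longrightarrow> y \<in> hcarrier K \<Longrightarrow> t x (c *\<^sub>C y) = c *\<^sub>C t x y"
  and tensor_diff_right: "x \<in> hcarrier H \<Longrightarrow> y \<in> hcarrier K \<Longrightarrow> y' \<in> hcarrier K \<Longrightarrow> t x (y - y') = t x y - t x y'"
  and tensor_0_left: "y \<in> hcarrier K \<Longrightarrow> t 0 y = 0"
  using clinear_onD[OF tensor_linear_left] clinear_onD[OF tensor_linear_right]
    clinear_on_diff[OF H.subspace_carr tensor_linear_left] clinear_on_diff[OF K.subspace_carr tensor_linear_right]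
    clinear_on_0[OF H.subspace_carr tensor_linear_left]
  by simp_all

end

lemma tensor_span_mono: "X \<subseteq> X' \<Longrightarrow> Y \<subseteq> Y' \<Longrightarrow> tensor_span t X Y \<subseteq> tensor_span t X' Y'"
  unfolding tensor_span_def by (intro complex_vector.span_mono) blast

lemma subspace_tensor_span: "csubspace (tensor_span t X Y)"
  unfolding tensor_span_def by (rule complex_vector.subspace_span)

lemma tensor_span_base: "x \<in> X \<Longrightarrow> y \<in> Y \<Longrightarrow> t x y \<in> tensor_span t X Y"
  unfolding tensor_span_def by (intro complex_vector.span_base) blast

text \<open>Induction over sums of elementary tensors for a linear relation \<open>R\<close> instead
  of a map: no well-definedness on tensors has to be shown, and the partner stays in the subspace
  \<open>X\<close>.\<close>

lemma tensor_span_related: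
  assumes w: "w \<in> tensor_span t X Y" and X: "csubspace X"
    and base: "\<And>x y. x \<in> X \<Longrightarrow> y \<in> Y \<Longrightarrow> \<exists>z\<in>X. R (t x y) z" and zero: "R 0 0"
    and add: "\<And>w x w' x'. x \<in> X \<Longrightarrow> x' \<in> X \<Longrightarrow> R w x \<Longrightarrow> R w' x' \<Longrightarrow> R (w + w') (x + x')"
    and scale: "\<And>c w x. x \<in> X \<Longrightarrow> R w x \<Longrightarrow> R (c *\<^sub>C w) (c *\<^sub>C x)"
  shows "\<exists>x\<in>X. R w x"
proof -
  have "complex_vector.subspace {w. \<exists>x\<in>X. R w x}"
    unfolding complex_vector.subspace_def
  proof (intro conjI ballI allI)
    show "0 \<in> {w. \<exists>x\<in>X. R w x}" using zero complex_vector.subspace_0[OF X] by blast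
    show "v + w \<in> {w. \<exists>x\<in>X. R w x}" if "v \<in> {w. \<exists>x\<in>X. R w x}" "w \<in> {w. \<exists>x\<in>X. R w x}" for v w
      using that add complex_vector.subspace_add[OF X] by blast
    show "c *\<^sub>C w \<in> {w. \<exists>x\<in>X. R w x}" if "w \<in> {w. \<exists>x\<in>X. R w x}" for c w
      using that scale complex_vector.subspace_scale[OF X] by blast
  qed
  then have "tensor_span t X Y \<subseteq> {w. \<exists>x\<in>X. R w x}"
    unfolding tensor_span_def by (intro complex_vector.span_minimal) (use base in auto)
  then show ?thesis using w by blast
qed

text \<open>If \<open>x \<otimes> p\<close> lies in the smaller tensor product, approximate it there by sums \<open>w k\<close> of elementary
  tensors. The slices \<open>z k\<close>, for which \<open>w k - z k \<otimes> p\<close> is orthogonal to all \<open>x' \<otimes> p\<close>, are the same for both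
  inner products; they converge in \<open>H2\<close> and their limit in \<open>H1\<close> is \<open>x\<close>.\<close>

lemma tensor_slice_mem:
  assumes H1: "hilbert_space H1" and H2: "hilbert_space H2" and K: "hilbert_space K"
    and W1: "hilbert_tensor H1 K t W1" and W2: "hilbert_tensor H2 K t W2"
    and H21: "cont_embedded H2 H1" and W21: "cont_embedded W2 W1"
    and p: "p \<in> hcarrier K" "p \<noteq> 0" and x: "x \<in> hcarrier H1" "t x p \<in> hcarrier W2"
  shows "x \<in> hcarrier H2"
proof -
  interpret H1: hilbert H1 by (rule hilbertD[OF H1])
  interpret H2: hilbert H2 by (rule hilbertD[OF H2])
  interpret K: hilbert K by (rule hilbertD[OF K])
  interpret W1: hilbert W1 by (rule hilbertD[OF tensor_hilbert[OF H1 K W1]])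
  interpret W2: hilbert W2 by (rule hilbertD[OF tensor_hilbert[OF H2 K W2]])
  note H21m = cont_embeddedD[OF H21] and W21m = cont_embeddedD[OF W21]
  note t1 = tensor_mem[OF H1 K W1] and t2 = tensor_mem[OF H2 K W2]
  note i1 = tensor_inner[OF H1 K W1] and i2 = tensor_inner[OF H2 K W2]
  define np where "np = hnorm K p"
  have np: "np > 0" unfolding np_def by (rule K.nrm_pos[OF p])
  \<comment> \<open>\<open>z\<close> is the slice of \<open>w\<close> along \<open>p\<close>.
    Demanding orthogonality in \<open>W1\<close> and \<open>W2\<close> at once makes the same slice
    usable for convergence in \<open>H2\<close> and for identifying the limit in
    \<open>H1\<close>.\<close>
  define R where "R = (\<lambda>w z. w \<in> hcarrier W2 \<and>
    (\<forall>x'\<in>hcarrier H2. hinner W2 (w - t z p) (t x' p) = 0) \<and>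
    (\<forall>x'\<in>hcarrier H1. hinner W1 (w - t z p) (t x' p) = 0))"
  have slice: "\<exists>z\<in>hcarrier H2. R w z" if "w \<in> tensor_span t (hcarrier H2) (hcarrier K)" for w
  proof (rule tensor_span_related[OF that H2.subspace_carr])
    fix x y assume xy: "x \<in> hcarrier H2" "y \<in> hcarrier K"
    \<comment> \<open>The coefficient of \<open>p\<close> in \<open>y\<close>. It is computed in
      \<open>K\<close> alone, the common second factor, and so serves both tensor products.\<close>
    define c where "c = hinner K y p / of_real (np\<^sup>2)"
    have cp: "c * hinner K p p = hinner K y p"
      using np p by (simp add: c_def K.ip_self np_def)
    note x1 = H21m[OF xy(1)]
    have "R (t x y) (c *\<^sub>C x)"
      unfolding R_def using xy x1 p cp
      by (simp add: t2 t1 W2.ip_diff_left W1.ip_diff_left tensor_scale_left[OF H2 K W2] W2.ip_scale_left W1.ip_scale_left i1 i2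
          mult.left_commute[of c])
    then show "\<exists>z\<in>hcarrier H2. R (t x y) z" using xy by blast
  next
    show "R 0 0" unfolding R_def using p by (simp add: tensor_0_left[OF H2 K W2] t1 t2)
  next
    fix w z w' z' assume z: "z \<in> hcarrier H2" "z' \<in> hcarrier H2" and R: "R w z" "R w' z'"
    have eq: "w + w' - t (z + z') p = (w - t z p) + (w' - t z' p)"
      using z p by (simp add: tensor_add_left[OF H2 K W2])
    show "R (w + w') (z + z')"
      using R unfolding R_def eq using z p
      by (simp add: W2.ip_add_left W1.ip_add_left t1 t2 W21m H21m)
  next
    fix c w z assume z: "z \<in> hcarrier H2" and R: "R w z"
    have eq: "c *\<^sub>C w - t (c *\<^sub>C z) p = c *\<^sub>C (w - t z p)"
      using z p by (simp add: tensor_scale_left[OF H2 K W2] complex_vector.scale_right_diff_distrib)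
    show "R (c *\<^sub>C w) (c *\<^sub>C z)"
      using R unfolding R_def eq using z p
      by (simp add: W2.ip_scale_left W1.ip_scale_left t1 t2 W21m H21m)
  qed
  obtain w :: "nat \<Rightarrow> _" where w: "\<And>k. w k \<in> tensor_span t (hcarrier H2) (hcarrier K)" "\<And>k. w k \<in> hcarrier W2"
      "(\<lambda>k. hnorm W2 (w k - t x p)) \<longlonglongrightarrow> 0"
    using W2.dense_sequence[OF tensor_dense[OF H2 K W2] x(2)] by blast
  obtain z where z: "\<And>k. z k \<in> hcarrier H2" "\<And>k. R (w k) (z k)" using slice[OF w(1)] by metis
  have zp2: "t (z k) p \<in> hcarrier W2" for k using t2 z(1) p(1) by blast
  \<comment> \<open>\<open>t (z m - z n) p\<close> is an orthogonal component of
    \<open>w m - w n\<close>, hence not longer.\<close>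
  have est2: "hnorm H2 (z m - z n) * np \<le> hnorm W2 (w m - w n)" for m n
  proof -
    have eq: "w m - w n = ((w m - t (z m) p) - (w n - t (z n) p)) + t (z m - z n) p"
      using z(1) p by (simp add: tensor_diff_left[OF H2 K W2])
    have c: "w m - t (z m) p \<in> hcarrier W2" "w n - t (z n) p \<in> hcarrier W2" using w(2) zp2 by blast+
    have d: "z m - z n \<in> hcarrier H2" using z(1) by blast
    have "hinner W2 ((w m - t (z m) p) - (w n - t (z n) p)) (t (z m - z n) p) = 0"
      using z(2)[of m] z(2)[of n] d c t2[OF d p(1)] unfolding R_def by (simp add: W2.ip_diff_left)
    then have "(hnorm W2 (w m - w n))\<^sup>2 =
        (hnorm W2 ((w m - t (z m) p) - (w n - t (z n) p)))\<^sup>2 + (hnorm W2 (t (z m - z n) p))\<^sup>2"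
      unfolding eq using c t2[OF d p(1)] by (intro W2.pythagoras) auto
    then have "(hnorm W2 (t (z m - z n) p))\<^sup>2 \<le> (hnorm W2 (w m - w n))\<^sup>2" by simp
    then have "hnorm W2 (t (z m - z n) p) \<le> hnorm W2 (w m - w n)"
      by (rule power2_le_imp_le) (use w(2) in auto)
    then show ?thesis using tensor_norm[OF H2 K W2 d p(1)] by (simp add: np_def)
  qed
  have "\<exists>N. \<forall>m\<ge>N. \<forall>n\<ge>N. hnorm H2 (z m - z n) < e" if e: "e > 0" for e
  proof -
    have "\<forall>\<^sub>F k in sequentially. hnorm W2 (w k - t x p) < e * np / 2"
      using order_tendstoD(2)[OF w(3), of "e * np / 2"] e np by simp
    then obtain N where N: "\<And>k. k \<ge> N \<Longrightarrow> hnorm W2 (w k - t x p) < e * np / 2"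
      unfolding eventually_sequentially by blast
    have "hnorm H2 (z m - z n) < e" if "m \<ge> N" "n \<ge> N" for m n
    proof -
      have "hnorm W2 (w m - w n) \<le> hnorm W2 (w m - t x p) + hnorm W2 (w n - t x p)"
        using W2.nrm_triangle3[OF w(2)[of m] x(2) w(2)[of n]] W2.nrm_diff_commute[OF x(2) w(2)[of n]] by simp
      then have "hnorm H2 (z m - z n) * np < e * np" using est2[of m n] N[OF that(1)] N[OF that(2)] by linarith
      then show ?thesis using np by simp
    qed
    then show ?thesis by blast
  qed
  then obtain y where y: "y \<in> hcarrier H2" "(\<lambda>k. hnorm H2 (z k - y)) \<longlonglongrightarrow> 0" using H2.complete[of z, OF z(1)] by blast
  obtain C where C: "C > 0" "\<And>u. u \<in> hcarrier H2 \<Longrightarrow> hnorm H1 u \<le> C * hnorm H2 u" using cont_embedded_bound[OF H21 H2] by blast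
  obtain D where D: "D > 0" "\<And>u. u \<in> hcarrier W2 \<Longrightarrow> hnorm W1 u \<le> D * hnorm W2 u"
    using cont_embedded_bound[OF W21 tensor_hilbert[OF H2 K W2]] by blast
  have est1: "hnorm H1 (z k - x) * np \<le> hnorm W1 (w k - t x p)" for k
  proof -
    have z1: "z k \<in> hcarrier H1" using z(1) H21m by blast
    have eq: "w k - t x p = (w k - t (z k) p) + t (z k - x) p"
      using z1 x p by (simp add: tensor_diff_left[OF H1 K W1])
    have c: "w k - t (z k) p \<in> hcarrier W1" using w(2) zp2 W21m by blast
    have d: "z k - x \<in> hcarrier H1" using z1 x(1) by blast
    have "hinner W1 (w k - t (z k) p) (t (z k - x) p) = 0" using z(2)[of k] d unfolding R_def by blast
    then have "(hnorm W1 (w k - t x p))\<^sup>2 = (hnorm W1 (w k - t (z k) p))\<^sup>2 + (hnorm W1 (t (z k - x) p))\<^sup>2"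
      unfolding eq using c t1[OF d p(1)] by (intro W1.pythagoras) auto
    then have "(hnorm W1 (t (z k - x) p))\<^sup>2 \<le> (hnorm W1 (w k - t x p))\<^sup>2" by simp
    then have "hnorm W1 (t (z k - x) p) \<le> hnorm W1 (w k - t x p)"
      by (rule power2_le_imp_le) (use w(2) W21m x in auto)
    then show ?thesis using tensor_norm[OF H1 K W1 d p(1)] by (simp add: np_def)
  qed
  have y1: "y \<in> hcarrier H1" using y(1) H21m by blast
  have "hnorm H1 (x - y) * np \<le> D * hnorm W2 (w k - t x p) + C * hnorm H2 (z k - y) * np" for k
  proof -
    have z1: "z k \<in> hcarrier H1" using z(1) H21m by blast
    have "hnorm H1 (x - y) \<le> hnorm H1 (z k - x) + hnorm H1 (z k - y)"
      using H1.nrm_triangle3[OF x(1) z1 y1] H1.nrm_diff_commute[OF x(1) z1] by simp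
    then have "hnorm H1 (x - y) * np \<le> hnorm H1 (z k - x) * np + hnorm H1 (z k - y) * np"
      using np by (simp flip: distrib_right)
    also have "hnorm H1 (z k - x) * np \<le> D * hnorm W2 (w k - t x p)"
      using est1[of k] D(2)[OF W2.mem_diff[OF w(2)[of k] x(2)]] by linarith
    also have "hnorm H1 (z k - y) * np \<le> C * hnorm H2 (z k - y) * np"
      using C(2)[OF H2.mem_diff[OF z(1)[of k] y(1)]] np by (intro mult_right_mono) auto
    finally show ?thesis by simp
  qed
  moreover have "(\<lambda>k. D * hnorm W2 (w k - t x p) + C * hnorm H2 (z k - y) * np) \<longlonglongrightarrow> D * 0 + C * 0 * np"
    by (intro tendsto_intros w y)
  ultimately have "hnorm H1 (x - y) * np \<le> D * 0 + C * 0 * np" using LIMSEQ_le_const by blast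
  then have "hnorm H1 (x - y) \<le> 0" using np by (simp add: mult_le_0_iff)
  then have "x = y" using H1.nrm_pos[of "x - y"] x(1) y1 by fastforce
  then show ?thesis using y(1) by simp
qed

text \<open>With a finite orthonormal basis \<open>E\<close> of \<open>Y\<close>, every element is a
  sum of \<open>t (x e) e\<close> with \<open>x e\<close> in \<open>X\<close>, and its norm is
  equivalent to those of the coefficients. Closedness of \<open>X\<close>, possibly
  infinite-dimensional, thus carries over.\<close>

lemma tensor_span_closed:
  assumes H: "hilbert_space H" and K: "hilbert_space K" and W: "hilbert_tensor H K t W"
    and X: "csubspace X" "closedin (htop H) X" and Y: "csubspace Y" "Y \<subseteq> hcarrier K" "fin_dim Y"
    and w: "\<And>k::nat. w k \<in> tensor_span t X Y" "u \<in> hcarrier W" "(\<lambda>k. hnorm W (w k - u)) \<longlonglongrightarrow> 0"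
  shows "u \<in> tensor_span t X Y"
proof -
  interpret H: hilbert H by (rule hilbertD[OF H])
  interpret K: hilbert K by (rule hilbertD[OF K])
  interpret W: hilbert W by (rule hilbertD[OF tensor_hilbert[OF H K W]])
  have XH: "X \<subseteq> hcarrier H" using X(2) H.closedin_iff by blast
  interpret X: hilbert "hsub H X" by (rule hilbertD[OF H.hilbert_hsub[OF X]])
  obtain E where E: "K.orthonormal E" "cspan E = Y" using K.fin_dim_orthonormal_basis[OF Y] by blast
  note finE = K.orthonormalD(1)[OF E(1)]
  have EK: "e \<in> hcarrier K" if "e \<in> E" for e using K.orthonormalD(2)[OF E(1)] that by blast
  have EY: "e \<in> Y" if "e \<in> E" for e using complex_vector.span_base[OF that] E(2) by simp
  define S where "S = (\<lambda>x. \<Sum>e\<in>E. t (x e) e)"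
  have S_mem: "S x \<in> tensor_span t X Y" if "\<And>e. e \<in> E \<Longrightarrow> x e \<in> X" for x
    unfolding S_def by (intro complex_vector.subspace_sum[OF subspace_tensor_span] tensor_span_base that EY)
  have rep: "\<exists>x. (\<forall>e\<in>E. x e \<in> X) \<and> v = S x" if "v \<in> tensor_span t X Y" for v
  proof -
    have "complex_vector.subspace {v. \<exists>x. (\<forall>e\<in>E. x e \<in> X) \<and> v = S x}"
      unfolding complex_vector.subspace_def
    proof (intro conjI ballI allI)
      have "0 = S (\<lambda>_. 0)" unfolding S_def using EK by (simp add: tensor_0_left[OF H K W])
      then show "0 \<in> {v. \<exists>x. (\<forall>e\<in>E. x e \<in> X) \<and> v = S x}" using complex_vector.subspace_0[OF X(1)] by force
    next
      fix v v' assume "v \<in> {v. \<exists>x. (\<forall>e\<in>E. x e \<in> X) \<and> v = S x}" "v' \<in> {v. \<exists>x. (\<forall>e\<in>E. x e \<in> X) \<and> v = S x}"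
      then obtain x x' where x: "\<forall>e\<in>E. x e \<in> X" "v = S x" "\<forall>e\<in>E. x' e \<in> X" "v' = S x'" by blast
      have "v + v' = S (\<lambda>e. x e + x' e)"
        unfolding x S_def sum.distrib[symmetric] using x XH EK
        by (intro sum.cong) (auto simp: tensor_add_left[OF H K W] subset_iff)
      then show "v + v' \<in> {v. \<exists>x. (\<forall>e\<in>E. x e \<in> X) \<and> v = S x}"
        using x complex_vector.subspace_add[OF X(1)] by (intro CollectI exI[of _ "\<lambda>e. x e + x' e"]) simp
    next
      fix c v assume "v \<in> {v. \<exists>x. (\<forall>e\<in>E. x e \<in> X) \<and> v = S x}"
      then obtain x where x: "\<forall>e\<in>E. x e \<in> X" "v = S x" by blast
      have "c *\<^sub>C v = S (\<lambda>e. c *\<^sub>C x e)"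
        unfolding x S_def complex_vector.scale_sum_right using x XH EK
        by (intro sum.cong) (auto simp: tensor_scale_left[OF H K W] subset_iff)
      then show "c *\<^sub>C v \<in> {v. \<exists>x. (\<forall>e\<in>E. x e \<in> X) \<and> v = S x}"
        using x complex_vector.subspace_scale[OF X(1)] by (intro CollectI exI[of _ "\<lambda>e. c *\<^sub>C x e"]) simp
    qed
    moreover have "{t x y |x y. x \<in> X \<and> y \<in> Y} \<subseteq> {v. \<exists>x. (\<forall>e\<in>E. x e \<in> X) \<and> v = S x}"
    proof clarify
      fix x y assume x: "x \<in> X" and y: "y \<in> Y"
      have xH: "x \<in> hcarrier H" using x XH by blast
      have "t x y = t x (\<Sum>e\<in>E. hinner K y e *\<^sub>C e)"
        using K.oproj_fixed[OF E(1), of y] y E(2) by (simp add: K.oproj_def)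
      also have "\<dots> = (\<Sum>e\<in>E. t x (hinner K y e *\<^sub>C e))"
        by (rule clinear_on_sum[OF K.subspace_carr tensor_linear_right[OF H K W xH]]) (use EK in auto)
      also have "\<dots> = S (\<lambda>e. hinner K y e *\<^sub>C x)"
        unfolding S_def using EK xH
        by (intro sum.cong) (auto simp: tensor_scale_left[OF H K W] tensor_scale_right[OF H K W])
      finally show "\<exists>x'. (\<forall>e\<in>E. x' e \<in> X) \<and> t x y = S x'" 
        using x complex_vector.subspace_scale[OF X(1)] by (intro exI[of _ "\<lambda>e. hinner K y e *\<^sub>C x"]) simp
    qed
    ultimately have "tensor_span t X Y \<subseteq> {v. \<exists>x. (\<forall>e\<in>E. x e \<in> X) \<and> v = S x}"
      unfolding tensor_span_def by (intro complex_vector.span_minimal)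
    then show ?thesis using that by blast
  qed
  have SW: "S x \<in> hcarrier W" if "\<And>e. e \<in> E \<Longrightarrow> x e \<in> hcarrier H" for x
    unfolding S_def by (intro W.mem_sum tensor_mem[OF H K W] that EK)
  have S_diff: "S x - S x' = S (\<lambda>e. x e - x' e)" if "\<And>e. e \<in> E \<Longrightarrow> x e \<in> hcarrier H" "\<And>e. e \<in> E \<Longrightarrow> x' e \<in> hcarrier H" for x x'
    unfolding S_def sum_subtractf[symmetric] using that EK
    by (intro sum.cong) (auto simp: tensor_diff_left[OF H K W])
  have S_ip: "hinner W (S x) (t x' e) = hinner H (x e) x'"
    if x: "\<And>e. e \<in> E \<Longrightarrow> x e \<in> hcarrier H" and x': "x' \<in> hcarrier H" and e: "e \<in> E" for x x' e
  proof -
    have "hinner W (S x) (t x' e) = (\<Sum>d\<in>E. hinner W (t (x d) d) (t x' e))"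
      unfolding S_def by (rule W.ip_sum_left) (use x x' e EK tensor_mem[OF H K W] in auto)
    also have "\<dots> = (\<Sum>d\<in>E. if d = e then hinner H (x e) x' else 0)"
      using x x' e EK K.orthonormalD(3)[OF E(1)] by (intro sum.cong) (auto simp: tensor_inner[OF H K W])
    finally show ?thesis using finE e by simp
  qed
  \<comment> \<open>Pairing \<open>S x\<close> with \<open>t (x e) e\<close> singles out the
    coefficient \<open>x e\<close>, so coefficients of a Cauchy sequence are Cauchy.\<close>
  have S_le: "hnorm H (x e) \<le> hnorm W (S x)" if x: "\<And>e. e \<in> E \<Longrightarrow> x e \<in> hcarrier H" and e: "e \<in> E" for x e
  proof (cases "x e = 0")
    case True
    then show ?thesis using W.nrm_nonneg[OF SW[OF x]] by simp
  next
    case False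
    have "hnorm H (x e) * hnorm H (x e) = cmod (hinner W (S x) (t (x e) e))"
      using S_ip[OF x x[OF e] e] H.ip_self[OF x[OF e]] by (simp add: norm_mult power2_eq_square)
    also have "\<dots> \<le> hnorm W (S x) * hnorm W (t (x e) e)"
      by (rule W.Cauchy_Schwarz[OF SW[OF x] tensor_mem[OF H K W x[OF e] EK[OF e]]])
    also have "hnorm W (t (x e) e) = hnorm H (x e)"
      using tensor_norm[OF H K W x[OF e] EK[OF e]] K.orthonormal_nrm[OF E(1) e] by simp
    finally show ?thesis using H.nrm_pos[OF x[OF e] False] by simp
  qed
  have S_ge: "hnorm W (S x) \<le> (\<Sum>e\<in>E. hnorm H (x e))" if x: "\<And>e. e \<in> E \<Longrightarrow> x e \<in> hcarrier H" for x
  proof -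
    have "hnorm W (S x) \<le> (\<Sum>e\<in>E. hnorm W (t (x e) e))"
      unfolding S_def by (rule W.nrm_sum) (use x EK tensor_mem[OF H K W] in auto)
    also have "\<dots> = (\<Sum>e\<in>E. hnorm H (x e))"
      using x EK by (intro sum.cong) (auto simp: tensor_norm[OF H K W] K.orthonormal_nrm[OF E(1)])
    finally show ?thesis .
  qed
  obtain x where x: "\<And>k e. e \<in> E \<Longrightarrow> x k e \<in> X" "\<And>k. w k = S (x k)" using rep[OF w(1)] by metis
  have xH: "x k e \<in> hcarrier H" if "e \<in> E" for k e using x(1)[OF that] XH by blast
  have wW: "w k \<in> hcarrier W" for k unfolding x(2) by (rule SW[OF xH])
  have cauw: "\<exists>N. \<forall>m\<ge>N. \<forall>n\<ge>N. hnorm W (w m - w n) < e" if e: "e > 0" for e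
  proof -
    have "\<forall>\<^sub>F k in sequentially. hnorm W (w k - u) < e / 2" using order_tendstoD(2)[OF w(3), of "e / 2"] e by simp
    then obtain N where N: "\<And>k. k \<ge> N \<Longrightarrow> hnorm W (w k - u) < e / 2" unfolding eventually_sequentially by blast
    have "hnorm W (w m - w n) < e" if "m \<ge> N" "n \<ge> N" for m n
      using W.nrm_triangle3[OF wW[of m] w(2) wW[of n]] W.nrm_diff_commute[OF w(2) wW[of n]] N[OF that(1)] N[OF that(2)] by simp
    then show ?thesis by blast
  qed
  have "\<exists>y\<in>X. (\<lambda>k. hnorm H (x k e - y)) \<longlonglongrightarrow> 0" if e: "e \<in> E" for e
  proof -
    have le: "hnorm H (x m e - x n e) \<le> hnorm W (w m - w n)" for m n
      using S_le[of "\<lambda>e. x m e - x n e" e] S_diff[of "x m" "x n"] xH e by (simp add: x(2))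
    show ?thesis
      using X.complete[of "\<lambda>k. x k e"] x(1)[OF e] Cauchy_le[OF cauw le] by (metis hcarrier_hsub hnorm_hsub)
  qed
  then obtain y where y: "\<And>e. e \<in> E \<Longrightarrow> y e \<in> X" "\<And>e. e \<in> E \<Longrightarrow> (\<lambda>k. hnorm H (x k e - y e)) \<longlonglongrightarrow> 0" by metis
  have yH: "y e \<in> hcarrier H" if "e \<in> E" for e using y(1)[OF that] XH by blast
  have "hnorm W (S y - u) \<le> (\<Sum>e\<in>E. hnorm H (x k e - y e)) + hnorm W (w k - u)" for k
  proof -
    have "hnorm W (S y - u) \<le> hnorm W (w k - S y) + hnorm W (w k - u)"
      using W.nrm_triangle3[OF SW[OF yH] wW[of k] w(2)] W.nrm_diff_commute[OF SW[OF yH] wW[of k]] by simp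
    also have "w k - S y = S (\<lambda>e. x k e - y e)" unfolding x(2) by (rule S_diff[OF xH yH])
    also have "hnorm W (S (\<lambda>e. x k e - y e)) \<le> (\<Sum>e\<in>E. hnorm H (x k e - y e))" by (rule S_ge) (use xH yH in auto)
    finally show ?thesis by simp
  qed
  moreover have "(\<lambda>k. (\<Sum>e\<in>E. hnorm H (x k e - y e)) + hnorm W (w k - u)) \<longlonglongrightarrow> (\<Sum>e\<in>E. 0) + 0"
    by (intro tendsto_add tendsto_sum y(2) w(3))
  ultimately have "hnorm W (S y - u) \<le> (\<Sum>e\<in>E. 0) + 0" using LIMSEQ_le_const by blast
  then have "S y = u" using W.nrm_pos[of "S y - u"] SW[OF yH] w(2) by fastforce
  then show ?thesis using S_mem[of y] y(1) by simp
qed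

section \<open>The coupled interior-exterior problem\<close>

lemma single_simps: "single i x i = x" "j \<noteq> i \<Longrightarrow> single i x j = 0"
  by (simp_all add: single_def)

lemma single_linear: "single i (x + y) = single i x + single i y" "single i (x - y) = single i x - single i y"
    "single i (c *\<^sub>C x) = c *\<^sub>C single i x"
  for x y :: "'a::complex_vector"
  by (auto simp: single_def fun_eq_iff plus_fun_def fun_diff_def scaleC_fun_def)

lemma sum_diagonal:
  fixes f :: "nat \<Rightarrow> nat \<Rightarrow> complex"
  assumes "\<And>m n. m \<noteq> n \<Longrightarrow> f m n = 0"
  shows "(\<Sum>m<N. \<Sum>n<N. f m n) = (\<Sum>n<N. f n n)"
proof -
  have "(\<Sum>n<N. f m n) = f m m" if "m < N" for m
  proof -
    have "(\<Sum>n<N. f m n) = (\<Sum>n<N. if n = m then f m m else 0)"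
      by (rule sum.cong) (use assms in auto)
    then show ?thesis using that by simp
  qed
  then show ?thesis by simp
qed

locale exterior_setting =
  fixes S :: "('v::complex_vector, 'z::complex_vector, 'x::complex_vector,
    'y::complex_vector, 'w::complex_vector) setting"
  assumes A: "assumption_A S"
begin

abbreviation Wl where "Wl l \<equiv> hinter (X2Y1 S l) (X1Y2 S l)"

lemma hilbert_Vint: "hilbert_space (Vint S)" and hilbert_Zsp: "hilbert_space (Zsp S)"
  and trp: "bounded_op (Vext S) (Zsp S) (trp S)" and trm: "bounded_op (Vint S) (Zsp S) (trm S)"
  and forms_bounded: "\<kappa> \<in> params S \<Longrightarrow> bounded_sesquilinear (Vint S) (sint S \<kappa>)"
    "\<kappa> \<in> params S \<Longrightarrow> bounded_sesquilinear (Vext S) (sext S \<kappa>)"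
  using A unfolding assumption_A_def by auto

context
  fixes l
  assumes l: "l \<in> {1..Lnum S}"
begin

lemma hilbert_l: "hilbert_space (X1 S l)" "hilbert_space (X2 S l)" "hilbert_space (Y1 S l)" "hilbert_space (Y2 S l)"
  and embedded_l: "cont_embedded (X2 S l) (X1 S l)" "cont_embedded (Y2 S l) (Y1 S l)"
    "cont_embedded (X2Y1 S l) (X1Y1 S l)" "cont_embedded (X1Y2 S l) (X1Y1 S l)"
  and tensor_l: "hilbert_tensor (X1 S l) (Y1 S l) (ten S l) (X1Y1 S l)"
    "hilbert_tensor (X2 S l) (Y1 S l) (ten S l) (X2Y1 S l)"
    "hilbert_tensor (X1 S l) (Y2 S l) (ten S l) (X1Y2 S l)"
  using A l unfolding assumption_A_def dense_cont_embedded_def by auto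

lemma hilbert_tl: "hilbert_space (X1Y1 S l)" "hilbert_space (X2Y1 S l)" "hilbert_space (X1Y2 S l)"
  using tensor_l unfolding hilbert_tensor_def by blast+

lemma hilbert_Wl: "hilbert_space (Wl l)"
  by (rule hilbert_hinter[OF hilbert_tl(2,3,1) embedded_l(3,4)])

lemma ten_mem:
  assumes "x \<in> hcarrier (X2 S l)" "y \<in> hcarrier (Y2 S l)"
  shows "ten S l x y \<in> hcarrier (Wl l)"
  using tensor_mem[OF hilbert_l(2,3) tensor_l(2)] tensor_mem[OF hilbert_l(1,4) tensor_l(3)]
    cont_embeddedD[OF embedded_l(1)] cont_embeddedD[OF embedded_l(2)] assms
  by (simp add: hcarrier_hinter[OF hilbert_tl(2,3)])

lemma ten_inner:
  assumes "x \<in> hcarrier (X2 S l)" "y \<in> hcarrier (Y2 S l)" "x' \<in> hcarrier (X2 S l)" "y' \<in> hcarrier (Y2 S l)"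
  shows "hinner (Wl l) (ten S l x y) (ten S l x' y') =
    hinner (X2 S l) x x' * hinner (Y1 S l) y y' + hinner (X1 S l) x x' * hinner (Y2 S l) y y'"
  using tensor_inner[OF hilbert_l(2,3) tensor_l(2)] tensor_inner[OF hilbert_l(1,4) tensor_l(3)]
    cont_embeddedD[OF embedded_l(1)] cont_embeddedD[OF embedded_l(2)] assms
  by (simp add: hinner_hinter[OF hilbert_tl(2,3)])

lemma ten_norm_le:
  obtains C where "C > 0" "\<And>x y. x \<in> hcarrier (X2 S l) \<Longrightarrow> y \<in> hcarrier (Y2 S l) \<Longrightarrow>
    hnorm (Wl l) (ten S l x y) \<le> C * hnorm (X2 S l) x * hnorm (Y2 S l) y"
proof -
  interpret X1: hilbert "X1 S l" by (rule hilbertD[OF hilbert_l(1)])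
  interpret X2: hilbert "X2 S l" by (rule hilbertD[OF hilbert_l(2)])
  interpret Y1: hilbert "Y1 S l" by (rule hilbertD[OF hilbert_l(3)])
  interpret Y2: hilbert "Y2 S l" by (rule hilbertD[OF hilbert_l(4)])
  obtain C where C: "C > 0" "\<And>x. x \<in> hcarrier (X2 S l) \<Longrightarrow> hnorm (X1 S l) x \<le> C * hnorm (X2 S l) x"
    using cont_embedded_bound[OF embedded_l(1) hilbert_l(2)] by blast
  obtain D where D: "D > 0" "\<And>x. x \<in> hcarrier (Y2 S l) \<Longrightarrow> hnorm (Y1 S l) x \<le> D * hnorm (Y2 S l) x"
    using cont_embedded_bound[OF embedded_l(2) hilbert_l(4)] by blast
  show ?thesis
  proof (rule that[of "C + D"])
    fix x y assume x: "x \<in> hcarrier (X2 S l)" and y: "y \<in> hcarrier (Y2 S l)"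
    note x1 = cont_embeddedD[OF embedded_l(1) x] and y1 = cont_embeddedD[OF embedded_l(2) y]
    have "hnorm (Wl l) (ten S l x y) \<le> hnorm (X2Y1 S l) (ten S l x y) + hnorm (X1Y2 S l) (ten S l x y)"
      by (rule hnorm_hinter_le[OF hilbert_tl(2,3) ten_mem[OF x y]])
    also have "\<dots> = hnorm (X2 S l) x * hnorm (Y1 S l) y + hnorm (X1 S l) x * hnorm (Y2 S l) y"
      using tensor_norm[OF hilbert_l(2,3) tensor_l(2) x y1] tensor_norm[OF hilbert_l(1,4) tensor_l(3) x1 y] by simp
    also have "\<dots> \<le> hnorm (X2 S l) x * (D * hnorm (Y2 S l) y) + (C * hnorm (X2 S l) x) * hnorm (Y2 S l) y"
      using C(2)[OF x] D(2)[OF y] x y by (intro add_mono mult_left_mono mult_right_mono) auto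
    finally show "hnorm (Wl l) (ten S l x y) \<le> (C + D) * hnorm (X2 S l) x * hnorm (Y2 S l) y"
      by (simp add: algebra_simps)
  qed (use C D in simp)
qed

lemma ten_norm_ge:
  assumes "x \<in> hcarrier (X2 S l)" "y \<in> hcarrier (Y2 S l)"
  shows "hnorm (X2 S l) x * hnorm (Y1 S l) y \<le> hnorm (Wl l) (ten S l x y)"
  using hnorm_hinter_ge(1)[OF hilbert_tl(2,3) ten_mem[OF assms]]
    tensor_norm[OF hilbert_l(2,3) tensor_l(2) assms(1) cont_embeddedD[OF embedded_l(2) assms(2)]] by simp

lemma single_mem: "single l w \<in> hcarrier (Vext S) \<longleftrightarrow> w \<in> hcarrier (Wl l)"
proof -
  have "0 \<in> hcarrier (Wl j)" if "j \<in> {1..Lnum S}" for j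
  proof -
    interpret Wj: hilbert "Wl j" by (rule hilbertD[OF exterior_setting.hilbert_Wl[OF exterior_setting_axioms that]])
    show ?thesis by (rule Wj.mem_0)
  qed
  then show ?thesis
    unfolding Vext_def using l by (auto simp: hsum_def single_def)
qed

lemma single_inner: "hinner (Vext S) u (single l w) = hinner (Wl l) (u l) w" if "u \<in> hcarrier (Vext S)"
proof -
  have "hinner (Vext S) u (single l w) = (\<Sum>i\<in>{1..Lnum S}. hinner (Wl i) (u i) (single l w i))"
    by (simp add: Vext_def hsum_def)
  also have "\<dots> = (\<Sum>i\<in>{1..Lnum S}. if i = l then hinner (Wl l) (u l) w else 0)"
  proof (rule sum.cong[OF refl])
    fix i assume i: "i \<in> {1..Lnum S}"
    show "hinner (Wl i) (u i) (single l w i) = (if i = l then hinner (Wl l) (u l) w else 0)"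
    proof (cases "i = l")
      case False
      interpret Wi: hilbert "Wl i" by (rule hilbertD[OF exterior_setting.hilbert_Wl[OF exterior_setting_axioms i]])
      have "u i \<in> hcarrier (Wl i)" using that i by (simp add: Vext_def hsum_def)
      then show ?thesis using False by (simp add: single_simps)
    qed (simp add: single_simps)
  qed
  finally show ?thesis using l by simp
qed

end

lemma hilbert_Vext: "hilbert_space (Vext S)"
  unfolding Vext_def by (rule hilbert_hsum) (auto intro: hilbert_Wl)

sublocale Vi: hilbert "Vint S" by (rule hilbertD[OF hilbert_Vint])
sublocale Z: hilbert "Zsp S" by (rule hilbertD[OF hilbert_Zsp])
sublocale Vx: hilbert "Vext S" by (rule hilbertD[OF hilbert_Vext])

lemma Vext_comp: "u \<in> Vx.carr \<Longrightarrow> l \<in> {1..Lnum S} \<Longrightarrow> u l \<in> hcarrier (Wl l)"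
  unfolding Vext_def hsum_def by simp

lemma single_norm:
  assumes l: "l \<in> {1..Lnum S}" and w: "w \<in> hcarrier (Wl l)"
  shows "Vx.nrm (single l w) = hnorm (Wl l) w"
  using single_inner[OF l, of "single l w" w] single_mem[OF l, of w] w by (simp add: hnorm_def single_simps)

lemma Vsp_mem: "u \<in> hcarrier (Vsp S) \<longleftrightarrow> fst u \<in> Vi.carr \<and> snd u \<in> Vx.carr \<and> trp S (snd u) = trm S (fst u)"
  unfolding Vsp_def by (auto simp: mem_Times_iff)

lemma Vsp_in_hprod: "u \<in> hcarrier (Vsp S) \<Longrightarrow> u \<in> hcarrier (hprod (Vint S) (Vext S))"
  unfolding Vsp_mem by (auto simp: hcarrier_hprod[OF hilbert_Vint hilbert_Vext] mem_Times_iff)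

lemma hnorm_Vsp: "hnorm (Vsp S) = hnorm (hprod (Vint S) (Vext S))"
  unfolding Vsp_def by simp

lemma hnorm_Vsp_sq: "u \<in> hcarrier (Vsp S) \<Longrightarrow> (hnorm (Vsp S) u)\<^sup>2 = (Vi.nrm (fst u))\<^sup>2 + (Vx.nrm (snd u))\<^sup>2"
  unfolding hnorm_Vsp by (rule hnorm_hprod_sq[OF hilbert_Vint hilbert_Vext Vsp_in_hprod])

lemma hnorm_Vsp_ge:
  assumes "u \<in> hcarrier (Vsp S)"
  shows "Vi.nrm (fst u) \<le> hnorm (Vsp S) u" "Vx.nrm (snd u) \<le> hnorm (Vsp S) u"
  unfolding hnorm_Vsp using hnorm_hprod_ge[OF hilbert_Vint hilbert_Vext Vsp_in_hprod[OF assms]] by blast+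

lemma hnorm_Vsp_le:
  "u \<in> hcarrier (Vsp S) \<Longrightarrow> hnorm (Vsp S) u \<le> Vi.nrm (fst u) + Vx.nrm (snd u)"
  unfolding hnorm_Vsp by (rule hnorm_hprod_le[OF hilbert_Vint hilbert_Vext Vsp_in_hprod])

lemmas trp_mem = bounded_opD(1)[OF trp] and trp_lin = bounded_opD(2)[OF trp]
  and trm_mem = bounded_opD(1)[OF trm] and trm_lin = bounded_opD(2)[OF trm]
lemmas trp_simps = clinear_onD[OF trp_lin] clinear_on_diff[OF Vx.subspace_carr trp_lin] clinear_on_0[OF Vx.subspace_carr trp_lin]
  and trm_simps = clinear_onD[OF trm_lin] clinear_on_diff[OF Vi.subspace_carr trm_lin] clinear_on_0[OF Vi.subspace_carr trm_lin]

text \<open>Matching traces is a condition that both continuous trace maps preserve under limits, so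
  the space is closed in the product.\<close>

lemma hilbert_Vsp: "hilbert_space (Vsp S)"
proof -
  interpret Pr: hilbert "hprod (Vint S) (Vext S)" by (rule hilbertD[OF hilbert_hprod[OF hilbert_Vint hilbert_Vext]])
  let ?V = "hcarrier (Vsp S)"
  have cs: "csubspace ?V"
    unfolding complex_vector.subspace_def
    by (auto simp: Vsp_mem trp_simps trm_simps scaleC_prod_def)
  have sub: "?V \<subseteq> hcarrier (hprod (Vint S) (Vext S))" using Vsp_in_hprod by blast
  have "closedin (htop (hprod (Vint S) (Vext S))) ?V"
    unfolding Pr.closedin_iff
  proof (intro conjI sub allI impI)
    fix x :: "nat \<Rightarrow> ('v, 'w) Defs.vec" and u
    assume x: "\<forall>k. x k \<in> ?V" and u: "u \<in> hcarrier (hprod (Vint S) (Vext S))"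
      and lim: "(\<lambda>k. hnorm (hprod (Vint S) (Vext S)) (x k - u)) \<longlonglongrightarrow> 0"
    have um: "fst u \<in> Vi.carr" "snd u \<in> Vx.carr" using u by (auto simp: hcarrier_hprod[OF hilbert_Vint hilbert_Vext])
    have xm: "fst (x k) \<in> Vi.carr" "snd (x k) \<in> Vx.carr" "trp S (snd (x k)) = trm S (fst (x k))" for k
      using x by (auto simp: Vsp_mem)
    obtain C where C: "C > 0" "\<And>x. x \<in> Vx.carr \<Longrightarrow> Z.nrm (trp S x) \<le> C * Vx.nrm x" using Vx.op_bound[OF trp] by blast
    obtain D where D: "D > 0" "\<And>x. x \<in> Vi.carr \<Longrightarrow> Z.nrm (trm S x) \<le> D * Vi.nrm x" using Vi.op_bound[OF trm] by blast
    have "Z.nrm (trp S (snd u) - trm S (fst u)) \<le> (C + D) * hnorm (hprod (Vint S) (Vext S)) (x k - u)" for k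
    proof -
      have d: "x k - u \<in> hcarrier (hprod (Vint S) (Vext S))" using x sub u Pr.mem_diff by blast
      have "Z.nrm (trp S (snd u) - trm S (fst u)) \<le> Z.nrm (trp S (snd (x k)) - trp S (snd u)) + Z.nrm (trm S (fst (x k)) - trm S (fst u))"
        using Z.nrm_triangle3[of "trp S (snd u)" "trp S (snd (x k))" "trm S (fst u)"] Z.nrm_diff_commute[of "trp S (snd u)" "trp S (snd (x k))"]
          um xm[of k] trp_mem trm_mem by simp
      also have "trp S (snd (x k)) - trp S (snd u) = trp S (snd (x k - u))" using trp_simps(3)[OF xm(2)[of k] um(2)] by simp
      also have "trm S (fst (x k)) - trm S (fst u) = trm S (fst (x k - u))" using trm_simps(3)[OF xm(1)[of k] um(1)] by simp
      also have "Z.nrm (trp S (snd (x k - u))) \<le> C * hnorm (hprod (Vint S) (Vext S)) (x k - u)"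
      proof -
        have "snd (x k - u) \<in> Vx.carr" using xm(2)[of k] um(2) by simp
        from order_trans[OF C(2)[OF this] mult_left_mono[OF hnorm_hprod_ge(2)[OF hilbert_Vint hilbert_Vext d]]] show ?thesis using C(1) by simp
      qed
      also have "Z.nrm (trm S (fst (x k - u))) \<le> D * hnorm (hprod (Vint S) (Vext S)) (x k - u)"
      proof -
        have "fst (x k - u) \<in> Vi.carr" using xm(1)[of k] um(1) by simp
        from order_trans[OF D(2)[OF this] mult_left_mono[OF hnorm_hprod_ge(1)[OF hilbert_Vint hilbert_Vext d]]] show ?thesis using D(1) by simp
      qed
      finally show ?thesis by (simp add: distrib_right)
    qed
    moreover have "(\<lambda>k. (C + D) * hnorm (hprod (Vint S) (Vext S)) (x k - u)) \<longlonglongrightarrow> (C + D) * 0" by (intro tendsto_intros lim)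
    ultimately have "Z.nrm (trp S (snd u) - trm S (fst u)) \<le> (C + D) * 0" using LIMSEQ_le_const by blast
    then have "trp S (snd u) = trm S (fst u)" using Z.nrm_pos[of "trp S (snd u) - trm S (fst u)"] um trp_mem trm_mem by fastforce
    then show "u \<in> ?V" using um by (simp add: Vsp_mem)
  qed
  from Pr.hilbert_hsub[OF cs this] show ?thesis
    unfolding Vsp_def by (simp add: hsub_def)
qed

sublocale V: hilbert "Vsp S" by (rule hilbertD[OF hilbert_Vsp])

lemma form_bounded:
  assumes k: "\<kappa> \<in> params S"
  shows "bounded_sesquilinear (Vsp S) (form S \<kappa>)"
proof -
  obtain C where C: "C > 0" "\<And>x y. x \<in> Vi.carr \<Longrightarrow> y \<in> Vi.carr \<Longrightarrow> cmod (sint S \<kappa> x y) \<le> C * Vi.nrm x * Vi.nrm y"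
    using Vi.form_bound[OF forms_bounded(1)[OF k]] by blast
  obtain D where D: "D > 0" "\<And>x y. x \<in> Vx.carr \<Longrightarrow> y \<in> Vx.carr \<Longrightarrow> cmod (sext S \<kappa> x y) \<le> D * Vx.nrm x * Vx.nrm y"
    using Vx.form_bound[OF forms_bounded(2)[OF k]] by blast
  have si: "sesquilinear_on (Vi.carr) (sint S \<kappa>)" and se: "sesquilinear_on (Vx.carr) (sext S \<kappa>)"
    using forms_bounded[OF k] unfolding bounded_sesquilinear_def by blast+
  note fs = sesquilinear_onD[OF si] sesquilinear_onD[OF se]
  show ?thesis
  proof (rule bounded_sesquilinearI)
    show "sesquilinear_on (V.carr) (form S \<kappa>)"
      by (rule sesquilinear_onI) (simp_all add: Vsp_mem form_def scaleC_prod_def fs algebra_simps)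
    fix x y assume x: "x \<in> V.carr" and y: "y \<in> V.carr"
    have m: "fst x \<in> Vi.carr" "snd x \<in> Vx.carr" "fst y \<in> Vi.carr" "snd y \<in> Vx.carr"
      using x y by (auto simp: Vsp_mem)
    have "cmod (form S \<kappa> x y) \<le> C * Vi.nrm (fst x) * Vi.nrm (fst y) + D * Vx.nrm (snd x) * Vx.nrm (snd y)"
      unfolding form_def using C(2)[OF m(1,3)] D(2)[OF m(2,4)] norm_triangle_ineq order_trans add_mono by meson
    also have "\<dots> \<le> C * V.nrm x * V.nrm y + D * V.nrm x * V.nrm y"
      using hnorm_Vsp_ge[OF x] hnorm_Vsp_ge[OF y] C(1) D(1) m x y
      by (intro add_mono mult_mono mult_left_mono mult_nonneg_nonneg) auto
    finally show "cmod (form S \<kappa> x y) \<le> (C + D) * V.nrm x * V.nrm y" by (simp add: algebra_simps)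
  qed
qed

end

subsection \<open>Separation of variables\<close>

locale separated = exterior_setting S
  for S :: "('v::complex_vector, 'z::complex_vector, 'x::complex_vector,
    'y::complex_vector, 'w::complex_vector) setting" +
  fixes \<phi> :: "nat \<Rightarrow> nat \<Rightarrow> 'y" and lidx :: "nat \<Rightarrow> nat" and \<kappa> :: complex
  assumes B: "assumption_B S \<phi> lidx \<kappa>" and \<kappa>: "\<kappa> \<in> params S"
begin

abbreviation p where "p n \<equiv> \<phi> n (lidx n)"
abbreviation tphi where "tphi \<equiv> tensor_phi S \<phi> lidx"

lemma lidx: "lidx n \<in> {1..Lnum S}" and \<phi>_0: "j \<noteq> lidx n \<Longrightarrow> \<phi> n j = 0"
  and cos: "complete_orthogonal_system (hsum {1..Lnum S} (Y2 S)) \<phi>"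
  and sep_orth: "m \<noteq> n \<Longrightarrow> u \<in> Vsep S \<phi> lidx m \<Longrightarrow> v \<in> Vsep S \<phi> lidx n \<Longrightarrow> Vx.ip u v = 0"
    "m \<noteq> n \<Longrightarrow> u \<in> Vsep S \<phi> lidx m \<Longrightarrow> v \<in> Vsep S \<phi> lidx n \<Longrightarrow> sext S \<kappa> u v = 0"
  and fin_trp: "fin_dim (trp S ` Vsep S \<phi> lidx n)"
  and sep_sum: "hilbert_orthogonal_sum (Vext S) (Vsep S \<phi> lidx)"
  using B unfolding assumption_B_def by blast+

lemma Vsep_subspace: "csubspace (Vsep S \<phi> lidx n)" and Vsep_closed: "closedin (htop (Vext S)) (Vsep S \<phi> lidx n)"
  and Vsep_dense: "hdense (Vext S) (cspan (\<Union>n. Vsep S \<phi> lidx n))"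
  using sep_sum unfolding hilbert_orthogonal_sum_def by blast+

lemma Vsep_carr: "Vsep S \<phi> lidx n \<subseteq> Vx.carr"
  using Vsep_closed Vx.closedin_iff by blast

lemma hilbert_Y2sum: "hilbert_space (hsum {1..Lnum S} (Y2 S))"
  by (rule hilbert_hsum) (auto intro: hilbert_l)

lemma p_mem: "p n \<in> hcarrier (Y2 S (lidx n))"
proof -
  have "\<phi> n \<in> hcarrier (hsum {1..Lnum S} (Y2 S))" using cos unfolding complete_orthogonal_system_def by blast
  then show ?thesis using lidx[of n] by (simp add: hsum_def)
qed

lemma p_nonzero: "p n \<noteq> 0"
proof
  assume "p n = 0"
  then have "\<phi> n j = 0" for j using \<phi>_0[of j n] by (cases "j = lidx n") auto
  then have "\<phi> n = 0" by (simp add: fun_eq_iff zero_fun_def)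
  then show False using cos unfolding complete_orthogonal_system_def by blast
qed

lemma p_mem1: "p n \<in> hcarrier (Y1 S (lidx n))"
  using cont_embeddedD[OF embedded_l(2)[OF lidx] p_mem] .

lemma tphi_mem: "x \<in> hcarrier (X2 S (lidx n)) \<Longrightarrow> tphi n x \<in> Vx.carr"
  unfolding tensor_phi_def by (simp only: single_mem[OF lidx] ten_mem[OF lidx _ p_mem])

lemma tphi_linear:
  assumes "x \<in> hcarrier (X2 S (lidx n))"
  shows "y \<in> hcarrier (X2 S (lidx n)) \<Longrightarrow> tphi n (x + y) = tphi n x + tphi n y"
    "y \<in> hcarrier (X2 S (lidx n)) \<Longrightarrow> tphi n (x - y) = tphi n x - tphi n y"
    "tphi n (c *\<^sub>C x) = c *\<^sub>C tphi n x"
  using assms p_mem1[of n]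
  by (simp_all add: tensor_phi_def single_linear tensor_add_left[OF hilbert_l(2,3)[OF lidx] tensor_l(2)[OF lidx]]
    tensor_diff_left[OF hilbert_l(2,3)[OF lidx] tensor_l(2)[OF lidx]] tensor_scale_left[OF hilbert_l(2,3)[OF lidx] tensor_l(2)[OF lidx]])

text \<open>\<open>Xsep\<close> is defined through \<open>X1\<close>, while the discrete spaces
  \<open>XN\<close> are dense in \<open>X2\<close>. That membership of
  \<open>x \<otimes> \<phi> n\<close> in \<open>Vext\<close> forces \<open>x\<close> into
  \<open>X2\<close> is \<open>tensor_slice_mem\<close>.\<close>

lemma Xsep_carrier: "hcarrier (Xsep S \<phi> lidx n) = hcarrier (X2 S (lidx n))"
proof (intro equalityI subsetI)
  fix x assume "x \<in> hcarrier (Xsep S \<phi> lidx n)"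
  then have x: "x \<in> hcarrier (X1 S (lidx n))" "tphi n x \<in> Vx.carr" by (simp_all add: Xsep_def)
  then have "ten S (lidx n) x (p n) \<in> hcarrier (Wl (lidx n))" by (simp add: tensor_phi_def single_mem[OF lidx] del: hcarrier_hinter)
  then have t: "ten S (lidx n) x (p n) \<in> hcarrier (X2Y1 S (lidx n))" by (simp add: hinter_def)
  show "x \<in> hcarrier (X2 S (lidx n))"
    by (rule tensor_slice_mem[OF hilbert_l(1)[OF lidx] hilbert_l(2)[OF lidx] hilbert_l(3)[OF lidx]
        tensor_l(1)[OF lidx] tensor_l(2)[OF lidx] embedded_l(1)[OF lidx] embedded_l(3)[OF lidx] p_mem1 p_nonzero x(1) t])
next
  fix x assume x: "x \<in> hcarrier (X2 S (lidx n))"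
  then show "x \<in> hcarrier (Xsep S \<phi> lidx n)"
    using tphi_mem[OF x] cont_embeddedD[OF embedded_l(1)[OF lidx] x] by (simp add: Xsep_def)
qed

text \<open>The second factor is one-dimensional, so every sum of elementary tensors collapses to a
  single one.\<close>

lemma Vsep_eq: "Vsep S \<phi> lidx n = tphi n ` hcarrier (X2 S (lidx n))"
proof (intro equalityI subsetI)
  fix u assume "u \<in> Vsep S \<phi> lidx n"
  then obtain w where w: "w \<in> tensor_span (ten S (lidx n)) (hcarrier (X1 S (lidx n))) (cspan {p n})" "u = single (lidx n) w"
    and u: "u \<in> Vx.carr" unfolding Vsep_def by blast
  interpret X1: hilbert "X1 S (lidx n)" by (rule hilbertD[OF hilbert_l(1)[OF lidx]])
  note t1 = hilbert_l(1,3)[OF lidx] tensor_l(1)[OF lidx]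
  have "\<exists>x\<in>hcarrier (X1 S (lidx n)). w = ten S (lidx n) x (p n)"
  proof (rule tensor_span_related[OF w(1) X1.subspace_carr])
    fix x y assume x: "x \<in> hcarrier (X1 S (lidx n))" and y: "y \<in> cspan {p n}"
    then obtain c where "y = c *\<^sub>C p n" by (auto simp: complex_vector.span_singleton)
    then have "ten S (lidx n) x y = ten S (lidx n) (c *\<^sub>C x) (p n)"
      using x p_mem1 by (simp add: tensor_scale_left[OF t1] tensor_scale_right[OF t1])
    then show "\<exists>z\<in>hcarrier (X1 S (lidx n)). ten S (lidx n) x y = ten S (lidx n) z (p n)" using x by blast
  qed (use p_mem1 in \<open>simp_all add: tensor_0_left[OF t1] tensor_add_left[OF t1] tensor_scale_left[OF t1]\<close>)
  then obtain x where x: "x \<in> hcarrier (X1 S (lidx n))" "u = tphi n x" using w(2) by (auto simp: tensor_phi_def)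
  then have "x \<in> hcarrier (Xsep S \<phi> lidx n)" using u by (simp add: Xsep_def)
  then show "u \<in> tphi n ` hcarrier (X2 S (lidx n))" using x(2) Xsep_carrier by blast
next
  fix u assume "u \<in> tphi n ` hcarrier (X2 S (lidx n))"
  then obtain x where x: "x \<in> hcarrier (X2 S (lidx n))" "u = tphi n x" by blast
  have "ten S (lidx n) x (p n) \<in> tensor_span (ten S (lidx n)) (hcarrier (X1 S (lidx n))) (cspan {p n})"
    by (intro tensor_span_base complex_vector.span_base cont_embeddedD[OF embedded_l(1)[OF lidx] x(1)]) simp
  then show "u \<in> Vsep S \<phi> lidx n"
    using tphi_mem[OF x(1)] unfolding x(2) Vsep_def tensor_phi_def by blast
qed

lemma tphi_norm_ge:
  assumes x: "x \<in> hcarrier (X2 S (lidx n))"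
  shows "hnorm (X2 S (lidx n)) x * hnorm (Y1 S (lidx n)) (p n) \<le> Vx.nrm (tphi n x)"
  using ten_norm_ge[OF lidx x p_mem] single_norm[OF lidx ten_mem[OF lidx x p_mem]] by (simp add: tensor_phi_def)

lemma p_norm1: "hnorm (Y1 S (lidx n)) (p n) > 0"
proof -
  interpret Y1: hilbert "Y1 S (lidx n)" by (rule hilbertD[OF hilbert_l(3)[OF lidx]])
  show ?thesis by (rule Y1.nrm_pos[OF p_mem1 p_nonzero])
qed

lemma tphi_inj:
  assumes "x \<in> hcarrier (X2 S (lidx n))" "y \<in> hcarrier (X2 S (lidx n))" "tphi n x = tphi n y"
  shows "x = y"
proof -
  interpret X2: hilbert "X2 S (lidx n)" by (rule hilbertD[OF hilbert_l(2)[OF lidx]])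
  have d: "x - y \<in> hcarrier (X2 S (lidx n))" using assms by blast
  have "hnorm (X2 S (lidx n)) (x - y) * hnorm (Y1 S (lidx n)) (p n) \<le> 0"
    using tphi_norm_ge[OF d] assms by (simp add: tphi_linear)
  then have "hnorm (X2 S (lidx n)) (x - y) \<le> 0" using p_norm1[of n] by (simp add: mult_le_0_iff)
  then show ?thesis using X2.nrm_pos[OF d] by fastforce
qed

text \<open>The inner products of \<open>Y1\<close> and \<open>Y2\<close> with \<open>p n\<close> agree up to normalization, because both
  annihilate every other \<open>p m\<close>: the one of \<open>Y1\<close> does so by the orthogonality of the spaces \<open>Vsep\<close>.\<close>

lemma coefficient_eq:
  assumes x: "x \<in> hcarrier (X2 S (lidx n))" "x \<noteq> 0" and y: "y \<in> hcarrier (Y2 S (lidx n))"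
  shows "hinner (Y1 S (lidx n)) y (p n) * hinner (Y2 S (lidx n)) (p n) (p n) =
    hinner (Y2 S (lidx n)) y (p n) * hinner (Y1 S (lidx n)) (p n) (p n)"
proof -
  let ?l = "lidx n" and ?Y = "hsum {1..Lnum S} (Y2 S)"
  interpret Y: hilbert ?Y by (rule hilbertD[OF hilbert_Y2sum])
  interpret Y1: hilbert "Y1 S ?l" by (rule hilbertD[OF hilbert_l(3)[OF lidx]])
  interpret Y2: hilbert "Y2 S ?l" by (rule hilbertD[OF hilbert_l(4)[OF lidx]])
  interpret X2: hilbert "X2 S ?l" by (rule hilbertD[OF hilbert_l(2)[OF lidx]])
  have Y21: "v \<in> hcarrier (Y1 S ?l)" if "v \<in> hcarrier (Y2 S ?l)" for v using cont_embeddedD[OF embedded_l(2)[OF lidx] that] .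
  obtain D where D: "D > 0" "\<And>v. v \<in> hcarrier (Y2 S ?l) \<Longrightarrow> hnorm (Y1 S ?l) v \<le> D * hnorm (Y2 S ?l) v"
    using cont_embedded_bound[OF embedded_l(2)[OF lidx] hilbert_l(4)[OF lidx]] by blast
  define a1 where "a1 = hinner (Y1 S ?l) (p n) (p n)"
  define a2 where "a2 = hinner (Y2 S ?l) (p n) (p n)"
  \<comment> \<open>The difference of the two sides as a function of \<open>y\<close>. It vanishes
    on every \<open>\<phi> m\<close> and is bounded for the norm of the sum of the
    \<open>Y2\<close>, hence it vanishes on \<open>y\<close> by completeness of the system.\<close>
  define f where "f = (\<lambda>v. hinner (Y1 S ?l) v (p n) * a2 - hinner (Y2 S ?l) v (p n) * a1)"
  have comp: "u ?l \<in> hcarrier (Y2 S ?l)" if "u \<in> hcarrier ?Y" for u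
    using that lidx[of n] by (simp add: hsum_def)
  have f_add: "f (u + v) = f u + f v" if "u \<in> hcarrier (Y2 S ?l)" "v \<in> hcarrier (Y2 S ?l)" for u v
    using that Y21 p_mem p_mem1 by (simp add: f_def Y1.ip_add_left Y2.ip_add_left algebra_simps)
  have f_scale: "f (c *\<^sub>C u) = c * f u" if "u \<in> hcarrier (Y2 S ?l)" for u c
    using that Y21 p_mem p_mem1 by (simp add: f_def Y1.ip_scale_left Y2.ip_scale_left algebra_simps)
  have bf: "bounded_functional ?Y (\<lambda>u. f (u ?l))"
  proof (rule bounded_functionalI[where C = "D * hnorm (Y1 S ?l) (p n) * cmod a2 + hnorm (Y2 S ?l) (p n) * cmod a1"])
    fix u assume u: "u \<in> hcarrier ?Y"
    note ul = comp[OF u]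
    have le: "hnorm (Y2 S ?l) (u ?l) \<le> hnorm ?Y u"
      by (rule hnorm_hsum_ge[OF _ _ u lidx]) (auto intro: hilbert_l)
    have "cmod (f (u ?l)) \<le> cmod (hinner (Y1 S ?l) (u ?l) (p n)) * cmod a2 + cmod (hinner (Y2 S ?l) (u ?l) (p n)) * cmod a1"
      unfolding f_def using norm_triangle_ineq4 by (metis norm_mult)
    also have "\<dots> \<le> (D * hnorm ?Y u * hnorm (Y1 S ?l) (p n)) * cmod a2 + (hnorm ?Y u * hnorm (Y2 S ?l) (p n)) * cmod a1"
    proof (intro add_mono mult_right_mono)
      have "hnorm (Y1 S ?l) (u ?l) \<le> D * hnorm ?Y u"
        using order_trans[OF D(2)[OF ul] mult_left_mono[OF le]] D(1) by simp
      then show "cmod (hinner (Y1 S ?l) (u ?l) (p n)) \<le> D * hnorm ?Y u * hnorm (Y1 S ?l) (p n)"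
        using order_trans[OF Y1.Cauchy_Schwarz[OF Y21[OF ul] p_mem1] mult_right_mono[of _ "D * hnorm ?Y u"]] p_mem1 by simp
      show "cmod (hinner (Y2 S ?l) (u ?l) (p n)) \<le> hnorm ?Y u * hnorm (Y2 S ?l) (p n)"
        using order_trans[OF Y2.Cauchy_Schwarz[OF ul p_mem] mult_right_mono[OF le]] p_mem by simp
    qed auto
    finally show "cmod (f (u ?l)) \<le> (D * hnorm (Y1 S ?l) (p n) * cmod a2 + hnorm (Y2 S ?l) (p n) * cmod a1) * hnorm ?Y u"
      by (simp add: algebra_simps)
  qed (use comp f_add f_scale in \<open>auto simp: fun_simps\<close>)
  have f\<phi>: "f (\<phi> m ?l) = 0" for m
  proof (cases "lidx m = ?l")
    case False
    then have "\<phi> m ?l = 0" using \<phi>_0 by metis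
    then show ?thesis using p_mem p_mem1 by (simp add: f_def)
  next
    case l: True
    show ?thesis
    proof (cases "m = n")
      case True
      then show ?thesis by (simp add: f_def a1_def a2_def)
    next
      case False
      have pm: "\<phi> m ?l \<in> hcarrier (Y2 S ?l)" using p_mem[of m] l by simp
      have "hinner ?Y (\<phi> m) (\<phi> n) = 0" using cos False unfolding complete_orthogonal_system_def by blast
      moreover have "hinner ?Y (\<phi> m) (\<phi> n) = (\<Sum>i\<in>{1..Lnum S}. if i = ?l then hinner (Y2 S ?l) (\<phi> m ?l) (p n) else 0)"
        unfolding hsum_def hspace.simps
      proof (rule sum.cong[OF refl])
        fix i assume i: "i \<in> {1..Lnum S}"
        interpret Y2i: hilbert "Y2 S i" by (rule hilbertD[OF hilbert_l(4)[OF i]])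
        show "hinner (Y2 S i) (\<phi> m i) (\<phi> n i) = (if i = ?l then hinner (Y2 S ?l) (\<phi> m ?l) (p n) else 0)"
          using \<phi>_0[of i n] \<phi>_0[of i m] l by auto
      qed
      ultimately have 2: "hinner (Y2 S ?l) (\<phi> m ?l) (p n) = 0" using lidx[of n] by simp
      \<comment> \<open>With the same \<open>x\<close> in both modes, the inner product of
        \<open>Vext\<close> is the sum of the \<open>Y1\<close> and \<open>Y2\<close> products
        weighted by the squared norms of \<open>x\<close>. The \<open>Y2\<close> part is already 0,
        and \<open>x \<noteq> 0\<close> then frees the \<open>Y1\<close> part.\<close>
      have "tphi m x \<in> Vsep S \<phi> lidx m" "tphi n x \<in> Vsep S \<phi> lidx n" unfolding Vsep_eq using x(1) l by auto
      then have "Vx.ip (tphi m x) (tphi n x) = 0" using sep_orth(1) False by blast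
      moreover have "Vx.ip (tphi m x) (tphi n x) = hinner (Wl ?l) (ten S ?l x (\<phi> m ?l)) (ten S ?l x (p n))"
        unfolding tensor_phi_def[of S \<phi> lidx n] using single_inner[OF lidx tphi_mem[of x m]] x(1) l
        by (simp add: tensor_phi_def single_simps)
      ultimately have "hinner (X2 S ?l) x x * hinner (Y1 S ?l) (\<phi> m ?l) (p n) = 0"
        using ten_inner[OF lidx x(1) pm x(1) p_mem] 2 by simp
      then have 1: "hinner (Y1 S ?l) (\<phi> m ?l) (p n) = 0" using X2.ip_pos[OF x] by auto
      show ?thesis using 1 2 by (simp add: f_def)
    qed
  qed
  have f0: "f 0 = 0" using f_scale[of 0 0] by simp
  have span: "f (u ?l) = 0" if "u \<in> cspan (range \<phi>)" for u
  proof -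
    have "complex_vector.subspace {u \<in> hcarrier ?Y. f (u ?l) = 0}"
      unfolding complex_vector.subspace_def
    proof (intro conjI ballI allI)
      show "0 \<in> {u \<in> hcarrier ?Y. f (u ?l) = 0}" using f0 Y.mem_0 by (simp only: mem_Collect_eq fun_simps simp_thms)
    next
      fix u v assume "u \<in> {u \<in> hcarrier ?Y. f (u ?l) = 0}" "v \<in> {u \<in> hcarrier ?Y. f (u ?l) = 0}"
      then have uv: "u \<in> hcarrier ?Y" "v \<in> hcarrier ?Y" "f (u ?l) = 0" "f (v ?l) = 0" by blast+
      have "f ((u + v) ?l) = 0" unfolding fun_simps(1) f_add[OF comp[OF uv(1)] comp[OF uv(2)]] uv by simp
      then show "u + v \<in> {u \<in> hcarrier ?Y. f (u ?l) = 0}" using Y.mem_add[OF uv(1,2)] by blast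
    next
      fix c u assume "u \<in> {u \<in> hcarrier ?Y. f (u ?l) = 0}"
      then have u: "u \<in> hcarrier ?Y" "f (u ?l) = 0" by blast+
      have "f ((c *\<^sub>C u) ?l) = 0" unfolding fun_simps(4) f_scale[OF comp[OF u(1)]] u by simp
      then show "c *\<^sub>C u \<in> {u \<in> hcarrier ?Y. f (u ?l) = 0}" using Y.mem_scale[OF u(1)] by blast
    qed
    moreover have "range \<phi> \<subseteq> {u \<in> hcarrier ?Y. f (u ?l) = 0}"
      using f\<phi> cos unfolding complete_orthogonal_system_def by blast
    ultimately show ?thesis using that complex_vector.span_minimal by blast
  qed
  have dense: "hdense ?Y (cspan (range \<phi>))" using cos unfolding complete_orthogonal_system_def by blast
  have sy: "single ?l y \<in> hcarrier ?Y"
  proof -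
    have "0 \<in> hcarrier (Y2 S i)" if i: "i \<in> {1..Lnum S}" for i
    proof -
      interpret Y2i: hilbert "Y2 S i" by (rule hilbertD[OF hilbert_l(4)[OF i]])
      show ?thesis by (rule Y2i.mem_0)
    qed
    then show ?thesis using y lidx[of n] by (simp add: hsum_def single_def)
  qed
  obtain v :: "nat \<Rightarrow> _" where v: "\<And>k. v k \<in> cspan (range \<phi>)" "\<And>k. v k \<in> hcarrier ?Y" "(\<lambda>k. hnorm ?Y (v k - single ?l y)) \<longlonglongrightarrow> 0"
    using Y.dense_sequence[OF dense sy] by blast
  have "(\<lambda>k. f (v k ?l)) \<longlonglongrightarrow> f (single ?l y ?l)" by (rule Y.functional_tendsto[OF bf v(2) sy v(3)])
  then have "(\<lambda>k. 0) \<longlonglongrightarrow> f y" using span[OF v(1)] by (simp add: single_simps)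
  then have "f y = 0" using LIMSEQ_unique[OF tendsto_const] by metis
  then show ?thesis by (simp add: f_def a1_def a2_def)
qed

section \<open>Projections onto the modes and coercivity of the exterior form\<close>

definition P :: "nat \<Rightarrow> (nat \<Rightarrow> 'w) \<Rightarrow> nat \<Rightarrow> 'w"
  where "P n = Vx.proj (Vsep S \<phi> lidx n)"

lemmas P_mem = Vx.proj_mem[OF Vsep_subspace Vsep_closed, folded P_def]
  and P_orth = Vx.proj_orth[OF Vsep_subspace Vsep_closed, folded P_def]
  and P_carr [simp] = Vx.proj_carr[OF Vsep_subspace Vsep_closed, folded P_def]
  and P_eqI = Vx.proj_eqI[OF Vsep_subspace Vsep_closed, folded P_def]
  and P_fixed = Vx.proj_fixed[OF Vsep_subspace Vsep_closed, folded P_def]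
  and P_linear = Vx.proj_linear[OF Vsep_subspace Vsep_closed, folded P_def]
  and P_norm = Vx.proj_nrm_le[OF Vsep_subspace Vsep_closed, folded P_def]

lemma P_other: "m \<noteq> n \<Longrightarrow> u \<in> Vsep S \<phi> lidx m \<Longrightarrow> P n u = 0"
  using sep_orth(1) Vsep_carr[of m] complex_vector.subspace_0[OF Vsep_subspace]
  by (intro P_eqI) auto

text \<open>By \<open>coefficient_eq\<close> the projection acts on the second factor only: it sends
  \<open>x \<otimes> y\<close> to a multiple of \<open>x \<otimes> p n\<close>. Hence the
  coefficient of the mode never leaves the given subspace \<open>X\<close>, which later is
  \<open>XN\<close>.\<close>

lemma P_tensor_span:
  assumes X: "csubspace X" "X \<subseteq> hcarrier (X2 S (lidx n))" and Y: "Y \<subseteq> hcarrier (Y2 S (lidx n))"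
    and u: "u \<in> Vx.carr" "u (lidx n) \<in> tensor_span (ten S (lidx n)) X Y"
  obtains x where "x \<in> X" "P n u = tphi n x"
proof -
  let ?l = "lidx n" and ?t = "ten S (lidx n)"
  interpret W: hilbert "Wl ?l" by (rule hilbertD[OF hilbert_Wl[OF lidx]])
  interpret Y2: hilbert "Y2 S ?l" by (rule hilbertD[OF hilbert_l(4)[OF lidx]])
  interpret Y1: hilbert "Y1 S ?l" by (rule hilbertD[OF hilbert_l(3)[OF lidx]])
  note t = hilbert_l(2,3)[OF lidx, of n] tensor_l(2)[OF lidx, of n]
  have tm: "?t x y \<in> hcarrier (Wl ?l)" if "x \<in> hcarrier (X2 S ?l)" "y \<in> hcarrier (Y2 S ?l)" for x y
    using ten_mem[OF lidx that] .
  have X2m: "x \<in> hcarrier (X2 S ?l)" if "x \<in> X" for x using that X(2) by blast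
  have Y21: "v \<in> hcarrier (Y1 S ?l)" if "v \<in> hcarrier (Y2 S ?l)" for v using cont_embeddedD[OF embedded_l(2)[OF lidx] that] .
  interpret X2: hilbert "X2 S ?l" by (rule hilbertD[OF hilbert_l(2)[OF lidx]])
  define R where "R = (\<lambda>w x. w \<in> hcarrier (Wl ?l) \<and>
    (\<forall>x'\<in>hcarrier (X2 S ?l). hinner (Wl ?l) (w - ?t x (p n)) (?t x' (p n)) = 0))"
  have "\<exists>x\<in>X. R (u ?l) x"
  proof (rule tensor_span_related[OF u(2) X(1)])
    show "R 0 0" unfolding R_def using p_mem tm p_mem1 by (simp add: tensor_0_left[OF t] del: hcarrier_hinter)
  next
    fix x y assume x: "x \<in> X" and y: "y \<in> Y"
    note x2 = X2m[OF x]
    have y2: "y \<in> hcarrier (Y2 S ?l)" using y Y by blast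
    show "\<exists>z\<in>X. R (?t x y) z"
    proof (cases "x = 0")
      case True
      have "?t x y = 0" using True tensor_0_left[OF t Y21[OF y2]] by simp
      then have "R (?t x y) 0" unfolding R_def using p_mem tm p_mem1 by (simp add: tensor_0_left[OF t] del: hcarrier_hinter)
      then show ?thesis using complex_vector.subspace_0[OF X(1)] by blast
    next
      case False
      \<comment> \<open>By \<open>coefficient_eq\<close>, which needs \<open>x \<noteq> 0\<close>,
        this quotient is the same for \<open>Y2\<close>; so one multiple of \<open>x\<close> makes
        both summands of the inner product of \<open>Wl\<close> vanish.\<close>
      define c where "c = hinner (Y1 S ?l) y (p n) / hinner (Y1 S ?l) (p n) (p n)"
      have n1: "hinner (Y1 S ?l) (p n) (p n) \<noteq> 0" using Y1.ip_pos[OF p_mem1 p_nonzero] by auto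
      have c1: "c * hinner (Y1 S ?l) (p n) (p n) = hinner (Y1 S ?l) y (p n)" using n1 by (simp add: c_def)
      have c2: "c * hinner (Y2 S ?l) (p n) (p n) = hinner (Y2 S ?l) y (p n)"
        using coefficient_eq[OF x2 False y2] n1 by (simp add: c_def field_simps)
      have cx: "c *\<^sub>C x \<in> X" using complex_vector.subspace_scale[OF X(1) x] .
      have "hinner (Wl ?l) (?t x y - ?t (c *\<^sub>C x) (p n)) (?t x' (p n)) = 0" if x': "x' \<in> hcarrier (X2 S ?l)" for x'
      proof -
        have "hinner (Wl ?l) (?t x y - ?t (c *\<^sub>C x) (p n)) (?t x' (p n)) =
          hinner (Wl ?l) (?t x y) (?t x' (p n)) - c * hinner (Wl ?l) (?t x (p n)) (?t x' (p n))"
          unfolding tensor_scale_left[OF t x2 p_mem1]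
          by (simp only: W.ip_diff_left[OF tm[OF x2 y2] W.mem_scale[OF tm[OF x2 p_mem]] tm[OF x' p_mem]]
             W.ip_scale_left[OF tm[OF x2 p_mem] tm[OF x' p_mem]])
        also have "\<dots> = 0"
          unfolding ten_inner[OF lidx x2 y2 x' p_mem] ten_inner[OF lidx x2 p_mem x' p_mem] c1[symmetric] c2[symmetric]
          by (simp add: algebra_simps)
        finally show ?thesis .
      qed
      then have "R (?t x y) (c *\<^sub>C x)" unfolding R_def using tm[OF x2 y2] by blast
      then show ?thesis using cx by blast
    qed
  next
    fix w x w' x' assume x: "x \<in> X" "x' \<in> X" and R: "R w x" "R w' x'"
    have eq: "w + w' - ?t (x + x') (p n) = (w - ?t x (p n)) + (w' - ?t x' (p n))"
      using X2m[OF x(1)] X2m[OF x(2)] p_mem1 by (simp add: tensor_add_left[OF t])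
    show "R (w + w') (x + x')"
      using R X2m[OF x(1)] X2m[OF x(2)] p_mem tm unfolding R_def eq
      by (simp add: W.ip_add_left del: hcarrier_hinter)
  next
    fix c w x assume x: "x \<in> X" and R: "R w x"
    have eq: "c *\<^sub>C w - ?t (c *\<^sub>C x) (p n) = c *\<^sub>C (w - ?t x (p n))"
      using X2m[OF x] p_mem1 by (simp add: tensor_scale_left[OF t] complex_vector.scale_right_diff_distrib)
    show "R (c *\<^sub>C w) (c *\<^sub>C x)"
      using R X2m[OF x] p_mem tm unfolding R_def eq
      by (simp add: W.ip_scale_left del: hcarrier_hinter)
  qed
  then obtain x where x: "x \<in> X" "R (u ?l) x" by blast
  have xm: "tphi n x \<in> Vx.carr" by (rule tphi_mem[OF X2m[OF x(1)]])
  have "P n u = tphi n x"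
  proof (rule P_eqI[OF u(1)])
    show "tphi n x \<in> Vsep S \<phi> lidx n" unfolding Vsep_eq using X2m[OF x(1)] by blast
    fix v assume "v \<in> Vsep S \<phi> lidx n"
    then obtain x' where x': "x' \<in> hcarrier (X2 S ?l)" "v = tphi n x'" unfolding Vsep_eq by blast
    have "Vx.ip (u - tphi n x) v = hinner (Wl ?l) ((u - tphi n x) ?l) (?t x' (p n))"
      unfolding x'(2) tensor_phi_def[of S \<phi> lidx n x'] by (rule single_inner[OF lidx Vx.mem_diff[OF u(1) xm]])
    also have "(u - tphi n x) ?l = u ?l - ?t x (p n)" by (simp add: fun_simps tensor_phi_def single_simps)
    also have "hinner (Wl ?l) (u ?l - ?t x (p n)) (?t x' (p n)) = 0" using x(2) x'(1) unfolding R_def by blast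
    finally show "Vx.ip (u - tphi n x) v = 0" .
  qed
  with x(1) show ?thesis using that by blast
qed

text \<open>Identity plus \<open>J\<close> multiplies the mode \<open>n < M\<close> by
  \<open>c n\<close> and keeps the others. The identity is left out so that the traces of
  \<open>J\<close> stay in a finite-dimensional space.\<close>

definition J :: "nat \<Rightarrow> (nat \<Rightarrow> complex) \<Rightarrow> (nat \<Rightarrow> 'w) \<Rightarrow> nat \<Rightarrow> 'w"
  where "J M c u = (\<Sum>n<M. (c n - 1) *\<^sub>C P n u)"

lemma J_mem [simp]: "u \<in> Vx.carr \<Longrightarrow> J M c u \<in> Vx.carr"
  unfolding J_def by (intro Vx.mem_sum Vx.mem_scale P_carr)

lemma J_bounded: "bounded_op (Vext S) (Vext S) (J M c)"
proof (rule bounded_opI[where C = "\<Sum>n<M. cmod (c n - 1)"])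
  show "clinear_on (Vx.carr) (J M c)"
    unfolding clinear_on_def J_def
    by (auto simp: clinear_onD[OF P_linear] complex_vector.scale_right_distrib sum.distrib
      complex_vector.scale_sum_right mult.commute)
  fix u assume u: "u \<in> Vx.carr"
  have "Vx.nrm (J M c u) \<le> (\<Sum>n<M. Vx.nrm ((c n - 1) *\<^sub>C P n u))"
    unfolding J_def by (rule Vx.nrm_sum) (use u in auto)
  also have "\<dots> \<le> (\<Sum>n<M. cmod (c n - 1) * Vx.nrm u)"
    using P_norm[OF u] u by (intro sum_mono) (auto intro: mult_left_mono)
  finally show "Vx.nrm (J M c u) \<le> (\<Sum>n<M. cmod (c n - 1)) * Vx.nrm u" by (simp add: sum_distrib_right)
qed simp

lemma P_J:
  assumes "n < M" and u: "u \<in> Vx.carr"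
  shows "P n (J M c u) = (c n - 1) *\<^sub>C P n u"
proof -
  have "P n (J M c u) = (\<Sum>m<M. P n ((c m - 1) *\<^sub>C P m u))"
    unfolding J_def by (rule clinear_on_sum[OF Vx.subspace_carr P_linear]) (use u in auto)
  also have "\<dots> = (\<Sum>m<M. if m = n then (c n - 1) *\<^sub>C P n u else 0)"
    using u P_mem[OF u] P_fixed P_other by (intro sum.cong) (auto simp: clinear_onD(2)[OF P_linear])
  finally show ?thesis using assms(1) by simp
qed

text \<open>This says that identity plus \<open>J M c\<close> inverts identity plus
  \<open>J M c'\<close>, with the identity cancelled. On mode \<open>n\<close> it is the factor
  \<open>c n * c' n - 1 = 0\<close>.\<close>

lemma J_inverse:
  assumes u: "u \<in> Vx.carr" and c: "\<And>n. n < M \<Longrightarrow> c n * c' n = 1"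
  shows "J M c' u + J M c (u + J M c' u) = 0"
proof -
  have "J M c (u + J M c' u) = (\<Sum>n<M. (c n - 1) *\<^sub>C (P n u + (c' n - 1) *\<^sub>C P n u))"
    unfolding J_def[of M c] using u by (intro sum.cong) (auto simp: clinear_onD(1)[OF P_linear] P_J)
  then have "J M c' u + J M c (u + J M c' u) = (\<Sum>n<M. (c' n - 1) *\<^sub>C P n u + (c n - 1) *\<^sub>C (P n u + (c' n - 1) *\<^sub>C P n u))"
    by (simp add: J_def sum.distrib)
  also have "\<dots> = (\<Sum>n<M. 0)"
  proof (rule sum.cong[OF refl])
    fix n assume "n \<in> {..<M}"
    then have "c n * c' n = 1" using c by simp
    then have "(c' n - 1) + ((c n - 1) + (c n - 1) * (c' n - 1)) = 0" by (simp add: algebra_simps)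
    then have "((c' n - 1) + ((c n - 1) + (c n - 1) * (c' n - 1))) *\<^sub>C P n u = 0" by simp
    then show "(c' n - 1) *\<^sub>C P n u + (c n - 1) *\<^sub>C (P n u + (c' n - 1) *\<^sub>C P n u) = 0"
      by (simp only: complex_vector.scale_left_distrib complex_vector.scale_right_distrib complex_vector.scale_scale)
  qed
  finally show ?thesis by simp
qed

text \<open>\<open>N \<ge> M\<close> is provided so that the sum over \<open>n < M\<close> in
  \<open>J\<close> can be extended to the range of \<open>u\<close>.\<close>

lemma span_Vsep:
  assumes "u \<in> cspan (\<Union>n. Vsep S \<phi> lidx n)"
  obtains N v where "N \<ge> M" "\<And>n. v n \<in> Vsep S \<phi> lidx n" "\<And>n. n \<ge> N \<Longrightarrow> v n = 0" "u = (\<Sum>n<N. v n)"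
proof -
  let ?Q = "{u. \<exists>N\<ge>M. \<exists>v. (\<forall>n. v n \<in> Vsep S \<phi> lidx n) \<and> (\<forall>n\<ge>N. v n = 0) \<and> u = (\<Sum>n<N. v n)}"
  have ext: "(\<Sum>n<N. v n) = (\<Sum>n<N'. v n)" if "\<forall>n\<ge>N. v n = 0" "N \<le> N'" for N N' and v :: "nat \<Rightarrow> nat \<Rightarrow> 'w"
    using that by (intro sum.mono_neutral_left) auto
  note sub = complex_vector.subspace_0[OF Vsep_subspace] complex_vector.subspace_add[OF Vsep_subspace] complex_vector.subspace_scale[OF Vsep_subspace]
  have "complex_vector.subspace ?Q"
    unfolding complex_vector.subspace_def
  proof (intro conjI ballI allI)
    show "0 \<in> ?Q" using sub(1) by (intro CollectI exI[of _ M] conjI exI[of _ "\<lambda>_. 0"]) auto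
  next
    fix x y assume "x \<in> ?Q" "y \<in> ?Q"
    then obtain N v N' v' where x: "N \<ge> M" "\<And>n. v n \<in> Vsep S \<phi> lidx n" "\<forall>n\<ge>N. v n = 0" "x = (\<Sum>n<N. v n)"
      and y: "N' \<ge> M" "\<And>n. v' n \<in> Vsep S \<phi> lidx n" "\<forall>n\<ge>N'. v' n = 0" "y = (\<Sum>n<N'. v' n)" by blast
    have "x + y = (\<Sum>n<max N N'. v n + v' n)"
      using ext[OF x(3), of "max N N'"] ext[OF y(3), of "max N N'"] x(4) y(4) by (simp add: sum.distrib)
    then show "x + y \<in> ?Q" using x y sub(2)
      by (intro CollectI exI[of _ "max N N'"] conjI exI[of _ "\<lambda>n. v n + v' n"]) auto
  next
    fix c x assume "x \<in> ?Q"
    then obtain N v where x: "N \<ge> M" "\<And>n. v n \<in> Vsep S \<phi> lidx n" "\<forall>n\<ge>N. v n = 0" "x = (\<Sum>n<N. v n)" by blast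
    then show "c *\<^sub>C x \<in> ?Q" using sub(3)
      by (intro CollectI exI[of _ N] conjI exI[of _ "\<lambda>n. c *\<^sub>C v n"]) (auto simp: complex_vector.scale_sum_right)
  qed
  moreover have "(\<Union>n. Vsep S \<phi> lidx n) \<subseteq> ?Q"
  proof clarify
    fix w n assume w: "w \<in> Vsep S \<phi> lidx n"
    have "(\<Sum>m<max M (Suc n). if m = n then w else 0) = w" by (subst sum.delta) auto
    then show "\<exists>N\<ge>M. \<exists>v. (\<forall>n. v n \<in> Vsep S \<phi> lidx n) \<and> (\<forall>n\<ge>N. v n = 0) \<and> w = (\<Sum>n<N. v n)"
      using w sub(1) by (intro exI[of _ "max M (Suc n)"] conjI exI[of _ "\<lambda>m. if m = n then w else 0"]) auto
  qed
  ultimately have "u \<in> ?Q" using assms complex_vector.span_minimal by blast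
  then show ?thesis using that by blast
qed

text \<open>For a finite sum of modes all cross terms vanish, both in \<open>sext\<close> and in the
  norm, and the factor \<open>cnj (\<theta> n)\<close> in the antilinear slot comes out as
  \<open>\<theta> n\<close>. The modewise coercivity then adds up, and density gives the
  rest.\<close>

lemma sext_coercive:
  assumes C: "assumption_C S \<phi> lidx M Cs \<alpha> \<theta> K \<kappa>" and u: "u \<in> Vx.carr"
  shows "\<alpha> * (Vx.nrm u)\<^sup>2 \<le> Re (sext S \<kappa> u (u + J M (\<lambda>n. cnj (\<theta> n)) u))"
proof -
  have se: "sesquilinear_on (Vx.carr) (sext S \<kappa>)" using forms_bounded(2)[OF \<kappa>] unfolding bounded_sesquilinear_def by blast
  note fe = sesquilinear_onD[OF se]
  let ?J = "J M (\<lambda>n. cnj (\<theta> n))"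
  have "bounded_sesquilinear (Vext S) (\<lambda>u v. sext S \<kappa> u v + sext S \<kappa> u (?J v))"
    by (rule Vx.bounded_sesquilinear_add[OF forms_bounded(2)[OF \<kappa>] Vx.bounded_sesquilinear_comp[OF forms_bounded(2)[OF \<kappa>] J_bounded]])
  then have "\<alpha> * (Vx.nrm u)\<^sup>2 \<le> Re (sext S \<kappa> u u + sext S \<kappa> u (?J u))"
  proof (rule Vx.coercive_dense[OF _ Vsep_dense _ u])
    fix u assume "u \<in> cspan (\<Union>n. Vsep S \<phi> lidx n)"
    then obtain N v where v: "N \<ge> M" "\<And>n. v n \<in> Vsep S \<phi> lidx n" "\<And>n. n \<ge> N \<Longrightarrow> v n = 0" "u = (\<Sum>n<N. v n)"
      by (rule span_Vsep[of u M]) blast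
    have vc: "v n \<in> Vx.carr" for n using v(2) Vsep_carr by blast
    have uc: "u \<in> Vx.carr" unfolding v(4) using vc by blast
    have Pu: "P n u = v n" for n
    proof -
      have "P n u = (\<Sum>m<N. P n (v m))" unfolding v(4) by (rule clinear_on_sum[OF Vx.subspace_carr P_linear]) (use vc in auto)
      also have "\<dots> = (\<Sum>m<N. if m = n then v n else 0)"
        using P_fixed[OF v(2)] P_other[OF _ v(2)] by (intro sum.cong) auto
      finally show ?thesis using v(3)[of n] by (cases "n < N") auto
    qed
    \<comment> \<open>The value 1 from \<open>M\<close> on leaves these modes unchanged and makes
      the added terms of \<open>J\<close> zero.\<close>
    define c where "c = (\<lambda>n. if n < M then cnj (\<theta> n) else 1)"
    have "?J u = (\<Sum>n<N. (c n - 1) *\<^sub>C v n)"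
    proof -
      have "?J u = (\<Sum>n<M. (c n - 1) *\<^sub>C v n)" unfolding J_def Pu by (intro sum.cong) (auto simp: c_def)
      also have "\<dots> = (\<Sum>n<N. (c n - 1) *\<^sub>C v n)" using v(1) by (intro sum.mono_neutral_left) (auto simp: c_def)
      finally show ?thesis .
    qed
    then have uJ: "u + ?J u = (\<Sum>n<N. c n *\<^sub>C v n)"
      unfolding v(4) by (simp add: sum.distrib[symmetric] complex_vector.scale_left_diff_distrib scaleC_one)
    have "sext S \<kappa> u u + sext S \<kappa> u (?J u) = sext S \<kappa> u (u + ?J u)" using fe(2)[OF uc J_mem[OF uc] uc] by simp
    also have "\<dots> = (\<Sum>n<N. sext S \<kappa> u (c n *\<^sub>C v n))"
      unfolding uJ by (rule form_sum_right[OF Vx.subspace_carr se]) (use vc uc in auto)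
    also have "\<dots> = (\<Sum>n<N. \<Sum>m<N. cnj (c n) * sext S \<kappa> (v m) (v n))"
    proof (rule sum.cong[OF refl])
      fix n
      have "sext S \<kappa> u (c n *\<^sub>C v n) = cnj (c n) * sext S \<kappa> u (v n)" by (rule fe(4)[OF uc vc])
      also have "sext S \<kappa> u (v n) = (\<Sum>m<N. sext S \<kappa> (v m) (v n))"
        unfolding v(4) by (rule form_sum_left[OF Vx.subspace_carr se]) (use vc in auto)
      finally show "sext S \<kappa> u (c n *\<^sub>C v n) = (\<Sum>m<N. cnj (c n) * sext S \<kappa> (v m) (v n))" by (simp add: sum_distrib_left)
    qed
    also have "\<dots> = (\<Sum>n<N. cnj (c n) * sext S \<kappa> (v n) (v n))"
    proof (rule sum_diagonal)
      fix m n :: nat assume "m \<noteq> n"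
      then show "cnj (c m) * sext S \<kappa> (v n) (v m) = 0" using sep_orth(2)[OF _ v(2) v(2), of n m] by simp
    qed
    finally have form: "sext S \<kappa> u u + sext S \<kappa> u (?J u) = (\<Sum>n<N. cnj (c n) * sext S \<kappa> (v n) (v n))" .
    have "Vx.ip u u = (\<Sum>m<N. \<Sum>n<N. Vx.ip (v m) (v n))"
    proof -
      have "Vx.ip u u = (\<Sum>m<N. Vx.ip (v m) u)"
        unfolding v(4) by (rule Vx.ip_sum_left) (use vc in auto)
      also have "\<dots> = (\<Sum>m<N. \<Sum>n<N. Vx.ip (v m) (v n))"
        unfolding v(4) by (intro sum.cong refl Vx.ip_sum_right) (use vc in auto)
      finally show ?thesis .
    qed
    also have "\<dots> = (\<Sum>n<N. Vx.ip (v n) (v n))"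
      by (rule sum_diagonal) (rule sep_orth(1)[OF _ v(2) v(2)])
    finally have norm: "(Vx.nrm u)\<^sup>2 = (\<Sum>n<N. (Vx.nrm (v n))\<^sup>2)"
      using uc vc by (simp add: Vx.nrm_sq)
    have each: "\<alpha> * (Vx.nrm (v n))\<^sup>2 \<le> Re (cnj (c n) * sext S \<kappa> (v n) (v n))" for n
    proof -
      obtain x where x: "x \<in> hcarrier (X2 S (lidx n))" "v n = tphi n x" using v(2)[of n] unfolding Vsep_eq by blast
      have xs: "x \<in> hcarrier (Xsep S \<phi> lidx n)" using x(1) Xsep_carrier by blast
      have nx: "hnorm (Xsep S \<phi> lidx n) x = Vx.nrm (v n)" by (simp add: hnorm_def Xsep_def x(2))
      have sx: "sn S \<phi> lidx \<kappa> n x x = sext S \<kappa> (v n) (v n)" by (simp add: sn_def x(2))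
      show ?thesis
      proof (cases "n < M")
        case True
        then have "Re (\<theta> n * sn S \<phi> lidx \<kappa> n x x) \<ge> \<alpha> * (hnorm (Xsep S \<phi> lidx n) x)\<^sup>2"
          using C xs unfolding assumption_C_def by blast
        then show ?thesis using True unfolding nx sx by (simp add: c_def)
      next
        case False
        then have "Re (sn S \<phi> lidx \<kappa> n x x) \<ge> \<alpha> * (hnorm (Xsep S \<phi> lidx n) x)\<^sup>2"
          using C xs unfolding assumption_C_def by (meson not_le)
        then show ?thesis using False unfolding nx sx by (simp add: c_def)
      qed
    qed
    have "\<alpha> * (Vx.nrm u)\<^sup>2 = (\<Sum>n<N. \<alpha> * (Vx.nrm (v n))\<^sup>2)" unfolding norm by (rule sum_distrib_left)
    also have "\<dots> \<le> (\<Sum>n<N. Re (cnj (c n) * sext S \<kappa> (v n) (v n)))" by (intro sum_mono each)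
    finally show "\<alpha> * (Vx.nrm u)\<^sup>2 \<le> Re (sext S \<kappa> u u + sext S \<kappa> u (?J u))"
      unfolding form Re_sum .
  qed
  then show ?thesis using fe(2)[OF u J_mem[OF u] u] by simp
qed

end

subsection \<open>Discretization\<close>

lemma eventually_fst_at_right:
  "eventually P (at_right (0::real)) \<Longrightarrow> \<forall>\<^sub>F i in at_right 0 \<times>\<^sub>F sequentially. P (fst i)"
  by (rule eventually_compose_filterlim[OF _ filterlim_fst])

lemma eventually_snd_sequentially:
  "eventually P sequentially \<Longrightarrow> \<forall>\<^sub>F i in at_right (0::real) \<times>\<^sub>F sequentially. P (snd i)"
  by (rule eventually_compose_filterlim[OF _ filterlim_snd])

lemma eventually_at_right_0I:
  "h0 > 0 \<Longrightarrow> (\<And>h. 0 < h \<Longrightarrow> h \<le> h0 \<Longrightarrow> P h) \<Longrightarrow> eventually P (at_right (0::real))"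
  unfolding eventually_at_right_field by (intro exI[of _ h0]) auto

locale discretized = separated S \<phi> lidx \<kappa>
  for S :: "('v::complex_vector, 'z::complex_vector, 'x::complex_vector,
    'y::complex_vector, 'w::complex_vector) setting" and \<phi> lidx \<kappa> +
  fixes D :: "('v, 'z, 'x, 'y) discretization"
    and M :: nat and Cs \<alpha> :: real and \<theta> :: "nat \<Rightarrow> complex" and K :: "'v \<Rightarrow> 'v"
  assumes D: "assumption_D S D" and C: "assumption_C S \<phi> lidx M Cs \<alpha> \<theta> K \<kappa>"
begin

abbreviation trd where "trd \<equiv> trm_dagger D"
abbreviation trh where "trh \<equiv> trmh_dagger D"

lemma Vh_int: "h > 0 \<Longrightarrow> csubspace (Vh_int D h)" "h > 0 \<Longrightarrow> fin_dim (Vh_int D h)" "h > 0 \<Longrightarrow> Vh_int D h \<subseteq> Vi.carr"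
    "h > 0 \<Longrightarrow> h \<le> h' \<Longrightarrow> Vh_int D h' \<subseteq> Vh_int D h"
  and Vh_int_dense: "hdense (Vint S) (\<Union>h\<in>{0<..}. Vh_int D h)"
  and VhN_ext_carr: "h > 0 \<Longrightarrow> VhN_ext S D h N \<subseteq> Vx.carr"
  and trp_VhN_ext: "h > 0 \<Longrightarrow> trp S ` VhN_ext S D h N = trm S ` Vh_int D h"
  and trd: "bounded_op (Zsp S) (Vint S) trd"
  and trh: "h > 0 \<Longrightarrow> bounded_op (Zsp S) (hsub (Vint S) (Vh_int D h)) (trh h)"
  and trm_trd: "g \<in> Z.carr \<Longrightarrow> trm S (trd g) = g"
  and trm_trh: "h > 0 \<Longrightarrow> u \<in> Vh_int D h \<Longrightarrow> trm S (trh h (trm S u)) = trm S u"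
  and trh_tendsto: "g \<in> Z.carr \<Longrightarrow> ((\<lambda>h. Vi.nrm (trd g - trh h g)) \<longlongrightarrow> 0) (at_right 0)"
  using D unfolding assumption_D_def by auto

lemma discrete_l:
  assumes "l \<in> {1..Lnum S}"
  shows "h > 0 \<Longrightarrow> csubspace (Yh D h l)" "h > 0 \<Longrightarrow> fin_dim (Yh D h l)" "h > 0 \<Longrightarrow> Yh D h l \<subseteq> hcarrier (Y2 S l)"
    "h > 0 \<Longrightarrow> h \<le> h' \<Longrightarrow> Yh D h' l \<subseteq> Yh D h l" "hdense (Y2 S l) (\<Union>h\<in>{0<..}. Yh D h l)"
    "csubspace (XN D N l)" "closedin (htop (X2 S l)) (XN D N l)" "N \<le> N' \<Longrightarrow> XN D N l \<subseteq> XN D N' l"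
    "hdense (X2 S l) (\<Union>N. XN D N l)"
  using D assms unfolding assumption_D_def by auto

lemma XN_carr: "l \<in> {1..Lnum S} \<Longrightarrow> XN D N l \<subseteq> hcarrier (X2 S l)"
  using discrete_l(9) unfolding hdense_def by blast

lemma \<alpha>: "\<alpha> > 0" and \<theta>: "n < M \<Longrightarrow> cmod (\<theta> n) = 1" and K: "compact_op (Vint S) (Vint S) K"
  and sint_coercive: "u \<in> Vi.carr \<Longrightarrow>
    Re (sint S \<kappa> u u) + Re (Vi.ip (K u) u) \<ge> \<alpha> * (Vi.nrm u)\<^sup>2"
  using C unfolding assumption_C_def by auto

lemmas trd_mem = bounded_opD(1)[OF trd]
  and trd_simps = clinear_onD[OF bounded_opD(2)[OF trd]] clinear_on_diff[OF Z.subspace_carr bounded_opD(2)[OF trd]]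
    clinear_on_0[OF Z.subspace_carr bounded_opD(2)[OF trd]]

lemma trh_mem: "h > 0 \<Longrightarrow> g \<in> Z.carr \<Longrightarrow> trh h g \<in> Vh_int D h"
  using bounded_opD(1)[OF trh] by auto

lemma trh_carr: "h > 0 \<Longrightarrow> g \<in> Z.carr \<Longrightarrow> trh h g \<in> Vi.carr"
  using trh_mem Vh_int(3) by blast

lemmas trh_simps = clinear_onD[OF bounded_opD(2)[OF trh]] clinear_on_diff[OF Z.subspace_carr bounded_opD(2)[OF trh]]

text \<open>Convergence as \<open>h\<close> tends to 0 bounds the values pointwise only along
  sequences. So a sequence \<open>h k\<close> tending to 0 is extracted on which the bound with
  constant \<open>k\<close> fails, and Banach-Steinhaus is applied to it.\<close>

lemma trh_uniform:
  obtains C where "C > 0" "\<forall>\<^sub>F h in at_right 0. \<forall>g\<in>Z.carr. Vi.nrm (trh h g) \<le> C * Z.nrm g"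
proof -
  have "\<exists>C. \<forall>\<^sub>F h in at_right 0. \<forall>g\<in>Z.carr. Vi.nrm (trh h g) \<le> C * Z.nrm g"
  proof (rule ccontr)
    assume "\<not> ?thesis"
    then have ne: "\<not> (\<forall>\<^sub>F h in at_right 0. \<forall>g\<in>Z.carr. Vi.nrm (trh h g) \<le> C * Z.nrm g)" for C by blast
    \<comment> \<open>Otherwise the constant \<open>k\<close> would do for all small
      \<open>h\<close>.\<close>
    have "\<exists>h. 0 < h \<and> h < inverse (real (Suc k)) \<and>
        (\<exists>g\<in>Z.carr. \<not> Vi.nrm (trh h g) \<le> real k * Z.nrm g)" for k
    proof (rule ccontr)
      assume "\<not> ?thesis"
      then have "\<forall>h>0. h < inverse (real (Suc k)) \<longrightarrow> (\<forall>g\<in>Z.carr. Vi.nrm (trh h g) \<le> real k * Z.nrm g)" by blast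
      then have "\<forall>\<^sub>F h in at_right 0. \<forall>g\<in>Z.carr. Vi.nrm (trh h g) \<le> real k * Z.nrm g"
        unfolding eventually_at_right_field by (intro exI[of _ "inverse (real (Suc k))"]) simp
      then show False using ne by blast
    qed
    then obtain h where h: "\<And>k. 0 < h k" "\<And>k. h k < inverse (real (Suc k))"
      "\<And>k. \<exists>g\<in>Z.carr. \<not> Vi.nrm (trh (h k) g) \<le> real k * Z.nrm g" by metis
    have h0: "filterlim h (at_right 0) sequentially"
    proof (rule tendsto_imp_filterlim_at_right)
      show "h \<longlonglongrightarrow> 0" by (rule null_squeeze[OF LIMSEQ_inverse_real_of_nat]) (use h in \<open>auto intro: less_imp_le\<close>)
    qed (use h in auto)
    obtain C where C: "\<And>k g. g \<in> Z.carr \<Longrightarrow> Vi.nrm (trh (h k) g) \<le> C * Z.nrm g"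
    proof (rule Z.uniform_boundedness[of "\<lambda>k g. Vi.nrm (trh (h k) g)"])
      fix k x y assume xy: "x \<in> Z.carr" "y \<in> Z.carr"
      show "Vi.nrm (trh (h k) (x - y)) \<le> Vi.nrm (trh (h k) x) + Vi.nrm (trh (h k) y)"
        unfolding trh_simps(3)[OF h(1) xy] by (intro Vi.nrm_triangle_diff trh_carr h(1) xy)
    next
      fix k c x assume x: "x \<in> Z.carr"
      show "Vi.nrm (trh (h k) (c *\<^sub>C x)) = cmod c * Vi.nrm (trh (h k) x)"
        unfolding trh_simps(2)[OF h(1) x] by (intro Vi.nrm_scale trh_carr h(1) x)
    next
      fix k
      show "\<exists>C. \<forall>x\<in>Z.carr. Vi.nrm (trh (h k) x) \<le> C * Z.nrm x"
        using trh[OF h(1)[of k]] unfolding bounded_op_def by simp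
    next
      fix g assume g: "g \<in> Z.carr"
      have "(\<lambda>k. Vi.nrm (trd g - trh (h k) g)) \<longlonglongrightarrow> 0"
        by (rule filterlim_compose[OF trh_tendsto[OF g] h0])
      then have "Bseq (\<lambda>k. Vi.nrm (trd g - trh (h k) g))" by (rule convergent_imp_Bseq[OF convergentI])
      then obtain B where B: "\<And>k. \<bar>Vi.nrm (trd g - trh (h k) g)\<bar> \<le> B" unfolding Bseq_def by auto
      have "Vi.nrm (trh (h k) g) \<le> Vi.nrm (trd g) + B" for k
      proof -
        have m: "trd g \<in> Vi.carr" "trh (h k) g \<in> Vi.carr" using trd_mem[OF g] trh_carr[OF h(1) g] .
        have "Vi.nrm (trh (h k) g) \<le> Vi.nrm (trd g) + Vi.nrm (trd g - trh (h k) g)"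
          using Vi.nrm_triangle_diff[OF m(1) Vi.mem_diff[OF m]] by simp
        then show ?thesis using B[of k] by linarith
      qed
      then show "\<exists>C. \<forall>k. Vi.nrm (trh (h k) g) \<le> C" by blast
    qed blast
    obtain k :: nat where k: "C \<le> real k" using real_arch_simple by blast
    obtain g where g: "g \<in> Z.carr" "\<not> Vi.nrm (trh (h k) g) \<le> real k * Z.nrm g" using h(3) by blast
    have "C * Z.nrm g \<le> real k * Z.nrm g" using k g(1) by (intro mult_right_mono) auto
    then show False using C[OF g(1), of k] g(2) by linarith
  qed
  then obtain C where C: "\<forall>\<^sub>F h in at_right 0. \<forall>g\<in>Z.carr. Vi.nrm (trh h g) \<le> C * Z.nrm g" by blast
  have "\<forall>\<^sub>F h in at_right 0. \<forall>g\<in>Z.carr. Vi.nrm (trh h g) \<le> (\<bar>C\<bar> + 1) * Z.nrm g"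
    using C
  proof eventually_elim
    case (elim h)
    show ?case
    proof
      fix g assume g: "g \<in> Z.carr"
      have "C * Z.nrm g \<le> (\<bar>C\<bar> + 1) * Z.nrm g" using g by (intro mult_right_mono) auto
      then show "Vi.nrm (trh h g) \<le> (\<bar>C\<bar> + 1) * Z.nrm g" using elim g by fastforce
    qed
  qed
  then show ?thesis using that[of "\<bar>C\<bar> + 1"] by simp
qed

text \<open>The traces come from the modes \<open>n < M\<close> only, and each of these has finitely
  many; the basis does not depend on \<open>c\<close> or \<open>u\<close>. On it the pointwise
  convergence of \<open>trh\<close> to \<open>trd\<close> becomes uniform.\<close>

lemma trace_basis:
  obtains E where "Z.orthonormal E" "\<And>c u. u \<in> Vx.carr \<Longrightarrow> trp S (J M c u) \<in> cspan E"
proof -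
  have "\<exists>E. Z.orthonormal E \<and> cspan E = trp S ` Vsep S \<phi> lidx n" for n
  proof -
    have sub: "trp S ` Vsep S \<phi> lidx n \<subseteq> Z.carr" using Vsep_carr trp_mem by blast
    have "csubspace (trp S ` Vsep S \<phi> lidx n)"
      unfolding complex_vector.subspace_def
    proof (intro conjI ballI allI)
      show "0 \<in> trp S ` Vsep S \<phi> lidx n" using trp_simps(4) complex_vector.subspace_0[OF Vsep_subspace] by (metis imageI)
    next
      fix x y assume "x \<in> trp S ` Vsep S \<phi> lidx n" "y \<in> trp S ` Vsep S \<phi> lidx n"
      then obtain u v where uv: "u \<in> Vsep S \<phi> lidx n" "x = trp S u" "v \<in> Vsep S \<phi> lidx n" "y = trp S v" by blast
      then have "x + y = trp S (u + v)" using Vsep_carr[of n] by (simp add: trp_simps(1) subset_iff)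
      then show "x + y \<in> trp S ` Vsep S \<phi> lidx n" using complex_vector.subspace_add[OF Vsep_subspace uv(1,3)] by blast
    next
      fix c x assume "x \<in> trp S ` Vsep S \<phi> lidx n"
      then obtain u where u: "u \<in> Vsep S \<phi> lidx n" "x = trp S u" by blast
      then have "c *\<^sub>C x = trp S (c *\<^sub>C u)" using Vsep_carr[of n] by (simp add: trp_simps(2) subset_iff)
      then show "c *\<^sub>C x \<in> trp S ` Vsep S \<phi> lidx n" using complex_vector.subspace_scale[OF Vsep_subspace u(1)] by blast
    qed
    then show ?thesis using Z.fin_dim_orthonormal_basis[OF _ sub fin_trp] by metis
  qed
  then obtain E where E: "\<And>n. Z.orthonormal (E n)" "\<And>n. cspan (E n) = trp S ` Vsep S \<phi> lidx n" by metis
  let ?B = "\<Union>n<M. E n"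
  have "finite ?B" "?B \<subseteq> Z.carr" using Z.orthonormalD(1,2)[OF E(1)] by auto
  then obtain O' where O': "Z.orthonormal O'" "cspan O' = cspan ?B" by (rule Z.Gram_Schmidt)
  have "trp S (J M c u) \<in> cspan O'" if u: "u \<in> Vx.carr" for c u
  proof -
    have "trp S (J M c u) = (\<Sum>n<M. trp S ((c n - 1) *\<^sub>C P n u))"
      unfolding J_def by (rule clinear_on_sum[OF Vx.subspace_carr trp_lin]) (use u in auto)
    also have "\<dots> = (\<Sum>n<M. (c n - 1) *\<^sub>C trp S (P n u))" using u by (simp add: trp_simps(2))
    also have "\<dots> \<in> cspan ?B"
    proof (intro complex_vector.span_sum complex_vector.span_scale)
      fix n assume n: "n \<in> {..<M}"
      have "trp S (P n u) \<in> cspan (E n)" unfolding E(2) using P_mem[OF u] by blast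
      then show "trp S (P n u) \<in> cspan ?B" using complex_vector.span_mono[of "E n" ?B] n by blast
    qed
    finally show ?thesis unfolding O'(2) .
  qed
  with O'(1) show ?thesis using that by blast
qed

text \<open>The factors \<open>c\<close> are a parameter because the same formula with reciprocal
  factors gives the inverse.\<close>

definition T :: "(nat \<Rightarrow> complex) \<Rightarrow> 'v \<times> (nat \<Rightarrow> 'w) \<Rightarrow> 'v \<times> (nat \<Rightarrow> 'w)"
  where "T c u = (fst u + trd (trp S (J M c (snd u))), snd u + J M c (snd u))"

lemma T_bounded: "bounded_op (Vsp S) (Vsp S) (T c)"
proof -
  obtain C1 where C1: "C1 > 0" "\<And>x. x \<in> Z.carr \<Longrightarrow> Vi.nrm (trd x) \<le> C1 * Z.nrm x" using Z.op_bound[OF trd] by blast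
  obtain C2 where C2: "C2 > 0" "\<And>x. x \<in> Vx.carr \<Longrightarrow> Z.nrm (trp S x) \<le> C2 * Vx.nrm x" using Vx.op_bound[OF trp] by blast
  obtain C3 where C3: "C3 > 0" "\<And>x. x \<in> Vx.carr \<Longrightarrow> Vx.nrm (J M c x) \<le> C3 * Vx.nrm x" using Vx.op_bound[OF J_bounded] by blast
  note Jl = clinear_onD[OF bounded_opD(2)[OF J_bounded]]
  have mem: "T c u \<in> V.carr" if "u \<in> V.carr" for u
    using that trd_mem trp_mem trm_mem by (auto simp: Vsp_mem T_def trm_simps trp_simps trm_trd)
  show ?thesis
  proof (rule bounded_opI[where C = "2 + C1 * C2 * C3 + C3"])
    show "clinear_on (V.carr) (T c)"
      unfolding clinear_on_def
      by (auto simp: Vsp_mem T_def Jl trp_simps trd_simps trp_mem scaleC_prod_def complex_vector.scale_right_distrib)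
    fix u assume u: "u \<in> V.carr"
    show "T c u \<in> V.carr" by (rule mem[OF u])
    have m: "fst u \<in> Vi.carr" "snd u \<in> Vx.carr" using u by (auto simp: Vsp_mem)
    have J: "J M c (snd u) \<in> Vx.carr" using m by simp
    have "V.nrm (T c u) \<le> Vi.nrm (fst u + trd (trp S (J M c (snd u)))) + Vx.nrm (snd u + J M c (snd u))"
      using hnorm_Vsp_le[OF mem[OF u]] by (simp add: T_def)
    also have "\<dots> \<le> (Vi.nrm (fst u) + Vi.nrm (trd (trp S (J M c (snd u))))) + (Vx.nrm (snd u) + Vx.nrm (J M c (snd u)))"
      by (intro add_mono Vi.nrm_triangle Vx.nrm_triangle m J trd_mem trp_mem)
    also have "Vi.nrm (trd (trp S (J M c (snd u)))) \<le> C1 * C2 * C3 * Vx.nrm (snd u)"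
    proof -
      have "Vi.nrm (trd (trp S (J M c (snd u)))) \<le> C1 * Z.nrm (trp S (J M c (snd u)))" by (rule C1(2)[OF trp_mem[OF J]])
      also have "\<dots> \<le> C1 * (C2 * Vx.nrm (J M c (snd u)))" using C2(2)[OF J] C1(1) by (intro mult_left_mono) auto
      also have "\<dots> \<le> C1 * (C2 * (C3 * Vx.nrm (snd u)))" using C3(2)[OF m(2)] C1(1) C2(1) by (intro mult_left_mono) auto
      finally show ?thesis by (simp add: mult.assoc)
    qed
    also have "Vx.nrm (J M c (snd u)) \<le> C3 * Vx.nrm (snd u)" by (rule C3(2)[OF m(2)])
    finally have le: "V.nrm (T c u) \<le> Vi.nrm (fst u) + (C1 * C2 * C3 + 1 + C3) * Vx.nrm (snd u)"
      by (simp add: algebra_simps)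
    also have "\<dots> \<le> V.nrm u + (C1 * C2 * C3 + 1 + C3) * V.nrm u"
      using hnorm_Vsp_ge[OF u] C1(1) C2(1) C3(1) by (intro add_mono mult_left_mono) auto
    finally show "V.nrm (T c u) \<le> (2 + C1 * C2 * C3 + C3) * V.nrm u" by (simp add: algebra_simps)
  qed
qed

lemma T_inverse:
  assumes u: "u \<in> V.carr" and c: "\<And>n. n < M \<Longrightarrow> c n * c' n = 1"
  shows "T c (T c' u) = u"
proof -
  define x where "x = snd u"
  have x: "x \<in> Vx.carr" using u by (simp add: Vsp_mem x_def)
  have J: "J M c' x \<in> Vx.carr" "J M c (x + J M c' x) \<in> Vx.carr" using x by simp_all
  have J0: "J M c' x + J M c (x + J M c' x) = 0" by (rule J_inverse[OF x c])
  have "trd (trp S (J M c' x)) + trd (trp S (J M c (x + J M c' x))) = trd (trp S (J M c' x + J M c (x + J M c' x)))"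
    using J by (simp add: trp_simps(1) trd_simps(1) trp_mem)
  also have "\<dots> = 0" unfolding J0 by (simp add: trp_simps(4) trd_simps(4))
  finally have t0: "trd (trp S (J M c' x)) + trd (trp S (J M c (x + J M c' x))) = 0" .
  show ?thesis
    using t0 J0 by (simp add: T_def x_def[symmetric] add.assoc prod_eq_iff)
qed

text \<open>The trace correction in \<open>T\<close> has finite rank and \<open>K\<close> is compact, hence up to a small error a
  finite-rank operator: both are absorbed into a finite-rank form.\<close>

lemma weak_coercivity:
  obtains n A B where "fredholm_form (Vsp S) (form S \<kappa>) (T (\<lambda>n. cnj (\<theta> n))) n A B (\<alpha> / 2)"
proof -
  let ?c = "\<lambda>n. cnj (\<theta> n)"
  \<comment> \<open>Half of \<alpha> is spent on replacing \<open>K\<close> by its projection on the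
    span of \<open>E\<close>; the other half is the final coercivity constant.\<close>
  obtain E where E: "Vi.orthonormal E" "\<And>u. u \<in> Vi.carr \<Longrightarrow> Vi.nrm (K u - Vi.oproj E (K u)) \<le> \<alpha> / 2 * Vi.nrm u"
    using Vi.compact_op_net[OF K, of "\<alpha> / 2"] \<alpha> by auto
  obtain G where G: "Z.orthonormal G" "\<And>c u. u \<in> Vx.carr \<Longrightarrow> trp S (J M c u) \<in> cspan G" using trace_basis by blast
  have EV: "e \<in> Vi.carr" if "e \<in> E" for e using Vi.orthonormalD(2)[OF E(1)] that by blast
  have GZ: "e \<in> Z.carr" if "e \<in> G" for e using Z.orthonormalD(2)[OF G(1)] that by blast
  have Kb: "bounded_op (Vint S) (Vint S) K" using K unfolding compact_op_def by blast
  note Km = bounded_opD(1)[OF Kb] and Kl = clinear_onD[OF bounded_opD(2)[OF Kb]]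
  have si: "sesquilinear_on (Vi.carr) (sint S \<kappa>)" using forms_bounded(1)[OF \<kappa>] unfolding bounded_sesquilinear_def by blast
  note fi = sesquilinear_onD[OF si]
  note Jl = clinear_onD[OF bounded_opD(2)[OF J_bounded]]
  have comp_int: "bounded_functional (Vsp S) (\<lambda>u. f (fst u))" if f: "bounded_functional (Vint S) f" for f
  proof -
    obtain C where C: "C > 0" "\<And>x. x \<in> Vi.carr \<Longrightarrow> cmod (f x) \<le> C * Vi.nrm x" using Vi.functional_bound[OF f] by blast
    have "cmod (f (fst u)) \<le> C * V.nrm u" if "u \<in> V.carr" for u
      using order_trans[OF C(2) mult_left_mono[OF hnorm_Vsp_ge(1)[OF that]]] that C(1) by (simp add: Vsp_mem)
    then show ?thesis
      by (intro bounded_functionalI[where C = C]) (auto simp: Vsp_mem bounded_functionalD[OF f] scaleC_prod_def)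
  qed
  have comp_ext: "bounded_functional (Vsp S) (\<lambda>u. f (snd u))" if f: "bounded_functional (Vext S) f" for f
  proof -
    obtain C where C: "C > 0" "\<And>x. x \<in> Vx.carr \<Longrightarrow> cmod (f x) \<le> C * Vx.nrm x" using Vx.functional_bound[OF f] by blast
    have "cmod (f (snd u)) \<le> C * V.nrm u" if "u \<in> V.carr" for u
      using order_trans[OF C(2) mult_left_mono[OF hnorm_Vsp_ge(2)[OF that]]] that C(1) by (simp add: Vsp_mem)
    then show ?thesis
      by (intro bounded_functionalI[where C = C]) (auto simp: Vsp_mem bounded_functionalD[OF f] scaleC_prod_def)
  qed
  have b1: "bounded_functional (Vint S) (\<lambda>u. Vi.ip (K u) e)" if e: "e \<in> E" for e
  proof -
    obtain C where C: "C > 0" "\<And>x. x \<in> Vi.carr \<Longrightarrow> Vi.nrm (K x) \<le> C * Vi.nrm x" using Vi.op_bound[OF Kb] by blast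
    show ?thesis
    proof (rule bounded_functionalI[where C = "C * Vi.nrm e"])
      fix x assume x: "x \<in> Vi.carr"
      show "cmod (Vi.ip (K x) e) \<le> C * Vi.nrm e * Vi.nrm x"
        using order_trans[OF Vi.Cauchy_Schwarz[OF Km[OF x] EV[OF e]] mult_right_mono[OF C(2)[OF x]]] EV[OF e] by (simp add: mult_ac)
    qed (simp_all add: Km Kl EV[OF e] Vi.ip_add_left Vi.ip_scale_left)
  qed
  have b2: "bounded_functional (Vint S) (\<lambda>u. - sint S \<kappa> u (trd e))" if e: "e \<in> G" for e
  proof -
    obtain C where C: "C > 0" "\<And>x y. x \<in> Vi.carr \<Longrightarrow> y \<in> Vi.carr \<Longrightarrow> cmod (sint S \<kappa> x y) \<le> C * Vi.nrm x * Vi.nrm y"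
      using Vi.form_bound[OF forms_bounded(1)[OF \<kappa>]] by blast
    have te: "trd e \<in> Vi.carr" using trd_mem[OF GZ[OF e]] .
    show ?thesis
      by (rule bounded_functionalI[where C = "C * Vi.nrm (trd e)"]) (use C(2)[OF _ te] te in \<open>auto simp: fi mult_ac\<close>)
  qed
  have b3: "bounded_functional (Vext S) (\<lambda>u. Z.ip (trp S (J M ?c u)) e)" if e: "e \<in> G" for e
  proof -
    obtain C2 where C2: "C2 > 0" "\<And>x. x \<in> Vx.carr \<Longrightarrow> Z.nrm (trp S x) \<le> C2 * Vx.nrm x" using Vx.op_bound[OF trp] by blast
    obtain C3 where C3: "C3 > 0" "\<And>x. x \<in> Vx.carr \<Longrightarrow> Vx.nrm (J M ?c x) \<le> C3 * Vx.nrm x" using Vx.op_bound[OF J_bounded] by blast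
    show ?thesis
    proof (rule bounded_functionalI[where C = "C2 * C3 * Z.nrm e"])
      fix x assume x: "x \<in> Vx.carr"
      have "Z.nrm (trp S (J M ?c x)) \<le> C2 * (C3 * Vx.nrm x)"
        using order_trans[OF C2(2)[OF J_mem[OF x]] mult_left_mono[OF C3(2)[OF x]]] C2(1) by simp
      from order_trans[OF Z.Cauchy_Schwarz[OF trp_mem[OF J_mem[OF x]] GZ[OF e]] mult_right_mono[OF this]]
      show "cmod (Z.ip (trp S (J M ?c x)) e) \<le> C2 * C3 * Z.nrm e * Vx.nrm x"
        using GZ[OF e] by (simp add: mult_ac)
    qed (simp_all add: trp_mem trp_simps Jl GZ[OF e] Z.ip_add_left Z.ip_scale_left)
  qed
  \<comment> \<open>At \<open>v = u\<close> the first sum supplies the projected \<open>K\<close>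
    needed for the interior coercivity; the second cancels the term of \<open>sint\<close> produced
    by the trace correction in \<open>T\<close>.\<close>
  define f where "f = (\<lambda>(u :: 'v \<times> (nat \<Rightarrow> 'w)) (v :: 'v \<times> (nat \<Rightarrow> 'w)). (\<Sum>e\<in>E. Vi.ip (K (fst u)) e * cnj (Vi.ip (fst v) e)) +
    (\<Sum>e\<in>G. - sint S \<kappa> (fst u) (trd e) * cnj (Z.ip (trp S (J M ?c (snd v))) e)))"
  have "V.finite_rank f"
    unfolding f_def
  proof (rule V.finite_rank_add)
    show "V.finite_rank (\<lambda>u v. \<Sum>e\<in>E. Vi.ip (K (fst u)) e * cnj (Vi.ip (fst v) e))"
    proof (rule V.finite_rank_sum[OF Vi.orthonormalD(1)[OF E(1)]])
      fix e assume e: "e \<in> E"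
      show "V.finite_rank (\<lambda>u v. Vi.ip (K (fst u)) e * cnj (Vi.ip (fst v) e))"
        by (rule V.finite_rank_rank1[OF comp_int[OF b1[OF e]] comp_int[OF Vi.bounded_functional_ip[OF EV[OF e]]]])
    qed
    show "V.finite_rank (\<lambda>u v. \<Sum>e\<in>G. - sint S \<kappa> (fst u) (trd e) * cnj (Z.ip (trp S (J M ?c (snd v))) e))"
    proof (rule V.finite_rank_sum[OF Z.orthonormalD(1)[OF G(1)]])
      fix e assume e: "e \<in> G"
      show "V.finite_rank (\<lambda>u v. - sint S \<kappa> (fst u) (trd e) * cnj (Z.ip (trp S (J M ?c (snd v))) e))"
        by (rule V.finite_rank_rank1[OF comp_int[OF b2[OF e]] comp_ext[OF b3[OF e]]])
    qed
  qed
  then obtain n A B where AB: "\<And>j. j < n \<Longrightarrow> bounded_functional (Vsp S) (A j)" "\<And>j. j < (n::nat) \<Longrightarrow> bounded_functional (Vsp S) (B j)"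
    and f: "\<And>u v. u \<in> V.carr \<Longrightarrow> v \<in> V.carr \<Longrightarrow> f u v = (\<Sum>j<n. A j u * cnj (B j v))"
    unfolding V.finite_rank_def by blast
  have "fredholm_form (Vsp S) (form S \<kappa>) (T ?c) n A B (\<alpha> / 2)"
  proof
    show "V.carr \<subseteq> T ?c ` V.carr"
    proof
      fix u assume u: "u \<in> V.carr"
      have "cnj (\<theta> n) * \<theta> n = 1" if "n < M" for n
        using \<theta>[OF that] complex_norm_square[of "\<theta> n"] by (simp add: mult.commute)
      then have "T ?c (T \<theta> u) = u" by (intro T_inverse[OF u])
      then show "u \<in> T ?c ` V.carr" using bounded_opD(1)[OF T_bounded u] by (metis imageI)
    qed
    fix u assume u: "u \<in> V.carr"
    define x y where "x = fst u" and "y = snd u"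
    have m: "x \<in> Vi.carr" "y \<in> Vx.carr" using u by (auto simp: Vsp_mem x_def y_def)
    define g where "g = trp S (J M ?c y)"
    have g: "g \<in> Z.carr" unfolding g_def using m by (intro trp_mem) simp
    \<comment> \<open>The trace lies in the span of \<open>G\<close>, so this expansion is exact and
      the cancellation leaves no error.\<close>
    have "g = (\<Sum>e\<in>G. Z.ip g e *\<^sub>C e)"
      using Z.oproj_fixed[OF G(1) G(2)[OF m(2)]] by (simp add: Z.oproj_def g_def)
    then have "trd g = trd (\<Sum>e\<in>G. Z.ip g e *\<^sub>C e)" by simp
    also have "\<dots> = (\<Sum>e\<in>G. trd (Z.ip g e *\<^sub>C e))"
      by (rule clinear_on_sum[OF Z.subspace_carr bounded_opD(2)[OF trd]]) (use GZ in auto)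
    also have "\<dots> = (\<Sum>e\<in>G. Z.ip g e *\<^sub>C trd e)" using GZ by (simp add: trd_simps(2))
    finally have "sint S \<kappa> x (trd g) = (\<Sum>e\<in>G. sint S \<kappa> x (Z.ip g e *\<^sub>C trd e))"
      using form_sum_right[OF Vi.subspace_carr si, of G "\<lambda>e. Z.ip g e *\<^sub>C trd e" x] GZ trd_mem m by simp
    also have "\<dots> = (\<Sum>e\<in>G. sint S \<kappa> x (trd e) * cnj (Z.ip g e))"
      using GZ trd_mem m by (intro sum.cong) (auto simp: fi)
    finally have sg: "sint S \<kappa> x (trd g) + (\<Sum>e\<in>G. - sint S \<kappa> x (trd e) * cnj (Z.ip g e)) = 0"
      by (simp add: sum_negf)
    have "(\<Sum>e\<in>E. Vi.ip (K x) e * cnj (Vi.ip x e)) = Vi.ip (Vi.oproj E (K x)) x"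
    proof -
      have "Vi.ip (Vi.oproj E (K x)) x = (\<Sum>e\<in>E. Vi.ip (Vi.ip (K x) e *\<^sub>C e) x)"
        unfolding Vi.oproj_def by (rule Vi.ip_sum_left) (use EV m in auto)
      also have "\<dots> = (\<Sum>e\<in>E. Vi.ip (K x) e * cnj (Vi.ip x e))"
      proof (rule sum.cong[OF refl])
        fix e assume e: "e \<in> E"
        show "Vi.ip (Vi.ip (K x) e *\<^sub>C e) x = Vi.ip (K x) e * cnj (Vi.ip x e)"
          unfolding Vi.ip_scale_left[OF EV[OF e] m(1)] Vi.ip_commute[OF m(1) EV[OF e]] ..
      qed
      finally show ?thesis by simp
    qed
    moreover have "Re (Vi.ip (K x) x) - \<alpha> / 2 * (Vi.nrm x)\<^sup>2 \<le> Re (Vi.ip (Vi.oproj E (K x)) x)"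
    proof -
      have Kx: "K x \<in> Vi.carr" "Vi.oproj E (K x) \<in> Vi.carr" using Km[OF m(1)] E(1) by auto
      have "cmod (Vi.ip (K x - Vi.oproj E (K x)) x) \<le> \<alpha> / 2 * Vi.nrm x * Vi.nrm x"
        using order_trans[OF Vi.Cauchy_Schwarz[OF Vi.mem_diff[OF Kx] m(1)] mult_right_mono[OF E(2)[OF m(1)]]] m(1) by simp
      moreover have "Re (Vi.ip (K x - Vi.oproj E (K x)) x) \<le> cmod (Vi.ip (K x - Vi.oproj E (K x)) x)" by (rule complex_Re_le_cmod)
      ultimately show ?thesis using Kx m by (simp add: Vi.ip_diff_left power2_eq_square)
    qed
    ultimately have KE: "Re (Vi.ip (K x) x) - \<alpha> / 2 * (Vi.nrm x)\<^sup>2 \<le> Re (\<Sum>e\<in>E. Vi.ip (K x) e * cnj (Vi.ip x e))"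
      by simp
    have "form S \<kappa> u (T ?c u) = sint S \<kappa> x x + sint S \<kappa> x (trd g) + sext S \<kappa> y (y + J M ?c y)"
      using m trd_mem[OF g] by (simp add: form_def T_def x_def[symmetric] y_def[symmetric] g_def[symmetric] fi)
    then have "form S \<kappa> u (T ?c u) + f u u = sint S \<kappa> x x + sext S \<kappa> y (y + J M ?c y) + (\<Sum>e\<in>E. Vi.ip (K x) e * cnj (Vi.ip x e))"
      using sg by (simp add: f_def x_def[symmetric] y_def[symmetric] g_def[symmetric] algebra_simps)
    then have "Re (form S \<kappa> u (T ?c u) + f u u) = Re (sint S \<kappa> x x) + Re (sext S \<kappa> y (y + J M ?c y)) + Re (\<Sum>e\<in>E. Vi.ip (K x) e * cnj (Vi.ip x e))"
      by simp
    moreover have "\<alpha> * (Vx.nrm y)\<^sup>2 \<le> Re (sext S \<kappa> y (y + J M ?c y))" by (rule sext_coercive[OF C m(2)])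
    moreover have "(V.nrm u)\<^sup>2 = (Vi.nrm x)\<^sup>2 + (Vx.nrm y)\<^sup>2" unfolding x_def y_def by (rule hnorm_Vsp_sq[OF u])
    moreover have "\<alpha> * (Vx.nrm y)\<^sup>2 \<ge> \<alpha> / 2 * (Vx.nrm y)\<^sup>2" using \<alpha> by (intro mult_right_mono) auto
    ultimately have "\<alpha> / 2 * (V.nrm u)\<^sup>2 \<le> Re (form S \<kappa> u (T ?c u) + f u u)"
      using KE sint_coercive[OF m(1)] by (simp add: distrib_left)
    then show "\<alpha> / 2 * (V.nrm u)\<^sup>2 \<le> Re (form S \<kappa> u (T ?c u) + (\<Sum>j<n. A j u * cnj (B j u)))"
      unfolding f[OF u u] .
  qed (use form_bounded[OF \<kappa>] T_bounded AB \<alpha> in auto)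
  then show ?thesis by (rule that)
qed

section \<open>Discrete exterior functions and their modes\<close>

lemma VhN_ext_subspace: "csubspace (VhN_ext S D h N)"
  unfolding complex_vector.subspace_def VhN_ext_def
  using subspace_tensor_span[of "ten S _" "XN D N _" "Yh D h _"]
  by (auto simp: fun_simps complex_vector.subspace_0 complex_vector.subspace_add complex_vector.subspace_scale)

lemma VhN_ext_single:
  assumes "l \<in> {1..Lnum S}" "w \<in> tensor_span (ten S l) (XN D N l) (Yh D h l)"
  shows "single l w \<in> VhN_ext S D h N"
  using assms complex_vector.subspace_0[OF subspace_tensor_span] by (auto simp: VhN_ext_def single_def)

lemma VhN_ext_mono:
  assumes "h > 0" "h \<le> h'" "N' \<le> N"
  shows "VhN_ext S D h' N' \<subseteq> VhN_ext S D h N"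
  unfolding VhN_ext_def
  using tensor_span_mono[OF discrete_l(8)[OF _ assms(3)] discrete_l(4)[OF _ assms(1,2)]] by blast

text \<open>The coefficient of the mode \<open>n\<close> of \<open>u\<close>; the choice is unique
  by \<open>tphi_inj\<close>, which makes it linear.\<close>

definition \<xi> :: "nat \<Rightarrow> (nat \<Rightarrow> 'w) \<Rightarrow> 'x"
  where "\<xi> n u = (SOME x. x \<in> hcarrier (X2 S (lidx n)) \<and> P n u = tphi n x)"

lemma \<xi>: "u \<in> Vx.carr \<Longrightarrow> \<xi> n u \<in> hcarrier (X2 S (lidx n))" "u \<in> Vx.carr \<Longrightarrow> P n u = tphi n (\<xi> n u)"
proof -
  assume "u \<in> Vx.carr"
  then have "\<exists>x. x \<in> hcarrier (X2 S (lidx n)) \<and> P n u = tphi n x" using P_mem[of u n] unfolding Vsep_eq by blast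
  from someI_ex[OF this] show "\<xi> n u \<in> hcarrier (X2 S (lidx n))" "P n u = tphi n (\<xi> n u)" unfolding \<xi>_def by blast+
qed

lemma \<xi>_linear:
  assumes u: "u \<in> Vx.carr"
  shows "v \<in> Vx.carr \<Longrightarrow> \<xi> n (u + v) = \<xi> n u + \<xi> n v" "\<xi> n (c *\<^sub>C u) = c *\<^sub>C \<xi> n u"
proof -
  interpret X2: hilbert "X2 S (lidx n)" by (rule hilbertD[OF hilbert_l(2)[OF lidx]])
  show "\<xi> n (c *\<^sub>C u) = c *\<^sub>C \<xi> n u"
  proof (rule tphi_inj[of _ n])
    have "tphi n (\<xi> n (c *\<^sub>C u)) = c *\<^sub>C tphi n (\<xi> n u)"
      using \<xi>(2)[OF Vx.mem_scale[OF u], of n c] \<xi>(2)[OF u, of n] clinear_onD(2)[OF P_linear u] by simp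
    then show "tphi n (\<xi> n (c *\<^sub>C u)) = tphi n (c *\<^sub>C \<xi> n u)" by (simp add: tphi_linear \<xi>(1)[OF u])
  qed (use \<xi>(1) u in auto)
  assume v: "v \<in> Vx.carr"
  show "\<xi> n (u + v) = \<xi> n u + \<xi> n v"
  proof (rule tphi_inj[of _ n])
    have "tphi n (\<xi> n (u + v)) = tphi n (\<xi> n u) + tphi n (\<xi> n v)"
      using \<xi>(2)[OF Vx.mem_add[OF u v], of n] \<xi>(2)[OF u, of n] \<xi>(2)[OF v, of n] clinear_onD(1)[OF P_linear u v] by simp
    then show "tphi n (\<xi> n (u + v)) = tphi n (\<xi> n u + \<xi> n v)" by (simp add: tphi_linear \<xi>(1) u v)
  qed (use \<xi>(1) u v in auto)
qed

text \<open>This is \<open>P_tensor_span\<close> with \<open>X = XN\<close>: although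
  \<open>\<phi> n\<close> need not belong to \<open>Yh\<close>, projecting onto its mode keeps the
  first factor discrete.\<close>

lemma \<xi>_discrete:
  assumes h: "h > 0" and u: "u \<in> VhN_ext S D h N"
  shows "\<xi> n u \<in> XN D N (lidx n)"
proof -
  have uc: "u \<in> Vx.carr" using VhN_ext_carr[OF h] u by blast
  have ul: "u (lidx n) \<in> tensor_span (ten S (lidx n)) (XN D N (lidx n)) (Yh D h (lidx n))" using u lidx unfolding VhN_ext_def by blast
  obtain x where x: "x \<in> XN D N (lidx n)" "P n u = tphi n x"
    by (rule P_tensor_span[OF discrete_l(6)[OF lidx] XN_carr[OF lidx] discrete_l(3)[OF lidx h] uc ul])
  have "x \<in> hcarrier (X2 S (lidx n))" using x(1) XN_carr[OF lidx] by blast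
  then have "x = \<xi> n u" by (rule tphi_inj[of _ n]) (use x \<xi>[OF uc] in auto)
  then show ?thesis using x(1) by simp
qed

text \<open>\<open>J\<close> with \<open>p n\<close> replaced by \<open>q n\<close> in the output
  only. The coefficient is still taken with respect to \<open>\<phi> n\<close>, so that the result
  is discrete as soon as every \<open>q n\<close> lies in \<open>Yh\<close>.\<close>

definition Jh :: "(nat \<Rightarrow> 'y) \<Rightarrow> (nat \<Rightarrow> complex) \<Rightarrow> (nat \<Rightarrow> 'w) \<Rightarrow> nat \<Rightarrow> 'w"
  where "Jh q c u = (\<Sum>n<M. (c n - 1) *\<^sub>C single (lidx n) (ten S (lidx n) (\<xi> n u) (q n)))"

lemma Jh_mem:
  assumes h: "h > 0" and u: "u \<in> VhN_ext S D h N" and q: "\<And>n. n < M \<Longrightarrow> q n \<in> Yh D h (lidx n)"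
  shows "Jh q c u \<in> VhN_ext S D h N"
  unfolding Jh_def
  by (intro complex_vector.subspace_sum[OF VhN_ext_subspace] complex_vector.subspace_scale[OF VhN_ext_subspace]
    VhN_ext_single[OF lidx] tensor_span_base \<xi>_discrete[OF h u] q) simp

lemma Jh_linear:
  assumes q: "\<And>n. n < M \<Longrightarrow> q n \<in> hcarrier (Y2 S (lidx n))" and u: "u \<in> Vx.carr"
  shows "v \<in> Vx.carr \<Longrightarrow> Jh q c (u + v) = Jh q c u + Jh q c v" "Jh q c (a *\<^sub>C u) = a *\<^sub>C Jh q c u"
proof -
  have q1: "q n \<in> hcarrier (Y1 S (lidx n))" if "n < M" for n using cont_embeddedD[OF embedded_l(2)[OF lidx] q[OF that]] .
  note t = hilbert_l(2,3)[OF lidx] tensor_l(2)[OF lidx]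
  show "Jh q c (a *\<^sub>C u) = a *\<^sub>C Jh q c u"
    unfolding Jh_def complex_vector.scale_sum_right using q1 u
    by (intro sum.cong) (auto simp: \<xi>_linear \<xi>(1) tensor_scale_left[OF t] single_linear mult.commute)
  assume v: "v \<in> Vx.carr"
  show "Jh q c (u + v) = Jh q c u + Jh q c v"
    unfolding Jh_def sum.distrib[symmetric] using q1 u v
    by (intro sum.cong) (auto simp: \<xi>_linear \<xi>(1) tensor_add_left[OF t] single_linear complex_vector.scale_right_distrib)
qed

text \<open>The operators differ by tensors of the coefficients with \<open>q n - p n\<close>.
  \<open>G\<close> depends on neither \<open>q\<close> nor \<open>e\<close>, so the error is made
  small by the choice of \<open>q\<close> alone.\<close>

lemma Jh_estimate:
  obtains G where "G > 0" "\<And>q e u. e \<ge> 0 \<Longrightarrow> (\<And>n. n < M \<Longrightarrow> q n \<in> hcarrier (Y2 S (lidx n)) \<and> hnorm (Y2 S (lidx n)) (q n - p n) \<le> e) \<Longrightarrow>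
    u \<in> Vx.carr \<Longrightarrow> Jh q c u \<in> Vx.carr \<and> Vx.nrm (Jh q c u - J M c u) \<le> G * e * Vx.nrm u"
proof -
  have "\<exists>C>0. \<forall>x\<in>hcarrier (X2 S (lidx n)). \<forall>y\<in>hcarrier (Y2 S (lidx n)).
    hnorm (Wl (lidx n)) (ten S (lidx n) x y) \<le> C * hnorm (X2 S (lidx n)) x * hnorm (Y2 S (lidx n)) y" for n
    using ten_norm_le[OF lidx[of n]] by metis
  then obtain C where C: "\<And>n. C n > 0" "\<And>n x y. x \<in> hcarrier (X2 S (lidx n)) \<Longrightarrow> y \<in> hcarrier (Y2 S (lidx n)) \<Longrightarrow>
    hnorm (Wl (lidx n)) (ten S (lidx n) x y) \<le> C n * hnorm (X2 S (lidx n)) x * hnorm (Y2 S (lidx n)) y" by metis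
  define a where "a n = hnorm (Y1 S (lidx n)) (p n)" for n
  have a: "a n > 0" for n unfolding a_def by (rule p_norm1)
  \<comment> \<open>\<open>C n\<close> bounds the tensor map, and \<open>a n\<close> enters because
    the coefficient is recovered from the mode only up to the \<open>Y1\<close> norm of
    \<open>p n\<close>.\<close>
  define G where "G = 1 + (\<Sum>n<M. cmod (c n - 1) * (C n / a n))"
  have G: "G > 0" unfolding G_def using C(1) a by (intro add_pos_nonneg sum_nonneg mult_nonneg_nonneg) (auto simp: less_imp_le)
  show ?thesis
  proof (rule that[OF G])
    fix q u and e :: real
    assume e: "e \<ge> 0" and q: "\<And>n. n < M \<Longrightarrow> q n \<in> hcarrier (Y2 S (lidx n)) \<and> hnorm (Y2 S (lidx n)) (q n - p n) \<le> e" and u: "u \<in> Vx.carr"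
    let ?s = "\<lambda>n y. single (lidx n) (ten S (lidx n) (\<xi> n u) y)"
    have sm: "?s n y \<in> Vx.carr" if "y \<in> hcarrier (Y2 S (lidx n))" for n y
      unfolding single_mem[OF lidx] by (rule ten_mem[OF lidx \<xi>(1)[OF u] that])
    have mem: "Jh q c u \<in> Vx.carr" unfolding Jh_def using q sm by (intro Vx.mem_sum Vx.mem_scale) auto
    have qp: "q n - p n \<in> hcarrier (Y2 S (lidx n))" if "n < M" for n
    proof -
      interpret Y2: hilbert "Y2 S (lidx n)" by (rule hilbertD[OF hilbert_l(4)[OF lidx]])
      show ?thesis using q[OF that] p_mem[of n] by blast
    qed
    have diff: "Jh q c u - J M c u = (\<Sum>n<M. (c n - 1) *\<^sub>C ?s n (q n - p n))"
    proof -
      have "Jh q c u - J M c u = (\<Sum>n<M. (c n - 1) *\<^sub>C ?s n (q n) - (c n - 1) *\<^sub>C ?s n (p n))"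
        unfolding Jh_def J_def sum_subtractf[symmetric] using \<xi>(2)[OF u] by (simp add: tensor_phi_def)
      also have "\<dots> = (\<Sum>n<M. (c n - 1) *\<^sub>C ?s n (q n - p n))"
      proof (rule sum.cong[OF refl])
        fix n assume "n \<in> {..<M}"
        then have q1: "q n \<in> hcarrier (Y1 S (lidx n))" using q cont_embeddedD[OF embedded_l(2)[OF lidx]] by blast
        show "(c n - 1) *\<^sub>C ?s n (q n) - (c n - 1) *\<^sub>C ?s n (p n) = (c n - 1) *\<^sub>C ?s n (q n - p n)"
          using tensor_diff_right[OF hilbert_l(2,3)[OF lidx] tensor_l(2)[OF lidx] \<xi>(1)[OF u] q1 p_mem1]
          by (simp add: single_linear complex_vector.scale_right_diff_distrib)
      qed
      finally show ?thesis .
    qed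
    have "Vx.nrm (Jh q c u - J M c u) \<le> (\<Sum>n<M. Vx.nrm ((c n - 1) *\<^sub>C ?s n (q n - p n)))"
      unfolding diff by (rule Vx.nrm_sum) (use sm[OF qp] in auto)
    also have "\<dots> \<le> (\<Sum>n<M. (cmod (c n - 1) * (C n / a n)) * (e * Vx.nrm u))"
    proof (rule sum_mono)
      fix n assume "n \<in> {..<M}"
      then have n: "n < M" by simp
      interpret Y2: hilbert "Y2 S (lidx n)" by (rule hilbertD[OF hilbert_l(4)[OF lidx]])
      interpret X2: hilbert "X2 S (lidx n)" by (rule hilbertD[OF hilbert_l(2)[OF lidx]])
      have nx: "hnorm (X2 S (lidx n)) (\<xi> n u) \<le> Vx.nrm u / a n"
      proof -
        have "hnorm (X2 S (lidx n)) (\<xi> n u) * a n \<le> Vx.nrm (P n u)"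
          using tphi_norm_ge[OF \<xi>(1)[OF u]] \<xi>(2)[OF u, of n] by (simp add: a_def)
        also have "\<dots> \<le> Vx.nrm u" by (rule P_norm[OF u])
        finally show ?thesis using a[of n] by (simp add: field_simps)
      qed
      have "Vx.nrm (?s n (q n - p n)) = hnorm (Wl (lidx n)) (ten S (lidx n) (\<xi> n u) (q n - p n))"
        by (rule single_norm[OF lidx ten_mem[OF lidx \<xi>(1)[OF u] qp[OF n]]])
      also have "\<dots> \<le> C n * hnorm (X2 S (lidx n)) (\<xi> n u) * hnorm (Y2 S (lidx n)) (q n - p n)" by (rule C(2)[OF \<xi>(1)[OF u] qp[OF n]])
      also have "\<dots> \<le> C n * (Vx.nrm u / a n) * e"
        using nx q[OF n] C(1)[of n] qp[OF n] u a[of n] \<xi>(1)[OF u, of n] by (intro mult_mono mult_left_mono) (auto simp: less_imp_le)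
      finally have "Vx.nrm (?s n (q n - p n)) \<le> (C n / a n) * (e * Vx.nrm u)" by (simp add: mult_ac)
      then have "cmod (c n - 1) * Vx.nrm (?s n (q n - p n)) \<le> cmod (c n - 1) * ((C n / a n) * (e * Vx.nrm u))"
        by (rule mult_left_mono) simp
      then show "Vx.nrm ((c n - 1) *\<^sub>C ?s n (q n - p n)) \<le> (cmod (c n - 1) * (C n / a n)) * (e * Vx.nrm u)"
        using sm[OF qp[OF n]] by (simp add: mult.assoc)
    qed
    also have "\<dots> = (\<Sum>n<M. cmod (c n - 1) * (C n / a n)) * (e * Vx.nrm u)" by (simp only: sum_distrib_right)
    also have "\<dots> \<le> G * (e * Vx.nrm u)" using e u by (intro mult_right_mono) (auto simp: G_def)
    finally show "Jh q c u \<in> Vx.carr \<and> Vx.nrm (Jh q c u - J M c u) \<le> G * e * Vx.nrm u"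
      using mem by (simp add: mult.assoc)
  qed
qed

end

section \<open>Approximation of the isomorphism and of the coupled space\<close>

context discretized
begin

abbreviation W where "W i \<equiv> VhN S D (fst i) (snd i)"
abbreviation F :: "(real \<times> nat) filter" where "F \<equiv> at_right 0 \<times>\<^sub>F sequentially"

lemma VhN_mem: "u \<in> VhN S D h N \<longleftrightarrow> fst u \<in> Vh_int D h \<and> snd u \<in> VhN_ext S D h N \<and> trm S (fst u) = trp S (snd u)"
  unfolding VhN_def by (auto simp: mem_Times_iff)

lemma VhN_carr: "h > 0 \<Longrightarrow> VhN S D h N \<subseteq> V.carr"
  using Vh_int(3)[of h] VhN_ext_carr[of h N] by (auto simp: VhN_mem Vsp_mem)

lemma VhN_subspace:
  assumes h: "h > 0"
  shows "csubspace (VhN S D h N)"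
proof -
  have 1: "x \<in> Vi.carr" if "x \<in> Vh_int D h" for x using that Vh_int(3)[OF h] by blast
  have 2: "x \<in> Vx.carr" if "x \<in> VhN_ext S D h N" for x using that VhN_ext_carr[OF h] by blast
  show ?thesis
    unfolding complex_vector.subspace_def
    using Vh_int(1)[OF h] VhN_ext_subspace[of h N]
    by (auto simp: VhN_mem 1 2 trp_simps trm_simps scaleC_prod_def complex_vector.subspace_0
      complex_vector.subspace_add complex_vector.subspace_scale)
qed

text \<open>The interior part is finite-dimensional, each exterior component is closed already for
  the weaker norm of \<open>X2Y1\<close> by \<open>tensor_span_closed\<close>, and the trace
  condition is inherited from \<open>Vsp\<close>.\<close>

lemma VhN_closed:
  assumes h: "h > 0"
  shows "closedin (htop (Vsp S)) (VhN S D h N)"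
  unfolding V.closedin_iff
proof (intro conjI VhN_carr[OF h] allI impI)
  fix x :: "nat \<Rightarrow> 'v \<times> (nat \<Rightarrow> 'w)" and u
  assume x: "\<forall>k. x k \<in> VhN S D h N" and u: "u \<in> V.carr" and lim: "(\<lambda>k. V.nrm (x k - u)) \<longlonglongrightarrow> 0"
  have xV: "x k \<in> V.carr" for k using x VhN_carr[OF h] by blast
  have d: "x k - u \<in> V.carr" for k using xV u by blast
  have um: "fst u \<in> Vi.carr" "snd u \<in> Vx.carr" using u by (auto simp: Vsp_mem)
  have dm: "fst (x k - u) \<in> Vi.carr" "snd (x k - u) \<in> Vx.carr" for k using d[of k] by (auto simp: Vsp_mem)
  have "fst u \<in> Vh_int D h"
  proof -
    obtain E where E: "Vi.orthonormal E" "cspan E = Vh_int D h"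
      using Vi.fin_dim_orthonormal_basis[OF Vh_int(1)[OF h] Vh_int(3)[OF h] Vh_int(2)[OF h]] by blast
    have "(\<lambda>k. Vi.nrm (fst (x k) - fst u)) \<longlonglongrightarrow> 0"
      using null_squeeze[OF lim Vi.nrm_nonneg[OF dm(1)] hnorm_Vsp_ge(1)[OF d]] by simp
    then have "fst u \<in> cspan E"
      by (intro Vi.closedin_span[OF E(1) um(1), of "\<lambda>k. fst (x k)"]) (use x E(2) in \<open>auto simp: VhN_mem\<close>)
    then show ?thesis using E(2) by simp
  qed
  moreover have "snd u \<in> VhN_ext S D h N"
    unfolding VhN_ext_def
  proof (intro CollectI conjI ballI allI impI)
    fix l assume l: "l \<in> {1..Lnum S}"
    have w: "snd (x k) l \<in> tensor_span (ten S l) (XN D N l) (Yh D h l)" for k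
      using x l by (simp add: VhN_mem VhN_ext_def)
    have ul: "snd u l \<in> hcarrier (Wl l)" using Vext_comp[OF um(2) l] .
    have dl: "snd (x k - u) l \<in> hcarrier (Wl l)" for k by (rule Vext_comp[OF dm(2) l])
    have dl2: "snd (x k - u) l \<in> hcarrier (X2Y1 S l)" for k using dl[of k] by (simp add: hinter_def)
    interpret T: hilbert "X2Y1 S l" by (rule hilbertD[OF hilbert_tl(2)[OF l]])
    have le: "hnorm (X2Y1 S l) (snd (x k - u) l) \<le> V.nrm (x k - u)" for k
    proof -
      have "hnorm (X2Y1 S l) (snd (x k - u) l) \<le> hnorm (Wl l) (snd (x k - u) l)"
        by (rule hnorm_hinter_ge(1)[OF hilbert_tl(2,3)[OF l] dl])
      also have "\<dots> \<le> Vx.nrm (snd (x k - u))"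
        unfolding Vext_def by (rule hnorm_hsum_ge[OF _ _ dm(2)[unfolded Vext_def] l]) (auto intro: hilbert_Wl)
      also have "\<dots> \<le> V.nrm (x k - u)" by (rule hnorm_Vsp_ge(2)[OF d])
      finally show ?thesis .
    qed
    have lim': "(\<lambda>k. hnorm (X2Y1 S l) (snd (x k) l - snd u l)) \<longlonglongrightarrow> 0"
    proof -
      have "snd (x k - u) l = snd (x k) l - snd u l" for k by (simp add: fun_diff_def)
      then show ?thesis using null_squeeze[OF lim T.nrm_nonneg[OF dl2] le] by simp
    qed
    have Y: "Yh D h l \<subseteq> hcarrier (Y1 S l)" using discrete_l(3)[OF l h] cont_embeddedD[OF embedded_l(2)[OF l]] by blast
    show "snd u l \<in> tensor_span (ten S l) (XN D N l) (Yh D h l)"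
      by (rule tensor_span_closed[OF hilbert_l(2,3)[OF l] tensor_l(2)[OF l] discrete_l(6,7)[OF l] discrete_l(1)[OF l h] Y discrete_l(2)[OF l h] w _ lim'])
        (use ul in \<open>simp add: hinter_def\<close>)
  next
    fix l assume "l \<notin> {1..Lnum S}"
    then show "snd u l = 0" using um(2) unfolding Vext_def hsum_def by simp
  qed
  ultimately show "u \<in> VhN S D h N" using u by (simp add: VhN_mem Vsp_mem)
qed

lemma eventually_h_pos: "\<forall>\<^sub>F i in F. fst i > 0"
  by (rule eventually_fst_at_right) (simp add: eventually_at_right_less)

lemma W_closed: "\<forall>\<^sub>F i in F. csubspace (W i) \<and> closedin (htop (Vsp S)) (W i)"
  using eventually_h_pos by eventually_elim (simp add: VhN_subspace VhN_closed)

definition Th :: "(nat \<Rightarrow> complex) \<Rightarrow> (nat \<Rightarrow> 'y) \<Rightarrow> real \<Rightarrow> 'v \<times> (nat \<Rightarrow> 'w) \<Rightarrow> 'v \<times> (nat \<Rightarrow> 'w)"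
  where "Th c q h u = (fst u + trh h (trp S (Jh q c (snd u))), snd u + Jh q c (snd u))"

text \<open>The trace of \<open>Jh\<close> is also the trace of some \<open>y\<close> in
  \<open>Vh_int\<close>, because the discrete trace spaces coincide. On such traces
  \<open>trh\<close> is a right inverse of \<open>trm\<close>, so the correction restores the
  matching.\<close>

lemma Th_mem:
  assumes h: "h > 0" and q: "\<And>n. n < M \<Longrightarrow> q n \<in> Yh D h (lidx n)" and u: "u \<in> VhN S D h N"
  shows "Th c q h u \<in> VhN S D h N"
proof -
  have um: "fst u \<in> Vh_int D h" "snd u \<in> VhN_ext S D h N" "trm S (fst u) = trp S (snd u)" using u by (auto simp: VhN_mem)
  have J: "Jh q c (snd u) \<in> VhN_ext S D h N" by (rule Jh_mem[OF h um(2) q])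
  then obtain y where y: "y \<in> Vh_int D h" "trp S (Jh q c (snd u)) = trm S y" using trp_VhN_ext[OF h] by blast
  have Jc: "Jh q c (snd u) \<in> Vx.carr" "snd u \<in> Vx.carr" using J um(2) VhN_ext_carr[OF h] by auto
  have yc: "y \<in> Vi.carr" "fst u \<in> Vi.carr" using y um(1) Vh_int(3)[OF h] by auto
  have t: "trh h (trm S y) \<in> Vh_int D h" by (rule trh_mem[OF h trm_mem[OF yc(1)]])
  have "trm S (fst u + trh h (trm S y)) = trm S (fst u) + trm S y"
    using trm_simps(1)[OF yc(2), of "trh h (trm S y)"] t Vh_int(3)[OF h] trm_trh[OF h y(1)] by auto
  then show ?thesis
    using complex_vector.subspace_add[OF Vh_int(1)[OF h] um(1) t] complex_vector.subspace_add[OF VhN_ext_subspace um(2) J] Jc um(3)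
    by (simp add: VhN_mem Th_def y(2) trp_simps(1))
qed

text \<open>The error has three parts: the exterior difference of \<open>Jh\<close> and
  \<open>J\<close>, its trace lifted by \<open>trh\<close>, and the difference of the two liftings
  on the trace of \<open>J\<close>. The uniform bound on \<open>trh\<close> handles the second, the
  finite basis \<open>E\<close> the third.\<close>

lemma T_approximable:
  assumes e: "e > 0"
  shows "\<forall>\<^sub>F i in F. \<exists>T'. bounded_op (hsub (Vsp S) (W i)) (hsub (Vsp S) (W i)) T' \<and>
    (\<forall>u\<in>W i. V.nrm (T' u - T c u) \<le> e * V.nrm u)"
proof -
  obtain Ch where Ch: "Ch > 0" "\<forall>\<^sub>F h in at_right 0. \<forall>g\<in>Z.carr. Vi.nrm (trh h g) \<le> Ch * Z.nrm g"
    by (rule trh_uniform)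
  obtain Cp where Cp: "Cp > 0" "\<And>x. x \<in> Vx.carr \<Longrightarrow> Z.nrm (trp S x) \<le> Cp * Vx.nrm x" using Vx.op_bound[OF trp] by blast
  obtain CJ where CJ: "CJ > 0" "\<And>x. x \<in> Vx.carr \<Longrightarrow> Vx.nrm (J M c x) \<le> CJ * Vx.nrm x" using Vx.op_bound[OF J_bounded] by blast
  obtain CT where CT: "CT > 0" "\<And>x. x \<in> V.carr \<Longrightarrow> V.nrm (T c x) \<le> CT * V.nrm x" using V.op_bound[OF T_bounded] by blast
  obtain G where G: "G > 0" "\<And>q e u. e \<ge> 0 \<Longrightarrow> (\<And>n. n < M \<Longrightarrow> q n \<in> hcarrier (Y2 S (lidx n)) \<and> hnorm (Y2 S (lidx n)) (q n - p n) \<le> e) \<Longrightarrow>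
    u \<in> Vx.carr \<Longrightarrow> Jh q c u \<in> Vx.carr \<and> Vx.nrm (Jh q c u - J M c u) \<le> G * e * Vx.nrm u"
    by (rule Jh_estimate[of c]) blast
  obtain E where E: "Z.orthonormal E" "\<And>c u. u \<in> Vx.carr \<Longrightarrow> trp S (J M c u) \<in> cspan E" using trace_basis by blast
  have EZ: "o' \<in> Z.carr" if "o' \<in> E" for o' using Z.orthonormalD(2)[OF E(1)] that by blast
  \<comment> \<open>\<open>e1\<close> is the accuracy of the vectors \<open>q n\<close> and covers
    the exterior error with its lifted trace; \<open>e2\<close> is the accuracy of
    \<open>trh\<close> on \<open>E\<close>. Each contributes at most \<open>e / 2\<close>; the 1 in
    \<open>e2\<close> guards against an empty \<open>E\<close>.\<close>
  define e1 where "e1 = e / (2 * (Ch * Cp * G + G))"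
  define e2 where "e2 = e / (2 * (real (card E) * Cp * CJ + 1))"
  have pos: "Ch * Cp * G + G > 0" "real (card E) * Cp * CJ + 1 > 0"
    using Ch(1) Cp(1) G(1) CJ(1) by (auto intro!: add_pos_pos add_nonneg_pos)
  have e1: "e1 > 0" and e2: "e2 > 0" using e pos by (auto simp: e1_def e2_def)
  have half: "q * (x / (2 * q)) = x / 2" if "q > 0" for q x :: real using that by simp
  have e1': "(Ch * Cp * G + G) * e1 = e / 2" unfolding e1_def by (rule half[OF pos(1)])
  have "(real (card E) * Cp * CJ + 1) * e2 = e / 2" unfolding e2_def by (rule half[OF pos(2)])
  then have e2': "real (card E) * Cp * CJ * e2 \<le> e / 2" using e2 by (simp add: distrib_right)
  have "\<forall>\<^sub>F h in at_right 0. \<forall>o'\<in>E. Vi.nrm (trd o' - trh h o') < e2"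
    using Z.orthonormalD(1)[OF E(1)] order_tendstoD(2)[OF trh_tendsto[OF EZ] e2] by (intro eventually_ball_finite) auto
  moreover have "\<forall>\<^sub>F h in at_right 0. \<forall>n\<in>{..<M}. \<exists>q\<in>Yh D h (lidx n). hnorm (Y2 S (lidx n)) (p n - q) < e1"
  proof (intro eventually_ball_finite ballI)
    fix n
    interpret Y2: hilbert "Y2 S (lidx n)" by (rule hilbertD[OF hilbert_l(4)[OF lidx]])
    obtain q h0 where "h0 > 0" "q \<in> Yh D h0 (lidx n)" "hnorm (Y2 S (lidx n)) (p n - q) < e1"
      using Y2.hdenseD[OF discrete_l(5)[OF lidx] p_mem e1] by auto
    then show "\<forall>\<^sub>F h in at_right 0. \<exists>q\<in>Yh D h (lidx n). hnorm (Y2 S (lidx n)) (p n - q) < e1"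
      using discrete_l(4)[OF lidx] by (intro eventually_at_right_0I[of h0]) blast+
  qed simp
  ultimately have "\<forall>\<^sub>F h in at_right 0. h > 0 \<and> (\<forall>o'\<in>E. Vi.nrm (trd o' - trh h o') < e2) \<and>
     (\<forall>n\<in>{..<M}. \<exists>q\<in>Yh D h (lidx n). hnorm (Y2 S (lidx n)) (p n - q) < e1) \<and>
     (\<forall>g\<in>Z.carr. Vi.nrm (trh h g) \<le> Ch * Z.nrm g)"
    using Ch(2) eventually_at_right_less[of "0::real"] by eventually_elim blast
  from eventually_fst_at_right[OF this] show ?thesis
  proof eventually_elim
    case (elim i)
    define h N where "h = fst i" and "N = snd i"
    have h: "h > 0" and tr: "\<And>o'. o' \<in> E \<Longrightarrow> Vi.nrm (trd o' - trh h o') < e2"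
      and qex: "\<forall>n\<in>{..<M}. \<exists>q\<in>Yh D h (lidx n). hnorm (Y2 S (lidx n)) (p n - q) < e1"
      and Chh: "\<And>g. g \<in> Z.carr \<Longrightarrow> Vi.nrm (trh h g) \<le> Ch * Z.nrm g"
      using elim unfolding h_def by blast+
    obtain q where q: "\<And>n. n < M \<Longrightarrow> q n \<in> Yh D h (lidx n)" "\<And>n. n < M \<Longrightarrow> hnorm (Y2 S (lidx n)) (p n - q n) < e1"
      using qex by (metis lessThan_iff)
    have q2: "q n \<in> hcarrier (Y2 S (lidx n)) \<and> hnorm (Y2 S (lidx n)) (q n - p n) \<le> e1" if n: "n < M" for n
    proof -
      interpret Y2: hilbert "Y2 S (lidx n)" by (rule hilbertD[OF hilbert_l(4)[OF lidx]])
      have qm: "q n \<in> hcarrier (Y2 S (lidx n))" using q(1)[OF n] discrete_l(3)[OF lidx h] by blast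
      then show ?thesis using q(2)[OF n] Y2.nrm_diff_commute[OF qm p_mem] by simp
    qed
    have Jhc: "Jh q c u \<in> Vx.carr \<and> Vx.nrm (Jh q c u - J M c u) \<le> G * e1 * Vx.nrm u"
      if "u \<in> Vx.carr" for u
      by (rule G(2)[OF less_imp_le[OF e1] q2 that])
    have Jhl: "v \<in> Vx.carr \<Longrightarrow> Jh q c (u + v) = Jh q c u + Jh q c v" "Jh q c (a *\<^sub>C u) = a *\<^sub>C Jh q c u"
      if "u \<in> Vx.carr" for u v a
      using Jh_linear[OF _ that, of q] q2 by blast+
    let ?V = "VhN S D h N"
    have Vc: "u \<in> V.carr" if "u \<in> ?V" for u using that VhN_carr[OF h] by blast
    have est: "V.nrm (Th c q h u - T c u) \<le> e * V.nrm u" if u: "u \<in> ?V" for u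
    proof -
      note uV = Vc[OF u]
      have ThV: "Th c q h u \<in> V.carr" by (rule Vc[OF Th_mem[OF h q(1) u]])
      have TV: "T c u \<in> V.carr" by (rule bounded_opD(1)[OF T_bounded uV])
      define x where "x = snd u"
      have x: "x \<in> Vx.carr" using uV by (simp add: x_def Vsp_mem)
      have xu: "Vx.nrm x \<le> V.nrm u" unfolding x_def by (rule hnorm_Vsp_ge(2)[OF uV])
      have Jm: "Jh q c x \<in> Vx.carr" "J M c x \<in> Vx.carr" using Jhc[OF x] x by auto
      define gh g where "gh = trp S (Jh q c x)" and "g = trp S (J M c x)"
      have gm: "gh \<in> Z.carr" "g \<in> Z.carr" using trp_mem Jm by (auto simp: gh_def g_def)
      have Jd: "Vx.nrm (Jh q c x - J M c x) \<le> G * e1 * Vx.nrm x" using Jhc[OF x] by blast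
      have "Z.nrm (gh - g) \<le> Cp * (G * e1 * Vx.nrm x)"
        using order_trans[OF Cp(2)[OF Vx.mem_diff[OF Jm]] mult_left_mono[OF Jd]] Cp(1) trp_simps(3)[OF Jm] by (simp add: gh_def g_def)
      then have d1: "Vi.nrm (trh h (gh - g)) \<le> Ch * (Cp * (G * e1 * Vx.nrm x))"
        using order_trans[OF Chh[OF Z.mem_diff[OF gm]] mult_left_mono] Ch(1) by (meson less_imp_le)
      have ng: "Z.nrm g \<le> Cp * (CJ * Vx.nrm x)"
        using order_trans[OF Cp(2)[OF Jm(2)] mult_left_mono[OF CJ(2)[OF x]]] Cp(1) by (simp add: g_def)
      \<comment> \<open>\<open>g\<close> is expanded in \<open>E\<close>, and each coefficient is at
        most the norm of \<open>g\<close>. So the accuracy on the basis is multiplied only by the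
        number of its elements and that norm.\<close>
      have d2: "Vi.nrm (trh h g - trd g) \<le> real (card E) * (Cp * (CJ * Vx.nrm x)) * e2"
      proof -
        have gs: "g = (\<Sum>o'\<in>E. Z.ip g o' *\<^sub>C o')"
          using Z.oproj_fixed[OF E(1) E(2)[OF x]] by (simp add: Z.oproj_def g_def)
        have "trd (\<Sum>o'\<in>E. Z.ip g o' *\<^sub>C o') = (\<Sum>o'\<in>E. trd (Z.ip g o' *\<^sub>C o'))"
          by (rule clinear_on_sum[OF Z.subspace_carr bounded_opD(2)[OF trd]]) (use EZ in auto)
        then have t1: "trd g = (\<Sum>o'\<in>E. Z.ip g o' *\<^sub>C trd o')" using gs EZ by (simp add: trd_simps(2))
        have "trh h (\<Sum>o'\<in>E. Z.ip g o' *\<^sub>C o') = (\<Sum>o'\<in>E. trh h (Z.ip g o' *\<^sub>C o'))"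
          by (rule clinear_on_sum[OF Z.subspace_carr bounded_opD(2)[OF trh[OF h]]]) (use EZ in auto)
        then have t2: "trh h g = (\<Sum>o'\<in>E. Z.ip g o' *\<^sub>C trh h o')" using gs EZ by (simp add: trh_simps(2)[OF h])
        have "trh h g - trd g = (\<Sum>o'\<in>E. Z.ip g o' *\<^sub>C (trh h o' - trd o'))"
          unfolding t1 t2 by (simp add: sum_subtractf complex_vector.scale_right_diff_distrib)
        then have "Vi.nrm (trh h g - trd g) \<le> (\<Sum>o'\<in>E. Vi.nrm (Z.ip g o' *\<^sub>C (trh h o' - trd o')))"
          using Vi.nrm_sum[of E "\<lambda>o'. Z.ip g o' *\<^sub>C (trh h o' - trd o')"] EZ trh_carr[OF h] trd_mem by simp
        also have "\<dots> \<le> (\<Sum>o'\<in>E. (Cp * (CJ * Vx.nrm x)) * e2)"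
        proof (rule sum_mono)
          fix o' assume o': "o' \<in> E"
          have m: "trh h o' \<in> Vi.carr" "trd o' \<in> Vi.carr" using EZ[OF o'] trh_carr[OF h] trd_mem by auto
          have "cmod (Z.ip g o') \<le> Z.nrm g"
            using Z.Cauchy_Schwarz[OF gm(2) EZ[OF o']] Z.orthonormal_nrm[OF E(1) o'] by simp
          then have "cmod (Z.ip g o') \<le> Cp * (CJ * Vx.nrm x)" using ng by linarith
          moreover have "Vi.nrm (trh h o' - trd o') \<le> e2" using tr[OF o'] Vi.nrm_diff_commute[OF m] by simp
          ultimately show "Vi.nrm (Z.ip g o' *\<^sub>C (trh h o' - trd o')) \<le> (Cp * (CJ * Vx.nrm x)) * e2"
            using m Cp(1) CJ(1) x by (simp, intro mult_mono) auto
        qed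
        finally show ?thesis by simp
      qed
      have eq: "Th c q h u - T c u = (trh h (gh - g) + (trh h g - trd g), Jh q c x - J M c x)"
        using trh_simps(3)[OF h gm] by (simp add: Th_def T_def x_def[symmetric] gh_def[symmetric] g_def[symmetric])
      have m: "trh h (gh - g) \<in> Vi.carr" "trh h g - trd g \<in> Vi.carr"
        using trh_carr[OF h] trd_mem gm by auto
      have "V.nrm (Th c q h u - T c u) \<le> Vi.nrm (trh h (gh - g) + (trh h g - trd g)) + Vx.nrm (Jh q c x - J M c x)"
        using hnorm_Vsp_le[OF V.mem_diff[OF ThV TV]] unfolding eq by simp
      also have "\<dots> \<le> (Ch * (Cp * (G * e1 * Vx.nrm x)) + real (card E) * (Cp * (CJ * Vx.nrm x)) * e2) + G * e1 * Vx.nrm x"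
        using Vi.nrm_triangle[OF m] d1 d2 Jd by linarith
      also have "\<dots> = ((Ch * Cp * G + G) * e1 + real (card E) * Cp * CJ * e2) * Vx.nrm x"
        by (simp add: algebra_simps)
      also have "\<dots> \<le> (e / 2 + e / 2) * Vx.nrm x"
        using e1' e2' x by (intro mult_right_mono add_mono) auto
      also have "\<dots> \<le> e * V.nrm u" using xu e by simp
      finally show ?thesis .
    qed
    have "bounded_op (hsub (Vsp S) ?V) (hsub (Vsp S) ?V) (Th c q h)"
    proof (rule bounded_opI[where C = "e + CT"])
      show "clinear_on (hcarrier (hsub (Vsp S) ?V)) (Th c q h)"
      proof -
        have 1: "snd u \<in> Vx.carr" if "u \<in> ?V" for u using Vc[OF that] by (simp add: Vsp_mem)
        have 2: "Jh q c (snd u) \<in> Vx.carr" if "u \<in> ?V" for u using Jhc[OF 1[OF that]] by blast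
        show ?thesis
          unfolding clinear_on_def
          by (auto simp: Th_def 1 2 Jhl trp_simps trp_mem trh_simps[OF h] scaleC_prod_def complex_vector.scale_right_distrib)
      qed
      fix u assume "u \<in> hcarrier (hsub (Vsp S) ?V)"
      then have u: "u \<in> ?V" by simp
      show "Th c q h u \<in> hcarrier (hsub (Vsp S) ?V)" using Th_mem[OF h q(1) u] by simp
      note uV = Vc[OF u]
      have ThV: "Th c q h u \<in> V.carr" by (rule Vc[OF Th_mem[OF h q(1) u]])
      have TV: "T c u \<in> V.carr" by (rule bounded_opD(1)[OF T_bounded uV])
      have "V.nrm (Th c q h u) \<le> V.nrm (Th c q h u - T c u) + V.nrm (T c u)"
        using V.nrm_triangle[OF V.mem_diff[OF ThV TV] TV] by simp
      also have "\<dots> \<le> e * V.nrm u + CT * V.nrm u" by (intro add_mono est[OF u] CT(2)[OF uV])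
      finally show "hnorm (hsub (Vsp S) ?V) (Th c q h u) \<le> (e + CT) * hnorm (hsub (Vsp S) ?V) u" by (simp add: distrib_right)
    qed
    then show ?case using est unfolding h_def N_def by blast
  qed
qed

text \<open>As the factors are unimodular, \<open>T \<theta>\<close> inverts \<open>T\<close> with
  conjugate factors. It has the same form, so \<open>T_approximable\<close> covers both.\<close>

lemma T_discretizable: "discretizable (Vsp S) W F (T (\<lambda>n. cnj (\<theta> n)))"
proof (rule V.discretizable_if_inverse[OF W_closed T_bounded T_bounded])
  fix u assume u: "u \<in> V.carr"
  have "cnj (\<theta> n) * \<theta> n = 1" if "n < M" for n
    using \<theta>[OF that] complex_norm_square[of "\<theta> n"] by (simp add: mult.commute)
  then show "T (\<lambda>n. cnj (\<theta> n)) (T \<theta> u) = u" by (intro T_inverse[OF u])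
qed (rule T_approximable; assumption)+

text \<open>Nestedness in \<open>h\<close> and \<open>N\<close> makes the approximable vectors a
  subspace: two approximants share the smaller \<open>h\<close> and the larger \<open>N\<close>. It
  contains every mode, since both factors of \<open>x \<otimes> \<phi> n\<close> can be
  approximated, and the modes span a dense set.\<close>

lemma Vext_approx:
  assumes u: "u \<in> Vx.carr" and e: "e > 0"
  shows "\<exists>h>0. \<exists>N. \<exists>v\<in>VhN_ext S D h N. Vx.nrm (u - v) < e"
proof -
  let ?Q = "{u \<in> Vx.carr. \<forall>e>0. \<exists>h>0. \<exists>N. \<exists>v\<in>VhN_ext S D h N. Vx.nrm (u - v) < e}"
  have "complex_vector.subspace ?Q"
    unfolding complex_vector.subspace_def
  proof (intro conjI ballI allI)
    have "0 \<in> VhN_ext S D 1 0" by (rule complex_vector.subspace_0[OF VhN_ext_subspace])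
    then show "0 \<in> ?Q"
      by (intro CollectI conjI Vx.mem_0 allI impI exI[of _ "1::real"] exI[of _ "0::nat"] bexI[of _ 0]) auto
  next
    fix x y assume x: "x \<in> ?Q" and y: "y \<in> ?Q"
    show "x + y \<in> ?Q"
    proof (intro CollectI conjI allI impI)
      fix e :: real assume "e > 0"
      then have e: "e / 2 > 0" by simp
      obtain h N v where v: "h > 0" "v \<in> VhN_ext S D h N" "Vx.nrm (x - v) < e / 2" using x e by blast
      obtain h' N' v' where v': "h' > 0" "v' \<in> VhN_ext S D h' N'" "Vx.nrm (y - v') < e / 2" using y e by blast
      define h0 N0 where "h0 = min h h'" and "N0 = max N N'"
      have h0: "h0 > 0" "h0 \<le> h" "h0 \<le> h'" "N \<le> N0" "N' \<le> N0" using v(1) v'(1) by (auto simp: h0_def N0_def)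
      have "v \<in> VhN_ext S D h0 N0" "v' \<in> VhN_ext S D h0 N0"
        using VhN_ext_mono[OF h0(1,2,4)] VhN_ext_mono[OF h0(1,3,5)] v(2) v'(2) by auto
      then have vv: "v + v' \<in> VhN_ext S D h0 N0" by (rule complex_vector.subspace_add[OF VhN_ext_subspace])
      have m: "x - v \<in> Vx.carr" "y - v' \<in> Vx.carr"
        using x y v v' VhN_ext_carr by auto
      have eq: "x + y - (v + v') = (x - v) + (y - v')" by simp
      have "Vx.nrm (x + y - (v + v')) < e" unfolding eq using Vx.nrm_triangle[OF m] v(3) v'(3) by simp
      then show "\<exists>h>0. \<exists>N. \<exists>v\<in>VhN_ext S D h N. Vx.nrm (x + y - v) < e" using vv h0(1) by blast
    qed (use x y in blast)
  next
    fix c x assume x: "x \<in> ?Q"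
    show "c *\<^sub>C x \<in> ?Q"
    proof (intro CollectI conjI allI impI)
      fix e :: real assume e: "e > 0"
      then have e': "e / (cmod c + 1) > 0" by (simp add: add_nonneg_pos)
      obtain h N v where v: "h > 0" "v \<in> VhN_ext S D h N" "Vx.nrm (x - v) < e / (cmod c + 1)" using x e' by blast
      have m: "x - v \<in> Vx.carr" using x v VhN_ext_carr by auto
      have "c *\<^sub>C x - c *\<^sub>C v = c *\<^sub>C (x - v)" by (simp add: complex_vector.scale_right_diff_distrib)
      then have "Vx.nrm (c *\<^sub>C x - c *\<^sub>C v) = cmod c * Vx.nrm (x - v)" using m by simp
      also have "\<dots> \<le> cmod c * (e / (cmod c + 1))" using v(3) by (intro mult_left_mono) auto
      also have "\<dots> < (cmod c + 1) * (e / (cmod c + 1))" using e' by (intro mult_strict_right_mono) auto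
      also have "\<dots> = e" using add_nonneg_pos[of "cmod c" 1] by simp
      finally show "\<exists>h>0. \<exists>N. \<exists>w\<in>VhN_ext S D h N. Vx.nrm (c *\<^sub>C x - w) < e"
        using v(1) complex_vector.subspace_scale[OF VhN_ext_subspace v(2)] by blast
    qed (use x in blast)
  qed
  moreover have "(\<Union>n. Vsep S \<phi> lidx n) \<subseteq> ?Q"
  proof clarify
    fix n u assume uV: "u \<in> Vsep S \<phi> lidx n"
    then obtain x where x: "x \<in> hcarrier (X2 S (lidx n))" "u = tphi n x" unfolding Vsep_eq by blast
    interpret X2: hilbert "X2 S (lidx n)" by (rule hilbertD[OF hilbert_l(2)[OF lidx]])
    interpret Y2: hilbert "Y2 S (lidx n)" by (rule hilbertD[OF hilbert_l(4)[OF lidx]])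
    obtain C where C: "C > 0" "\<And>x y. x \<in> hcarrier (X2 S (lidx n)) \<Longrightarrow> y \<in> hcarrier (Y2 S (lidx n)) \<Longrightarrow>
        hnorm (Wl (lidx n)) (ten S (lidx n) x y) \<le> C * hnorm (X2 S (lidx n)) x * hnorm (Y2 S (lidx n)) y"
      using ten_norm_le[OF lidx] by blast
    show "u \<in> Vx.carr \<and> (\<forall>e>0. \<exists>h>0. \<exists>N. \<exists>v\<in>VhN_ext S D h N. Vx.nrm (u - v) < e)"
    proof (intro conjI allI impI)
      show "u \<in> Vx.carr" using uV Vsep_carr by blast
      fix e :: real assume e: "e > 0"
      \<comment> \<open>Bounds for the factors multiplying the errors of \<open>x'\<close> and
        \<open>q\<close>; the added 1 makes them positive. \<open>b\<close> contains the norm of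
        \<open>x\<close> plus 1 because \<open>d \<le> 1\<close> below bounds \<open>x'\<close>
        accordingly.\<close>
      define a b where "a = C * hnorm (Y2 S (lidx n)) (p n) + 1" and "b = C * (hnorm (X2 S (lidx n)) x + 1) + 1"
      have ab: "a > 0" "b > 0" unfolding a_def b_def using C(1) p_mem x(1) by (auto intro!: add_nonneg_pos)
      define d where "d = min 1 (e / (2 * a))"
      have d: "d > 0" using e ab by (simp add: d_def)
      obtain N x' where x': "x' \<in> XN D N (lidx n)" "x' \<in> hcarrier (X2 S (lidx n))" "hnorm (X2 S (lidx n)) (x - x') < d"
        using X2.hdenseD[OF discrete_l(9)[OF lidx] x(1) d] by auto
      have d'1: "hnorm (X2 S (lidx n)) (x - x') < 1" "hnorm (X2 S (lidx n)) (x - x') < e / (2 * a)" using x'(3) by (auto simp: d_def)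
      have nx': "hnorm (X2 S (lidx n)) x' \<le> hnorm (X2 S (lidx n)) x + 1"
        using X2.nrm_triangle_diff[OF x(1) X2.mem_diff[OF x(1) x'(2)]] d'1(1) by simp
      obtain h q where q: "h > 0" "q \<in> Yh D h (lidx n)" "q \<in> hcarrier (Y2 S (lidx n))" "hnorm (Y2 S (lidx n)) (p n - q) < e / (2 * b)"
        using Y2.hdenseD[OF discrete_l(5)[OF lidx] p_mem, of "e / (2 * b)"] e ab by auto
      have q1: "q \<in> hcarrier (Y1 S (lidx n))" using cont_embeddedD[OF embedded_l(2)[OF lidx] q(3)] .
      note t = hilbert_l(2,3)[OF lidx, of n] tensor_l(2)[OF lidx, of n]
      let ?v = "single (lidx n) (ten S (lidx n) x' q)"
      have vm: "?v \<in> VhN_ext S D h N" by (rule VhN_ext_single[OF lidx tensor_span_base[OF x'(1) q(2)]])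
      have dx: "x - x' \<in> hcarrier (X2 S (lidx n))" and dq: "p n - q \<in> hcarrier (Y2 S (lidx n))" using x x' q p_mem by auto
      have s1: "single (lidx n) (ten S (lidx n) (x - x') (p n)) \<in> Vx.carr" "single (lidx n) (ten S (lidx n) x' (p n - q)) \<in> Vx.carr"
        by (simp_all only: single_mem[OF lidx] ten_mem[OF lidx dx p_mem] ten_mem[OF lidx x'(2) dq])
      have eq: "u - ?v = single (lidx n) (ten S (lidx n) (x - x') (p n)) + single (lidx n) (ten S (lidx n) x' (p n - q))"
        using tensor_diff_left[OF t x(1) x'(2) p_mem1] tensor_diff_right[OF t x'(2) p_mem1 q1]
        by (simp add: x(2) tensor_phi_def single_linear)
      have "Vx.nrm (u - ?v) \<le> hnorm (Wl (lidx n)) (ten S (lidx n) (x - x') (p n)) + hnorm (Wl (lidx n)) (ten S (lidx n) x' (p n - q))"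
        unfolding eq using Vx.nrm_triangle[OF s1] single_norm[OF lidx ten_mem[OF lidx dx p_mem]] single_norm[OF lidx ten_mem[OF lidx x'(2) dq]] by simp
      also have "\<dots> \<le> C * hnorm (X2 S (lidx n)) (x - x') * hnorm (Y2 S (lidx n)) (p n) + C * hnorm (X2 S (lidx n)) x' * hnorm (Y2 S (lidx n)) (p n - q)"
        by (intro add_mono C(2) dx p_mem x'(2) dq)
      also have "\<dots> \<le> a * hnorm (X2 S (lidx n)) (x - x') + b * hnorm (Y2 S (lidx n)) (p n - q)"
      proof (rule add_mono)
        have "C * hnorm (X2 S (lidx n)) (x - x') * hnorm (Y2 S (lidx n)) (p n) = (a - 1) * hnorm (X2 S (lidx n)) (x - x')" by (simp add: a_def)
        also have "\<dots> \<le> a * hnorm (X2 S (lidx n)) (x - x')" using dx by (intro mult_right_mono) auto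
        finally show "C * hnorm (X2 S (lidx n)) (x - x') * hnorm (Y2 S (lidx n)) (p n) \<le> a * hnorm (X2 S (lidx n)) (x - x')" .
        have "C * hnorm (X2 S (lidx n)) x' \<le> C * (hnorm (X2 S (lidx n)) x + 1)" using nx' C(1) by (intro mult_left_mono) auto
        then have "C * hnorm (X2 S (lidx n)) x' \<le> b" by (simp add: b_def)
        then show "C * hnorm (X2 S (lidx n)) x' * hnorm (Y2 S (lidx n)) (p n - q) \<le> b * hnorm (Y2 S (lidx n)) (p n - q)" using dq by (intro mult_right_mono) auto
      qed
      also have "\<dots> < e / 2 + e / 2"
      proof (rule add_strict_mono)
        show "a * hnorm (X2 S (lidx n)) (x - x') < e / 2" using d'1(2) ab(1) by (simp add: field_simps)
        show "b * hnorm (Y2 S (lidx n)) (p n - q) < e / 2" using q(4) ab(2) by (simp add: field_simps)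
      qed
      finally show "\<exists>h>0. \<exists>N. \<exists>v\<in>VhN_ext S D h N. Vx.nrm (u - v) < e" using q(1) vm by (metis field_sum_of_halves)
    qed
  qed
  ultimately have sub: "cspan (\<Union>n. Vsep S \<phi> lidx n) \<subseteq> ?Q" by (intro complex_vector.span_minimal)
  have e': "e / 2 > 0" using e by simp
  obtain y where y: "y \<in> cspan (\<Union>n. Vsep S \<phi> lidx n)" "y \<in> Vx.carr" "Vx.nrm (u - y) < e / 2"
    using Vx.hdenseD[OF Vsep_dense u e'] by blast
  then obtain h N v where v: "h > 0" "v \<in> VhN_ext S D h N" "Vx.nrm (y - v) < e / 2" using sub e' by blast
  have vc: "v \<in> Vx.carr" using v VhN_ext_carr by blast
  have "Vx.nrm (u - v) < e" using Vx.nrm_triangle3[OF u y(2) vc] y(3) v(3) by simp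
  then show ?thesis using v by blast
qed

text \<open>Approximating the two components separately breaks the matching of traces. The mismatch
  \<open>g\<close> is small, and adding \<open>trh g\<close> to the interior component repairs it at
  a cost controlled by the uniform bound on \<open>trh\<close>.\<close>

lemma V_approx:
  assumes u: "u \<in> V.carr" and e: "e > 0"
  shows "\<forall>\<^sub>F i in F. \<exists>w\<in>W i. V.nrm (u - w) < e"
proof -
  obtain Ch where Ch: "Ch > 0" "\<forall>\<^sub>F h in at_right 0. \<forall>g\<in>Z.carr. Vi.nrm (trh h g) \<le> Ch * Z.nrm g"
    by (rule trh_uniform)
  obtain Cp where Cp: "Cp > 0" "\<And>x. x \<in> Vx.carr \<Longrightarrow> Z.nrm (trp S x) \<le> Cp * Vx.nrm x" using Vx.op_bound[OF trp] by blast
  obtain Cm where Cm: "Cm > 0" "\<And>x. x \<in> Vi.carr \<Longrightarrow> Z.nrm (trm S x) \<le> Cm * Vi.nrm x" using Vi.op_bound[OF trm] by blast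
  \<comment> \<open>The 2 counts the errors of the two components, the products bound the lifted
    mismatch; so the total error is below \<open>c * d = e\<close>.\<close>
  define c where "c = 2 + Ch * Cp + Ch * Cm"
  have c: "c > 0" unfolding c_def using Ch(1) Cp(1) Cm(1) by (auto intro!: add_pos_pos)
  define d where "d = e / c"
  have d: "d > 0" using e c by (simp add: d_def)
  have um: "fst u \<in> Vi.carr" "snd u \<in> Vx.carr" "trp S (snd u) = trm S (fst u)" using u by (auto simp: Vsp_mem)
  obtain h1 w where w: "h1 > 0" "w \<in> Vh_int D h1" "w \<in> Vi.carr" "Vi.nrm (fst u - w) < d"
    using Vi.hdenseD[OF Vh_int_dense um(1) d] by auto
  obtain h0 N0 v where v: "h0 > 0" "v \<in> VhN_ext S D h0 N0" "Vx.nrm (snd u - v) < d"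
    using Vext_approx[OF um(2) d] by blast
  have vc: "v \<in> Vx.carr" using v VhN_ext_carr by blast
  have "\<forall>\<^sub>F h in at_right 0. 0 < h \<and> h \<le> min h0 h1"
    by (rule eventually_at_right_0I[of "min h0 h1"]) (use v(1) w(1) in auto)
  then have "\<forall>\<^sub>F h in at_right 0. (0 < h \<and> h \<le> min h0 h1) \<and> (\<forall>g\<in>Z.carr. Vi.nrm (trh h g) \<le> Ch * Z.nrm g)"
    using Ch(2) by eventually_elim blast
  from eventually_fst_at_right[OF this] eventually_snd_sequentially[OF eventually_ge_at_top[of N0]]
  show ?thesis
  proof eventually_elim
    case (elim i)
    define h N where "h = fst i" and "N = snd i"
    have h: "h > 0" "h \<le> h0" "h \<le> h1" and N: "N0 \<le> N"
      and Chh: "\<And>g. g \<in> Z.carr \<Longrightarrow> Vi.nrm (trh h g) \<le> Ch * Z.nrm g"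
      using elim unfolding h_def N_def by auto
    have wh: "w \<in> Vh_int D h" using Vh_int(4)[OF h(1,3)] w(2) by blast
    have vh: "v \<in> VhN_ext S D h N" using VhN_ext_mono[OF h(1,2) N] v(2) by blast
    define g where "g = trp S v - trm S w"
    have gm: "g \<in> Z.carr" unfolding g_def using trp_mem[OF vc] trm_mem[OF w(3)] by blast
    obtain y where y: "y \<in> Vh_int D h" "trp S v = trm S y" using trp_VhN_ext[OF h(1)] vh by blast
    have yc: "y \<in> Vi.carr" using y Vh_int(3)[OF h(1)] by blast
    \<comment> \<open>The mismatch is the trace of a function in \<open>Vh_int\<close>, and only for
      such traces is \<open>trh\<close> known to be a right inverse.\<close>
    have "g = trm S (y - w)" using trm_simps(3)[OF yc w(3)] by (simp add: g_def y(2))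
    then have tg: "trm S (trh h g) = g" using trm_trh[OF h(1) complex_vector.subspace_diff[OF Vh_int(1)[OF h(1)] y(1) wh]] by simp
    have thh: "trh h g \<in> Vh_int D h" by (rule trh_mem[OF h(1) gm])
    have thc: "trh h g \<in> Vi.carr" by (rule trh_carr[OF h(1) gm])
    have mem: "(w + trh h g, v) \<in> VhN S D h N"
      using complex_vector.subspace_add[OF Vh_int(1)[OF h(1)] wh thh] vh trm_simps(1)[OF w(3) thc] tg by (simp add: VhN_mem g_def)
    have "Z.nrm g \<le> Cp * d + Cm * d"
    proof -
      have a: "trp S v - trp S (snd u) \<in> Z.carr" "trm S (fst u) - trm S w \<in> Z.carr"
        using trp_mem[OF vc] trp_mem[OF um(2)] trm_mem[OF um(1)] trm_mem[OF w(3)] by auto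
      have "g = (trp S v - trp S (snd u)) + (trm S (fst u) - trm S w)" using um(3) by (simp add: g_def)
      then have "Z.nrm g \<le> Z.nrm (trp S v - trp S (snd u)) + Z.nrm (trm S (fst u) - trm S w)"
        using Z.nrm_triangle[OF a] by simp
      also have "\<dots> \<le> Cp * Vx.nrm (v - snd u) + Cm * Vi.nrm (fst u - w)"
        using Cp(2)[OF Vx.mem_diff[OF vc um(2)]] Cm(2)[OF Vi.mem_diff[OF um(1) w(3)]] trp_simps(3)[OF vc um(2)] trm_simps(3)[OF um(1) w(3)] by simp
      also have "\<dots> \<le> Cp * d + Cm * d"
        using v(3) w(4) Cp(1) Cm(1) Vx.nrm_diff_commute[OF vc um(2)] by (intro add_mono mult_left_mono) auto
      finally show ?thesis .
    qed
    then have nt: "Vi.nrm (trh h g) \<le> Ch * (Cp * d + Cm * d)"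
      using order_trans[OF Chh[OF gm] mult_left_mono] Ch(1) by (meson less_imp_le)
    have V2: "u - (w + trh h g, v) \<in> V.carr" using u mem VhN_carr[OF h(1)] by blast
    have "V.nrm (u - (w + trh h g, v)) \<le> Vi.nrm ((fst u - w) - trh h g) + Vx.nrm (snd u - v)"
      using hnorm_Vsp_le[OF V2] by (simp add: algebra_simps)
    also have "Vi.nrm ((fst u - w) - trh h g) \<le> Vi.nrm (fst u - w) + Vi.nrm (trh h g)"
      by (rule Vi.nrm_triangle_diff[OF Vi.mem_diff[OF um(1) w(3)] thc])
    finally have "V.nrm (u - (w + trh h g, v)) < d + Ch * (Cp * d + Cm * d) + d"
      using nt w(4) v(3) by linarith
    also have "\<dots> = c * d" by (simp add: c_def algebra_simps)
    also have "\<dots> = e" using c by (simp add: d_def)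
    finally show ?case using mem unfolding h_def N_def by blast
  qed
qed

end

section \<open>The operator of the eigenvalue problem and its holomorphy\<close>

context exterior_setting
begin

text \<open>On the carrier the description in \<open>Top\<close> picks the value of the Riesz
  operator of the form, because the representing vector is unique.\<close>

lemma Top_bounded: "bounded_op (Vsp S) (Vsp S) (Top S \<kappa>)"
  and hinner_Top: "u \<in> V.carr \<Longrightarrow> v \<in> V.carr \<Longrightarrow> V.ip (Top S \<kappa> u) v = form S \<kappa> u v"
  if \<kappa>: "\<kappa> \<in> params S"
proof -
  obtain A where A: "bounded_op (Vsp S) (Vsp S) A"
    "\<And>u v. u \<in> V.carr \<Longrightarrow> v \<in> V.carr \<Longrightarrow> V.ip (A u) v = form S \<kappa> u v"
    by (rule V.Riesz_form[OF form_bounded[OF \<kappa>]]) blast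
  have eq: "Top S \<kappa> u = A u" if u: "u \<in> V.carr" for u
    unfolding Top_def
  proof (rule the_equality)
    show "A u \<in> V.carr \<and> (\<forall>v\<in>V.carr. form S \<kappa> u v = V.ip (A u) v)"
      using bounded_opD(1)[OF A(1) u] A(2)[OF u] by simp
    fix w assume "w \<in> V.carr \<and> (\<forall>v\<in>V.carr. form S \<kappa> u v = V.ip w v)"
    then show "w = A u" by (intro V.ip_eqI bounded_opD(1)[OF A(1) u]) (auto simp: A(2)[OF u])
  qed
  show "u \<in> V.carr \<Longrightarrow> v \<in> V.carr \<Longrightarrow> V.ip (Top S \<kappa> u) v = form S \<kappa> u v"
    by (simp add: eq A(2))
  obtain C where C: "C > 0" "\<And>x. x \<in> V.carr \<Longrightarrow> V.nrm (A x) \<le> C * V.nrm x"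
    using V.op_bound[OF A(1)] by blast
  show "bounded_op (Vsp S) (Vsp S) (Top S \<kappa>)"
  proof (rule bounded_opI[where C = C])
    show "clinear_on (V.carr) (Top S \<kappa>)"
      using clinear_onD[OF bounded_opD(2)[OF A(1)]] by (auto simp: clinear_on_def eq)
  qed (simp_all add: eq C(2) bounded_opD(1)[OF A(1)])
qed

lemma not_eigenvalue_if_invertible:
  assumes \<kappa>: "\<kappa> \<in> params S" and inv: "invertible_op (Vsp S) (Top S \<kappa>)"
  shows "\<kappa> \<notin> eigenvalues S"
proof
  assume "\<kappa> \<in> eigenvalues S"
  then obtain u where u: "u \<in> V.carr" "u \<noteq> 0" "\<And>v. v \<in> V.carr \<Longrightarrow> form S \<kappa> u v = 0"
    unfolding eigenvalues_def by blast
  obtain R where R: "bounded_op (Vsp S) (Vsp S) R" "\<And>x. x \<in> V.carr \<Longrightarrow> R (Top S \<kappa> x) = x"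
    using inv unfolding invertible_op_def by blast
  have "Top S \<kappa> u = 0"
    by (rule V.ip_eqI) (use u hinner_Top[OF \<kappa> u(1)] bounded_opD(1)[OF Top_bounded[OF \<kappa>] u(1)] in auto)
  then have "u = R 0" using R(2)[OF u(1)] by simp
  then show False using u(2) clinear_on_0[OF V.subspace_carr bounded_opD(2)[OF R(1)]] by simp
qed

text \<open>The derivative form is \<open>V.ip (T' u) v\<close>. The limit in \<open>op_norm\<close>
  turns into estimates for forms by Cauchy-Schwarz, after the difference quotients are shown to be
  bounded operators as required by \<open>op_norm_bound\<close>.\<close>

lemma form_holomorphic_form:
  assumes E: "assumption_E S"
  shows "form_holomorphic (Vsp S) (params S) (form S)"
  unfolding form_holomorphic_def
proof (intro conjI ballI)
  fix k assume k: "k \<in> params S"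
  then show "bounded_sesquilinear (Vsp S) (form S k)" by (rule form_bounded)
  define R where "R T' \<kappa> u = (1 / (\<kappa> - k)) *\<^sub>C (Top S \<kappa> u - Top S k u) - T' u" for T' \<kappa> u
  obtain T' where T': "bounded_op (Vsp S) (Vsp S) T'"
    "((\<lambda>\<kappa>. op_norm (Vsp S) (Vsp S) (R T' \<kappa>)) \<longlongrightarrow> 0) (at k)"
    using E k unfolding assumption_E_def R_def by blast
  obtain C where C: "C > 0" "\<And>x. x \<in> V.carr \<Longrightarrow> V.nrm (T' x) \<le> C * V.nrm x"
    using V.op_bound[OF T'(1)] by blast
  note T'm = bounded_opD(1)[OF T'(1)] and T'l = clinear_onD[OF bounded_opD(2)[OF T'(1)]]
  note Tm = bounded_opD(1)[OF Top_bounded]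
  let ?d = "\<lambda>u v. V.ip (T' u) v"
  have Rb: "bounded_op (Vsp S) (Vsp S) (R T' \<kappa>)" if \<kappa>: "\<kappa> \<in> params S" for \<kappa>
  proof -
    obtain C1 where C1: "\<And>x. x \<in> V.carr \<Longrightarrow> V.nrm (Top S \<kappa> x) \<le> C1 * V.nrm x"
      using V.op_bound[OF Top_bounded[OF \<kappa>]] by blast
    obtain C2 where C2: "\<And>x. x \<in> V.carr \<Longrightarrow> V.nrm (Top S k x) \<le> C2 * V.nrm x"
      using V.op_bound[OF Top_bounded[OF k]] by blast
    note l1 = clinear_onD[OF bounded_opD(2)[OF Top_bounded[OF \<kappa>]]] and l2 = clinear_onD[OF bounded_opD(2)[OF Top_bounded[OF k]]]
    let ?c = "1 / (\<kappa> - k)"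
    show ?thesis
    proof (rule bounded_opI[where C = "cmod ?c * (C1 + C2) + C"])
      show "clinear_on (V.carr) (R T' \<kappa>)"
        unfolding clinear_on_def R_def
        by (simp add: l1 l2 T'l complex_vector.scale_right_distrib complex_vector.scale_right_diff_distrib mult.commute)
      fix x assume x: "x \<in> V.carr"
      note m = Tm[OF \<kappa> x] Tm[OF k x] T'm[OF x]
      show "R T' \<kappa> x \<in> V.carr" unfolding R_def using m by simp
      have "V.nrm (R T' \<kappa> x) \<le> V.nrm (?c *\<^sub>C (Top S \<kappa> x - Top S k x)) + V.nrm (T' x)"
        unfolding R_def using m by (intro V.nrm_triangle_diff) auto
      also have "V.nrm (?c *\<^sub>C (Top S \<kappa> x - Top S k x)) = cmod ?c * V.nrm (Top S \<kappa> x - Top S k x)"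
        using m by (intro V.nrm_scale) auto
      also have "\<dots> \<le> cmod ?c * ((C1 + C2) * V.nrm x)"
        using V.nrm_triangle_diff[OF m(1,2)] C1[OF x] C2[OF x] by (intro mult_left_mono) (simp_all add: distrib_right)
      also have "V.nrm (T' x) \<le> C * V.nrm x" by (rule C(2)[OF x])
      finally show "V.nrm (R T' \<kappa> x) \<le> (cmod ?c * (C1 + C2) + C) * V.nrm x"
        by (simp add: algebra_simps)
    qed
  qed
  show "\<exists>d. bounded_sesquilinear (Vsp S) d \<and> (\<forall>e>0. \<exists>\<delta>>0. \<forall>\<kappa>\<in>params S. cmod (\<kappa> - k) < \<delta> \<longrightarrow>
      (\<forall>u\<in>V.carr. \<forall>v\<in>V.carr.
        cmod (form S \<kappa> u v - form S k u v - (\<kappa> - k) * d u v) \<le> e * cmod (\<kappa> - k) * V.nrm u * V.nrm v))"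
  proof (intro exI[of _ ?d] conjI allI impI)
    show "bounded_sesquilinear (Vsp S) ?d"
    proof (rule bounded_sesquilinearI[where C = C])
      show "sesquilinear_on (V.carr) ?d"
        unfolding sesquilinear_on_def
        by (simp add: T'l T'm V.ip_add_left V.ip_add_right V.ip_scale_left V.ip_scale_right)
      fix x y assume xy: "x \<in> V.carr" "y \<in> V.carr"
      show "cmod (V.ip (T' x) y) \<le> C * V.nrm x * V.nrm y"
        by (rule order_trans[OF V.Cauchy_Schwarz[OF T'm[OF xy(1)] xy(2)] mult_right_mono[OF C(2)[OF xy(1)]]]) (use xy in simp)
    qed
    fix e :: real assume e: "e > 0"
    obtain \<delta> where \<delta>: "\<delta> > 0" "\<And>\<kappa>. \<kappa> \<noteq> k \<Longrightarrow> dist \<kappa> k < \<delta> \<Longrightarrow> op_norm (Vsp S) (Vsp S) (R T' \<kappa>) < e"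
      using order_tendstoD(2)[OF T'(2) e] unfolding eventually_at by blast
    have "cmod (form S \<kappa> u v - form S k u v - (\<kappa> - k) * ?d u v) \<le> e * cmod (\<kappa> - k) * V.nrm u * V.nrm v"
      if \<kappa>: "\<kappa> \<in> params S" "cmod (\<kappa> - k) < \<delta>" and u: "u \<in> V.carr" and v: "v \<in> V.carr" for \<kappa> u v
    proof (cases "\<kappa> = k")
      case False
      note m = Tm[OF \<kappa>(1) u] Tm[OF k u] T'm[OF u] bounded_opD(1)[OF Rb[OF \<kappa>(1)] u]
      have "(\<kappa> - k) * V.ip (R T' \<kappa> u) v = form S \<kappa> u v - form S k u v - (\<kappa> - k) * ?d u v"
        unfolding R_def using m False
        by (simp add: V.ip_diff_left V.ip_scale_left v hinner_Top[OF _ u v] \<kappa>(1) k right_diff_distrib)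
      then have "cmod (form S \<kappa> u v - form S k u v - (\<kappa> - k) * ?d u v) = cmod (\<kappa> - k) * cmod (V.ip (R T' \<kappa> u) v)"
        by (metis norm_mult)
      also have "\<dots> \<le> cmod (\<kappa> - k) * (e * V.nrm u * V.nrm v)"
      proof (rule mult_left_mono)
        have "V.nrm (R T' \<kappa> u) \<le> op_norm (Vsp S) (Vsp S) (R T' \<kappa>) * V.nrm u"
          by (rule V.op_norm_bound[OF Rb[OF \<kappa>(1)] hilbert_Vsp u])
        also have "\<dots> \<le> e * V.nrm u"
          using \<delta>(2)[OF False] \<kappa>(2) u by (intro mult_right_mono) (auto simp: dist_norm)
        finally have "V.nrm (R T' \<kappa> u) \<le> e * V.nrm u" .
        then show "cmod (V.ip (R T' \<kappa> u) v) \<le> e * V.nrm u * V.nrm v"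
          using order_trans[OF V.Cauchy_Schwarz[OF m(4) v] mult_right_mono] v by simp
      qed simp
      finally show ?thesis by (simp add: mult_ac)
    qed simp
    then show "\<exists>\<delta>>0. \<forall>\<kappa>\<in>params S. cmod (\<kappa> - k) < \<delta> \<longrightarrow>
      (\<forall>u\<in>V.carr. \<forall>v\<in>V.carr.
        cmod (form S \<kappa> u v - form S k u v - (\<kappa> - k) * ?d u v) \<le> e * cmod (\<kappa> - k) * V.nrm u * V.nrm v)"
      using \<delta>(1) by blast
  qed
qed

end

text \<open>Regularity at one \<kappa> acts only within its connected component of the parameter
  set, hence the connectedness. An eigenvalue on the frontier of \<open>\<Lambda>'\<close> could be
  approached by discrete ones from outside only, which would keep the distance away from 0; the
  frontier condition excludes this.\<close>

theorem theorem3p4: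
  fixes S :: "('v::complex_vector, 'z::complex_vector, 'x::complex_vector,
      'y::complex_vector, 'w::complex_vector) setting"
    and D :: "('v, 'z, 'x, 'y) discretization"
  assumes "assumption_A S"
    and "assumption_D S D"
    and "assumption_E S"
    and "connected (params S)"
    and "\<exists>\<kappa>\<in>params S. invertible_op (Vsp S) (Top S \<kappa>)"
  shows "discrete (eigenvalues S) \<and>
    (\<forall>z\<in>params S. \<not> z islimpt eigenvalues S) \<and>
    (\<forall>\<Lambda>'. compact \<Lambda>' \<and> \<Lambda>' \<subseteq> params S \<and> eigenvalues S \<inter> frontier \<Lambda>' = {} \<longrightarrow>
      ((\<lambda>(h, N). hausdorff_distance (eigenvalues S \<inter> \<Lambda>') (discrete_eigenvalues S D h N \<inter> \<Lambda>'))
        \<longlongrightarrow> 0) (at_right 0 \<times>\<^sub>F sequentially))"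
proof -
  interpret exterior_setting S by (rule exterior_setting.intro[OF assms(1)])
  let ?W = "\<lambda>i. VhN S D (fst i) (snd i)" and ?F = "(at_right 0 \<times>\<^sub>F sequentially) :: (real \<times> nat) filter"
  have disc: "\<exists>\<phi> lidx M Cs \<alpha> \<theta> K. discretized S \<phi> lidx \<kappa> D M Cs \<alpha> \<theta> K" if \<kappa>: "\<kappa> \<in> params S" for \<kappa>
  proof -
    obtain U \<phi> lidx M Cs \<alpha> \<theta> K where "\<kappa> \<in> U"
      "\<forall>\<kappa>\<in>U. assumption_B S \<phi> lidx \<kappa> \<and> assumption_C S \<phi> lidx M Cs \<alpha> \<theta> K \<kappa>"
      using assms(3) \<kappa> unfolding assumption_E_def by (elim conjE) (drule (1) bspec, elim exE conjE, rule that)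
    then have "discretized S \<phi> lidx \<kappa> D M Cs \<alpha> \<theta> K"
      using \<kappa> assms(2) by unfold_locales blast+
    then show ?thesis by blast
  qed
  obtain k where k: "k \<in> params S" "k \<notin> eigenvalues S"
    using assms(5) not_eigenvalue_if_invertible by blast
  \<comment> \<open>One parameter suffices here: closedness and density of the discrete spaces do
    not involve \<kappa>. The weak coercivity below is obtained anew at each \<kappa>.\<close>
  obtain \<phi> lidx M Cs \<alpha> \<theta> K where "discretized S \<phi> lidx k D M Cs \<alpha> \<theta> K" using disc[OF k(1)] by blast
  then interpret k: discretized S \<phi> lidx k D M Cs \<alpha> \<theta> K .
  interpret G: galerkin "Vsp S" "params S" "form S" ?W ?F
  proof unfold_locales
    show "open (params S)" using assms(3) unfolding assumption_E_def by blast
    show "form_holomorphic (Vsp S) (params S) (form S)" by (rule form_holomorphic_form[OF assms(3)])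
    fix \<kappa> assume "\<kappa> \<in> params S"
    then obtain \<phi> lidx M Cs \<alpha> \<theta> K where "discretized S \<phi> lidx \<kappa> D M Cs \<alpha> \<theta> K" using disc by blast
    then interpret \<kappa>: discretized S \<phi> lidx \<kappa> D M Cs \<alpha> \<theta> K .
    obtain n A B where "fredholm_form (Vsp S) (form S \<kappa>) (\<kappa>.T (\<lambda>n. cnj (\<theta> n))) n A B (\<alpha> / 2)"
      by (rule \<kappa>.weak_coercivity)
    then show "\<exists>g T n A B. fredholm_form (Vsp S) (form S \<kappa>) T n A B g \<and> discretizable (Vsp S) ?W ?F T"
      using \<kappa>.T_discretizable by blast
  qed (fact assms(4) k.W_closed k.V_approx)+
  have eig: "G.eig = eigenvalues S" unfolding G.eig_def eigenvalues_def ..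
  have eigW: "G.eigW = (\<lambda>(h, N). discrete_eigenvalues S D h N)"
    by (simp add: fun_eq_iff G.eigW_def discrete_eigenvalues_def)
  have lim: "\<not> z islimpt eigenvalues S" if "z \<in> params S" for z
    using G.eig_no_limpt[of k z] k that unfolding eig by blast
  have "discrete (eigenvalues S)"
    unfolding discrete_def isolated_in_islimpt_iff using lim by (auto simp: eigenvalues_def)
  moreover have "((\<lambda>(h, N). hausdorff_distance (eigenvalues S \<inter> L) (discrete_eigenvalues S D h N \<inter> L)) \<longlongrightarrow> 0) ?F"
    if "compact L" "L \<subseteq> params S" "eigenvalues S \<inter> frontier L = {}" for L
    using G.eigenvalue_convergence[of k L] k that unfolding eig eigW by (simp add: case_prod_beta')
  ultimately show ?thesis using lim by blast
qed

end
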